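(* Consider the cooperative wireless network model described in the context, with sum power constraint $P\in(0,\infty)$ and noise power $N_0>0$. The unicasting capacity and the multicasting capacity coincide, and both are equal to $$C=\log_2\left(1+\frac{P}{N_0}\right).$$
   Context: Network model. For each $K\ge 1$ there is a source node $0$ and receiving nodes $1,\dots,K$. For every ordered pair of distinct nodes $(j,k)$, $j,k\in\{0,1,\dots,K\}$, there is a channel gain $h_{jk}$; these gains are i.i.d. zero-mean unit-variance circularly symmetric complex Gaussian ($\mathcal{CN}(0,1)$) and remain fixed during the $n$ channel uses of a transmission. If $\mathcal{T}(i)$ denotes the set of nodes transmitting at time $i$ and $x_j(i)$ is the symbol sent by node $j$, a node $k$ that is receiving at time $i$ observes $y_k(i)=\sum_{j\in\mathcal{T}(i)}h_{jk}x_j(i)+z_k(i)$. The noises $z_k(i)$ are i.i.d. $\mathcal{CN}(0,N_0)$, independent across nodes and across time, and independent of the gains. Nodes are half-duplex: at each time a node either transmits or receives. Admissible protocol. The source draws a message $W$ uniformly from $\{1,\dots,M\}$. Whether the source transmits at time $i$ is fixed a priori for $i=1,\dots,n$, and the source transmits at time $1$. When it transmits, its symbol is a function of $W$. Nodes $1,\dots,K$ start in receive mode and collect their observations $y_k(i)$ while receiving. After any time $i<n$, a receiving node $k$ may decide to switch to transmit mode; once it switches, it transmits for all remaining times and never returns to receive mode. When node $k$ transmits, its symbol $x_k(i)$ is a function of its collected observations and of its incoming channel gains $\{h_{jk}\}_j$. Nodes do not know any other gains. At time $n$, each node $k$ produces a decision $\hat W_k\in\{1,\dots,M\}$ as a function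 of its collected observations and of $\{h_{jk}\}_j$. The transmissions must satisfy the expected sum power constraint $E\left[\frac1n\sum_{i=1}^n\sum_{k\in\mathcal{T}(i)}|X_k(i)|^2\right]\le P$, where the expectation is over the message, the channel gains, the noise and any randomization of the protocol. Unicasting and multicasting. In unicasting there is a single designated destination node among $1,\dots,K$, and a failure occurs if that node's decision is wrong. In multicasting all nodes $1,\dots,K$ are destinations, and a failure occurs if any of them decodes wrongly. Capacity. A rate $R$ is achievable (for unicasting, respectively multicasting) if for every $K$ there is an admissible protocol $\pi_K$ with some number $n_K$ of channel uses and $M_K=2^{n_KR}$ messages such that the failure probability tends to $0$ as $K\to\infty$. The corresponding capacity is the supremum of the achievable rates. *)

theory Defs
  imports "HOL-Probability.Probability"
begin

definition cgauss :: "real \<Rightarrow> complex measure" where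
  "cgauss s = density lborel (\<lambda>z. ennreal (exp (- ((cmod z)\<^sup>2) / s) / (pi * s)))"

text \<open>A protocol. Nodes are 0 (source) and 1..K; times are 1..n.
  The real number u is the (shared) randomization seed of the protocol.
  - src_on i: whether the source transmits at time i (fixed a priori);
  - src_sym i W u: source symbol at time i for message W;
  - switch k t obs g u: relay k decides after time t to switch to transmit mode,
    based on its observations obs (times 1..t) and incoming gains g (j \<mapsto> h_jk);
  - relay_sym k i obs g u: symbol of relay k at time i (obs = collected observations);
  - decide k obs g u: decision of node k at time n.\<close>
record protocol =
  src_on :: "nat \<Rightarrow> bool"
  src_sym :: "nat \<Rightarrow> nat \<Rightarrow> real \<Rightarrow> complex"
  switch :: "nat \<Rightarrow> nat \<Rightarrow> (nat \<Rightarrow> complex) \<Rightarrow> (nat \<Rightarrow> complex) \<Rightarrow> real \<Rightarrow> bool"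
  relay_sym :: "nat \<Rightarrow> nat \<Rightarrow> (nat \<Rightarrow> complex) \<Rightarrow> (nat \<Rightarrow> complex) \<Rightarrow> real \<Rightarrow> complex"
  decide :: "nat \<Rightarrow> (nat \<Rightarrow> complex) \<Rightarrow> (nat \<Rightarrow> complex) \<Rightarrow> real \<Rightarrow> nat"

definition gain_idx :: "nat \<Rightarrow> (nat \<times> nat) set" where
  "gain_idx K = {(j, k). j \<le> K \<and> k \<le> K \<and> j \<noteq> k}"

definition noise_idx :: "nat \<Rightarrow> nat \<Rightarrow> (nat \<times> nat) set" where
  "noise_idx K n = {(k, i). 1 \<le> k \<and> k \<le> K \<and> 1 \<le> i \<and> i \<le> n}"

text \<open>Sample space: message W, gains h, noises z (indexed by (node, time)), seed u.\<close>
definition netspace :: "real \<Rightarrow> nat \<Rightarrow> nat \<Rightarrow> nat \<Rightarrow>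
    (nat \<times> ((nat \<times> nat) \<Rightarrow> complex) \<times> ((nat \<times> nat) \<Rightarrow> complex) \<times> real) measure" where
  "netspace N0 K n M =
     pair_measure (measure_pmf (pmf_of_set {1..M}))
      (pair_measure (PiM (gain_idx K) (\<lambda>_. cgauss 1))
        (pair_measure (PiM (noise_idx K n) (\<lambda>_. cgauss N0))
          (uniform_measure lborel {0..1::real})))"

definition inc :: "nat \<Rightarrow> ((nat \<times> nat) \<Rightarrow> complex) \<Rightarrow> nat \<Rightarrow> nat \<Rightarrow> complex" where
  "inc K h k = (\<lambda>j. if j \<le> K \<and> j \<noteq> k then h (j, k) else 0)"

text \<open>A history H t k is the (would-be) observation y_k(t) of node k at time t.
  Node k's observations up to time t:\<close>
definition trunc :: "(nat \<Rightarrow> nat \<Rightarrow> complex) \<Rightarrow> nat \<Rightarrow> nat \<Rightarrow> nat \<Rightarrow> complex" where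
  "trunc H k t = (\<lambda>s. if 1 \<le> s \<and> s \<le> t then H s k else 0)"

definition switched :: "protocol \<Rightarrow> nat \<Rightarrow> ((nat \<times> nat) \<Rightarrow> complex) \<Rightarrow> real \<Rightarrow>
    (nat \<Rightarrow> nat \<Rightarrow> complex) \<Rightarrow> nat \<Rightarrow> nat \<Rightarrow> bool" where
  "switched p K h u H k i \<longleftrightarrow>
     (\<exists>t. 1 \<le> t \<and> t < i \<and> switch p k t (trunc H k t) (inc K h k) u)"

definition sw_time :: "protocol \<Rightarrow> nat \<Rightarrow> ((nat \<times> nat) \<Rightarrow> complex) \<Rightarrow> real \<Rightarrow>
    (nat \<Rightarrow> nat \<Rightarrow> complex) \<Rightarrow> nat \<Rightarrow> nat" where
  "sw_time p K h u H k = (LEAST t. 1 \<le> t \<and> switch p k t (trunc H k t) (inc K h k) u)"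

definition transmits :: "protocol \<Rightarrow> nat \<Rightarrow> ((nat \<times> nat) \<Rightarrow> complex) \<Rightarrow> real \<Rightarrow>
    (nat \<Rightarrow> nat \<Rightarrow> complex) \<Rightarrow> nat \<Rightarrow> nat \<Rightarrow> bool" where
  "transmits p K h u H k i =
     (if k = 0 then src_on p i else 1 \<le> k \<and> k \<le> K \<and> switched p K h u H k i)"

definition symb :: "protocol \<Rightarrow> nat \<Rightarrow> nat \<Rightarrow> ((nat \<times> nat) \<Rightarrow> complex) \<Rightarrow> real \<Rightarrow>
    (nat \<Rightarrow> nat \<Rightarrow> complex) \<Rightarrow> nat \<Rightarrow> nat \<Rightarrow> complex" where
  "symb p K W h u H k i =
     (if k = 0 then src_sym p i W u
      else relay_sym p k i (trunc H k (sw_time p K h u H k)) (inc K h k) u)"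

definition yval :: "protocol \<Rightarrow> nat \<Rightarrow> nat \<Rightarrow> ((nat \<times> nat) \<Rightarrow> complex) \<Rightarrow>
    ((nat \<times> nat) \<Rightarrow> complex) \<Rightarrow> real \<Rightarrow> (nat \<Rightarrow> nat \<Rightarrow> complex) \<Rightarrow> nat \<Rightarrow> nat \<Rightarrow> complex" where
  "yval p K W h z u H i k =
     (\<Sum>j\<in>{j. j \<le> K \<and> j \<noteq> k \<and> transmits p K h u H j i}. h (j, k) * symb p K W h u H j i)
     + z (k, i)"

primrec hist :: "protocol \<Rightarrow> nat \<Rightarrow> nat \<Rightarrow> ((nat \<times> nat) \<Rightarrow> complex) \<Rightarrow>
    ((nat \<times> nat) \<Rightarrow> complex) \<Rightarrow> real \<Rightarrow> nat \<Rightarrow> (nat \<Rightarrow> nat \<Rightarrow> complex)" where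
  "hist p K W h z u 0 = (\<lambda>t k. 0)"
| "hist p K W h z u (Suc i) =
     (\<lambda>t k. if t = Suc i then yval p K W h z u (hist p K W h z u i) (Suc i) k
            else hist p K W h z u i t k)"

text \<open>Decision of node k at the end (time n): based on the observations collected
  while in receive mode, i.e. up to its switching time, or up to n if it never switched.\<close>
definition decision :: "protocol \<Rightarrow> nat \<Rightarrow> nat \<Rightarrow>
    (nat \<times> ((nat \<times> nat) \<Rightarrow> complex) \<times> ((nat \<times> nat) \<Rightarrow> complex) \<times> real) \<Rightarrow> nat \<Rightarrow> nat" where
  "decision p K n \<omega> k =
     (case \<omega> of (W, h, z, u) \<Rightarrow>
       (let H = hist p K W h z u n;
            T = (if switched p K h u H k n then sw_time p K h u H k else n)
        in decide p k (trunc H k T) (inc K h k) u))"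

definition power :: "protocol \<Rightarrow> nat \<Rightarrow> nat \<Rightarrow>
    (nat \<times> ((nat \<times> nat) \<Rightarrow> complex) \<times> ((nat \<times> nat) \<Rightarrow> complex) \<times> real) \<Rightarrow> real" where
  "power p K n \<omega> =
     (case \<omega> of (W, h, z, u) \<Rightarrow>
       (1 / real n) * (\<Sum>i\<in>{1..n}.
          (let H = hist p K W h z u (i - 1) in
            \<Sum>k\<in>{k. k \<le> K \<and> transmits p K h u H k i}. (cmod (symb p K W h u H k i))\<^sup>2)))"

definition admissible :: "real \<Rightarrow> real \<Rightarrow> nat \<Rightarrow> nat \<Rightarrow> nat \<Rightarrow> protocol \<Rightarrow> bool" where
  "admissible P N0 K n M p \<longleftrightarrow>
     1 \<le> n \<and> 1 \<le> M \<and> src_on p 1 \<and>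
     (\<forall>k obs g u. decide p k obs g u \<in> {1..M}) \<and>
     power p K n \<in> borel_measurable (netspace N0 K n M) \<and>
     (\<forall>k\<in>{1..K}. {\<omega> \<in> space (netspace N0 K n M). decision p K n \<omega> k \<noteq> fst \<omega>}
        \<in> sets (netspace N0 K n M)) \<and>
     (\<integral>\<^sup>+ \<omega>. ennreal (power p K n \<omega>) \<partial>netspace N0 K n M) \<le> ennreal P"

definition num_msgs :: "nat \<Rightarrow> real \<Rightarrow> nat" where
  "num_msgs n R = nat \<lceil>2 powr (real n * R)\<rceil>"

definition fail_uni :: "real \<Rightarrow> nat \<Rightarrow> nat \<Rightarrow> nat \<Rightarrow> protocol \<Rightarrow> nat \<Rightarrow> real" where
  "fail_uni N0 K n M p d =
     measure (netspace N0 K n M) {\<omega> \<in> space (netspace N0 K n M). decision p K n \<omega> d \<noteq> fst \<omega>}"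

definition fail_multi :: "real \<Rightarrow> nat \<Rightarrow> nat \<Rightarrow> nat \<Rightarrow> protocol \<Rightarrow> real" where
  "fail_multi N0 K n M p =
     measure (netspace N0 K n M)
       {\<omega> \<in> space (netspace N0 K n M). \<exists>k\<in>{1..K}. decision p K n \<omega> k \<noteq> fst \<omega>}"

text \<open>Achievability; d K is the designated unicast destination when there are K relays.\<close>
definition achievable_uni :: "real \<Rightarrow> real \<Rightarrow> (nat \<Rightarrow> nat) \<Rightarrow> real \<Rightarrow> bool" where
  "achievable_uni P N0 d R \<longleftrightarrow>
     (\<exists>(\<pi> :: nat \<Rightarrow> protocol) (nK :: nat \<Rightarrow> nat).
        (\<forall>K\<ge>1. admissible P N0 K (nK K) (num_msgs (nK K) R) (\<pi> K)) \<and>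
        (\<lambda>K. fail_uni N0 K (nK K) (num_msgs (nK K) R) (\<pi> K) (d K)) \<longlonglongrightarrow> 0)"

definition achievable_multi :: "real \<Rightarrow> real \<Rightarrow> real \<Rightarrow> bool" where
  "achievable_multi P N0 R \<longleftrightarrow>
     (\<exists>(\<pi> :: nat \<Rightarrow> protocol) (nK :: nat \<Rightarrow> nat).
        (\<forall>K\<ge>1. admissible P N0 K (nK K) (num_msgs (nK K) R) (\<pi> K)) \<and>
        (\<lambda>K. fail_multi N0 K (nK K) (num_msgs (nK K) R) (\<pi> K)) \<longlonglongrightarrow> 0)"

definition capacity_uni :: "real \<Rightarrow> real \<Rightarrow> (nat \<Rightarrow> nat) \<Rightarrow> real" where
  "capacity_uni P N0 d = Sup {R. achievable_uni P N0 d R}"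

definition capacity_multi :: "real \<Rightarrow> real \<Rightarrow> real" where
  "capacity_multi P N0 = Sup {R. achievable_multi P N0 R}"

end

theory Submission
  imports Defs "HOL-Real_Asymp.Real_Asymp"
begin

text \<open>Achievability: with high probability a constant fraction of the nodes has a channel from the source
  of gain at least \<open>G\<close>, so for large \<open>G\<close> they decode a random Gaussian code within a small
  fraction of the \<open>n\<close> channel uses. They spend the rest of the time sending independent Gaussian
  codewords for the message at total power close to \<open>P\<close>. By concentration of the sum of their
  gains every other node sees a channel with signal-to-noise ratio close to \<open>P / N0\<close>. The union bound
  over nodes and over sets of relays costs a factor exponential in \<open>K\<close>, which a block length chosen
  after \<open>K\<close> absorbs.

  Converse: fix everything except the gains \<open>h\<close> into the destination \<open>d\<close> and its noise. As long as
  \<open>d\<close> listens, the symbols sent by the others are then fixed vectors \<open>x i\<close>, and the only feedback is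
  through the time at which \<open>d\<close> stops. A change of measure replaces the output by noise of variance
  \<open>N0 + P\<close>; for a small error probability \<open>d\<close> can stop only after the accumulated received energy
  \<open>\<Sum> \<bar>h \<bullet> x i\<bar>^2\<close> has passed a level that exceeds \<open>n P\<close> if the rate exceeds capacity. The events
  that the level is not yet reached are ellipsoids in \<open>h\<close>. On these the mean of \<open>\<bar>h \<bullet> x i\<bar>^2\<close> is at
  most the transmitted energy \<open>\<bar>x i\<bar>^2\<close> times the probability of the ellipsoid, so the transmitted
  energy has to exceed \<open>n P\<close> too. Bounded block lengths are excluded separately: there finite energy
  keeps two messages statistically confusable.\<close>

section \<open>Circularly symmetric Gaussian variables\<close>

text \<open>The obstacle in the converse is feedback: a node that has heard enough may start to
  transmit and thereby tell the others to save energy, so the duration of a transmission is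
  correlated with the gains into that node. What saves the argument is the sign of this correlation:
  still listening means, up to small probability, that the gains have been weak so far, and this
  cannot raise the mean of the energy received next. The reference variance
  \<open>v = N0 + P\<close> makes the collected information linear in received energy, and
  \<open>v * (ln (1 + P / N0) - kl N0 v) = P\<close> is the exact point at which rates above
  capacity violate the power constraint. The error terms decay in the block length only, whereas
  achievability lets just \<open>K\<close> grow; hence the separate treatment of bounded blocks. In
  the direct part independent codewords make the relays' powers add up at every receiver whatever
  the phases of the gains between them, which the senders do not know.\<close>

lemma cmod_sq: "(cmod z)\<^sup>2 = (Re z)\<^sup>2 + (Im z)\<^sup>2"
  by (simp add: cmod_def)
lemma nn_integral_lborel_complex_prod:
  fixes f g :: "real \<Rightarrow> ennreal"
  assumes [measurable]: "f \<in> borel_measurable borel" "g \<in> borel_measurable borel"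
  shows "(\<integral>\<^sup>+z. f (Re z) * g (Im z) \<partial>lborel) = (\<integral>\<^sup>+x. f x \<partial>lborel) * (\<integral>\<^sup>+x. g x \<partial>lborel)"
proof -
  have ne: "(1::complex) \<noteq> \<i>" "\<i> \<noteq> (1::complex)" by (auto simp: complex_eq_iff)
  have "(\<integral>\<^sup>+z. (\<Prod>b\<in>Basis. (if b = (1::complex) then f else g) (z \<bullet> b)) \<partial>lborel)
      = (\<Prod>b\<in>Basis. (\<integral>\<^sup>+x. (if b = (1::complex) then f else g) x \<partial>lborel))"
    by (rule nn_integral_lborel_prod) auto
  then show ?thesis
    using ne by (simp add: Basis_complex_def inner_complex_def)
qed

lemma nn_integral_exp_sq_real:
  fixes a m :: real
  assumes "0 < a"
  shows "(\<integral>\<^sup>+x. ennreal (exp (- a * (x - m)\<^sup>2)) \<partial>lborel) = ennreal (sqrt (pi / a))"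
proof -
  define \<sigma> where "\<sigma> = sqrt (1 / (2 * a))"
  have s: "0 < \<sigma>" "\<sigma>\<^sup>2 = 1 / (2*a)" using assms by (auto simp: \<sigma>_def)
  have "sqrt (pi/a) > 0" using assms by simp
  then have eq: "exp (- a * (x - m)\<^sup>2) = sqrt (pi / a) * normal_density m \<sigma> x" for x
    using assms unfolding normal_density_def s(2) by (simp add: mult.commute)
  have "(\<integral>\<^sup>+x. ennreal (normal_density m \<sigma> x) \<partial>lborel) = 1"
    using s by (subst nn_integral_eq_integral) auto
  then show ?thesis
    using assms s(1) unfolding eq by (simp add: ennreal_mult nn_integral_cmult)
qed

lemma nn_integral_exp_sq_complex:
  fixes a :: real and m :: complex
  assumes "0 < a"
  shows "(\<integral>\<^sup>+z. ennreal (exp (- a * (cmod (z - m))\<^sup>2)) \<partial>lborel) = ennreal (pi / a)"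
proof -
  have "(\<integral>\<^sup>+z. ennreal (exp (- a * (cmod (z - m))\<^sup>2)) \<partial>lborel) =
     (\<integral>\<^sup>+z. ennreal (exp (- a * (Re z - Re m)\<^sup>2)) * ennreal (exp (- a * (Im z - Im m)\<^sup>2)) \<partial>lborel)"
    by (intro nn_integral_cong)
       (simp add: cmod_sq ennreal_mult[symmetric] exp_add[symmetric] algebra_simps)
  also have "\<dots> = ennreal (sqrt (pi / a)) * ennreal (sqrt (pi / a))"
    by (subst nn_integral_lborel_complex_prod) (auto simp: nn_integral_exp_sq_real[OF assms, simplified])
  finally show ?thesis using assms by (simp add: ennreal_mult[symmetric])
qed

lemma nn_integral_exp_quadratic:
  fixes a c :: real and b :: complex
  assumes "0 < a"
  shows "(\<integral>\<^sup>+z. ennreal (exp (- a * (cmod z)\<^sup>2 + 2 * Re (cnj b * z) + c)) \<partial>lborel)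
    = ennreal (pi / a * exp ((cmod b)\<^sup>2 / a + c))"
proof -
  have *: "exp (- a * (cmod z)\<^sup>2 + 2 * Re (cnj b * z) + c) =
      exp ((cmod b)\<^sup>2 / a + c) * exp (- a * (cmod (z - of_real (1/a) * b))\<^sup>2)" for z
  proof -
    have "a * (cmod (z - of_real (1/a) * b))\<^sup>2 = a * (cmod z)\<^sup>2 - 2 * Re (cnj b * z) + (cmod b)\<^sup>2 / a"
      unfolding cmod_sq using assms by (simp add: power2_eq_square field_simps)
    then show ?thesis by (simp add: exp_add[symmetric])
  qed
  have "(\<integral>\<^sup>+z. ennreal (exp ((cmod b)\<^sup>2 / a + c) * exp (- a * (cmod (z - of_real (1/a) * b))\<^sup>2)) \<partial>lborel)
    = (\<integral>\<^sup>+z. ennreal (exp ((cmod b)\<^sup>2 / a + c)) * ennreal (exp (- a * (cmod (z - of_real (1/a) * b))\<^sup>2)) \<partial>lborel)"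
    by (simp add: ennreal_mult)
  also have "\<dots> = ennreal (exp ((cmod b)\<^sup>2 / a + c)) * ennreal (pi / a)"
    using nn_integral_exp_sq_complex[OF assms] by (subst nn_integral_cmult) auto
  also have "\<dots> = ennreal (pi / a * exp ((cmod b)\<^sup>2 / a + c))"
    using assms by (simp add: ennreal_mult[symmetric] mult.commute)
  finally show ?thesis unfolding * .
qed

lemma sets_cgauss [simp, measurable_cong]: "sets (cgauss s) = sets borel"
  and space_cgauss [simp]: "space (cgauss s) = UNIV"
  by (simp_all add: cgauss_def)

lemma nn_integral_cgauss:
  assumes [measurable]: "f \<in> borel_measurable borel"
  shows "(\<integral>\<^sup>+z. f z \<partial>cgauss s) = (\<integral>\<^sup>+z. ennreal (exp (- ((cmod z)\<^sup>2) / s) / (pi * s)) * f z \<partial>lborel)"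
  unfolding cgauss_def by (subst nn_integral_density) auto

text \<open>The exponential moment behind the Gaussian estimates below: \<kappa> > 0 serves upper
  tails of energies, \<kappa> < 0 lower tails, and \<open>b\<close> translations. The condition
  \<open>\<kappa> * s < 1\<close> is exactly what keeps the quadratic form in the total exponent
  negative.\<close>

lemma nn_integral_cgauss_exp_linear:
  fixes s \<kappa> c :: real and b :: complex
  assumes s: "0 < s" and k: "\<kappa> * s < 1"
  shows "(\<integral>\<^sup>+z. ennreal (exp (\<kappa> * (cmod z)\<^sup>2 + 2 * Re (cnj b * z) + c)) \<partial>cgauss s)
    = ennreal (1 / (1 - \<kappa> * s) * exp (s * (cmod b)\<^sup>2 / (1 - \<kappa> * s) + c))"
proof -
  have a: "0 < 1 / s - \<kappa>" using s k by (simp add: field_simps)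
  have *: "exp (- ((cmod z)\<^sup>2) / s) / (pi * s) * exp (\<kappa> * (cmod z)\<^sup>2 + 2 * Re (cnj b * z) + c)
     = 1 / (pi * s) * exp (- (1 / s - \<kappa>) * (cmod z)\<^sup>2 + 2 * Re (cnj b * z) + c)" for z
  proof -
    have "exp (- ((cmod z)\<^sup>2) / s) * exp (\<kappa> * (cmod z)\<^sup>2 + 2 * Re (cnj b * z) + c) = 
      exp (- (1 / s - \<kappa>) * (cmod z)\<^sup>2 + 2 * Re (cnj b * z) + c)"
      by (simp add: exp_add[symmetric] left_diff_distrib)
    then show ?thesis by simp
  qed
  have "(\<integral>\<^sup>+z. ennreal (exp (\<kappa> * (cmod z)\<^sup>2 + 2 * Re (cnj b * z) + c)) \<partial>cgauss s)
    = (\<integral>\<^sup>+z. ennreal (1 / (pi * s)) * ennreal (exp (- (1 / s - \<kappa>) * (cmod z)\<^sup>2 + 2 * Re (cnj b * z) + c)) \<partial>lborel)"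
    using s * by (subst nn_integral_cgauss) (auto intro!: nn_integral_cong simp: ennreal_mult[symmetric])
  also have "\<dots> = ennreal (1 / (pi * s)) * ennreal (pi / (1 / s - \<kappa>) * exp ((cmod b)\<^sup>2 / (1 / s - \<kappa>) + c))"
    by (subst nn_integral_cmult) (simp_all only: nn_integral_exp_quadratic[OF a], measurable)
  also have "\<dots> = ennreal (1 / (1 - \<kappa> * s) * exp (s * (cmod b)\<^sup>2 / (1 - \<kappa> * s) + c))"
  proof -
    have e: "1 / s - \<kappa> = (1 - \<kappa> * s) / s" using s by (simp add: field_simps)
    have "0 < 1 - \<kappa> * s" using k by simp
    then show ?thesis using s unfolding e by (subst ennreal_mult[symmetric]) (auto simp: mult.commute)
  qed
  finally show ?thesis .
qed
lemma cmod_add_sq: "(cmod (a + b))\<^sup>2 = (cmod a)\<^sup>2 + 2 * Re (cnj a * b) + (cmod b)\<^sup>2"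
  unfolding cmod_sq by (simp add: power2_eq_square algebra_simps)

lemma nn_integral_cgauss_exp_shift:
  fixes s \<kappa> :: real and y :: complex
  assumes s: "0 < s" and k: "\<kappa> * s < 1"
  shows "(\<integral>\<^sup>+z. ennreal (exp (\<kappa> * (cmod (y + z))\<^sup>2)) \<partial>cgauss s)
    = ennreal (1 / (1 - \<kappa> * s) * exp (\<kappa> * (cmod y)\<^sup>2 / (1 - \<kappa> * s)))"
proof -
  have "\<kappa> * (cmod (y + z))\<^sup>2 = \<kappa> * (cmod z)\<^sup>2 + 2 * Re (cnj (of_real \<kappa> * y) * z) + \<kappa> * (cmod y)\<^sup>2" for z
    by (simp add: cmod_add_sq algebra_simps)
  then have "(\<integral>\<^sup>+z. ennreal (exp (\<kappa> * (cmod (y + z))\<^sup>2)) \<partial>cgauss s) =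
    ennreal (1 / (1 - \<kappa> * s) * exp (s * (cmod (of_real \<kappa> * y))\<^sup>2 / (1 - \<kappa> * s) + \<kappa> * (cmod y)\<^sup>2))"
    using nn_integral_cgauss_exp_linear[OF s k, of "of_real \<kappa> * y" "\<kappa> * (cmod y)\<^sup>2"] by simp
  moreover have "s * (cmod (of_real \<kappa> * y))\<^sup>2 / (1 - \<kappa> * s) + \<kappa> * (cmod y)\<^sup>2 = \<kappa> * (cmod y)\<^sup>2 / (1 - \<kappa> * s)"
  proof -
    have "1 - \<kappa> * s \<noteq> 0" using k by simp
    then show ?thesis by (simp add: norm_mult power_mult_distrib divide_simps) (simp add: power2_eq_square algebra_simps)
  qed
  ultimately show ?thesis by simp
qed

lemma prob_space_cgauss:
  assumes "0 < s" shows "prob_space (cgauss s)"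
proof
  show "emeasure (cgauss s) (space (cgauss s)) = 1"
    using nn_integral_cgauss_exp_shift[OF assms, of 0 0] by simp
qed

lemma nn_integral_cgauss_translate:
  assumes [measurable]: "f \<in> borel_measurable borel"
  shows "(\<integral>\<^sup>+z. f (s + z) \<partial>cgauss v) =
     (\<integral>\<^sup>+y. ennreal (exp (- ((cmod (y - s))\<^sup>2) / v) / (pi * v)) * f y \<partial>lborel)"
proof -
  have "(\<integral>\<^sup>+y. ennreal (exp (- ((cmod (y - s))\<^sup>2) / v) / (pi * v)) * f y \<partial>lborel)
     = (\<integral>\<^sup>+y. ennreal (exp (- ((cmod (y - s))\<^sup>2) / v) / (pi * v)) * f y \<partial>distr lborel borel ((+) s))"
    by (simp add: lborel_distr_plus)
  also have "\<dots> = (\<integral>\<^sup>+z. ennreal (exp (- ((cmod z)\<^sup>2) / v) / (pi * v)) * f (s + z) \<partial>lborel)"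
    by (subst nn_integral_distr) auto
  finally show ?thesis by (simp add: nn_integral_cgauss)
qed

section \<open>The characteristic function of the circular Gaussian law\<close>

lemma borel_measurable_Complex [measurable (raw)]:
  assumes "f \<in> borel_measurable M" "g \<in> borel_measurable M"
  shows "(\<lambda>x. Complex (f x) (g x)) \<in> borel_measurable M"
  using assms unfolding Complex_eq by measurable

text \<open>Writing Lebesgue measure as the image of a planar product opens Fubini for the
  oscillating integrand of the characteristic function, to which the product rule for nonnegative
  integrands does not apply.\<close>

lemma lborel_complex_eq:
  "(lborel :: complex measure) = distr (lborel \<Otimes>\<^sub>M lborel) borel (\<lambda>p. Complex (fst p) (snd p))"
proof (rule lborel_eqI)
  fix l u :: complex
  assume lu: "\<And>b. b \<in> Basis \<Longrightarrow> l \<bullet> b \<le> u \<bullet> b"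
  have ne: "(1::complex) \<noteq> \<i>" "\<i> \<noteq> (1::complex)" by (auto simp: complex_eq_iff)
  have lu': "Re l \<le> Re u" "Im l \<le> Im u"
    using lu[of 1] lu[of \<i>] by (auto simp: Basis_complex_def inner_complex_def)
  have eq: "(\<lambda>p. Complex (fst p) (snd p)) -` box l u \<inter> space (lborel \<Otimes>\<^sub>M lborel) = {Re l <..< Re u} \<times> {Im l <..< Im u}"
    by (auto simp: box_def Basis_complex_def inner_complex_def space_pair_measure)
  show "emeasure (distr (lborel \<Otimes>\<^sub>M lborel) borel (\<lambda>p. Complex (fst p) (snd p))) (box l u) = (\<Prod>b\<in>Basis. (u - l) \<bullet> b)"
    using ne lu' by (subst emeasure_distr)
      (auto simp: eq lborel.emeasure_pair_measure_Times Basis_complex_def inner_complex_def ennreal_mult[symmetric] simp del: Complex_eq)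
qed simp

lemma integral_gauss_iexp_real:
  "integrable lborel (\<lambda>x. complex_of_real (exp (- x\<^sup>2) / sqrt pi) * iexp (2 * a * x))"
  "(\<integral>x. complex_of_real (exp (- x\<^sup>2) / sqrt pi) * iexp (2 * a * x) \<partial>lborel) = exp (- a\<^sup>2)"
proof -
  have nd: "exp (- x\<^sup>2) / sqrt pi = normal_density 0 (1 / sqrt 2) x" for x
    by (simp add: normal_density_def power_divide)
  have ir: "integrable lborel (\<lambda>x. exp (- x\<^sup>2) / sqrt pi)"
    unfolding nd by simp
  show "integrable lborel (\<lambda>x. complex_of_real (exp (- x\<^sup>2) / sqrt pi) * iexp (2 * a * x))"
    by (rule Bochner_Integration.integrable_bound[OF ir]) (measurable, simp add: norm_mult norm_divide)
  \<comment> \<open>The substitution by \<open>1 / sqrt 2\<close> turns the density into the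
    standard normal one, whose characteristic function is known.\<close>
  have "(\<integral>x. complex_of_real (exp (- x\<^sup>2) / sqrt pi) * iexp (2 * a * x) \<partial>lborel)
     = (1 / sqrt 2) *\<^sub>R (\<integral>y. complex_of_real (exp (- (y / sqrt 2)\<^sup>2) / sqrt pi) * iexp (2 * a * (y / sqrt 2)) \<partial>lborel)"
    by (subst lborel_integral_real_affine[where c="1 / sqrt 2" and t=0]) auto
  also have "\<dots> = (\<integral>y. std_normal_density y *\<^sub>R iexp ((sqrt 2 * a) * y) \<partial>lborel)"
  proof -
    have *: "(1 / sqrt 2) *\<^sub>R (complex_of_real (exp (- (y / sqrt 2)\<^sup>2) / sqrt pi) * iexp (2 * a * (y / sqrt 2)))
      = std_normal_density y *\<^sub>R iexp ((sqrt 2 * a) * y)" for y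
    proof -
      have "2 * a * (y / sqrt 2) = (sqrt 2 * a) * y" by (simp add: field_simps) 
      then show ?thesis
        by (simp add: normal_density_def scaleR_conv_of_real power_divide real_sqrt_mult)
    qed
    show ?thesis
      unfolding integral_scaleR_right[symmetric] by (rule Bochner_Integration.integral_cong[OF refl *])
  qed
  also have "\<dots> = char std_normal_distribution (sqrt 2 * a)"
    unfolding char_def by (subst integral_density) auto
  also have "\<dots> = exp (- a\<^sup>2)"
    by (simp add: char_std_normal_distribution power_mult_distrib)
  finally show "(\<integral>x. complex_of_real (exp (- x\<^sup>2) / sqrt pi) * iexp (2 * a * x) \<partial>lborel) = exp (- a\<^sup>2)" .
qed

text \<open>Real and imaginary part have variance 1 / 2; the factor 2 compensates for this, so that
  the result is \<open>exp (- (cmod a)\<^sup>2)\<close> without a constant and can replace any such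
  exponential below.\<close>

lemma integral_cgauss_iexp:
  "(\<integral>g. iexp (2 * Re (g * a)) \<partial>cgauss 1) = complex_of_real (exp (- (cmod a)\<^sup>2))"
proof -
  let ?f = "\<lambda>a x. complex_of_real (exp (- x\<^sup>2) / sqrt pi) * iexp (2 * a * x)"
  interpret lborel_pair: pair_sigma_finite "lborel :: real measure" "lborel :: real measure" ..
  have "(\<integral>g. iexp (2 * Re (g * a)) \<partial>cgauss 1) = (\<integral>g. (exp (- (cmod g)\<^sup>2) / pi) *\<^sub>R iexp (2 * Re (g * a)) \<partial>lborel)"
    unfolding cgauss_def by (subst integral_density) auto
  also have "\<dots> = (\<integral>p. ?f (Re a) (fst p) * ?f (- Im a) (snd p) \<partial>(lborel \<Otimes>\<^sub>M lborel))"
    unfolding lborel_complex_eq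
  proof (subst integral_distr)
    have "(exp (- (cmod (Complex x y))\<^sup>2) / pi) *\<^sub>R iexp (2 * Re (Complex x y * a)) = ?f (Re a) x * ?f (- Im a) y" for x y
    proof -
      have e1: "exp (- (cmod (Complex x y))\<^sup>2) / pi = exp (- x\<^sup>2) / sqrt pi * (exp (- y\<^sup>2) / sqrt pi)"
        by (simp add: cmod_sq exp_add[symmetric])
      have e2: "iexp (2 * Re (Complex x y * a)) = iexp (2 * Re a * x) * iexp (2 * (- Im a) * y)"
        unfolding exp_add[symmetric] by (rule arg_cong[where f=exp]) (simp add: complex_eq_iff algebra_simps)
      show ?thesis by (subst e1, subst e2) (simp only: scaleR_conv_of_real of_real_mult mult_ac)
    qed
    then show "(\<integral>p. (exp (- (cmod (Complex (fst p) (snd p)))\<^sup>2) / pi) *\<^sub>R iexp (2 * Re (Complex (fst p) (snd p) * a)) \<partial>(lborel \<Otimes>\<^sub>M lborel))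
      = (\<integral>p. ?f (Re a) (fst p) * ?f (- Im a) (snd p) \<partial>(lborel \<Otimes>\<^sub>M lborel))" by simp
  qed measurable
  also have "\<dots> = (\<integral>x. ?f (Re a) x \<partial>lborel) * (\<integral>x. ?f (- Im a) x \<partial>lborel)"
  proof -
    have ir: "integrable lborel (\<lambda>x. exp (- x\<^sup>2) / sqrt pi)"
      using integrable_norm[OF integral_gauss_iexp_real(1)[of 0]] by (simp add: norm_mult norm_divide)
    have "integrable (lborel \<Otimes>\<^sub>M lborel) (\<lambda>p. ?f (Re a) (fst p) * ?f (- Im a) (snd p))"
    proof (rule lborel_pair.Fubini_integrable)
      show "integrable lborel (\<lambda>x. \<integral>y. norm (?f (Re a) (fst (x, y)) * ?f (- Im a) (snd (x, y))) \<partial>lborel)"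
      proof -
        have n: "norm (?f (Re a) (fst (x, y)) * ?f (- Im a) (snd (x, y))) = exp (- x\<^sup>2) / sqrt pi * (exp (- y\<^sup>2) / sqrt pi)" for x y
          by (simp add: norm_mult norm_divide)
        show ?thesis unfolding n integral_mult_right_zero by (rule integrable_mult_left[OF ir])
      qed
      show "AE x in lborel. integrable lborel (\<lambda>y. ?f (Re a) (fst (x, y)) * ?f (- Im a) (snd (x, y)))"
        using integral_gauss_iexp_real(1)[of "- Im a"] by (intro AE_I2) (simp del: times_divide_eq_left)
    qed measurable
    from lborel_pair.integral_fst'[OF this] show ?thesis by simp
  qed
  also have "\<dots> = complex_of_real (exp (- (cmod a)\<^sup>2))"
    unfolding integral_gauss_iexp_real(2) by (simp add: cmod_sq exp_add[symmetric] flip: of_real_mult)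
  finally show ?thesis .
qed

section \<open>Ellipsoids and the energy in a direction\<close>

lemma product_sigma_finite_cgauss: "0 < s \<Longrightarrow> product_sigma_finite (\<lambda>_. cgauss s)"
  using prob_space_cgauss prob_space_imp_sigma_finite by (auto simp: product_sigma_finite_def)

lemma prob_space_PiM_cgauss: "0 < s \<Longrightarrow> prob_space (PiM J (\<lambda>_. cgauss s))"
  by (intro prob_space_PiM prob_space_cgauss)

lemma integral_PiM_cgauss_iexp:
  assumes "finite T"
  shows "(\<integral>g. iexp (2 * Re (\<Sum>k\<in>T. g k * a k)) \<partial>PiM T (\<lambda>_. cgauss 1))
    = complex_of_real (exp (- (\<Sum>k\<in>T. (cmod (a k))\<^sup>2)))"
proof -
  interpret product_sigma_finite "\<lambda>_. cgauss 1" by (rule product_sigma_finite_cgauss) simp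
  interpret g: prob_space "cgauss 1" by (rule prob_space_cgauss) simp
  have "iexp (2 * Re (\<Sum>k\<in>T. g k * a k)) = (\<Prod>k\<in>T. iexp (2 * Re (g k * a k)))" for g
    using assms by (simp add: exp_sum sum_distrib_left sum_distrib_right)
  then have "(\<integral>g. iexp (2 * Re (\<Sum>k\<in>T. g k * a k)) \<partial>PiM T (\<lambda>_. cgauss 1))
     = (\<integral>g. (\<Prod>k\<in>T. iexp (2 * Re (g k * a k))) \<partial>PiM T (\<lambda>_. cgauss 1))" by simp
  also have "\<dots> = (\<Prod>k\<in>T. \<integral>g. iexp (2 * Re (g * a k)) \<partial>cgauss 1)"
    by (rule product_integral_prod[OF assms]) (rule g.integrable_const_bound[where B=1], simp, measurable)
  also have "\<dots> = complex_of_real (exp (- (\<Sum>k\<in>T. (cmod (a k))\<^sup>2)))"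
    unfolding integral_cgauss_iexp using assms by (simp add: exp_sum sum_negf[symmetric])
  finally show ?thesis .
qed

text \<open>Each square is linearised by a characteristic function: both sides are the mean of
  \<open>iexp (2 * Re (\<Sum>k\<in>T. \<Sum>j\<in>J. g k * Y k j * h j))\<close> over independent
  \<open>g\<close> and \<open>h\<close>, integrated in the two possible orders. This is Sylvester's
  determinant identity in probabilistic form.\<close>

lemma integral_exp_gaussian_transpose:
  fixes Y :: "'k \<Rightarrow> 'j \<Rightarrow> complex"
  assumes J: "finite J" and T: "finite T"
  shows "(\<integral>h. exp (- (\<Sum>k\<in>T. (cmod (\<Sum>j\<in>J. Y k j * h j))\<^sup>2)) \<partial>PiM J (\<lambda>_. cgauss 1))
    = (\<integral>g. exp (- (\<Sum>j\<in>J. (cmod (\<Sum>k\<in>T. Y k j * g k))\<^sup>2)) \<partial>PiM T (\<lambda>_. cgauss 1))"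
proof -
  let ?M = "PiM J (\<lambda>_. cgauss 1)" and ?N = "PiM T (\<lambda>_. cgauss 1)"
  interpret M: prob_space ?M by (rule prob_space_PiM_cgauss) simp
  interpret N: prob_space ?N by (rule prob_space_PiM_cgauss) simp
  interpret MN: pair_prob_space ?M ?N ..
  let ?f = "\<lambda>h g. iexp (2 * Re (\<Sum>k\<in>T. \<Sum>j\<in>J. g k * Y k j * h j))"
  have i: "integrable (?M \<Otimes>\<^sub>M ?N) (\<lambda>(h, g). ?f h g)"
    by (rule MN.integrable_const_bound[where B=1]) (auto simp: case_prod_beta)
  have "(\<integral>h. complex_of_real (exp (- (\<Sum>k\<in>T. (cmod (\<Sum>j\<in>J. Y k j * h j))\<^sup>2))) \<partial>?M) = (\<integral>h. \<integral>g. ?f h g \<partial>?N \<partial>?M)"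
    using integral_PiM_cgauss_iexp[OF T, of "\<lambda>k. \<Sum>j\<in>J. Y k j * h j" for h] by (simp add: sum_distrib_left mult.assoc)
  also have "\<dots> = (\<integral>g. \<integral>h. ?f h g \<partial>?M \<partial>?N)"
    by (rule MN.Fubini_integral[OF i, symmetric])
  also have "\<dots> = (\<integral>g. complex_of_real (exp (- (\<Sum>j\<in>J. (cmod (\<Sum>k\<in>T. Y k j * g k))\<^sup>2))) \<partial>?N)"
  proof -
    have "(\<Sum>k\<in>T. \<Sum>j\<in>J. g k * Y k j * h j) = (\<Sum>j\<in>J. h j * (\<Sum>k\<in>T. Y k j * g k))" for g h
      by (subst sum.swap) (simp add: sum_distrib_left mult_ac)
    then show ?thesis using integral_PiM_cgauss_iexp[OF J, of "\<lambda>j. \<Sum>k\<in>T. Y k j * g k" for g] by simp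
  qed
  finally show ?thesis by (simp del: of_real_exp add: integral_complex_of_real)
qed

text \<open>Both variables live in [0, 1], where by Weierstrass polynomials, hence moments,
  determine the integrals of continuous functions. The density \<phi> stands on one side only
  because a tilted law is to be identified with the law of another variable under an untilted
  measure.\<close>

lemma moments_determine_continuous:
  fixes u w \<phi> :: "_ \<Rightarrow> real"
  assumes "prob_space M" "prob_space N"
    and [measurable]: "u \<in> borel_measurable M" "w \<in> borel_measurable N" "\<phi> \<in> borel_measurable M"
    and u: "\<And>x. u x \<in> {0..1}" and w: "\<And>x. w x \<in> {0..1}" and \<phi>: "\<And>x. \<phi> x \<in> {0..C}"
    and mom: "\<And>n::nat. (\<integral>x. \<phi> x * u x ^ n \<partial>M) = (\<integral>x. w x ^ n \<partial>N)"
    and f: "continuous_on UNIV f"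
  shows "(\<integral>x. \<phi> x * f (u x) \<partial>M) = (\<integral>x. f (w x) \<partial>N)"
proof -
  interpret M: prob_space M by fact
  interpret N: prob_space N by fact
  have [measurable]: "f \<in> borel_measurable borel" using f by (rule borel_measurable_continuous_onI)
  have C: "0 \<le> C" using \<phi>[of undefined] by auto
  have bdd: "\<exists>B. \<forall>x\<in>{0..1::real}. \<bar>g x\<bar> \<le> B" if "continuous_on UNIV g" for g :: "real \<Rightarrow> real"
  proof -
    have "compact (g ` {0..1})" by (intro compact_continuous_image continuous_on_subset[OF that]) auto
    then show ?thesis using compact_imp_bounded bounded_iff[of "g ` {0..1}"] by (force simp: real_norm_def)
  qed
  have iM: "integrable M (\<lambda>x. \<phi> x * g (u x))" if g: "continuous_on UNIV g" for g :: "real \<Rightarrow> real"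
  proof -
    have [measurable]: "g \<in> borel_measurable borel" using g by (rule borel_measurable_continuous_onI)
    obtain B where B: "\<forall>x\<in>{0..1::real}. \<bar>g x\<bar> \<le> B" using bdd[OF g] by auto
    then have "0 \<le> B" by (meson abs_ge_zero atLeastAtMost_iff order.trans order_refl zero_le_one)
    have "norm (\<phi> x * g (u x)) \<le> C * B" for x
      using B u[of x] \<phi>[of x] C unfolding real_norm_def abs_mult by (intro mult_mono) auto
    then show ?thesis by (intro M.integrable_const_bound[where B="C * B"]) auto
  qed
  have iN: "integrable N (\<lambda>x. g (w x))" if g: "continuous_on UNIV g" for g :: "real \<Rightarrow> real"
  proof -
    have [measurable]: "g \<in> borel_measurable borel" using g by (rule borel_measurable_continuous_onI)
    obtain B where B: "\<forall>x\<in>{0..1::real}. \<bar>g x\<bar> \<le> B" using bdd[OF g] by auto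
    then show ?thesis using w by (intro N.integrable_const_bound[where B="B"]) auto
  qed
  have "\<bar>(\<integral>x. \<phi> x * f (u x) \<partial>M) - (\<integral>x. f (w x) \<partial>N)\<bar> \<le> (C + 1) * e" if e: "0 < e" for e
  proof -
    obtain g where g: "real_polynomial_function g" "\<And>x. x \<in> {0..1} \<Longrightarrow> \<bar>f x - g x\<bar> < e"
      using Stone_Weierstrass_real_polynomial_function[of "{0..1::real}" f e] continuous_on_subset[OF f] e by auto
    obtain a n where gs: "g = (\<lambda>x. \<Sum>i\<le>n. a i * x ^ i)" using g(1) unfolding real_polynomial_function_iff_sum by auto
    have gc: "continuous_on UNIV g" unfolding gs by (intro continuous_intros)
    have "(\<integral>x. \<phi> x * g (u x) \<partial>M) = (\<Sum>i\<le>n. a i * (\<integral>x. \<phi> x * u x ^ i \<partial>M))"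
    proof -
      have "(\<integral>x. \<phi> x * g (u x) \<partial>M) = (\<integral>x. (\<Sum>i\<le>n. a i * (\<phi> x * u x ^ i)) \<partial>M)"
        unfolding gs by (simp add: sum_distrib_left mult_ac)
      also have "\<dots> = (\<Sum>i\<le>n. \<integral>x. a i * (\<phi> x * u x ^ i) \<partial>M)"
      proof (intro Bochner_Integration.integral_sum integrable_mult_right)
        have "continuous_on UNIV (\<lambda>x::real. x ^ i)" for i by (intro continuous_intros)
        from iM[OF this] show "integrable M (\<lambda>x. \<phi> x * u x ^ i)" for i .
      qed
      finally show ?thesis by simp
    qed
    also have "\<dots> = (\<Sum>i\<le>n. a i * (\<integral>x. w x ^ i \<partial>N))" by (simp add: mom)
    also have "\<dots> = (\<integral>x. g (w x) \<partial>N)"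
    proof -
      have "continuous_on UNIV (\<lambda>x::real. x ^ i)" for i by (intro continuous_intros)
      from iN[OF this] show ?thesis unfolding gs by (subst Bochner_Integration.integral_sum) auto
    qed
    finally have eq: "(\<integral>x. \<phi> x * g (u x) \<partial>M) = (\<integral>x. g (w x) \<partial>N)" .
    have "\<bar>(\<integral>x. \<phi> x * f (u x) \<partial>M) - (\<integral>x. \<phi> x * g (u x) \<partial>M)\<bar> = \<bar>\<integral>x. \<phi> x * f (u x) - \<phi> x * g (u x) \<partial>M\<bar>"
      using iM[OF f] iM[OF gc] by simp
    also have "\<dots> \<le> (\<integral>x. C * e \<partial>M)"
    proof (rule order_trans[OF integral_abs_bound integral_mono])
      show "\<bar>\<phi> x * f (u x) - \<phi> x * g (u x)\<bar> \<le> C * e" for x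
        using g(2)[OF u[of x]] \<phi>[of x] C unfolding right_diff_distrib[symmetric] abs_mult by (intro mult_mono) auto
    qed (use iM[OF f] iM[OF gc] in auto)
    finally have 1: "\<bar>(\<integral>x. \<phi> x * f (u x) \<partial>M) - (\<integral>x. \<phi> x * g (u x) \<partial>M)\<bar> \<le> C * e" using M.prob_space by simp
    have "\<bar>(\<integral>x. f (w x) \<partial>N) - (\<integral>x. g (w x) \<partial>N)\<bar> = \<bar>\<integral>x. f (w x) - g (w x) \<partial>N\<bar>"
      using iN[OF f] iN[OF gc] by simp
    also have "\<dots> \<le> (\<integral>x. e \<partial>N)"
    proof (rule order_trans[OF integral_abs_bound integral_mono])
      show "\<bar>f (w x) - g (w x)\<bar> \<le> e" for x using g(2)[OF w[of x]] by simp
    qed (use iN[OF f] iN[OF gc] in auto)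
    finally have 2: "\<bar>(\<integral>x. f (w x) \<partial>N) - (\<integral>x. g (w x) \<partial>N)\<bar> \<le> e" using N.prob_space by simp
    show ?thesis using 1 2 eq by (simp add: algebra_simps)
  qed
  note b = this
  have "\<bar>(\<integral>x. \<phi> x * f (u x) \<partial>M) - (\<integral>x. f (w x) \<partial>N)\<bar> \<le> 0"
  proof (rule field_le_epsilon)
    fix e :: real assume "0 < e"
    moreover have "(C + 1) * (e / (C + 1)) = e" using C by simp
    ultimately show "\<bar>(\<integral>x. \<phi> x * f (u x) \<partial>M) - (\<integral>x. f (w x) \<partial>N)\<bar> \<le> 0 + e"
      using b[of "e / (C + 1)"] C by simp
  qed
  then show ?thesis by simp
qed

section \<open>Laplace transforms under an exponential tilt in one direction\<close>

lemma cmod_sum_mult_sq_le: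
  "(cmod (\<Sum>j\<in>J. cnj (x j) * a j))\<^sup>2 \<le> (\<Sum>j\<in>J. (cmod (x j))\<^sup>2) * (\<Sum>j\<in>J. (cmod (a j))\<^sup>2)"
proof -
  have "cmod (\<Sum>j\<in>J. cnj (x j) * a j) \<le> (\<Sum>j\<in>J. cmod (x j) * cmod (a j))"
    by (rule order_trans[OF norm_sum]) (simp add: norm_mult)
  then have "(cmod (\<Sum>j\<in>J. cnj (x j) * a j))\<^sup>2 \<le> (\<Sum>j\<in>J. cmod (x j) * cmod (a j))\<^sup>2"
    by (intro power_mono) auto
  also have "\<dots> \<le> (\<Sum>j\<in>J. (cmod (x j))\<^sup>2) * (\<Sum>j\<in>J. (cmod (a j))\<^sup>2)"
    by (rule Cauchy_Schwarz_ineq_sum)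
  finally show ?thesis .
qed
text \<open>The tilt is absorbed as one more row \<open>sqrt \<epsilon> * x\<close> below the matrix
  \<open>sqrt \<theta> * X\<close>. After transposition this row contributes one more Gaussian
  coordinate, which is integrated out; what remains is the Laplace transform at \<theta> of an
  explicit quadratic form in the other coordinates.\<close>

lemma integral_exp_gaussian_tilt:
  fixes X :: "nat \<Rightarrow> 'j \<Rightarrow> complex" and x :: "'j \<Rightarrow> complex" and t :: nat
  assumes J: "finite J" and \<epsilon>: "0 \<le> \<epsilon>" and \<theta>: "0 \<le> \<theta>"
  defines "a \<equiv> \<lambda>g j. \<Sum>k<t. X k j * g k"
  defines "x2 \<equiv> \<Sum>j\<in>J. (cmod (x j))\<^sup>2"
  shows "(\<integral>h. exp (- \<theta> * (\<Sum>k<t. (cmod (\<Sum>j\<in>J. X k j * h j))\<^sup>2) - \<epsilon> * (cmod (\<Sum>j\<in>J. x j * h j))\<^sup>2) \<partial>PiM J (\<lambda>_. cgauss 1))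
    = (\<integral>g. 1 / (1 + \<epsilon> * x2) * exp (- \<theta> * ((\<Sum>j\<in>J. (cmod (a g j))\<^sup>2) - \<epsilon> / (1 + \<epsilon> * x2) * (cmod (\<Sum>j\<in>J. cnj (x j) * a g j))\<^sup>2))
        \<partial>PiM {..<t} (\<lambda>_. cgauss 1))"
proof -
  interpret product_sigma_finite "\<lambda>_. cgauss 1" by (rule product_sigma_finite_cgauss) simp
  interpret G: prob_space "cgauss 1" by (rule prob_space_cgauss) simp
  interpret N: prob_space "PiM {..t} (\<lambda>_. cgauss 1)" by (rule prob_space_PiM_cgauss) simp
  define Y where "Y k j = (if k < t then sqrt \<theta> * X k j else sqrt \<epsilon> * x j)" for k j
  have x2: "0 \<le> \<epsilon> * x2" unfolding x2_def using \<epsilon> by (simp add: sum_nonneg)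
  have T: "{..t} = insert t {..<t}" by auto
  have "(\<integral>h. exp (- \<theta> * (\<Sum>k<t. (cmod (\<Sum>j\<in>J. X k j * h j))\<^sup>2) - \<epsilon> * (cmod (\<Sum>j\<in>J. x j * h j))\<^sup>2) \<partial>PiM J (\<lambda>_. cgauss 1))
     = (\<integral>h. exp (- (\<Sum>k\<le>t. (cmod (\<Sum>j\<in>J. Y k j * h j))\<^sup>2)) \<partial>PiM J (\<lambda>_. cgauss 1))"
  proof (intro Bochner_Integration.integral_cong refl arg_cong[where f=exp])
    fix h
    have "(cmod (\<Sum>j\<in>J. Y k j * h j))\<^sup>2 = \<theta> * (cmod (\<Sum>j\<in>J. X k j * h j))\<^sup>2" if "k < t" for k
      using that \<theta> by (simp add: Y_def mult.assoc sum_distrib_left[symmetric] norm_mult power_mult_distrib)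
    moreover have "(cmod (\<Sum>j\<in>J. Y t j * h j))\<^sup>2 = \<epsilon> * (cmod (\<Sum>j\<in>J. x j * h j))\<^sup>2"
      using \<epsilon> by (simp add: Y_def mult.assoc sum_distrib_left[symmetric] norm_mult power_mult_distrib)
    ultimately show "- \<theta> * (\<Sum>k<t. (cmod (\<Sum>j\<in>J. X k j * h j))\<^sup>2) - \<epsilon> * (cmod (\<Sum>j\<in>J. x j * h j))\<^sup>2
       = - (\<Sum>k\<le>t. (cmod (\<Sum>j\<in>J. Y k j * h j))\<^sup>2)"
      unfolding T by (simp add: sum_distrib_left sum_negf)
  qed
  also have "\<dots> = (\<integral>g. exp (- (\<Sum>j\<in>J. (cmod (\<Sum>k\<le>t. Y k j * g k))\<^sup>2)) \<partial>PiM {..t} (\<lambda>_. cgauss 1))"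
    by (rule integral_exp_gaussian_transpose) (use J in auto)
  also have "\<dots> = (\<integral>g. (\<integral>y. exp (- (\<Sum>j\<in>J. (cmod (\<Sum>k\<le>t. Y k j * (g(t := y)) k))\<^sup>2)) \<partial>cgauss 1) \<partial>PiM {..<t} (\<lambda>_. cgauss 1))"
    unfolding T
    by (rule product_integral_insert)
       (auto simp: T[symmetric] intro!: N.integrable_const_bound[where B=1] AE_I2 sum_nonneg)
  also have "\<dots> = (\<integral>g. 1 / (1 + \<epsilon> * x2) * exp (- \<theta> * ((\<Sum>j\<in>J. (cmod (a g j))\<^sup>2) - \<epsilon> / (1 + \<epsilon> * x2) * (cmod (\<Sum>j\<in>J. cnj (x j) * a g j))\<^sup>2))
        \<partial>PiM {..<t} (\<lambda>_. cgauss 1))"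
  proof (intro Bochner_Integration.integral_cong refl)
    fix g :: "nat \<Rightarrow> complex"
    define A where "A = (\<Sum>j\<in>J. (cmod (a g j))\<^sup>2)"
    define b where "b = - of_real (sqrt (\<theta> * \<epsilon>)) * (\<Sum>j\<in>J. cnj (x j) * a g j)"
    have ex: "- (\<Sum>j\<in>J. (cmod (\<Sum>k\<le>t. Y k j * (g(t := y)) k))\<^sup>2) = (- \<epsilon> * x2) * (cmod y)\<^sup>2 + 2 * Re (cnj b * y) + (- \<theta> * A)" for y
    proof -
      have s: "(\<Sum>k\<le>t. Y k j * (g(t := y)) k) = of_real (sqrt \<theta>) * a g j + of_real (sqrt \<epsilon>) * x j * y" for j
        unfolding T by (simp add: Y_def a_def sum_distrib_left mult_ac)
      have "(\<Sum>j\<in>J. (cmod (of_real (sqrt \<theta>) * a g j + of_real (sqrt \<epsilon>) * x j * y))\<^sup>2)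
        = (\<Sum>j\<in>J. \<theta> * (cmod (a g j))\<^sup>2 + 2 * Re (of_real (sqrt (\<theta> * \<epsilon>)) * (x j * cnj (a g j)) * y) + \<epsilon> * (cmod (x j))\<^sup>2 * (cmod y)\<^sup>2)"
        unfolding cmod_add_sq using \<theta> \<epsilon> by (simp add: norm_mult power_mult_distrib real_sqrt_mult mult_ac)
      also have "\<dots> = \<theta> * A + 2 * Re (\<Sum>j\<in>J. of_real (sqrt (\<theta> * \<epsilon>)) * (x j * cnj (a g j)) * y) + \<epsilon> * x2 * (cmod y)\<^sup>2"
        by (simp add: sum.distrib A_def x2_def sum_distrib_left sum_distrib_right)
      also have "(\<Sum>j\<in>J. of_real (sqrt (\<theta> * \<epsilon>)) * (x j * cnj (a g j)) * y) = - (cnj b * y)"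
        by (simp add: b_def sum_distrib_left sum_distrib_right sum_negf mult_ac)
      finally show ?thesis unfolding s by simp
    qed
    have bb: "(cmod b)\<^sup>2 = \<theta> * \<epsilon> * (cmod (\<Sum>j\<in>J. cnj (x j) * a g j))\<^sup>2"
      unfolding b_def norm_mult power_mult_distrib using \<theta> \<epsilon> by (simp add: power2_eq_square)
    have "(\<integral>y. exp ((- \<epsilon> * x2) * (cmod y)\<^sup>2 + 2 * Re (cnj b * y) + (- \<theta> * A)) \<partial>cgauss 1)
      = enn2real (\<integral>\<^sup>+y. ennreal (exp ((- \<epsilon> * x2) * (cmod y)\<^sup>2 + 2 * Re (cnj b * y) + (- \<theta> * A))) \<partial>cgauss 1)"
      by (rule integral_eq_nn_integral) auto
    also have "\<dots> = 1 / (1 + \<epsilon> * x2) * exp ((cmod b)\<^sup>2 / (1 + \<epsilon> * x2) - \<theta> * A)"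
      using x2 by (subst nn_integral_cgauss_exp_linear) auto
    also have "(cmod b)\<^sup>2 / (1 + \<epsilon> * x2) - \<theta> * A = - \<theta> * (A - \<epsilon> / (1 + \<epsilon> * x2) * (cmod (\<Sum>j\<in>J. cnj (x j) * a g j))\<^sup>2)"
      unfolding bb by (simp add: algebra_simps)
    finally show "(\<integral>y. exp (- (\<Sum>j\<in>J. (cmod (\<Sum>k\<le>t. Y k j * (g(t := y)) k))\<^sup>2)) \<partial>cgauss 1)
      = 1 / (1 + \<epsilon> * x2) * exp (- \<theta> * ((\<Sum>j\<in>J. (cmod (a g j))\<^sup>2) - \<epsilon> / (1 + \<epsilon> * x2) * (cmod (\<Sum>j\<in>J. cnj (x j) * a g j))\<^sup>2))"
      unfolding ex A_def .
  qed
  finally show ?thesis .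
qed

text \<open>Under the normalised tilt \<open>exp (- S h)\<close> has the same law as
  \<open>exp (- T \<epsilon> g)\<close> for an untilted \<open>g\<close>. Since
  \<open>T \<epsilon> g\<close> is pointwise at most \<open>T 0 g\<close>, this is a coupling:
  damping the gains along \<open>x\<close> makes \<open>S\<close> stochastically smaller, so means
  of increasing functions of \<open>exp (- S h)\<close> can only grow.\<close>

lemma gaussian_tilt_mono:
  fixes X :: "nat \<Rightarrow> 'j \<Rightarrow> complex" and x :: "'j \<Rightarrow> complex" and t :: nat and f :: "real \<Rightarrow> real"
  assumes J: "finite J" and \<epsilon>: "0 \<le> \<epsilon>" and f: "continuous_on UNIV f" "mono f"
  defines "S \<equiv> \<lambda>h. \<Sum>k<t. (cmod (\<Sum>j\<in>J. X k j * h j))\<^sup>2"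
  defines "x2 \<equiv> \<Sum>j\<in>J. (cmod (x j))\<^sup>2"
  shows "(\<integral>h. f (exp (- S h)) \<partial>PiM J (\<lambda>_. cgauss 1))
     \<le> (1 + \<epsilon> * x2) * (\<integral>h. exp (- \<epsilon> * (cmod (\<Sum>j\<in>J. x j * h j))\<^sup>2) * f (exp (- S h)) \<partial>PiM J (\<lambda>_. cgauss 1))"
proof -
  let ?M = "PiM J (\<lambda>_. cgauss 1)" and ?N = "PiM {..<t} (\<lambda>_. cgauss 1)"
  interpret N: prob_space ?N by (rule prob_space_PiM_cgauss) simp
  have P: "prob_space ?M" "prob_space ?N" by (auto intro: prob_space_PiM_cgauss)
  have [measurable]: "f \<in> borel_measurable borel" using f(1) by (rule borel_measurable_continuous_onI)
  have x2: "0 \<le> x2" unfolding x2_def by (simp add: sum_nonneg)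
  have p: "0 < 1 + e * x2" if "0 \<le> e" for e using x2 that by (simp add: add_pos_nonneg)
  define a where "a = (\<lambda>(g :: nat \<Rightarrow> complex) j. \<Sum>k<t. X k j * g k)"
  define A where "A g = (\<Sum>j\<in>J. (cmod (a g j))\<^sup>2)" for g
  define T where "T e g = A g - e / (1 + e * x2) * (cmod (\<Sum>j\<in>J. cnj (x j) * a g j))\<^sup>2" for e g
  have [measurable]: "A \<in> borel_measurable ?N" "T e \<in> borel_measurable ?N" for e
    unfolding T_def A_def a_def by measurable
  have [measurable]: "S \<in> borel_measurable ?M" unfolding S_def by measurable
  \<comment> \<open>Cauchy-Schwarz keeps \<open>T e g\<close> nonnegative, so that
    \<open>exp (- T e g)\<close> stays in [0, 1], where moments determine the law.\<close>
  have TA: "T e g \<le> A g" "0 \<le> T e g" if e: "0 \<le> e" for e g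
  proof -
    show "T e g \<le> A g" unfolding T_def using p[OF e] e by simp
    have "e / (1 + e * x2) * (cmod (\<Sum>j\<in>J. cnj (x j) * a g j))\<^sup>2 \<le> e / (1 + e * x2) * (x2 * A g)"
      unfolding x2_def A_def using p[OF e] e by (intro mult_left_mono cmod_sum_mult_sq_le) (auto simp: x2_def)
    also have "\<dots> = (e * x2) / (1 + e * x2) * A g" by simp
    also have "\<dots> \<le> 1 * A g"
      using p[OF e] by (intro mult_right_mono) (auto simp: A_def sum_nonneg)
    finally show "0 \<le> T e g" unfolding T_def by simp
  qed
  have key: "(\<integral>h. ((1 + e * x2) * exp (- e * (cmod (\<Sum>j\<in>J. x j * h j))\<^sup>2)) * f (exp (- S h)) \<partial>?M)
     = (\<integral>g. f (exp (- T e g)) \<partial>?N)" if e: "0 \<le> e" for e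
  proof (rule moments_determine_continuous[OF P, where f=f and u="\<lambda>h. exp (- S h)" and w="\<lambda>g. exp (- T e g)"
      and \<phi>="\<lambda>h. (1 + e * x2) * exp (- e * (cmod (\<Sum>j\<in>J. x j * h j))\<^sup>2)" and C="1 + e * x2"])
    show "exp (- S h) \<in> {0..1}" for h by (auto simp: S_def sum_nonneg)
    show "exp (- T e g) \<in> {0..1}" for g using TA[OF e] by auto
    show "(1 + e * x2) * exp (- e * (cmod (\<Sum>j\<in>J. x j * h j))\<^sup>2) \<in> {0..1 + e * x2}" for h
      using p[OF e] e by (auto intro!: mult_left_le)
    show "(\<integral>h. ((1 + e * x2) * exp (- e * (cmod (\<Sum>j\<in>J. x j * h j))\<^sup>2)) * exp (- S h) ^ n \<partial>?M)
       = (\<integral>g. exp (- T e g) ^ n \<partial>?N)" for n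
    proof -
      \<comment> \<open>The moment of order \<open>n\<close> of \<open>exp (- S h)\<close> is the
        Laplace transform at \<open>\<theta> = n\<close>, so integer arguments suffice.\<close>
      have "(\<integral>h. ((1 + e * x2) * exp (- e * (cmod (\<Sum>j\<in>J. x j * h j))\<^sup>2)) * exp (- S h) ^ n \<partial>?M)
        = (\<integral>h. (1 + e * x2) * exp (- real n * S h - e * (cmod (\<Sum>j\<in>J. x j * h j))\<^sup>2) \<partial>?M)"
        by (intro Bochner_Integration.integral_cong refl) (simp add: exp_of_nat_mult[symmetric] exp_add[symmetric])
      also have "\<dots> = (1 + e * x2) * (\<integral>g. 1 / (1 + e * x2) * exp (- real n * T e g) \<partial>?N)"
        unfolding integral_mult_right_zero S_def integral_exp_gaussian_tilt[OF J e of_nat_0_le_iff] T_def A_def a_def x2_def ..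
      also have "\<dots> = (\<integral>g. exp (- T e g) ^ n \<partial>?N)"
        using p[OF e] unfolding integral_mult_right_zero by (simp add: exp_of_nat_mult[symmetric])
      finally show ?thesis .
    qed
  qed (use f in auto)
  have ib: "integrable ?N (\<lambda>g. f (exp (- T e g)))" if e: "0 \<le> e" for e
  proof (rule N.integrable_const_bound[where B="\<bar>f 0\<bar> + \<bar>f 1\<bar>"])
    have "f 0 \<le> f (exp (- T e g))" "f (exp (- T e g)) \<le> f 1" for g
      using TA(2)[OF e, of g] by (auto intro!: monoD[OF f(2)])
    then show "AE g in ?N. norm (f (exp (- T e g))) \<le> \<bar>f 0\<bar> + \<bar>f 1\<bar>"
      by (intro AE_I2) (smt (verit) real_norm_def)
  qed measurable
  have "(\<integral>h. f (exp (- S h)) \<partial>?M) = (\<integral>g. f (exp (- T 0 g)) \<partial>?N)" using key[of 0] by simp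
  also have "\<dots> \<le> (\<integral>g. f (exp (- T \<epsilon> g)) \<partial>?N)"
    using TA(1)[OF \<epsilon>] by (intro integral_mono ib \<epsilon> order_refl monoD[OF f(2)]) (simp add: T_def)
  also have "\<dots> = (1 + \<epsilon> * x2) * (\<integral>h. exp (- \<epsilon> * (cmod (\<Sum>j\<in>J. x j * h j))\<^sup>2) * f (exp (- S h)) \<partial>?M)"
    using key[OF \<epsilon>] by (simp add: mult.assoc)
  finally show ?thesis .
qed

lemma gaussian_tilt_indicator:
  fixes X :: "nat \<Rightarrow> 'j \<Rightarrow> complex" and x :: "'j \<Rightarrow> complex" and t :: nat
  assumes J: "finite J" and \<epsilon>: "0 \<le> \<epsilon>"
  defines "S \<equiv> \<lambda>h. \<Sum>k<t. (cmod (\<Sum>j\<in>J. X k j * h j))\<^sup>2"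
  defines "x2 \<equiv> \<Sum>j\<in>J. (cmod (x j))\<^sup>2"
  shows "(\<integral>h. indicator {h. S h < B} h \<partial>PiM J (\<lambda>_. cgauss 1))
     \<le> (1 + \<epsilon> * x2) * (\<integral>h. exp (- \<epsilon> * (cmod (\<Sum>j\<in>J. x j * h j))\<^sup>2) * indicator {h. S h < B} h \<partial>PiM J (\<lambda>_. cgauss 1))"
proof -
  let ?M = "PiM J (\<lambda>_. cgauss 1)"
  interpret M: prob_space ?M by (rule prob_space_PiM_cgauss) simp
  \<comment> \<open>Continuous increasing ramps that vanish up to \<open>exp (- B)\<close> and tend
    to 1 beyond it; their limit is the indicator of the strict inequality
    \<open>S h < B\<close>.\<close>
  define f where "f m v = min 1 (max 0 (real m * (v - exp (- B))))" for m :: nat and v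
  have fc: "continuous_on UNIV (f m)" for m unfolding f_def by (intro continuous_intros)
  have fm: "mono (f m)" for m unfolding f_def
    by (intro monoI min.mono max.mono order_refl mult_left_mono) auto
  have [measurable]: "f m \<in> borel_measurable borel" for m using fc by (rule borel_measurable_continuous_onI)
  have [measurable]: "S \<in> borel_measurable ?M" unfolding S_def by measurable
  have [measurable]: "(\<lambda>h. indicator {h. S h < B} h :: real) \<in> borel_measurable ?M"
    by (simp add: indicator_def)
  have lim: "(\<lambda>m. f m (exp (- S h))) \<longlonglongrightarrow> indicator {h. S h < B} h" for h
  proof (cases "S h < B")
    case True
    define d where "d = exp (- S h) - exp (- B)"
    have d: "0 < d" using True by (simp add: d_def)
    obtain m0 :: nat where m0: "1 / d < real m0" using reals_Archimedean2 by blast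
    have "f m (exp (- S h)) = 1" if "m0 \<le> m" for m
    proof -
      have "1 / d < real m" using m0 that by simp
      then have "1 < real m * d" using d by (simp add: field_simps)
      then show ?thesis unfolding f_def d_def[symmetric] by simp
    qed
    then show ?thesis using True by (intro tendsto_eventually) (auto simp: eventually_sequentially)
  next
    case False
    then have "exp (- S h) - exp (- B) \<le> 0" by simp
    then have "real m * (exp (- S h) - exp (- B)) \<le> 0" for m by (rule mult_nonneg_nonpos[rotated]) simp
    then have "max 0 (real m * (exp (- S h) - exp (- B))) = 0" for m by (rule max_absorb1)
    then have "f m (exp (- S h)) = 0" for m
      unfolding f_def by simp
    then show ?thesis using False by simp
  qed
  have f01: "0 \<le> f m v" "f m v \<le> 1" for m v unfolding f_def by auto
  have e01: "exp (- \<epsilon> * (cmod (\<Sum>j\<in>J. x j * h j))\<^sup>2) \<le> 1" for h using \<epsilon> by simp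
  have 1: "(\<lambda>m. \<integral>h. f m (exp (- S h)) \<partial>?M) \<longlonglongrightarrow> (\<integral>h. indicator {h. S h < B} h \<partial>?M)"
    by (rule integral_dominated_convergence[where w="\<lambda>_. 1"]) (auto simp: lim f01)
  have 2: "(\<lambda>m. (1 + \<epsilon> * x2) * (\<integral>h. exp (- \<epsilon> * (cmod (\<Sum>j\<in>J. x j * h j))\<^sup>2) * f m (exp (- S h)) \<partial>?M))
    \<longlonglongrightarrow> (1 + \<epsilon> * x2) * (\<integral>h. exp (- \<epsilon> * (cmod (\<Sum>j\<in>J. x j * h j))\<^sup>2) * indicator {h. S h < B} h \<partial>?M)"
  proof (intro tendsto_mult_left integral_dominated_convergence[where w="\<lambda>_. 1"] AE_I2 lim)
    show "norm (exp (- \<epsilon> * (cmod (\<Sum>j\<in>J. x j * h j))\<^sup>2) * f m (exp (- S h))) \<le> 1" for h m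
      using mult_mono[OF e01 f01(2) _ f01(1)] f01(1) by (simp add: abs_mult)
  qed (auto intro!: lim)
  show ?thesis
    by (rule LIMSEQ_le[OF 1 2]) (use gaussian_tilt_mono[OF J \<epsilon> fc fm] in \<open>auto simp: S_def x2_def\<close>)
qed

text \<open>Having received little so far does not make the energy received next exceed its mean. Hence a
  stopping rule that depends on the incoming gains gives the receiver no advantage in the converse.\<close>

lemma gaussian_ellipsoid_correlation:
  fixes X :: "nat \<Rightarrow> 'j \<Rightarrow> complex" and x :: "'j \<Rightarrow> complex" and t :: nat
  assumes J: "finite J"
  defines "S \<equiv> \<lambda>h. \<Sum>k<t. (cmod (\<Sum>j\<in>J. X k j * h j))\<^sup>2"
  shows "(\<integral>\<^sup>+h. ennreal ((cmod (\<Sum>j\<in>J. x j * h j))\<^sup>2) * indicator {h. S h < B} h \<partial>PiM J (\<lambda>_. cgauss 1))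
     \<le> ennreal (\<Sum>j\<in>J. (cmod (x j))\<^sup>2) * (\<integral>\<^sup>+h. indicator {h. S h < B} h \<partial>PiM J (\<lambda>_. cgauss 1))"
proof -
  let ?M = "PiM J (\<lambda>_. cgauss 1)"
  interpret M: prob_space ?M by (rule prob_space_PiM_cgauss) simp
  define x2 where "x2 = (\<Sum>j\<in>J. (cmod (x j))\<^sup>2)"
  define q where "q h = (cmod (\<Sum>j\<in>J. x j * h j))\<^sup>2" for h
  define \<phi> where "\<phi> h = (indicator {h. S h < B} h :: real)" for h
  have x2: "0 \<le> x2" unfolding x2_def by (simp add: sum_nonneg)
  have q: "0 \<le> q h" for h by (simp add: q_def)
  have [measurable]: "S \<in> borel_measurable ?M" "q \<in> borel_measurable ?M" unfolding S_def q_def by measurable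
  have [measurable]: "\<phi> \<in> borel_measurable ?M"
    unfolding \<phi>_def by (simp add: indicator_def)
  have \<phi>01: "0 \<le> \<phi> h" "\<phi> h \<le> 1" for h by (auto simp: \<phi>_def indicator_def)
  define e where "e m = 1 / real (Suc m)" for m
  have e: "0 < e m" for m by (simp add: e_def)
  \<comment> \<open>Difference quotient of the tilt at 0, with limit \<open>q h\<close> as
    \<open>e m\<close> tends to 0. The fact \<open>bound\<close> is the tilt inequality divided by
    \<open>e m\<close>; Fatou's lemma carries it to the limit.\<close>
  define u where "u m h = (1 - exp (- e m * q h)) / e m" for m h
  have u0: "0 \<le> u m h" for m h unfolding u_def using e[of m] q[of h] by simp
  have i1: "integrable ?M \<phi>" by (rule M.integrable_const_bound[where B=1]) (use \<phi>01 in auto)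
  have i2: "integrable ?M (\<lambda>h. exp (- e m * q h) * \<phi> h)" for m
  proof (rule M.integrable_const_bound[where B=1])
    show "AE h in ?M. norm (exp (- e m * q h) * \<phi> h) \<le> 1"
      using mult_mono[of "exp (- e m * q h)" 1 "\<phi> h" 1 for h] \<phi>01 q less_imp_le[OF e[of m]]
      by (intro AE_I2) (simp add: abs_mult)
  qed measurable
  have bound: "(\<integral>h. u m h * \<phi> h \<partial>?M) \<le> x2 * (\<integral>h. \<phi> h \<partial>?M)" for m
  proof -
    let ?E = "\<integral>h. exp (- e m * q h) * \<phi> h \<partial>?M"
    have t: "(\<integral>h. \<phi> h \<partial>?M) \<le> (1 + e m * x2) * ?E"
      using gaussian_tilt_indicator[OF J less_imp_le[OF e[of m]], where X=X and x=x and t=t and B=B]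
      by (simp add: S_def q_def x2_def \<phi>_def)
    have E: "?E \<le> (\<integral>h. \<phi> h \<partial>?M)"
      by (intro integral_mono i1 i2 mult_left_le_one_le \<phi>01) (use q less_imp_le[OF e[of m]] in auto)
    have "(\<integral>h. u m h * \<phi> h \<partial>?M) = (\<integral>h. (\<phi> h - exp (- e m * q h) * \<phi> h) / e m \<partial>?M)"
      by (simp add: u_def field_simps)
    also have "\<dots> = ((\<integral>h. \<phi> h \<partial>?M) - ?E) / e m"
      using i1 i2 by simp
    also have "\<dots> \<le> (e m * x2 * ?E) / e m"
      using t e[of m] by (intro divide_right_mono) (auto simp: algebra_simps)
    also have "\<dots> = x2 * ?E" using e[of m] by simp
    also have "\<dots> \<le> x2 * (\<integral>h. \<phi> h \<partial>?M)" using E x2 by (intro mult_left_mono)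
    finally show ?thesis .
  qed
  have nnphi: "(\<integral>\<^sup>+h. ennreal (\<phi> h) \<partial>?M) = (\<integral>h. \<phi> h \<partial>?M)"
    using i1 \<phi>01 by (intro nn_integral_eq_integral) auto
  have iu: "integrable ?M (\<lambda>h. u m h * \<phi> h)" for m
  proof -
    have "u m h * \<phi> h = (\<phi> h - exp (- e m * q h) * \<phi> h) / e m" for h by (simp add: u_def field_simps)
    then show ?thesis using i1 i2 by simp
  qed
  have lim: "(\<lambda>m. ennreal (u m h * \<phi> h)) \<longlonglongrightarrow> ennreal (q h * \<phi> h)" for h
  proof -
    have "((\<lambda>y. (1 - exp (- y * q h)) / y) \<longlongrightarrow> q h) (at_right 0)"
    proof (cases "q h = 0")
      case False
      have "((\<lambda>y. (1 - exp (- y * c)) / y) \<longlongrightarrow> c) (at_right 0)" if "0 < c" for c :: real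
        using that by real_asymp
      from this[of "q h"] show ?thesis using False q[of h] by simp
    qed simp
    moreover have "filterlim e (at_right 0) sequentially" unfolding e_def by real_asymp
    ultimately have "(\<lambda>m. u m h) \<longlonglongrightarrow> q h" unfolding u_def by (rule filterlim_compose)
    then show ?thesis by (intro tendsto_ennrealI tendsto_mult_right)
  qed
  have "(\<integral>\<^sup>+h. ennreal (q h * \<phi> h) \<partial>?M) = (\<integral>\<^sup>+h. liminf (\<lambda>m. ennreal (u m h * \<phi> h)) \<partial>?M)"
    by (intro nn_integral_cong) (rule lim_imp_Liminf[OF sequentially_bot lim, symmetric])
  also have "\<dots> \<le> liminf (\<lambda>m. \<integral>\<^sup>+h. ennreal (u m h * \<phi> h) \<partial>?M)"
    by (rule nn_integral_liminf) (auto simp: u_def)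
  also have "\<dots> \<le> ennreal (x2 * (\<integral>h. \<phi> h \<partial>?M))"
  proof (rule Liminf_le)
    show "\<forall>\<^sub>F m in sequentially. (\<integral>\<^sup>+h. ennreal (u m h * \<phi> h) \<partial>?M) \<le> ennreal (x2 * (\<integral>h. \<phi> h \<partial>?M))"
      using bound iu u0 \<phi>01 by (intro always_eventually allI) (subst nn_integral_eq_integral, auto intro!: ennreal_leI)
  qed simp
  also have "\<dots> = ennreal x2 * (\<integral>\<^sup>+h. ennreal (\<phi> h) \<partial>?M)"
    unfolding nnphi using x2 by (simp add: ennreal_mult')
  finally show ?thesis
    unfolding \<phi>_def q_def x2_def by (simp add: ennreal_mult' ennreal_indicator)
qed

section \<open>Change of measure on a prefix\<close>

text \<open>The Radon-Nikodym density of \<open>cgauss N\<close> translated by \<open>s\<close> with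
  respect to the centred \<open>cgauss v\<close>.\<close>

definition lratio :: "real \<Rightarrow> real \<Rightarrow> complex \<Rightarrow> complex \<Rightarrow> real" where
  "lratio N v s y = v / N * exp ((cmod y)\<^sup>2 / v - (cmod (y - s))\<^sup>2 / N)"

lemma lratio_pos: "0 < N \<Longrightarrow> 0 < v \<Longrightarrow> 0 < lratio N v s y"
  by (simp add: lratio_def)

lemma borel_measurable_lratio [measurable (raw)]:
  assumes [measurable]: "f \<in> borel_measurable M"
  shows "(\<lambda>x. lratio N v s (f x)) \<in> borel_measurable M"
  unfolding lratio_def by measurable

lemma nn_integral_cgauss_lratio:
  assumes N: "0 < N" "0 < v" and [measurable]: "f \<in> borel_measurable borel"
  shows "(\<integral>\<^sup>+z. f (s + z) \<partial>cgauss N) = (\<integral>\<^sup>+y. ennreal (lratio N v s y) * f y \<partial>cgauss v)"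
proof -
  have "ennreal (exp (- ((cmod (y - s))\<^sup>2) / N) / (pi * N))
     = ennreal (exp (- ((cmod y)\<^sup>2) / v) / (pi * v)) * ennreal (lratio N v s y)" for y
  proof -
    have "exp (- ((cmod y)\<^sup>2) / v) * exp ((cmod y)\<^sup>2 / v - (cmod (y - s))\<^sup>2 / N) = exp (- ((cmod (y - s))\<^sup>2) / N)"
      by (simp flip: exp_add)
    then show ?thesis
      using N by (subst ennreal_mult[symmetric]) (auto simp: lratio_def)
  qed
  then show ?thesis
    by (simp add: nn_integral_cgauss_translate nn_integral_cgauss mult.assoc)
qed

text \<open>Relative entropy, in nats, of \<open>cgauss N\<close> with respect to
  \<open>cgauss v\<close>. A translation by \<open>s\<close> adds
  \<open>(cmod s)\<^sup>2 / v\<close>, which is why information becomes linear in received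
  energy.\<close>

definition kl :: "real \<Rightarrow> real \<Rightarrow> real" where
  "kl N v = ln (v / N) - (1 - N / v)"

lemma kl_nonneg:
  assumes "0 < N" "N \<le> v" shows "0 \<le> kl N v"
proof -
  have "ln (N / v) \<le> N / v - 1" using assms by (intro ln_le_minus_one) auto
  then show ?thesis using assms by (simp add: kl_def ln_div)
qed

text \<open>A bound on the Renyi divergence of order 1 + \<open>l\<close>. For small
  \<open>l\<close> the exponent divided by \<open>l\<close> approaches the relative entropy
  \<open>kl N v + (cmod s)\<^sup>2 / v\<close> of the translated law, so Markov's inequality with
  small \<open>l\<close> loses arbitrarily little. One factor of the density returns to the true
  law, where only an exponential moment is left to compute.\<close>

lemma nn_integral_lratio_powr:
  assumes N: "0 < N" "N \<le> v" and l: "0 < l" "l \<le> 1"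
  shows "(\<integral>\<^sup>+y. ennreal (lratio N v s y powr (1 + l)) \<partial>cgauss v)
    \<le> ennreal (exp (l * (kl N v + l + (1 + l) * (cmod s)\<^sup>2 / v)))"
proof -
  have v: "0 < v" using N by simp
  define \<theta> where "\<theta> = 1 - N / v"
  have \<theta>: "0 \<le> \<theta>" "\<theta> \<le> 1" using N v by (auto simp: \<theta>_def)
  define D where "D = 1 + l * \<theta>"
  have D: "1 \<le> D" using \<theta> l by (simp add: D_def)
  have D': "1 - (l / v - l / N) * N = D" using N v by (simp add: D_def \<theta>_def field_simps)
  have k: "(l / v - l / N) * N < 1" using D' D by linarith
  have "(\<integral>\<^sup>+y. ennreal (lratio N v s y powr (1 + l)) \<partial>cgauss v)
      = (\<integral>\<^sup>+y. ennreal (lratio N v s y) * ennreal (lratio N v s y powr l) \<partial>cgauss v)"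
    using lratio_pos[OF N(1) v] by (simp add: powr_add ennreal_mult[symmetric] less_imp_le)
  also have "\<dots> = (\<integral>\<^sup>+z. ennreal (lratio N v s (s + z) powr l) \<partial>cgauss N)"
    by (rule nn_integral_cgauss_lratio[symmetric]) (use N v in auto)
  also have "\<dots> = (\<integral>\<^sup>+z. ennreal ((v / N) powr l) * ennreal (exp ((l / v - l / N) * (cmod z)\<^sup>2 + 2 * Re (cnj (of_real (l / v) * s) * z) + l / v * (cmod s)\<^sup>2)) \<partial>cgauss N)"
  proof (intro nn_integral_cong)
    fix z
    have "lratio N v s (s + z) powr l = (v / N) powr l * exp (l * ((cmod (s + z))\<^sup>2 / v - (cmod z)\<^sup>2 / N))"
    proof -
      have "exp e powr l = exp (l * e)" for e by (simp add: powr_def)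
      moreover have "0 \<le> v / N" using N v by simp
      ultimately show ?thesis unfolding lratio_def by (simp add: powr_mult del: times_divide_eq_left)
    qed
    also have "l * ((cmod (s + z))\<^sup>2 / v - (cmod z)\<^sup>2 / N) = (l / v - l / N) * (cmod z)\<^sup>2 + 2 * Re (cnj (of_real (l / v) * s) * z) + l / v * (cmod s)\<^sup>2"
      unfolding cmod_add_sq using N v by (simp add: field_simps)
    finally show "ennreal (lratio N v s (s + z) powr l) = ennreal ((v / N) powr l) * ennreal (exp ((l / v - l / N) * (cmod z)\<^sup>2 + 2 * Re (cnj (of_real (l / v) * s) * z) + l / v * (cmod s)\<^sup>2))"
      by (simp add: ennreal_mult[symmetric])
  qed
  also have "\<dots> = ennreal ((v / N) powr l) * ennreal (1 / D * exp (N * (cmod (of_real (l / v) * s))\<^sup>2 / D + l / v * (cmod s)\<^sup>2))"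
    by (subst nn_integral_cmult) (simp_all only: nn_integral_cgauss_exp_linear[OF N(1) k] D', measurable)
  also have "\<dots> = ennreal ((v / N) powr l / D * exp (N * (l / v)\<^sup>2 * (cmod s)\<^sup>2 / D + l / v * (cmod s)\<^sup>2))"
  proof -
    have "(cmod (of_real (l / v) * s))\<^sup>2 = (l / v)\<^sup>2 * (cmod s)\<^sup>2"
      unfolding norm_mult norm_of_real power_mult_distrib by (simp add: power_divide)
    then show ?thesis using D by (subst ennreal_mult[symmetric]) (auto simp: mult.assoc)
  qed
  also have "\<dots> \<le> ennreal (exp (l * ln (v / N)) * exp (- (l * \<theta>) + l * l) * exp (l * (1 + l) * (cmod s)\<^sup>2 / v))"
  proof (intro ennreal_leI mult_mono)
    \<comment> \<open>This supplies the part \<open>- (1 - N / v)\<close> of \<open>kl N v\<close>,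
      at the price of the error \<open>l * l\<close>.\<close>
    have "1 / D \<le> exp (- (l * \<theta>) + l * l)"
    proof -
      have "l * \<theta> - (l * \<theta>)\<^sup>2 \<le> ln D" unfolding D_def
        using l \<theta> by (intro ln_one_plus_pos_lower_bound) (auto simp: mult_le_one)
      moreover have "(l * \<theta>)\<^sup>2 \<le> l * l"
        using l \<theta> by (simp add: power2_eq_square mult_mono mult_le_one mult_left_le)
      ultimately have "- ln D \<le> - (l * \<theta>) + l * l" by simp
      then have "exp (- ln D) \<le> exp (- (l * \<theta>) + l * l)" by simp
      then show ?thesis using D by (simp add: exp_minus inverse_eq_divide)
    qed
    moreover have "(v / N) powr l = exp (l * ln (v / N))" using N v by (simp add: powr_def)
    ultimately show "(v / N) powr l / D \<le> exp (l * ln (v / N)) * exp (- (l * \<theta>) + l * l)"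
      by (simp add: divide_inverse mult_left_mono)
    have "N * (l / v)\<^sup>2 * (cmod s)\<^sup>2 / D \<le> N * (l / v)\<^sup>2 * (cmod s)\<^sup>2 / 1"
      using D N by (intro divide_left_mono) auto
    also have "\<dots> = (N / v) * (l * l * (cmod s)\<^sup>2 / v)" using v by (simp add: power2_eq_square)
    also have "\<dots> \<le> 1 * (l * l * (cmod s)\<^sup>2 / v)" using N v l by (intro mult_right_mono) auto
    finally show "exp (N * (l / v)\<^sup>2 * (cmod s)\<^sup>2 / D + l / v * (cmod s)\<^sup>2) \<le> exp (l * (1 + l) * (cmod s)\<^sup>2 / v)"
      by (simp add: algebra_simps add_divide_distrib)
  qed auto
  also have "\<dots> = ennreal (exp (l * (kl N v + l + (1 + l) * (cmod s)\<^sup>2 / v)))"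
    unfolding exp_add[symmetric] kl_def \<theta>_def by (simp add: algebra_simps)
  finally show ?thesis .
qed

lemma nn_integral_PiM_cgauss_lratio:
  assumes N: "0 < N" "0 < v" and I: "finite I" and f: "f \<in> borel_measurable (PiM I (\<lambda>_. borel))"
  shows "(\<integral>\<^sup>+z. f (\<lambda>k\<in>I. s k + z k) \<partial>PiM I (\<lambda>_. cgauss N))
    = (\<integral>\<^sup>+y. ennreal (\<Prod>k\<in>I. lratio N v (s k) (y k)) * f y \<partial>PiM I (\<lambda>_. cgauss v))"
  using I f
proof (induction I arbitrary: f)
  case empty
  then show ?case by (simp add: PiM_empty nn_integral_count_space_finite)
next
  case (insert i I)
  note [measurable] = insert.prems
  interpret P: product_sigma_finite "\<lambda>_. cgauss N" by (rule product_sigma_finite_cgauss) fact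
  interpret Q: product_sigma_finite "\<lambda>_. cgauss v" by (rule product_sigma_finite_cgauss) fact
  interpret q: sigma_finite_measure "cgauss v" using Q.sigma_finite_measures .
  define F where "F w = (\<integral>\<^sup>+y. ennreal (lratio N v (s i) y) * f (w(i := y)) \<partial>cgauss v)" for w
  have [measurable]: "F \<in> borel_measurable (PiM I (\<lambda>_. borel))"
    unfolding F_def by measurable
  have "(\<integral>\<^sup>+z. f (\<lambda>k\<in>insert i I. s k + z k) \<partial>PiM (insert i I) (\<lambda>_. cgauss N))
     = (\<integral>\<^sup>+x. \<integral>\<^sup>+y. f (\<lambda>k\<in>insert i I. s k + (x(i := y)) k) \<partial>cgauss N \<partial>PiM I (\<lambda>_. cgauss N))"
    by (rule P.product_nn_integral_insert) (use insert.hyps in measurable)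
  also have "\<dots> = (\<integral>\<^sup>+x. F (\<lambda>k\<in>I. s k + x k) \<partial>PiM I (\<lambda>_. cgauss N))"
  proof (intro nn_integral_cong)
    fix x
    have "(\<lambda>k\<in>insert i I. s k + (x(i := y)) k) = (\<lambda>k\<in>I. s k + x k)(i := s i + y)" for y
      using insert.hyps by (auto simp: fun_eq_iff restrict_def)
    moreover have "(\<lambda>y. f ((\<lambda>k\<in>I. s k + x k)(i := y))) \<in> borel_measurable borel"
    proof -
      have "(\<lambda>k\<in>I. s k + x k) \<in> space (PiM I (\<lambda>_. borel))" by (auto simp: space_PiM)
      then show ?thesis by measurable
    qed
    ultimately show "(\<integral>\<^sup>+y. f (\<lambda>k\<in>insert i I. s k + (x(i := y)) k) \<partial>cgauss N) = F (\<lambda>k\<in>I. s k + x k)"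
      unfolding F_def using nn_integral_cgauss_lratio[OF N, of "\<lambda>y. f ((\<lambda>k\<in>I. s k + x k)(i := y))" "s i"] by simp
  qed
  also have "\<dots> = (\<integral>\<^sup>+x. ennreal (\<Prod>k\<in>I. lratio N v (s k) (x k)) * F x \<partial>PiM I (\<lambda>_. cgauss v))"
    by (rule insert.IH) measurable
  also have "\<dots> = (\<integral>\<^sup>+x. \<integral>\<^sup>+y. ennreal (\<Prod>k\<in>insert i I. lratio N v (s k) ((x(i := y)) k)) * f (x(i := y)) \<partial>cgauss v \<partial>PiM I (\<lambda>_. cgauss v))"
  proof (intro nn_integral_cong)
    fix x assume x: "x \<in> space (PiM I (\<lambda>_. cgauss v))"
    have "(\<Prod>k\<in>insert i I. lratio N v (s k) ((x(i := y)) k)) = lratio N v (s i) y * (\<Prod>k\<in>I. lratio N v (s k) (x k))" for y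
    proof -
      have "(\<Prod>k\<in>I. lratio N v (s k) ((x(i := y)) k)) = (\<Prod>k\<in>I. lratio N v (s k) (x k))"
        using insert.hyps by (intro prod.cong) auto
      then show ?thesis using insert.hyps by simp
    qed
    moreover have "x \<in> space (PiM I (\<lambda>_. borel))" using x by (simp add: space_PiM)
    moreover have "0 \<le> (\<Prod>k\<in>I. lratio N v (s k) (x k))" using lratio_pos[OF N] by (intro prod_nonneg) (simp add: less_imp_le)
    ultimately show "ennreal (\<Prod>k\<in>I. lratio N v (s k) (x k)) * F x
      = (\<integral>\<^sup>+y. ennreal (\<Prod>k\<in>insert i I. lratio N v (s k) ((x(i := y)) k)) * f (x(i := y)) \<partial>cgauss v)"
      unfolding F_def using lratio_pos[OF N]
      by (subst nn_integral_cmult[symmetric]) (auto simp: ennreal_mult less_imp_le mult_ac)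
  qed
  also have "\<dots> = (\<integral>\<^sup>+y. ennreal (\<Prod>k\<in>insert i I. lratio N v (s k) (y k)) * f y \<partial>PiM (insert i I) (\<lambda>_. cgauss v))"
    by (rule Q.product_nn_integral_insert[symmetric]) (use insert.hyps in measurable)
  finally show ?case .
qed

text \<open>Where the likelihood ratio is at most \<open>exp g\<close>, passing to the reference law
  costs the factor \<open>exp g\<close>. Elsewhere \<open>f\<close> is bounded by 1 and the ratio by
  \<open>exp (- l * g)\<close> times its power 1 + \<open>l\<close>, whose mean factorises over the
  slots because the shifts \<open>s\<close> are constants.\<close>

lemma nn_integral_change_of_measure:
  assumes N: "0 < N" "N \<le> v" and l: "0 < l" "l \<le> 1" and I: "finite I"
    and f [measurable]: "f \<in> borel_measurable (PiM I (\<lambda>_. borel))" and f1: "\<And>y. f y \<le> 1"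
  shows "(\<integral>\<^sup>+z. f (\<lambda>k\<in>I. s k + z k) \<partial>PiM I (\<lambda>_. cgauss N))
    \<le> ennreal (exp g) * (\<integral>\<^sup>+y. f y \<partial>PiM I (\<lambda>_. cgauss v))
      + ennreal (exp (- l * g + (\<Sum>k\<in>I. l * (kl N v + l + (1 + l) * (cmod (s k))\<^sup>2 / v))))"
proof -
  have v: "0 < v" using N by simp
  interpret Q: product_sigma_finite "\<lambda>_. cgauss v" by (rule product_sigma_finite_cgauss) fact
  define R where "R y = (\<Prod>k\<in>I. lratio N v (s k) (y k))" for y
  have R: "0 < R y" for y unfolding R_def by (intro prod_pos) (simp add: lratio_pos N v)
  have [measurable]: "R \<in> borel_measurable (PiM I (\<lambda>_. cgauss v))" unfolding R_def by measurable
  have [measurable]: "f \<in> borel_measurable (PiM I (\<lambda>_. cgauss v))" by measurable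
  have pt: "ennreal (R y) * f y \<le> ennreal (exp g) * f y + ennreal (exp (- l * g)) * ennreal (R y powr (1 + l))" for y
  proof (cases "R y \<le> exp g")
    case True
    then have "ennreal (R y) * f y \<le> ennreal (exp g) * f y" by (intro mult_right_mono ennreal_leI) auto
    then show ?thesis by (meson add_increasing2 zero_le)
  next
    case False
    have "exp (l * g) \<le> R y powr l"
    proof -
      have "exp g powr l \<le> R y powr l" using False l by (intro powr_mono2) auto
      then show ?thesis by (simp add: powr_def)
    qed
    then have "1 \<le> exp (- l * g) * R y powr l" by (simp add: exp_minus field_simps)
    then have "R y * 1 \<le> R y * (exp (- l * g) * R y powr l)" using R[of y] by (intro mult_left_mono) auto
    also have "\<dots> = exp (- l * g) * R y powr (1 + l)" using R[of y] by (simp add: powr_add)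
    finally have "ennreal (R y) \<le> ennreal (exp (- l * g)) * ennreal (R y powr (1 + l))"
      by (simp add: ennreal_mult[symmetric])
    moreover have "ennreal (R y) * f y \<le> ennreal (R y)" using mult_left_mono[OF f1[of y], of "ennreal (R y)"] by simp
    ultimately show ?thesis by (meson add_increasing order_trans zero_le)
  qed
  let ?S = "\<Sum>k\<in>I. l * (kl N v + l + (1 + l) * (cmod (s k))\<^sup>2 / v)"
  have "(\<integral>\<^sup>+y. ennreal (R y powr (1 + l)) \<partial>PiM I (\<lambda>_. cgauss v))
     = (\<integral>\<^sup>+y. (\<Prod>k\<in>I. ennreal (lratio N v (s k) (y k) powr (1 + l))) \<partial>PiM I (\<lambda>_. cgauss v))"
    unfolding R_def using lratio_pos[OF N(1) v]
    by (intro nn_integral_cong) (simp add: prod_ennreal prod_powr_distrib less_imp_le)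
  also have "\<dots> = (\<Prod>k\<in>I. \<integral>\<^sup>+y. ennreal (lratio N v (s k) y powr (1 + l)) \<partial>cgauss v)"
    by (rule Q.product_nn_integral_prod) (use I in auto)
  also have "\<dots> \<le> (\<Prod>k\<in>I. ennreal (exp (l * (kl N v + l + (1 + l) * (cmod (s k))\<^sup>2 / v))))"
    by (intro prod_mono_ennreal nn_integral_lratio_powr N l)
  also have "\<dots> = ennreal (exp ?S)"
    using I by (simp add: prod_ennreal exp_sum)
  finally have moment: "(\<integral>\<^sup>+y. ennreal (R y powr (1 + l)) \<partial>PiM I (\<lambda>_. cgauss v)) \<le> ennreal (exp ?S)" .
  have "(\<integral>\<^sup>+z. f (\<lambda>k\<in>I. s k + z k) \<partial>PiM I (\<lambda>_. cgauss N)) = (\<integral>\<^sup>+y. ennreal (R y) * f y \<partial>PiM I (\<lambda>_. cgauss v))"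
    unfolding R_def by (rule nn_integral_PiM_cgauss_lratio) (use N v I in auto)
  also have "\<dots> \<le> (\<integral>\<^sup>+y. ennreal (exp g) * f y + ennreal (exp (- l * g)) * ennreal (R y powr (1 + l)) \<partial>PiM I (\<lambda>_. cgauss v))"
    by (intro nn_integral_mono pt)
  also have "\<dots> = ennreal (exp g) * (\<integral>\<^sup>+y. f y \<partial>PiM I (\<lambda>_. cgauss v))
     + ennreal (exp (- l * g)) * (\<integral>\<^sup>+y. ennreal (R y powr (1 + l)) \<partial>PiM I (\<lambda>_. cgauss v))"
    by (subst nn_integral_add) (auto simp: nn_integral_cmult)
  also have "\<dots> \<le> ennreal (exp g) * (\<integral>\<^sup>+y. f y \<partial>PiM I (\<lambda>_. cgauss v)) + ennreal (exp (- l * g)) * ennreal (exp ?S)"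
    by (intro add_left_mono mult_left_mono moment) simp
  also have "ennreal (exp (- l * g)) * ennreal (exp ?S) = ennreal (exp (- l * g + ?S))"
    unfolding exp_add by (simp add: ennreal_mult)
  finally show ?thesis .
qed

text \<open>If a point of \<open>B\<close> forces the output into \<open>D\<close> whatever arrives
  in the slots \<open>I2\<close>, these slots may be given the reference law for free, and only the
  information of \<open>I1\<close> enters the exponent. The mean \<open>r\<close> of the reference
  output is left open: it is 0 against a pure noise output and another codeword when two messages
  are compared.\<close>

lemma prefix_change_of_measure:
  fixes I1 I2 :: "'k set" and s r :: "'k \<Rightarrow> complex"
  assumes N: "0 < N" "N \<le> v" and l: "0 < l" "l \<le> 1" and I: "finite I1" "finite I2" "I1 \<inter> I2 = {}"
    and B [measurable]: "B \<in> sets (PiM (I1 \<union> I2) (\<lambda>_. cgauss N))"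
    and D [measurable]: "D \<in> sets (PiM (I1 \<union> I2) (\<lambda>_. borel))"
    and stop: "\<And>z y. z \<in> B \<Longrightarrow> y \<in> extensional (I1 \<union> I2) \<Longrightarrow> (\<And>k. k \<in> I1 \<Longrightarrow> y k = s k + z k) \<Longrightarrow> y \<in> D"
  shows "emeasure (PiM (I1 \<union> I2) (\<lambda>_. cgauss N)) B
    \<le> ennreal (exp g) * (\<integral>\<^sup>+y. indicator D (\<lambda>k\<in>I1 \<union> I2. r k + y k) \<partial>PiM (I1 \<union> I2) (\<lambda>_. cgauss v))
      + ennreal (exp (- l * g + (\<Sum>k\<in>I1. l * (kl N v + l + (1 + l) * (cmod (s k - r k))\<^sup>2 / v))))"
proof -
  have v: "0 < v" using N by simp
  interpret P: product_sigma_finite "\<lambda>_. cgauss N" by (rule product_sigma_finite_cgauss) fact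
  interpret Q: product_sigma_finite "\<lambda>_. cgauss v" by (rule product_sigma_finite_cgauss) fact
  interpret P2: prob_space "PiM I2 (\<lambda>_. cgauss N)" by (rule prob_space_PiM_cgauss) fact
  interpret Q2: prob_space "PiM I2 (\<lambda>_. cgauss v)" by (rule prob_space_PiM_cgauss) fact
  \<comment> \<open>Conditional probability of \<open>D\<close> given the prefix when the remaining
    slots follow the reference law.\<close>
  define f where "f y1 = (\<integral>\<^sup>+y2. indicator D (merge I1 I2 (y1, \<lambda>k\<in>I2. r k + y2 k)) \<partial>PiM I2 (\<lambda>_. cgauss v))" for y1
  have [measurable]: "f \<in> borel_measurable (PiM I1 (\<lambda>_. borel))" unfolding f_def by measurable
  have f1: "f y \<le> 1" for y
    unfolding f_def using nn_integral_mono[of "PiM I2 (\<lambda>_. cgauss v)" "\<lambda>y2. indicator D (merge I1 I2 (y, \<lambda>k\<in>I2. r k + y2 k))" "\<lambda>_. 1"]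
    by (simp add: Q2.emeasure_space_1 indicator_def)
  have "emeasure (PiM (I1 \<union> I2) (\<lambda>_. cgauss N)) B = (\<integral>\<^sup>+z. indicator B z \<partial>PiM (I1 \<union> I2) (\<lambda>_. cgauss N))"
    by simp
  also have "\<dots> = (\<integral>\<^sup>+z1. \<integral>\<^sup>+z2. indicator B (merge I1 I2 (z1, z2)) \<partial>PiM I2 (\<lambda>_. cgauss N) \<partial>PiM I1 (\<lambda>_. cgauss N))"
    by (rule P.product_nn_integral_fold) (use I in auto)
  also have "\<dots> \<le> (\<integral>\<^sup>+z1. f (\<lambda>k\<in>I1. s k + z1 k) \<partial>PiM I1 (\<lambda>_. cgauss N))"
  proof (intro nn_integral_mono)
    fix z1
    show "(\<integral>\<^sup>+z2. indicator B (merge I1 I2 (z1, z2)) \<partial>PiM I2 (\<lambda>_. cgauss N)) \<le> f (\<lambda>k\<in>I1. s k + z1 k)"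
    proof (cases "\<exists>z2. merge I1 I2 (z1, z2) \<in> B")
      case True
      then obtain z2 where z2: "merge I1 I2 (z1, z2) \<in> B" by auto
      have "merge I1 I2 (\<lambda>k\<in>I1. s k + z1 k, \<lambda>k\<in>I2. r k + y2 k) \<in> D" for y2
        by (rule stop[OF z2]) (use I in \<open>auto simp: merge_def extensional_def\<close>)
      then have "f (\<lambda>k\<in>I1. s k + z1 k) = 1"
        unfolding f_def by (simp add: Q2.emeasure_space_1)
      moreover have "(\<integral>\<^sup>+z2. indicator B (merge I1 I2 (z1, z2)) \<partial>PiM I2 (\<lambda>_. cgauss N)) \<le> (\<integral>\<^sup>+z2. 1 \<partial>PiM I2 (\<lambda>_. cgauss N))"
        by (intro nn_integral_mono) (simp add: indicator_def)
      ultimately show ?thesis by (simp add: P2.emeasure_space_1)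
    qed simp
  qed
  also have "\<dots> = (\<integral>\<^sup>+z1. f (\<lambda>k\<in>I1. r k + (\<lambda>k\<in>I1. (s k - r k) + z1 k) k) \<partial>PiM I1 (\<lambda>_. cgauss N))"
    by (intro nn_integral_cong arg_cong[where f=f]) auto
  also have "\<dots> \<le> ennreal (exp g) * (\<integral>\<^sup>+y. f (\<lambda>k\<in>I1. r k + y k) \<partial>PiM I1 (\<lambda>_. cgauss v))
      + ennreal (exp (- l * g + (\<Sum>k\<in>I1. l * (kl N v + l + (1 + l) * (cmod (s k - r k))\<^sup>2 / v))))"
    by (rule nn_integral_change_of_measure[OF N l I(1), where f="\<lambda>y. f (\<lambda>k\<in>I1. r k + y k)"]) (auto simp: f1)
  also have "(\<integral>\<^sup>+y. f (\<lambda>k\<in>I1. r k + y k) \<partial>PiM I1 (\<lambda>_. cgauss v))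
    = (\<integral>\<^sup>+y1. \<integral>\<^sup>+y2. indicator D (\<lambda>k\<in>I1 \<union> I2. r k + merge I1 I2 (y1, y2) k) \<partial>PiM I2 (\<lambda>_. cgauss v) \<partial>PiM I1 (\<lambda>_. cgauss v))"
    unfolding f_def
    by (intro nn_integral_cong arg_cong[where f="indicator D"]) (use I in \<open>auto simp: merge_def fun_eq_iff\<close>)
  also have "\<dots> = (\<integral>\<^sup>+y. indicator D (\<lambda>k\<in>I1 \<union> I2. r k + y k) \<partial>PiM (I1 \<union> I2) (\<lambda>_. cgauss v))"
    by (rule Q.product_nn_integral_fold[symmetric]) (use I in auto)
  finally show ?thesis .
qed

section \<open>The energy needed by a receiver\<close>

definition recv :: "'j set \<Rightarrow> (nat \<Rightarrow> 'j \<Rightarrow> complex) \<Rightarrow> ('j \<Rightarrow> complex) \<Rightarrow> nat \<Rightarrow> complex" where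
  "recv J x h i = (\<Sum>j\<in>J. x i j * h j)"

definition energy :: "'j set \<Rightarrow> (nat \<Rightarrow> 'j \<Rightarrow> complex) \<Rightarrow> nat \<Rightarrow> real" where
  "energy J x i = (\<Sum>j\<in>J. (cmod (x i j))\<^sup>2)"

lemma energy_nonneg: "0 \<le> energy J x i"
  by (simp add: energy_def sum_nonneg)

text \<open>A receiver with incoming gains \<open>h\<close> and noise \<open>z\<close> observes \<open>y\<^sub>i = recv J x h i + z\<^sub>i\<close>; the
  set \<open>D\<close> collects the pairs \<open>(h, y)\<close> on which it decides for the message encoded by \<open>x\<close>, and
  \<open>pw\<close> is the energy spent by the network. The hypothesis \<open>stop\<close> expresses that the receiver
  has stopped listening before time \<open>i\<close> whenever less than the energy of \<open>x\<close> up to time \<open>i\<close> was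
  spent, so that its decision depends on the observations before time \<open>i\<close> only.\<close>

locale reception =
  fixes J :: "'j set" and n :: nat and N :: real and x :: "nat \<Rightarrow> 'j \<Rightarrow> complex"
    and D :: "(('j \<Rightarrow> complex) \<times> (nat \<Rightarrow> complex)) set"
    and pw :: "('j \<Rightarrow> complex) \<times> (nat \<Rightarrow> complex) \<Rightarrow> real"
  assumes J: "finite J" and N: "0 < N"
    and D [measurable]: "D \<in> sets (PiM J (\<lambda>_. cgauss 1) \<Otimes>\<^sub>M PiM {1..n} (\<lambda>_. borel))"
    and pw [measurable]: "pw \<in> borel_measurable (PiM J (\<lambda>_. cgauss 1) \<Otimes>\<^sub>M PiM {1..n} (\<lambda>_. cgauss N))"
    and pw_nonneg: "\<And>p. 0 \<le> pw p"
    and stop: "\<And>h z y i. h \<in> space (PiM J (\<lambda>_. cgauss 1)) \<Longrightarrow> z \<in> space (PiM {1..n} (\<lambda>_. cgauss N)) \<Longrightarrow>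
      i \<in> {1..n} \<Longrightarrow> pw (h, z) < (\<Sum>k=1..i. energy J x k) \<Longrightarrow>
      (h, \<lambda>k\<in>{1..n}. recv J x h k + z k) \<in> D \<Longrightarrow> y \<in> extensional {1..n} \<Longrightarrow>
      (\<And>k. k \<in> {1..<i} \<Longrightarrow> y k = recv J x h k + z k) \<Longrightarrow> (h, y) \<in> D"
begin

abbreviation "H \<equiv> PiM J (\<lambda>_. cgauss 1)"
abbreviation "Z v \<equiv> PiM {1..n} (\<lambda>_. cgauss v)"

lemma recv_measurable [measurable]: "(\<lambda>h. recv J x' h i) \<in> borel_measurable H"
  unfolding recv_def by measurable

lemma shift_measurable [measurable]:
  "(\<lambda>(h, z). (h, \<lambda>k\<in>{1..n}. recv J x' h k + z k)) \<in> H \<Otimes>\<^sub>M Z v \<rightarrow>\<^sub>M H \<Otimes>\<^sub>M PiM {1..n} (\<lambda>_. borel)"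
  unfolding recv_def by measurable

lemma shift_measurable_section:
  assumes "h \<in> space H"
  shows "(\<lambda>z. (h, \<lambda>k\<in>{1..n}. recv J x' h k + z k)) \<in> Z v \<rightarrow>\<^sub>M H \<Otimes>\<^sub>M PiM {1..n} (\<lambda>_. borel)"
  using measurable_compose[OF measurable_Pair1'[OF assms] shift_measurable[of x' v]] by (simp only: prod.case)

definition err :: ennreal where
  "err = (\<integral>\<^sup>+h. \<integral>\<^sup>+z. indicator (- D) (h, \<lambda>k\<in>{1..n}. recv J x h k + z k) \<partial>Z N \<partial>H)"

text \<open>With the zero signal the reference law is the same for all messages, so over disjoint
  regions these probabilities sum to at most 1. With another codeword and \<open>v = N\<close> the
  value is at most the error probability of that other message.\<close>

definition hit :: "(nat \<Rightarrow> 'j \<Rightarrow> complex) \<Rightarrow> real \<Rightarrow> ennreal" where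
  "hit x' v = (\<integral>\<^sup>+h. \<integral>\<^sup>+y. indicator D (h, \<lambda>k\<in>{1..n}. recv J x' h k + y k) \<partial>Z v \<partial>H)"

text \<open>At \<open>i = n + 1\<close> the condition is vacuous; thus the whole observation also
  counts as a prefix and the end of the block is covered by the same bound.\<close>

definition low :: "nat \<Rightarrow> (('j \<Rightarrow> complex) \<times> (nat \<Rightarrow> complex)) \<Rightarrow> bool" where
  "low i p \<longleftrightarrow> (i \<le> n \<longrightarrow> pw p < (\<Sum>k=1..i. energy J x k))"

lemma low_measurable [measurable]: "Measurable.pred (H \<Otimes>\<^sub>M Z N) (low i)"
  unfolding low_def by measurable

text \<open>A correct decision at low expenditure is settled by the observations before
  \<open>i\<close>, by \<open>stop\<close>. Hence only those slots enter the exponent, and on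
  \<open>A\<close> their information is at most \<open>b\<close>.\<close>

lemma low_bound:
  assumes v: "N \<le> v" and l: "0 < l" "l \<le> 1" and i: "i \<in> {1..n+1}"
    and A [measurable]: "A \<in> sets H"
    and A_le: "\<And>h. h \<in> A \<Longrightarrow> (\<Sum>k\<in>{1..<i}. l * (kl N v + l + (1 + l) * (cmod (recv J x h k - recv J x' h k))\<^sup>2 / v)) \<le> b"
  shows "(\<integral>\<^sup>+h. \<integral>\<^sup>+z. indicator {(h, z). h \<in> A \<and> low i (h, z)} (h, z) \<partial>Z N \<partial>H)
    \<le> err + ennreal (exp g) * hit x' v + ennreal (exp (- l * g + b))"
proof -
  interpret H: prob_space H by (rule prob_space_PiM_cgauss) simp
  interpret Z: prob_space "Z N" by (rule prob_space_PiM_cgauss) (rule N)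
  interpret Zv: prob_space "Z v" by (rule prob_space_PiM_cgauss) (use N v in simp)
  have split: "{1..n} = {1..<i} \<union> {i..n}" using i by auto
  have Dh: "{y. (h, y) \<in> D} \<in> sets (PiM {1..n} (\<lambda>_. borel))" if "h \<in> space H" for h
  proof -
    have "Pair h -` D \<in> sets (PiM {1..n} (\<lambda>_. borel))" by (rule sets_Pair1[OF D])
    then show ?thesis by (simp add: vimage_def)
  qed
  have "(\<integral>\<^sup>+h. \<integral>\<^sup>+z. indicator {(h, z). h \<in> A \<and> low i (h, z)} (h, z) \<partial>Z N \<partial>H)
    \<le> (\<integral>\<^sup>+h. (\<integral>\<^sup>+z. indicator (- D) (h, \<lambda>k\<in>{1..n}. recv J x h k + z k) \<partial>Z N)
        + (ennreal (exp g) * (\<integral>\<^sup>+y. indicator D (h, \<lambda>k\<in>{1..n}. recv J x' h k + y k) \<partial>Z v) + ennreal (exp (- l * g + b))) \<partial>H)"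
  proof (intro nn_integral_mono)
    fix h assume h: "h \<in> space H"
    show "(\<integral>\<^sup>+z. indicator {(h, z). h \<in> A \<and> low i (h, z)} (h, z) \<partial>Z N)
      \<le> (\<integral>\<^sup>+z. indicator (- D) (h, \<lambda>k\<in>{1..n}. recv J x h k + z k) \<partial>Z N)
        + (ennreal (exp g) * (\<integral>\<^sup>+y. indicator D (h, \<lambda>k\<in>{1..n}. recv J x' h k + y k) \<partial>Z v) + ennreal (exp (- l * g + b)))"
    proof (cases "h \<in> A")
      case True
      define B where "B = {z \<in> space (Z N). low i (h, z) \<and> (h, \<lambda>k\<in>{1..n}. recv J x h k + z k) \<in> D}"
      have B: "B \<in> sets (Z N)"
      proof -
        have "Measurable.pred (Z N) (\<lambda>z. low i (h, z))"
          using measurable_compose[OF measurable_Pair1'[OF h] low_measurable] .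
        moreover have "(\<lambda>z. (h, \<lambda>k\<in>{1..n}. recv J x h k + z k)) -` D \<inter> space (Z N) \<in> sets (Z N)"
          by (rule measurable_sets[OF shift_measurable_section[OF h] D])
        ultimately have "{z \<in> space (Z N). low i (h, z)} \<inter> ((\<lambda>z. (h, \<lambda>k\<in>{1..n}. recv J x h k + z k)) -` D \<inter> space (Z N)) \<in> sets (Z N)"
          unfolding pred_def by (rule sets.Int)
        moreover have "{z \<in> space (Z N). low i (h, z)} \<inter> ((\<lambda>z. (h, \<lambda>k\<in>{1..n}. recv J x h k + z k)) -` D \<inter> space (Z N)) = B"
          by (auto simp: B_def)
        ultimately show ?thesis by (simp only:)
      qed
      have m1: "(\<lambda>z. indicator (- D) (h, \<lambda>k\<in>{1..n}. recv J x h k + z k) :: ennreal) \<in> borel_measurable (Z N)"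
      proof -
        have "(\<lambda>p. 1 - indicator D p :: ennreal) \<in> borel_measurable (H \<Otimes>\<^sub>M PiM {1..n} (\<lambda>_. borel))" by measurable
        from measurable_compose[OF shift_measurable_section[OF h] this]
        have "(\<lambda>z. 1 - indicator D (h, \<lambda>k\<in>{1..n}. recv J x h k + z k) :: ennreal) \<in> borel_measurable (Z N)" .
        moreover have "(\<lambda>z. indicator (- D) (h, \<lambda>k\<in>{1..n}. recv J x h k + z k) :: ennreal)
          = (\<lambda>z. 1 - indicator D (h, \<lambda>k\<in>{1..n}. recv J x h k + z k))" by (auto simp: indicator_def)
        ultimately show ?thesis by (simp only:)
      qed
      have "emeasure (Z N) B \<le> ennreal (exp g) * (\<integral>\<^sup>+y. indicator {y. (h, y) \<in> D} (\<lambda>k\<in>{1..n}. recv J x' h k + y k) \<partial>Z v)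
        + ennreal (exp (- l * g + (\<Sum>k\<in>{1..<i}. l * (kl N v + l + (1 + l) * (cmod (recv J x h k - recv J x' h k))\<^sup>2 / v))))"
        unfolding split
      proof (rule prefix_change_of_measure[OF N v l])
        fix z y assume z: "z \<in> B" and y: "y \<in> extensional ({1..<i} \<union> {i..n})"
          and eq: "\<And>k. k \<in> {1..<i} \<Longrightarrow> y k = recv J x h k + z k"
        have zD: "z \<in> space (Z N)" "low i (h, z)" "(h, \<lambda>k\<in>{1..n}. recv J x h k + z k) \<in> D" using z by (auto simp: B_def)
        show "y \<in> {y. (h, y) \<in> D}"
        proof (cases "i \<le> n")
          case True
          then have i': "i \<in> {1..n}" "pw (h, z) < (\<Sum>k=1..i. energy J x k)" using zD i by (auto simp: low_def)
          show ?thesis using stop[OF h zD(1) i' zD(3) _ eq] y unfolding split by blast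
        next
          case False
          then have "{1..<i} = {1..n}" "{i..n} = {}" using i by auto
          then have "y = (\<lambda>k\<in>{1..n}. recv J x h k + z k)"
            using y eq by (auto simp: fun_eq_iff extensional_def restrict_def)
          then show ?thesis using zD by simp
        qed
      qed (simp_all only: split[symmetric] B Dh[OF h], auto)
      also have "\<dots> \<le> ennreal (exp g) * (\<integral>\<^sup>+y. indicator D (h, \<lambda>k\<in>{1..n}. recv J x' h k + y k) \<partial>Z v) + ennreal (exp (- l * g + b))"
        using A_le[OF True] by (intro add_mono ennreal_leI) (auto simp: indicator_def)
      finally have eB: "emeasure (Z N) B \<le> ennreal (exp g) * (\<integral>\<^sup>+y. indicator D (h, \<lambda>k\<in>{1..n}. recv J x' h k + y k) \<partial>Z v) + ennreal (exp (- l * g + b))" .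
      have "(\<integral>\<^sup>+z. indicator {(h, z). h \<in> A \<and> low i (h, z)} (h, z) \<partial>Z N)
        \<le> (\<integral>\<^sup>+z. indicator (- D) (h, \<lambda>k\<in>{1..n}. recv J x h k + z k) + indicator B z \<partial>Z N)"
        by (intro nn_integral_mono) (auto simp: B_def indicator_def)
      also have "\<dots> = (\<integral>\<^sup>+z. indicator (- D) (h, \<lambda>k\<in>{1..n}. recv J x h k + z k) \<partial>Z N) + emeasure (Z N) B"
        by (simp only: nn_integral_add[OF m1 borel_measurable_indicator[OF B]] nn_integral_indicator[OF B])
      also have "\<dots> \<le> (\<integral>\<^sup>+z. indicator (- D) (h, \<lambda>k\<in>{1..n}. recv J x h k + z k) \<partial>Z N) + (ennreal (exp g) * (\<integral>\<^sup>+y. indicator D (h, \<lambda>k\<in>{1..n}. recv J x' h k + y k) \<partial>Z v) + ennreal (exp (- l * g + b)))"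
        by (rule add_left_mono[OF eB])
      finally show ?thesis .
    qed (simp add: indicator_def)
  qed
  also have "\<dots> = err + (ennreal (exp g) * hit x' v + ennreal (exp (- l * g + b)))"
  proof -
    have m1: "(\<lambda>h. \<integral>\<^sup>+z. indicator (- D) (h, \<lambda>k\<in>{1..n}. recv J x h k + z k) \<partial>Z N) \<in> borel_measurable H"
    proof -
      have "(\<lambda>p. 1 - indicator D p :: ennreal) \<in> borel_measurable (H \<Otimes>\<^sub>M PiM {1..n} (\<lambda>_. borel))" by measurable
      from Z.borel_measurable_nn_integral_fst[OF measurable_compose[OF shift_measurable this]]
      have "(\<lambda>h. \<integral>\<^sup>+z. 1 - indicator D (h, \<lambda>k\<in>{1..n}. recv J x h k + z k) \<partial>Z N) \<in> borel_measurable H"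
        by (simp only: prod.case)
      moreover have "(indicator (- D) p :: ennreal) = 1 - indicator D p" for p
        by (cases "p \<in> D") simp_all
      ultimately show ?thesis by (simp only:)
    qed
    have m2: "(\<lambda>h. \<integral>\<^sup>+y. indicator D (h, \<lambda>k\<in>{1..n}. recv J x' h k + y k) \<partial>Z v) \<in> borel_measurable H"
    proof -
      have "(\<lambda>p. indicator D p :: ennreal) \<in> borel_measurable (H \<Otimes>\<^sub>M PiM {1..n} (\<lambda>_. borel))" by measurable
      from Zv.borel_measurable_nn_integral_fst[OF measurable_compose[OF shift_measurable this]]
      show ?thesis by (simp only: prod.case)
    qed
    have m3: "(\<lambda>h. ennreal (exp g) * (\<integral>\<^sup>+y. indicator D (h, \<lambda>k\<in>{1..n}. recv J x' h k + y k) \<partial>Z v)) \<in> borel_measurable H"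
      by (rule borel_measurable_times_ennreal[OF borel_measurable_const m2])
    show ?thesis unfolding err_def hit_def
      by (simp only: nn_integral_add[OF m1 borel_measurable_add[OF m3 borel_measurable_const]] nn_integral_add[OF m3 borel_measurable_const]
        nn_integral_cmult[OF m2] nn_integral_const H.emeasure_space_1 mult_1_right)
  qed
  finally show ?thesis by (simp add: add.assoc)
qed

text \<open>Energies are counted only while their running total stays within \<open>w\<close>, so
  the counted part is at most \<open>w\<close>. The second conjunct closes the induction at a step
  that is still counted.\<close>

lemma sum_levels_le:
  fixes e :: "nat \<Rightarrow> real" and m :: nat
  assumes "0 \<le> (w :: real)" "\<And>i. 0 \<le> e i"
  shows "(\<Sum>i=1..m. e i * indicator {i. (\<Sum>k=1..i. e k) \<le> w} i) \<le> w \<and>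
    (\<Sum>i=1..m. e i * indicator {i. (\<Sum>k=1..i. e k) \<le> w} i) \<le> (\<Sum>k=1..m. e k)"
proof (induction m)
  case (Suc m)
  then show ?case using assms(2)[of "Suc m"] by (auto simp: indicator_def)
qed (use assms in auto)

text \<open>\<open>A i\<close> says that the information collected before slot \<open>i\<close> is
  below \<open>L\<close>. On \<open>A i\<close> the receiver can hardly have stopped, so the energy
  up to slot \<open>i\<close> is spent with nearly the probability of \<open>A i\<close>; ellipsoid
  correlation turns these probabilities back into received energy, which reaches \<open>A0\<close>
  outside a set of probability \<kappa>. The slots from the first \<open>A i\<close> rarer than
  \<kappa> on are dropped: there an absolute error \<eta> of the probability could be multiplied by
  an arbitrarily large slot energy.\<close>

lemma energy_bound:
  fixes l v L g \<kappa> A0 :: real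
  assumes v: "N \<le> v" and l: "0 < l" "l \<le> 1" and L: "0 < L" and \<kappa>: "0 < \<kappa>" "\<kappa> < 1"
    and A0: "A0 = v * (L - n * kl N v)" "0 \<le> A0"
  shows "ennreal ((1 - \<kappa>) * A0) \<le> (\<integral>\<^sup>+h. \<integral>\<^sup>+z. ennreal (pw (h, z)) \<partial>Z N \<partial>H)
    + ennreal ((1 - \<kappa>) * A0 / \<kappa>) * (err + ennreal (exp g) * hit (\<lambda>_ _. 0) v + ennreal (exp (- l * g + l * (n * l + (1 + l) * L))))"
    (is "_ \<le> ?En + _ * ?\<eta>")
proof (cases "ennreal \<kappa> \<le> ?\<eta>")
  \<comment> \<open>If the error terms reach \<kappa>, the second summand alone is at least
    \<open>(1 - \<kappa>) * A0\<close>.\<close>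
  case True
  have "ennreal ((1 - \<kappa>) * A0) = ennreal ((1 - \<kappa>) * A0 / \<kappa>) * ennreal \<kappa>"
    using \<kappa> A0 by (subst ennreal_mult[symmetric]) auto
  also have "\<dots> \<le> ennreal ((1 - \<kappa>) * A0 / \<kappa>) * ?\<eta>"
    using True by (intro mult_left_mono) auto
  finally show ?thesis by (rule add_increasing[OF zero_le])
next
  case False
  then have "?\<eta> < ennreal \<kappa>" by simp
  then obtain \<eta> where \<eta>: "?\<eta> = ennreal \<eta>" "0 \<le> \<eta>" "\<eta> < \<kappa>"
    using \<kappa> by (cases ?\<eta> rule: ennreal_cases) (auto simp: ennreal_less_iff)
  have v0: "0 < v" using N v by simp
  have kl0: "0 \<le> kl N v" by (rule kl_nonneg[OF N v])
  interpret H: prob_space H by (rule prob_space_PiM_cgauss) simp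
  interpret Z: prob_space "Z N" by (rule prob_space_PiM_cgauss) (rule N)
  define S where "S i h = (\<Sum>k\<in>{1..<i}. (cmod (recv J x h k))\<^sup>2)" for i h
  have [measurable]: "S i \<in> borel_measurable H" for i unfolding S_def by measurable
  define A where "A i = {h \<in> space H. (real i - 1) * kl N v + S i h / v < L}" for i :: nat
  have Am [measurable]: "A i \<in> sets H" for i unfolding A_def by measurable
  have step: "(\<integral>\<^sup>+h. \<integral>\<^sup>+z. indicator {(h, z). h \<in> A i \<and> low i (h, z)} (h, z) \<partial>Z N \<partial>H) \<le> ennreal \<eta>"
    if i: "i \<in> {1..n+1}" for i
    unfolding \<eta>(1)[symmetric]
  proof (rule low_bound[OF v l i])
    show "A i \<in> sets H" by (rule Am)
  next
    fix h assume h: "h \<in> A i"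
    have i1: "real (card {1..<i}) = real i - 1" using i by (auto simp: of_nat_diff)
    have "(\<Sum>k\<in>{1..<i}. l * (kl N v + l + (1 + l) * (cmod (recv J x h k - recv J (\<lambda>_ _. 0) h k))\<^sup>2 / v))
      = (\<Sum>k\<in>{1..<i}. l * (kl N v + l) + (l * (1 + l) / v) * (cmod (recv J x h k))\<^sup>2)"
      by (intro sum.cong refl) (simp add: recv_def algebra_simps)
    also have "\<dots> = (real i - 1) * (l * (kl N v + l)) + (l * (1 + l) / v) * S i h"
      unfolding sum.distrib sum_constant i1 S_def sum_distrib_left[symmetric] ..
    also have "\<dots> = l * ((real i - 1) * l + (real i - 1) * kl N v + (1 + l) * (S i h / v))"
      by (simp add: algebra_simps)
    also have "\<dots> \<le> l * (n * l + (1 + l) * L)"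
    proof (intro mult_left_mono)
      have "(real i - 1) * l \<le> n * l" using i l by (intro mult_right_mono) auto
      moreover have "(real i - 1) * kl N v + (1 + l) * (S i h / v) \<le> (1 + l) * ((real i - 1) * kl N v + S i h / v)"
      proof -
        have *: "a + (1 + l) * w \<le> (1 + l) * (a + w)" if "0 \<le> a" for a w
          using mult_nonneg_nonneg[OF less_imp_le[OF l(1)] that] by (simp add: algebra_simps)
        have "0 \<le> (real i - 1) * kl N v" using i kl0 by (intro mult_nonneg_nonneg) auto
        from *[OF this] show ?thesis .
      qed
      moreover have "(1 + l) * ((real i - 1) * kl N v + S i h / v) \<le> (1 + l) * L"
        using h l by (intro mult_left_mono) (auto simp: A_def)
      ultimately show "(real i - 1) * l + (real i - 1) * kl N v + (1 + l) * (S i h / v) \<le> n * l + (1 + l) * L"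
        by simp
    qed (use l in simp)
    finally show "(\<Sum>k\<in>{1..<i}. l * (kl N v + l + (1 + l) * (cmod (recv J x h k - recv J (\<lambda>_ _. 0) h k))\<^sup>2 / v)) \<le> l * (n * l + (1 + l) * L)" .
  qed
  \<comment> \<open>Since \<open>low (n + 1)\<close> is vacuous, too little information over the
    full block has probability below \<kappa>; this makes \<open>m\<close> exist and be at most
    \<open>n\<close>.\<close>
  have last: "H.prob (A (n + 1)) < \<kappa>"
  proof -
    have "emeasure H (A (n + 1)) = (\<integral>\<^sup>+h. \<integral>\<^sup>+z. indicator (A (n + 1)) h \<partial>Z N \<partial>H)"
      by (simp add: Z.emeasure_space_1 del: One_nat_def)
    also have "\<dots> \<le> (\<integral>\<^sup>+h. \<integral>\<^sup>+z. indicator {(h, z). h \<in> A (n + 1) \<and> low (n + 1) (h, z)} (h, z) \<partial>Z N \<partial>H)"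
      by (intro nn_integral_mono) (auto simp: indicator_def low_def)
    also have "\<dots> \<le> ennreal \<eta>" by (rule step) simp
    finally show ?thesis using \<eta> by (simp add: H.emeasure_eq_measure)
  qed
  \<comment> \<open>All of \<open>A 1\<close> to \<open>A m\<close> have probability at least
    \<kappa>, while \<open>A (Suc m)\<close> is rarer.\<close>
  define m where "m = (LEAST m. H.prob (A (Suc m)) < \<kappa>)"
  have m1: "H.prob (A (Suc m)) < \<kappa>" unfolding m_def by (rule LeastI[of _ n]) (use last in simp)
  have mn: "m \<le> n" unfolding m_def by (rule Least_le) (use last in simp)
  have ge: "\<kappa> \<le> H.prob (A i)" if "i \<in> {1..m}" for i
  proof -
    have "i - 1 < m" using that by auto
    from not_less_Least[OF this[unfolded m_def]] show ?thesis using that by (simp add: not_less)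
  qed
  have pw_m: "(\<lambda>z. pw (h, z)) \<in> borel_measurable (Z N)" if "h \<in> space H" for h
    by (rule measurable_compose[OF measurable_Pair1'[OF that] pw])
  define E where "E i = (\<Sum>k=1..i. energy J x k)" for i
  define b where "b i = (\<integral>\<^sup>+h. \<integral>\<^sup>+z. indicator {p. E i \<le> pw p} (h, z) \<partial>Z N \<partial>H)" for i
  have bm: "(\<lambda>z. indicator {p. E i \<le> pw p} (h, z) :: ennreal) \<in> borel_measurable (Z N)" if "h \<in> space H" for i h
    using pw_m[OF that, unfolded borel_measurable_iff_ge] by (intro borel_measurable_indicator') (simp only: mem_Collect_eq)
  have bm2: "(\<lambda>h. \<integral>\<^sup>+z. indicator {p. E i \<le> pw p} (h, z) \<partial>Z N :: ennreal) \<in> borel_measurable H" for i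
  proof -
    have "(\<lambda>p. indicator {p. E i \<le> pw p} p :: ennreal) \<in> borel_measurable (H \<Otimes>\<^sub>M Z N)"
      using pw[unfolded borel_measurable_iff_ge] by (intro borel_measurable_indicator') (simp only: mem_Collect_eq)
    from Z.borel_measurable_nn_integral_fst[OF this] show ?thesis .
  qed
  have b_ge: "ennreal ((1 - \<eta> / \<kappa>) * H.prob (A i)) \<le> b i" if i: "i \<in> {1..m}" for i
  proof -
    have iin: "i \<in> {1..n+1}" using i mn by auto
    have lm: "(\<lambda>p. indicator {(h, z). h \<in> A i \<and> low i (h, z)} p :: ennreal) \<in> borel_measurable (H \<Otimes>\<^sub>M Z N)"
    proof -
      have "Measurable.pred (H \<Otimes>\<^sub>M Z N) (\<lambda>p. fst p \<in> A i \<and> low i p)" by measurable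
      then show ?thesis unfolding pred_def by (intro borel_measurable_indicator') (simp only: mem_Collect_eq case_prod_beta prod.collapse)
    qed
    have lm1: "(\<lambda>z. indicator {(h, z). h \<in> A i \<and> low i (h, z)} (h, z) :: ennreal) \<in> borel_measurable (Z N)" if "h \<in> space H" for h
      by (rule measurable_compose[OF measurable_Pair1'[OF that] lm])
    have "ennreal (H.prob (A i)) = (\<integral>\<^sup>+h. \<integral>\<^sup>+z. indicator (A i) h \<partial>Z N \<partial>H)"
      by (simp add: Z.emeasure_space_1 H.emeasure_eq_measure del: One_nat_def)
    also have "\<dots> \<le> (\<integral>\<^sup>+h. \<integral>\<^sup>+z. indicator {p. E i \<le> pw p} (h, z) + indicator {(h, z). h \<in> A i \<and> low i (h, z)} (h, z) \<partial>Z N \<partial>H)"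
      by (intro nn_integral_mono) (auto simp: indicator_def low_def E_def not_less)
    also have "\<dots> = (\<integral>\<^sup>+h. (\<integral>\<^sup>+z. indicator {p. E i \<le> pw p} (h, z) \<partial>Z N) + (\<integral>\<^sup>+z. indicator {(h, z). h \<in> A i \<and> low i (h, z)} (h, z) \<partial>Z N) \<partial>H)"
      by (intro nn_integral_cong nn_integral_add bm lm1)
    also have "\<dots> = b i + (\<integral>\<^sup>+h. \<integral>\<^sup>+z. indicator {(h, z). h \<in> A i \<and> low i (h, z)} (h, z) \<partial>Z N \<partial>H)"
      unfolding b_def by (intro nn_integral_add bm2 Z.borel_measurable_nn_integral_fst lm)
    also have "\<dots> \<le> b i + ennreal \<eta>" by (intro add_left_mono step iin)
    finally have "ennreal (H.prob (A i)) \<le> ennreal \<eta> + b i" by (simp add: add.commute)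
    then have "ennreal (H.prob (A i)) - ennreal \<eta> \<le> b i" by (simp add: ennreal_minus_le_iff)
    then have "ennreal (H.prob (A i) - \<eta>) \<le> b i" using \<eta> by (simp add: ennreal_minus)
    \<comment> \<open>The absolute error \<eta> becomes a relative one because \<open>A i\<close>
      has probability at least \<kappa>.\<close>
    moreover have "(1 - \<eta> / \<kappa>) * H.prob (A i) \<le> H.prob (A i) - \<eta>"
    proof -
      have "\<eta> / \<kappa> * \<kappa> \<le> \<eta> / \<kappa> * H.prob (A i)" using ge[OF i] \<eta> \<kappa> by (intro mult_left_mono) auto
      then show ?thesis using \<kappa> by (simp add: algebra_simps)
    qed
    ultimately show ?thesis by (meson ennreal_leI order_trans)
  qed
  have En: "(\<Sum>i=1..m. ennreal (energy J x i) * b i) \<le> ?En"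
  proof -
    have "(\<Sum>i=1..m. ennreal (energy J x i) * b i)
      = (\<integral>\<^sup>+h. (\<Sum>i=1..m. ennreal (energy J x i) * (\<integral>\<^sup>+z. indicator {p. E i \<le> pw p} (h, z) \<partial>Z N)) \<partial>H)"
      unfolding b_def nn_integral_cmult[OF bm2, symmetric]
      by (rule nn_integral_sum[symmetric]) (rule borel_measurable_times_ennreal[OF borel_measurable_const bm2])
    also have "\<dots> = (\<integral>\<^sup>+h. \<integral>\<^sup>+z. (\<Sum>i=1..m. ennreal (energy J x i) * indicator {p. E i \<le> pw p} (h, z)) \<partial>Z N \<partial>H)"
    proof (intro nn_integral_cong)
      fix h assume h: "h \<in> space H"
      show "(\<Sum>i=1..m. ennreal (energy J x i) * (\<integral>\<^sup>+z. indicator {p. E i \<le> pw p} (h, z) \<partial>Z N))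
        = (\<integral>\<^sup>+z. (\<Sum>i=1..m. ennreal (energy J x i) * indicator {p. E i \<le> pw p} (h, z)) \<partial>Z N)"
        unfolding nn_integral_cmult[OF bm[OF h], symmetric]
        by (rule nn_integral_sum[symmetric]) (rule borel_measurable_times_ennreal[OF borel_measurable_const bm[OF h]])
    qed
    also have "\<dots> \<le> ?En"
    proof (intro nn_integral_mono)
      fix h z
      have "(\<Sum>i=1..m. ennreal (energy J x i) * indicator {p. E i \<le> pw p} (h, z))
         = ennreal (\<Sum>i=1..m. energy J x i * indicator {i. (\<Sum>k=1..i. energy J x k) \<le> pw (h, z)} i)"
        by (subst sum_ennreal[symmetric]) (auto simp: energy_nonneg E_def indicator_def intro!: sum.cong)
      also have "\<dots> \<le> ennreal (pw (h, z))"
        using sum_levels_le[of "pw (h, z)" "energy J x" m, OF pw_nonneg energy_nonneg] by (intro ennreal_leI) (rule conjunct1)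
      finally show "(\<Sum>i=1..m. ennreal (energy J x i) * indicator {p. E i \<le> pw p} (h, z)) \<le> ennreal (pw (h, z))" .
    qed
    finally show ?thesis .
  qed
  have corr: "(\<integral>\<^sup>+h. ennreal ((cmod (recv J x h i))\<^sup>2) * indicator (A i) h \<partial>H) \<le> ennreal (energy J x i) * emeasure H (A i)"
    if i: "1 \<le> i" for i
  proof -
    let ?B = "v * (L - (real i - 1) * kl N v)"
    \<comment> \<open>\<open>S i\<close> adds the slots 1 to \<open>i - 1\<close>, whereas the
      correlation inequality numbers its \<open>t = i - 1\<close> summands from 0.\<close>
    have Seq: "S i h = (\<Sum>k<i - 1. (cmod (\<Sum>j\<in>J. x (Suc k) j * h j))\<^sup>2)" for h
    proof -
      obtain i' where "i = Suc i'" using i by (cases i) auto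
      then show ?thesis
        unfolding S_def recv_def by (simp add: atLeastLessThanSuc_atLeastAtMost sum.atLeast1_atMost_eq)
    qed
    have Aeq: "A i = {h. S i h < ?B} \<inter> space H" unfolding A_def using v0 by (auto simp: field_simps)
    have "(\<integral>\<^sup>+h. ennreal ((cmod (recv J x h i))\<^sup>2) * indicator (A i) h \<partial>H)
      = (\<integral>\<^sup>+h. ennreal ((cmod (\<Sum>j\<in>J. x i j * h j))\<^sup>2) * indicator {h. S i h < ?B} h \<partial>H)"
      by (intro nn_integral_cong) (auto simp: Aeq recv_def indicator_def)
    also have "\<dots> \<le> ennreal (energy J x i) * (\<integral>\<^sup>+h. indicator {h. S i h < ?B} h \<partial>H)"
      unfolding Seq energy_def by (rule gaussian_ellipsoid_correlation[OF J])
    also have "(\<integral>\<^sup>+h. indicator {h. S i h < ?B} h \<partial>H) = (\<integral>\<^sup>+h. indicator (A i) h \<partial>H)"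
      by (intro nn_integral_cong) (auto simp: Aeq indicator_def)
    finally show ?thesis by simp
  qed
  have total: "ennreal ((1 - \<kappa>) * A0) \<le> (\<Sum>i=1..m. ennreal (energy J x i) * emeasure H (A i))"
  proof -
    have "(1 - \<kappa>) * A0 \<le> A0 * H.prob (space H - A (Suc m))"
      using m1 A0(2) unfolding H.prob_compl[OF Am] by (subst mult.commute) (intro mult_left_mono, auto)
    then have "ennreal ((1 - \<kappa>) * A0) \<le> ennreal A0 * emeasure H (space H - A (Suc m))"
      using A0 by (subst H.emeasure_eq_measure, subst ennreal_mult[symmetric]) (auto intro: ennreal_leI)
    also have "\<dots> = (\<integral>\<^sup>+h. ennreal A0 * indicator (space H - A (Suc m)) h \<partial>H)"
      by (subst nn_integral_cmult_indicator) auto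
    also have "\<dots> \<le> (\<integral>\<^sup>+h. (\<Sum>i=1..m. ennreal ((cmod (recv J x h i))\<^sup>2) * indicator (A i) h) \<partial>H)"
    proof (intro nn_integral_mono)
      fix h assume h: "h \<in> space H"
      show "ennreal A0 * indicator (space H - A (Suc m)) h \<le> (\<Sum>i=1..m. ennreal ((cmod (recv J x h i))\<^sup>2) * indicator (A i) h)"
      proof (cases "h \<in> A (Suc m)")
        case False
        \<comment> \<open>The first exit: in every slot up to \<sigma> the gains still lie in
          \<open>A i\<close>, and together these slots already carry the received energy
          \<open>A0\<close>.\<close>
        define \<sigma> where "\<sigma> = (LEAST s. h \<notin> A (Suc s))"
        have \<sigma>1: "h \<notin> A (Suc \<sigma>)" unfolding \<sigma>_def by (rule LeastI) (rule False)
        have \<sigma>m: "\<sigma> \<le> m" unfolding \<sigma>_def by (rule Least_le) (rule False)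
        have \<sigma>in: "h \<in> A i" if "i \<in> {1..\<sigma>}" for i
        proof -
          have "i - 1 < \<sigma>" using that by auto
          from not_less_Least[OF this[unfolded \<sigma>_def]] show ?thesis using that by simp
        qed
        have "L \<le> real \<sigma> * kl N v + S (Suc \<sigma>) h / v" using \<sigma>1 h by (auto simp: A_def)
        then have "v * (L - real \<sigma> * kl N v) \<le> S (Suc \<sigma>) h" using v0 by (simp add: field_simps)
        moreover have "real \<sigma> * kl N v \<le> real n * kl N v" using \<sigma>m mn kl0 by (intro mult_right_mono) auto
        then have "A0 \<le> v * (L - real \<sigma> * kl N v)" unfolding A0 using v0 by (intro mult_left_mono) auto
        ultimately have "A0 \<le> S (Suc \<sigma>) h" by simp
        then have "ennreal A0 \<le> ennreal (\<Sum>i=1..\<sigma>. (cmod (recv J x h i))\<^sup>2)"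
          unfolding S_def by (intro ennreal_leI) (simp add: atLeastLessThanSuc_atLeastAtMost)
        also have "\<dots> = (\<Sum>i=1..\<sigma>. ennreal ((cmod (recv J x h i))\<^sup>2) * indicator (A i) h)"
          using \<sigma>in by (subst sum_ennreal[symmetric]) (auto intro!: sum.cong)
        also have "\<dots> \<le> (\<Sum>i=1..m. ennreal ((cmod (recv J x h i))\<^sup>2) * indicator (A i) h)"
          using \<sigma>m by (intro sum_mono2) auto
        finally show ?thesis using False h by simp
      qed simp
    qed
    also have "\<dots> = (\<Sum>i=1..m. \<integral>\<^sup>+h. ennreal ((cmod (recv J x h i))\<^sup>2) * indicator (A i) h \<partial>H)"
      by (rule nn_integral_sum) measurable
    also have "\<dots> \<le> (\<Sum>i=1..m. ennreal (energy J x i) * emeasure H (A i))"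
      by (intro sum_mono corr) simp
    finally show ?thesis .
  qed
  have r: "0 \<le> 1 - \<eta> / \<kappa>" using \<eta> \<kappa> by simp
  have "ennreal ((1 - \<eta> / \<kappa>) * ((1 - \<kappa>) * A0)) = ennreal (1 - \<eta> / \<kappa>) * ennreal ((1 - \<kappa>) * A0)"
    using r \<kappa> A0 by (subst ennreal_mult) auto
  also have "\<dots> \<le> ennreal (1 - \<eta> / \<kappa>) * (\<Sum>i=1..m. ennreal (energy J x i) * emeasure H (A i))"
    by (intro mult_left_mono total) simp
  also have "\<dots> = (\<Sum>i=1..m. ennreal (energy J x i) * ennreal ((1 - \<eta> / \<kappa>) * H.prob (A i)))"
    unfolding sum_distrib_left H.emeasure_eq_measure using r
    by (intro sum.cong refl) (simp add: ennreal_mult mult_ac)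
  also have "\<dots> \<le> (\<Sum>i=1..m. ennreal (energy J x i) * b i)"
    by (intro sum_mono mult_left_mono b_ge) auto
  also note En
  finally have main: "ennreal ((1 - \<eta> / \<kappa>) * ((1 - \<kappa>) * A0)) \<le> ?En" .
  define Q where "Q = (1 - \<kappa>) * A0"
  have Q: "0 \<le> Q" using \<kappa> A0 by (simp add: Q_def)
  have "ennreal Q = ennreal ((1 - \<eta> / \<kappa>) * Q + Q / \<kappa> * \<eta>)"
    by (rule arg_cong[where f=ennreal]) (use \<kappa> in \<open>simp add: field_simps\<close>)
  also have "\<dots> = ennreal ((1 - \<eta> / \<kappa>) * Q) + ennreal (Q / \<kappa> * \<eta>)"
    using r Q \<kappa> \<eta> by (intro ennreal_plus) auto
  also have "ennreal (Q / \<kappa> * \<eta>) = ennreal (Q / \<kappa>) * ennreal \<eta>"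
    using Q \<kappa> \<eta> by (intro ennreal_mult) auto
  finally have "ennreal ((1 - \<kappa>) * A0) = ennreal ((1 - \<eta> / \<kappa>) * ((1 - \<kappa>) * A0)) + ennreal ((1 - \<kappa>) * A0 / \<kappa>) * ennreal \<eta>"
    unfolding Q_def .
  also have "\<dots> \<le> ?En + ennreal ((1 - \<kappa>) * A0 / \<kappa>) * ennreal \<eta>"
    by (intro add_right_mono main)
  finally show ?thesis unfolding \<eta>(1) .
qed

end

section \<open>Two messages of bounded energy remain confusable\<close>

lemma nn_integral_markov:
  assumes f: "f \<in> borel_measurable M" and c: "0 < (c::real)"
  shows "(\<integral>\<^sup>+x. indicator {x. c \<le> f x} x \<partial>M) \<le> ennreal (1 / c) * (\<integral>\<^sup>+x. ennreal (f x) \<partial>M)"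
proof -
  have m: "(\<lambda>x. ennreal (f x)) \<in> borel_measurable M" using f by measurable
  have "(\<integral>\<^sup>+x. indicator {x. c \<le> f x} x \<partial>M) \<le> (\<integral>\<^sup>+x. ennreal (1 / c) * ennreal (f x) \<partial>M)"
  proof (intro nn_integral_mono)
    fix x
    show "indicator {x. c \<le> f x} x \<le> ennreal (1 / c) * ennreal (f x)"
    proof (cases "c \<le> f x")
      case True
      then have "1 \<le> 1 / c * f x" using c by (simp add: field_simps)
      then have "ennreal 1 \<le> ennreal (1 / c * f x)" by (rule ennreal_leI)
      also have "\<dots> = ennreal (1 / c) * ennreal (f x)" using True c by (intro ennreal_mult) auto
      finally show ?thesis using True by simp
    qed simp
  qed
  also have "\<dots> = ennreal (1 / c) * (\<integral>\<^sup>+x. ennreal (f x) \<partial>M)" by (rule nn_integral_cmult[OF m])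
  finally show ?thesis .
qed

text \<open>Ellipsoid correlation with an empty sum, for which the ellipsoid is the whole
  space.\<close>

lemma nn_integral_recv_sq_le:
  assumes J: "finite J"
  shows "(\<integral>\<^sup>+h. ennreal ((cmod (recv J x h i))\<^sup>2) \<partial>PiM J (\<lambda>_. cgauss 1)) \<le> ennreal (energy J x i)"
proof -
  interpret H: prob_space "PiM J (\<lambda>_. cgauss 1)" by (rule prob_space_PiM_cgauss) simp
  show ?thesis
    using gaussian_ellipsoid_correlation[OF J, where x="x i" and t=0 and B=1 and X=x]
    by (simp add: recv_def energy_def H.emeasure_space_1)
qed

lemma recv_diff: "recv J x h i - recv J x' h i = recv J (\<lambda>i j. x i j - x' i j) h i"
  by (simp add: recv_def sum_subtractf left_diff_distrib)

lemma energy_diff_le: "energy J (\<lambda>i j. x i j - x' i j) i \<le> 2 * energy J x i + 2 * energy J x' i"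
  unfolding energy_def sum_distrib_left sum.distrib[symmetric]
proof (intro sum_mono)
  fix j
  have "cmod (x i j - x' i j) \<le> cmod (x i j) + cmod (x' i j)" by (rule norm_triangle_ineq4)
  then have "(cmod (x i j - x' i j))\<^sup>2 \<le> (cmod (x i j) + cmod (x' i j))\<^sup>2" by (intro power_mono) auto
  also have "\<dots> \<le> 2 * (cmod (x i j))\<^sup>2 + 2 * (cmod (x' i j))\<^sup>2"
    using sum_squares_bound[of "cmod (x i j)" "cmod (x' i j)"] by (simp add: power2_sum)
  finally show "(cmod (x i j - x' i j))\<^sup>2 \<le> 2 * (cmod (x i j))\<^sup>2 + 2 * (cmod (x' i j))\<^sup>2" .
qed

text \<open>The threshold \<open>g\<close> that makes the tail term of the change of measure equal
  to 1 / 8 for \<open>l = 1\<close> and \<open>v = N\<close>. The exponent is at most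
  \<open>n + 2 * \<rho> / N\<close> if the squared distance of the two received signals stays below
  \<open>\<rho> = 128 * n * E + 1\<close>; the constant 128 is 8 times 16, since the mean distance
  is at most \<open>16 * E\<close> per slot and Markov's inequality is to lose 1 / 8.\<close>

definition confusion_exp :: "nat \<Rightarrow> real \<Rightarrow> real \<Rightarrow> real" where
  "confusion_exp n E N = n + 2 * (128 * n * E + 1) / N + ln 8"

context reception
begin

text \<open>The slot \<open>i\<close> stands for the first one in which \<open>x\<close> would spend
  more than \<open>4 * E\<close>, or \<open>n + 1\<close>. Reaching it is unlikely by the mean
  energy, and before it both signals are weak, so their outputs can be exchanged at the cost
  \<open>exp g\<close>. The losses 1 / 8 for the tail term, 1 / 4 for reaching \<open>i\<close> and
  1 / 8 for a large distance leave 1 / 2.\<close>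

lemma confusion_bound:
  assumes E: "0 < E" and i: "i \<in> {1..n+1}"
    and small: "\<And>k. k \<in> {1..<i} \<Longrightarrow> energy J x k \<le> 4 * E \<and> energy J x' k \<le> 4 * E"
    and large: "i \<le> n \<Longrightarrow> 4 * E < energy J x i"
    and En: "(\<integral>\<^sup>+h. \<integral>\<^sup>+z. ennreal (pw (h, z)) \<partial>Z N \<partial>H) \<le> ennreal E"
  shows "ennreal (1 / 2) \<le> err + ennreal (exp (confusion_exp n E N)) * hit x' N"
proof -
  interpret H: prob_space H by (rule prob_space_PiM_cgauss) simp
  interpret Z: prob_space "Z N" by (rule prob_space_PiM_cgauss) (rule N)
  define S where "S h = (\<Sum>k\<in>{1..<i}. (cmod (recv J x h k - recv J x' h k))\<^sup>2)" for h
  have Sm [measurable]: "S \<in> borel_measurable H" unfolding S_def by measurable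
  define \<rho> where "\<rho> = 128 * n * E + 1"
  have \<rho>: "0 < \<rho>" using E by (simp add: \<rho>_def add_nonneg_pos)
  define A where "A = {h \<in> space H. S h < \<rho>}"
  have Am [measurable]: "A \<in> sets H" unfolding A_def by measurable
  define b where "b = n + 2 * \<rho> / N"
  define g where "g = confusion_exp n E N"
  have gb: "exp (- 1 * g + b) = 1 / 8" by (simp add: g_def b_def confusion_exp_def \<rho>_def exp_minus)
  have P1: "(\<integral>\<^sup>+h. \<integral>\<^sup>+z. indicator {(h, z). h \<in> A \<and> low i (h, z)} (h, z) \<partial>Z N \<partial>H)
    \<le> err + ennreal (exp g) * hit x' N + ennreal (1 / 8)"
    unfolding gb[symmetric]
  proof (rule low_bound[OF order_refl _ _ i Am])
    fix h assume h: "h \<in> A"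
    have "(\<Sum>k\<in>{1..<i}. 1 * (kl N N + 1 + (1 + 1) * (cmod (recv J x h k - recv J x' h k))\<^sup>2 / N)) = real (card {1..<i}) + 2 / N * S h"
      unfolding S_def sum_distrib_left using N by (simp add: kl_def sum.distrib)
    also have "\<dots> \<le> n + 2 / N * \<rho>"
      using h i N by (intro add_mono mult_left_mono) (auto simp: A_def)
    finally show "(\<Sum>k\<in>{1..<i}. 1 * (kl N N + 1 + (1 + 1) * (cmod (recv J x h k - recv J x' h k))\<^sup>2 / N)) \<le> b"
      by (simp add: b_def)
  qed auto
  have P2: "(\<integral>\<^sup>+h. indicator {h. \<rho> \<le> S h} h \<partial>H) \<le> ennreal (1 / 8)"
  proof -
    have "(\<integral>\<^sup>+h. ennreal (S h) \<partial>H) = (\<Sum>k\<in>{1..<i}. \<integral>\<^sup>+h. ennreal ((cmod (recv J x h k - recv J x' h k))\<^sup>2) \<partial>H)"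
      unfolding S_def by (subst nn_integral_sum[symmetric]) (auto simp: sum_ennreal)
    also have "\<dots> \<le> (\<Sum>k\<in>{1..<i}. ennreal (16 * E))"
    proof (intro sum_mono)
      fix k assume k: "k \<in> {1..<i}"
      have "energy J (\<lambda>i j. x i j - x' i j) k \<le> 16 * E"
        using energy_diff_le[of J x x' k] small[OF k] by linarith
      then show "(\<integral>\<^sup>+h. ennreal ((cmod (recv J x h k - recv J x' h k))\<^sup>2) \<partial>H) \<le> ennreal (16 * E)"
        unfolding recv_diff by (intro order_trans[OF nn_integral_recv_sq_le[OF J]] ennreal_leI)
    qed
    also have "\<dots> = ennreal (real (card {1..<i}) * (16 * E))"
      using E by (simp add: ennreal_mult ennreal_of_nat_eq_real_of_nat)
    also have "\<dots> \<le> ennreal (\<rho> / 8)"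
    proof (intro ennreal_leI)
      have "real (card {1..<i}) * (16 * E) \<le> real n * (16 * E)" using i E by (intro mult_right_mono) auto
      then show "real (card {1..<i}) * (16 * E) \<le> \<rho> / 8" by (simp add: \<rho>_def)
    qed
    finally have S_le: "(\<integral>\<^sup>+h. ennreal (S h) \<partial>H) \<le> ennreal (\<rho> / 8)" .
    have "(\<integral>\<^sup>+h. indicator {h. \<rho> \<le> S h} h \<partial>H) \<le> ennreal (1 / \<rho>) * (\<integral>\<^sup>+h. ennreal (S h) \<partial>H)"
      by (rule nn_integral_markov[OF Sm \<rho>])
    also have "\<dots> \<le> ennreal (1 / \<rho>) * ennreal (\<rho> / 8)" by (intro mult_left_mono S_le) simp
    also have "\<dots> = ennreal (1 / 8)" using \<rho> by (subst ennreal_mult[symmetric]) auto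
    finally show ?thesis .
  qed
  have pw_m: "(\<lambda>z. pw (h, z)) \<in> borel_measurable (Z N)" if "h \<in> space H" for h
    by (rule measurable_compose[OF measurable_Pair1'[OF that] pw])
  have P3: "(\<integral>\<^sup>+h. \<integral>\<^sup>+z. indicator {p. \<not> low i p} (h, z) \<partial>Z N \<partial>H) \<le> ennreal (1 / 4)"
  proof (cases "i \<le> n")
    case True
    have lowE: "4 * E \<le> pw p" if "\<not> low i p" for p
    proof -
      have "energy J x i \<le> (\<Sum>k=1..i. energy J x k)"
        using i by (intro member_le_sum) (auto simp: energy_nonneg)
      then show ?thesis using that large[OF True] by (simp add: low_def True)
    qed
    have "(\<integral>\<^sup>+h. \<integral>\<^sup>+z. indicator {p. \<not> low i p} (h, z) \<partial>Z N \<partial>H)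
      \<le> (\<integral>\<^sup>+h. ennreal (1 / (4 * E)) * (\<integral>\<^sup>+z. ennreal (pw (h, z)) \<partial>Z N) \<partial>H)"
    proof (intro nn_integral_mono)
      fix h assume h: "h \<in> space H"
      have "(\<integral>\<^sup>+z. indicator {p. \<not> low i p} (h, z) \<partial>Z N) \<le> (\<integral>\<^sup>+z. indicator {z. 4 * E \<le> pw (h, z)} z \<partial>Z N)"
        using lowE by (intro nn_integral_mono) (auto simp: indicator_def)
      also have "\<dots> \<le> ennreal (1 / (4 * E)) * (\<integral>\<^sup>+z. ennreal (pw (h, z)) \<partial>Z N)"
        by (rule nn_integral_markov[OF pw_m[OF h]]) (use E in simp)
      finally show "(\<integral>\<^sup>+z. indicator {p. \<not> low i p} (h, z) \<partial>Z N) \<le> ennreal (1 / (4 * E)) * (\<integral>\<^sup>+z. ennreal (pw (h, z)) \<partial>Z N)" .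
    qed
    also have "\<dots> = ennreal (1 / (4 * E)) * (\<integral>\<^sup>+h. \<integral>\<^sup>+z. ennreal (pw (h, z)) \<partial>Z N \<partial>H)"
      by (rule nn_integral_cmult) (rule Z.borel_measurable_nn_integral_fst[OF measurable_compose[OF pw measurable_ennreal]])
    also have "\<dots> \<le> ennreal (1 / (4 * E)) * ennreal E" by (intro mult_left_mono En) simp
    also have "\<dots> = ennreal (1 / 4)" using E by (subst ennreal_mult[symmetric]) auto
    finally show ?thesis .
  qed (simp add: low_def)
  have lm: "(\<lambda>p. indicator {(h, z). h \<in> A \<and> low i (h, z)} p :: ennreal) \<in> borel_measurable (H \<Otimes>\<^sub>M Z N)"
  proof -
    have "Measurable.pred (H \<Otimes>\<^sub>M Z N) (\<lambda>p. fst p \<in> A \<and> low i p)" by measurable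
    then show ?thesis unfolding pred_def by (intro borel_measurable_indicator') (simp only: mem_Collect_eq case_prod_beta prod.collapse)
  qed
  have lm': "(\<lambda>p. indicator {p. \<not> low i p} p :: ennreal) \<in> borel_measurable (H \<Otimes>\<^sub>M Z N)"
  proof -
    have "Measurable.pred (H \<Otimes>\<^sub>M Z N) (\<lambda>p. \<not> low i p)" by measurable
    then show ?thesis unfolding pred_def by (intro borel_measurable_indicator') (simp only: mem_Collect_eq)
  qed
  note sec = measurable_compose[OF measurable_Pair1']
  have Sind: "(\<lambda>h. indicator {h. \<rho> \<le> S h} h :: ennreal) \<in> borel_measurable H"
    using Sm[unfolded borel_measurable_iff_ge] by (intro borel_measurable_indicator') (simp only: mem_Collect_eq)
  have "(1::ennreal) = (\<integral>\<^sup>+h. \<integral>\<^sup>+z. 1 \<partial>Z N \<partial>H)"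
    by (simp add: Z.emeasure_space_1 H.emeasure_space_1 del: One_nat_def)
  also have "\<dots> \<le> (\<integral>\<^sup>+h. \<integral>\<^sup>+z. (indicator {(h, z). h \<in> A \<and> low i (h, z)} (h, z) + indicator {p. \<not> low i p} (h, z)) + indicator {h. \<rho> \<le> S h} h \<partial>Z N \<partial>H)"
    by (intro nn_integral_mono) (auto simp: indicator_def A_def)
  also have "\<dots> = (\<integral>\<^sup>+h. ((\<integral>\<^sup>+z. indicator {(h, z). h \<in> A \<and> low i (h, z)} (h, z) \<partial>Z N) + (\<integral>\<^sup>+z. indicator {p. \<not> low i p} (h, z) \<partial>Z N)) + indicator {h. \<rho> \<le> S h} h \<partial>H)"
    by (intro nn_integral_cong) (simp only: nn_integral_add[OF borel_measurable_add[OF sec[OF _ lm] sec[OF _ lm']] borel_measurable_const]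
       nn_integral_add[OF sec[OF _ lm] sec[OF _ lm']] nn_integral_const Z.emeasure_space_1 mult_1_right)
  also have "\<dots> = ((\<integral>\<^sup>+h. \<integral>\<^sup>+z. indicator {(h, z). h \<in> A \<and> low i (h, z)} (h, z) \<partial>Z N \<partial>H)
      + (\<integral>\<^sup>+h. \<integral>\<^sup>+z. indicator {p. \<not> low i p} (h, z) \<partial>Z N \<partial>H)) + (\<integral>\<^sup>+h. indicator {h. \<rho> \<le> S h} h \<partial>H)"
  proof -
    note a = Z.borel_measurable_nn_integral_fst[OF lm] and b = Z.borel_measurable_nn_integral_fst[OF lm']
    show ?thesis by (simp only: nn_integral_add[OF borel_measurable_add[OF a b] Sind] nn_integral_add[OF a b])
  qed
  also have "\<dots> \<le> ((err + ennreal (exp g) * hit x' N + ennreal (1 / 8)) + ennreal (1 / 4)) + ennreal (1 / 8)"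
    by (intro add_mono P1 P2 P3)
  also have "\<dots> = (err + ennreal (exp g) * hit x' N) + ennreal (1 / 2)"
  proof -
    have "ennreal (1 / 8) + ennreal (1 / 4) + ennreal (1 / 8) = ennreal (1 / 2)"
      by (subst ennreal_plus[symmetric], simp, simp, subst ennreal_plus[symmetric]) auto
    then show ?thesis by (simp only: add.assoc)
  qed
  finally have "1 \<le> (err + ennreal (exp g) * hit x' N) + ennreal (1 / 2)" .
  then have "ennreal (1 / 2) + ennreal (1 / 2) \<le> ennreal (1 / 2) + (err + ennreal (exp g) * hit x' N)"
    by (subst ennreal_plus[symmetric]) (auto simp: add.commute)
  then show ?thesis unfolding g_def by (subst (asm) ennreal_add_left_cancel_le) auto
qed

end

text \<open>The codeword that is the first to spend more than \<open>4 * E\<close> in one slot takes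
  the role of \<open>x\<close>; before that slot the other one is weak as well. Disjointness bounds
  \<open>hit\<close> for the other codeword by its error, and the symmetric conclusion covers both
  orders.\<close>

lemma confusion_bound_pair:
  assumes R1: "reception J n N x1 D1 pw1" and R2: "reception J n N x2 D2 pw2"
    and disj: "D1 \<inter> D2 = {}" and E: "0 < E"
    and En1: "(\<integral>\<^sup>+h. \<integral>\<^sup>+z. ennreal (pw1 (h, z)) \<partial>PiM {1..n} (\<lambda>_. cgauss N) \<partial>PiM J (\<lambda>_. cgauss 1)) \<le> ennreal E"
    and En2: "(\<integral>\<^sup>+h. \<integral>\<^sup>+z. ennreal (pw2 (h, z)) \<partial>PiM {1..n} (\<lambda>_. cgauss N) \<partial>PiM J (\<lambda>_. cgauss 1)) \<le> ennreal E"
  shows "ennreal (1 / 2) \<le> ennreal (exp (confusion_exp n E N)) * (reception.err J n N x1 D1 + reception.err J n N x2 D2)"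
proof -
  have N: "0 < N" using R1 by (simp add: reception_def)
  have g1: "1 \<le> exp (confusion_exp n E N)" using E N by (simp add: confusion_exp_def)
  define i where "i y = (LEAST k. 1 \<le> k \<and> (k \<le> n \<longrightarrow> 4 * E < energy J y k))" for y
  have iP: "1 \<le> i y \<and> (i y \<le> n \<longrightarrow> 4 * E < energy J y (i y))" and il: "i y \<le> n + 1" for y
    unfolding i_def by (rule LeastI[of _ "n+1"], simp) (rule Least_le, simp)
  have im: "energy J y k \<le> 4 * E" if "k \<in> {1..<i y}" for k y
    using not_less_Least[of k "\<lambda>k. 1 \<le> k \<and> (k \<le> n \<longrightarrow> 4 * E < energy J y k)"] that unfolding i_def by auto
  have main: "ennreal (1 / 2) \<le> ennreal (exp (confusion_exp n E N)) * (reception.err J n N y1 C1 + reception.err J n N y2 C2)"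
    if R1: "reception J n N y1 C1 p1" and R2: "reception J n N y2 C2 p2" and disj: "C1 \<inter> C2 = {}" and le: "i y1 \<le> i y2"
      and En: "(\<integral>\<^sup>+h. \<integral>\<^sup>+z. ennreal (p1 (h, z)) \<partial>PiM {1..n} (\<lambda>_. cgauss N) \<partial>PiM J (\<lambda>_. cgauss 1)) \<le> ennreal E" for y1 y2 C1 C2 p1 p2
  proof -
    interpret R1: reception J n N y1 C1 p1 by fact
    interpret R2: reception J n N y2 C2 p2 by fact
    have "ennreal (1 / 2) \<le> R1.err + ennreal (exp (confusion_exp n E N)) * R1.hit y2 N"
      by (rule R1.confusion_bound[OF E, of "i y1"]) (use iP[of y1] il[of y1] im le En in auto)
    also have "R1.hit y2 N \<le> R2.err"
      unfolding R1.hit_def R2.err_def using disj by (intro nn_integral_mono) (auto simp: indicator_def)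
    also have "R1.err \<le> ennreal (exp (confusion_exp n E N)) * R1.err"
      using mult_right_mono[of 1 "ennreal (exp (confusion_exp n E N))" R1.err] g1 by simp
    finally show ?thesis by (simp add: distrib_left add_mono mult_left_mono)
  qed
  show ?thesis
  proof (cases "i x1 \<le> i x2")
    case True
    from main[OF R1 R2 disj True En1] show ?thesis .
  next
    case False
    then have "i x2 \<le> i x1" "D2 \<inter> D1 = {}" using disj by auto
    from main[OF R2 R1 this(2,1) En2] show ?thesis by (simp add: add.commute)
  qed
qed

section \<open>Silencing the destination\<close>

definition obs_upto :: "(nat \<Rightarrow> complex) \<Rightarrow> nat \<Rightarrow> nat \<Rightarrow> complex" where
  "obs_upto y t = (\<lambda>s. if 1 \<le> s \<and> s \<le> t then y s else 0)"

lemma trunc_eq_obs_upto: "trunc H k t = obs_upto (\<lambda>s. H s k) t"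
  by (simp add: trunc_def obs_upto_def)

lemma obs_upto_cong: "(\<And>s. 1 \<le> s \<Longrightarrow> s \<le> t \<Longrightarrow> y s = y' s) \<Longrightarrow> obs_upto y t = obs_upto y' t"
  by (auto simp: obs_upto_def)

text \<open>The last slot whose observation enters the decision. The bound \<open>t < n\<close>
  agrees with \<open>switched\<close> at time \<open>n\<close>: a switch after slot \<open>n\<close>
  counts as none.\<close>

definition stop_time :: "protocol \<Rightarrow> nat \<Rightarrow> nat \<Rightarrow> (nat \<Rightarrow> complex) \<Rightarrow> real \<Rightarrow> (nat \<Rightarrow> complex) \<Rightarrow> nat" where
  "stop_time p d n g u y = (if \<exists>t. 1 \<le> t \<and> t < n \<and> switch p d t (obs_upto y t) g u
     then LEAST t. 1 \<le> t \<and> switch p d t (obs_upto y t) g u else n)"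

definition verdict :: "protocol \<Rightarrow> nat \<Rightarrow> nat \<Rightarrow> (nat \<Rightarrow> complex) \<Rightarrow> real \<Rightarrow> (nat \<Rightarrow> complex) \<Rightarrow> nat" where
  "verdict p d n g u y = decide p d (obs_upto y (stop_time p d n g u y)) g u"

lemma stop_time_le: "stop_time p d n g u y \<le> n"
proof (cases "\<exists>t. 1 \<le> t \<and> t < n \<and> switch p d t (obs_upto y t) g u")
  case True
  then obtain t where t: "1 \<le> t" "t < n" "switch p d t (obs_upto y t) g u" by auto
  then have "(LEAST t. 1 \<le> t \<and> switch p d t (obs_upto y t) g u) \<le> t" by (intro Least_le) auto
  then show ?thesis using t True by (simp add: stop_time_def)
next
  case False
  then show ?thesis unfolding stop_time_def by (simp only: if_False order_refl)
qed

lemma not_switch_before_stop_time: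
  assumes "1 \<le> t" "t < stop_time p d n g u y"
  shows "\<not> switch p d t (obs_upto y t) g u"
proof (cases "\<exists>t. 1 \<le> t \<and> t < n \<and> switch p d t (obs_upto y t) g u")
  case True
  then show ?thesis using assms not_less_Least[of t "\<lambda>t. 1 \<le> t \<and> switch p d t (obs_upto y t) g u"]
    by (auto simp: stop_time_def)
next
  case False
  then have "stop_time p d n g u y = n" unfolding stop_time_def by (simp only: if_False)
  then show ?thesis using assms False by auto
qed

text \<open>The stopping-time property: whether listening ends after a slot depends on the
  observations up to that slot, so changing later ones cannot move the end.\<close>

lemma stop_time_cong:
  assumes eq: "\<And>s. 1 \<le> s \<Longrightarrow> s \<le> stop_time p d n g u y \<Longrightarrow> y' s = y s"
  shows "stop_time p d n g u y' = stop_time p d n g u y"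
proof -
  define T where "T = stop_time p d n g u y"
  have pre: "obs_upto y' t = obs_upto y t" if "t \<le> T" for t
    using eq that by (intro obs_upto_cong) (auto simp: T_def)
  have no: "\<not> switch p d t (obs_upto y' t) g u" if "1 \<le> t" "t < T" for t
    using not_switch_before_stop_time[of t p d n g u y] that pre[of t] by (simp add: T_def)
  show ?thesis
  proof (cases "\<exists>t. 1 \<le> t \<and> t < n \<and> switch p d t (obs_upto y t) g u")
    case True
    then obtain t where t: "1 \<le> t" "t < n" "switch p d t (obs_upto y t) g u" by auto
    have TL: "T = (LEAST t. 1 \<le> t \<and> switch p d t (obs_upto y t) g u)" using True by (simp add: T_def stop_time_def)
    have T: "1 \<le> T \<and> switch p d T (obs_upto y T) g u" unfolding TL by (rule LeastI[of _ t]) (use t in auto)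
    have "T \<le> t" unfolding TL by (rule Least_le) (use t in auto)
    then have Tn: "T < n" using t by simp
    have ex: "\<exists>t. 1 \<le> t \<and> t < n \<and> switch p d t (obs_upto y' t) g u" using T Tn pre[of T] by auto
    have "(LEAST t. 1 \<le> t \<and> switch p d t (obs_upto y' t) g u) = T"
      using T pre[of T] no by (intro Least_equality) (auto simp: not_less[symmetric])
    then show ?thesis using ex by (simp add: stop_time_def[of p d n g u y'] T_def)
  next
    case False
    then have Tn: "T = n" unfolding T_def stop_time_def by (simp only: if_False)
    then have "\<not> (\<exists>t. 1 \<le> t \<and> t < n \<and> switch p d t (obs_upto y' t) g u)" using no by auto
    then have "stop_time p d n g u y' = n" unfolding stop_time_def by (simp only: if_False)
    then show ?thesis using Tn by (simp only: T_def)
  qed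
qed

lemma verdict_cong:
  assumes eq: "\<And>s. 1 \<le> s \<Longrightarrow> s \<le> stop_time p d n g u y \<Longrightarrow> y' s = y s"
  shows "verdict p d n g u y' = verdict p d n g u y"
  using stop_time_cong[OF eq] obs_upto_cong[of "stop_time p d n g u y" y' y] eq by (simp add: verdict_def)

lemma decision_eq_verdict:
  "decision p K n (W, h, z, u) d = verdict p d n (inc K h d) u (\<lambda>s. hist p K W h z u n s d)"
  unfolding decision_def verdict_def stop_time_def switched_def sw_time_def trunc_eq_obs_upto Let_def prod.case ..

lemma hist_stable: "t \<le> i \<Longrightarrow> hist p K W h z u i t k = hist p K W h z u t t k"
  by (induction i) (auto simp: le_Suc_eq)

text \<open>The protocol in which node \<open>d\<close> never leaves receive mode. Up to the stopping time of \<open>d\<close> it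
  behaves like the original one, but its transmissions do not depend on the gains into \<open>d\<close> and
  the noise at \<open>d\<close>.\<close>

definition silenced :: "protocol \<Rightarrow> nat \<Rightarrow> protocol" where
  "silenced p d = p\<lparr>switch := \<lambda>k t obs g u. k \<noteq> d \<and> switch p k t obs g u\<rparr>"

lemma transmits_cong:
  assumes "\<And>s. H s k = H' s k" "inc K h k = inc K h' k"
  shows "transmits p K h u H k i = transmits p K h' u H' k i"
  using assms by (simp add: transmits_def switched_def trunc_eq_obs_upto)

lemma symb_cong:
  assumes "\<And>s. H s k = H' s k" "inc K h k = inc K h' k"
  shows "symb p K W h u H k i = symb p K W h' u H' k i"
  using assms by (simp add: symb_def sw_time_def trunc_eq_obs_upto)

lemma transmits_silenced: "k \<noteq> d \<Longrightarrow> transmits (silenced p d) K h u H k i = transmits p K h u H k i"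
  and symb_silenced: "k \<noteq> d \<Longrightarrow> symb (silenced p d) K W h u H k i = symb p K W h u H k i"
  and not_transmits_silenced: "1 \<le> d \<Longrightarrow> \<not> transmits (silenced p d) K h u H d i"
  by (auto simp: silenced_def transmits_def switched_def symb_def sw_time_def)

definition tx :: "protocol \<Rightarrow> nat \<Rightarrow> nat \<Rightarrow> nat \<Rightarrow> ((nat \<times> nat) \<Rightarrow> complex) \<Rightarrow> ((nat \<times> nat) \<Rightarrow> complex) \<Rightarrow> real \<Rightarrow> nat \<Rightarrow> nat \<Rightarrow> complex" where
  "tx p K d W h z u i j =
    (let p' = silenced p d; H = hist p' K W h z u (i - 1) in if transmits p' K h u H j i then symb p' K W h u H j i else 0)"

text \<open>In the silenced protocol \<open>d\<close> never transmits, so its gains and noise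
  influence no other node; the induction runs along time, for all other nodes at once.\<close>

lemma hist_silenced_indep:
  assumes d: "1 \<le> d"
    and h: "\<And>j k. k \<noteq> d \<Longrightarrow> h (j, k) = h' (j, k)" and z: "\<And>k i. k \<noteq> d \<Longrightarrow> z (k, i) = z' (k, i)"
    and k: "k \<noteq> d"
  shows "hist (silenced p d) K W h z u i t k = hist (silenced p d) K W h' z' u i t k"
  using k
proof (induction i arbitrary: t k)
  case (Suc i)
  let ?H = "hist (silenced p d) K W h z u i" and ?H' = "hist (silenced p d) K W h' z' u i"
  have inc: "inc K h j = inc K h' j" if "j \<noteq> d" for j using h[OF that] by (auto simp: inc_def)
  have tr: "transmits (silenced p d) K h u ?H j (Suc i) = transmits (silenced p d) K h' u ?H' j (Suc i)" for j
  proof (cases "j = d")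
    case False
    show ?thesis by (rule transmits_cong) (use False Suc.IH inc in auto)
  qed (use not_transmits_silenced[OF d] in auto)
  have sy: "symb (silenced p d) K W h u ?H j (Suc i) = symb (silenced p d) K W h' u ?H' j (Suc i)" if "j \<noteq> d" for j
    by (rule symb_cong) (use that Suc.IH inc in auto)
  have "yval (silenced p d) K W h z u ?H (Suc i) k = yval (silenced p d) K W h' z' u ?H' (Suc i) k"
    unfolding yval_def tr using Suc.prems not_transmits_silenced[OF d] h z
    by (intro arg_cong2[where f="(+)"] sum.cong) (auto intro!: arg_cong2[where f="(*)"] sy)
  then show ?case using Suc by simp
qed simp

lemma tx_indep:
  assumes d: "1 \<le> d"
    and h: "\<And>j k. k \<noteq> d \<Longrightarrow> h (j, k) = h' (j, k)" and z: "\<And>k i. k \<noteq> d \<Longrightarrow> z (k, i) = z' (k, i)"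
    and j: "j \<noteq> d"
  shows "tx p K d W h z u i j = tx p K d W h' z' u i j"
proof -
  have H: "hist (silenced p d) K W h z u (i - 1) s j = hist (silenced p d) K W h' z' u (i - 1) s j" for s
    by (rule hist_silenced_indep) (use assms in auto)
  have inc: "inc K h j = inc K h' j" using h[OF j] by (auto simp: inc_def)
  show ?thesis unfolding tx_def Let_def 
    using transmits_cong[where k=j and H="hist (silenced p d) K W h z u (i - 1)" and H'="hist (silenced p d) K W h' z' u (i - 1)", OF H inc]
      symb_cong[where k=j and H="hist (silenced p d) K W h z u (i - 1)" and H'="hist (silenced p d) K W h' z' u (i - 1)", OF H inc] by simp
qed

lemma hist_silenced_receiver:
  assumes d: "1 \<le> d" and i: "1 \<le> i" "i \<le> n"
  shows "hist (silenced p d) K W h z u n i d = (\<Sum>j\<in>{j. j \<le> K \<and> j \<noteq> d}. tx p K d W h z u i j * h (j, d)) + z (d, i)"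
proof -
  obtain i' where i': "i = Suc i'" using i by (cases i) auto
  let ?p = "silenced p d" let ?H = "hist (silenced p d) K W h z u i'"
  have fin: "finite {j. j \<le> K \<and> j \<noteq> d}" by simp
  have "hist ?p K W h z u n i d = yval ?p K W h z u ?H (Suc i') d"
    using hist_stable[OF i(2)] by (simp add: i')
  also have "\<dots> = (\<Sum>j\<in>{j. j \<le> K \<and> j \<noteq> d}. tx p K d W h z u i j * h (j, d)) + z (d, i)"
  proof -
    let ?P = "\<lambda>j. transmits ?p K h u ?H j (Suc i')"
    have "{j. j \<le> K \<and> j \<noteq> d \<and> ?P j} = {j \<in> {j. j \<le> K \<and> j \<noteq> d}. ?P j}" by auto
    moreover have "(\<Sum>j\<in>{j \<in> {j. j \<le> K \<and> j \<noteq> d}. ?P j}. h (j, d) * symb ?p K W h u ?H j (Suc i'))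
      = (\<Sum>j\<in>{j. j \<le> K \<and> j \<noteq> d}. if ?P j then h (j, d) * symb ?p K W h u ?H j (Suc i') else 0)"
      by (rule sum.inter_filter[OF fin])
    moreover have "\<dots> = (\<Sum>j\<in>{j. j \<le> K \<and> j \<noteq> d}. tx p K d W h z u i j * h (j, d))"
      by (intro sum.cong refl) (auto simp: tx_def Let_def i')
    ultimately show ?thesis unfolding yval_def i' by simp
  qed
  finally show ?thesis .
qed

text \<open>As long as \<open>d\<close> is still listening in the silenced run, its past is the same
  in both runs; hence it does not transmit in the original run either, and the next observations
  agree at every node.\<close>

lemma hist_eq_silenced:
  assumes d: "1 \<le> d"
    and i: "i \<le> stop_time p d n (inc K h d) u (\<lambda>s. hist (silenced p d) K W h z u n s d)"
  shows "hist p K W h z u i = hist (silenced p d) K W h z u i"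
  using i
proof (induction i)
  case (Suc i)
  let ?p = "silenced p d"
  let ?H = "hist p K W h z u i" and ?H' = "hist ?p K W h z u i"
  let ?y = "\<lambda>s. hist ?p K W h z u n s d"
  have HH: "?H = ?H'" using Suc by simp
  have n: "Suc i \<le> n" using Suc.prems stop_time_le order_trans by blast
  have nd: "\<not> transmits p K h u ?H d (Suc i)"
  proof
    assume "transmits p K h u ?H d (Suc i)"
    then obtain t where t: "1 \<le> t" "t \<le> i" "switch p d t (trunc ?H' d t) (inc K h d) u"
      using d unfolding HH by (auto simp: transmits_def switched_def less_Suc_eq_le)
    have "trunc ?H' d t = obs_upto ?y t" unfolding trunc_eq_obs_upto
    proof (rule obs_upto_cong)
      fix s assume "s \<le> t"
      then show "?H' s d = ?y s" using t n hist_stable[of s i] hist_stable[of s n] by auto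
    qed
    then show False using t not_switch_before_stop_time[of t p d n "inc K h d" u ?y] Suc.prems by simp
  qed
  have tr: "transmits p K h u ?H j (Suc i) = transmits ?p K h u ?H' j (Suc i)" for j
    using nd not_transmits_silenced[OF d] transmits_silenced HH by (cases "j = d") auto
  have y: "yval p K W h z u ?H (Suc i) k = yval ?p K W h z u ?H' (Suc i) k" for k
  proof -
    have "symb p K W h u ?H j (Suc i) = symb ?p K W h u ?H' j (Suc i)" if "transmits ?p K h u ?H' j (Suc i)" for j
      using that not_transmits_silenced[OF d] symb_silenced HH by (cases "j = d") auto
    then show ?thesis unfolding yval_def tr
      by (intro arg_cong2[where f="(+)"] sum.cong refl) auto
  qed
  show ?case by (simp only: hist.simps HH y[unfolded HH])
qed simp

lemma decision_eq_silenced_verdict: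
  assumes d: "1 \<le> d"
  shows "decision p K n (W, h, z, u) d = verdict p d n (inc K h d) u (\<lambda>s. hist (silenced p d) K W h z u n s d)"
  unfolding decision_eq_verdict
proof (rule verdict_cong)
  let ?y = "\<lambda>s. hist (silenced p d) K W h z u n s d"
  fix s assume s: "1 \<le> s" "s \<le> stop_time p d n (inc K h d) u ?y"
  then have "s \<le> n" using stop_time_le order_trans by blast
  then show "hist p K W h z u n s d = ?y s"
    using hist_eq_silenced[OF d s(2)] hist_stable[of s n] by metis
qed

lemma power_nonneg: "0 \<le> power p K n \<omega>"
  by (cases \<omega>) (auto simp: power_def Let_def intro!: divide_nonneg_nonneg sum_nonneg)

text \<open>Up to the stopping time of \<open>d\<close> both runs send the same symbols, and later
  slots only add power.\<close>

lemma power_ge_tx_energy: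
  assumes d: "1 \<le> d" and n: "1 \<le> n"
    and m: "m \<le> stop_time p d n (inc K h d) u (\<lambda>s. hist (silenced p d) K W h z u n s d)"
  shows "(\<Sum>i=1..m. \<Sum>j\<in>{j. j \<le> K \<and> j \<noteq> d}. (cmod (tx p K d W h z u i j))\<^sup>2) \<le> real n * power p K n (W, h, z, u)"
proof -
  let ?p = "silenced p d"
  have mn: "m \<le> n" using m stop_time_le order_trans by blast
  define e where "e i = (let H = hist p K W h z u (i - 1) in
            \<Sum>k\<in>{k. k \<le> K \<and> transmits p K h u H k i}. (cmod (symb p K W h u H k i))\<^sup>2)" for i
  have e0: "0 \<le> e i" for i unfolding e_def Let_def by (intro sum_nonneg) auto
  have "(\<Sum>i=1..m. \<Sum>j\<in>{j. j \<le> K \<and> j \<noteq> d}. (cmod (tx p K d W h z u i j))\<^sup>2) \<le> (\<Sum>i=1..m. e i)"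
  proof (intro sum_mono)
    fix i assume i: "i \<in> {1..m}"
    let ?H = "hist p K W h z u (i - 1)"
    have H: "?H = hist ?p K W h z u (i - 1)"
      by (rule hist_eq_silenced[OF d, where n=n]) (use i m in auto)
    have "(\<Sum>j\<in>{j. j \<le> K \<and> j \<noteq> d}. (cmod (tx p K d W h z u i j))\<^sup>2)
      = (\<Sum>j\<in>{j \<in> {j. j \<le> K \<and> j \<noteq> d}. transmits ?p K h u ?H j i}. (cmod (symb ?p K W h u ?H j i))\<^sup>2)"
      unfolding tx_def Let_def H by (subst sum.inter_filter) (auto intro!: sum.cong)
    also have "\<dots> \<le> e i"
      unfolding e_def Let_def
      by (rule order_trans[OF _ sum_mono2[where A="{j \<in> {j. j \<le> K \<and> j \<noteq> d}. transmits ?p K h u ?H j i}"]])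
         (auto simp: transmits_silenced symb_silenced)
    finally show "(\<Sum>j\<in>{j. j \<le> K \<and> j \<noteq> d}. (cmod (tx p K d W h z u i j))\<^sup>2) \<le> e i" .
  qed
  also have "\<dots> \<le> (\<Sum>i=1..n. e i)" using mn e0 by (intro sum_mono2) auto
  also have "\<dots> = real n * power p K n (W, h, z, u)"
    using n by (simp add: power_def e_def)
  finally show ?thesis .
qed

section \<open>Conditioning on the remaining network\<close>

text \<open>Besides splitting off the coordinates \<open>I2\<close>, this renames them along
  \<open>f\<close>, so that the gains into \<open>d\<close> become a family over senders and its
  noise a family over slots, as \<open>reception\<close> expects.\<close>

lemma nn_integral_PiM_split:
  assumes s: "0 < s" and fin: "finite I1" "finite I2" "I1 \<inter> I2 = {}"
    and f: "inj_on f I2" "f ` I2 \<subseteq> J"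
    and F [measurable]: "F \<in> borel_measurable (PiM (I1 \<union> I2) (\<lambda>_. cgauss s))"
  shows "(\<integral>\<^sup>+x. F x \<partial>PiM (I1 \<union> I2) (\<lambda>_. cgauss s)) =
    (\<integral>\<^sup>+x. \<integral>\<^sup>+y. F (merge I1 I2 (x, \<lambda>k\<in>I2. y (f k))) \<partial>PiM J (\<lambda>_. cgauss s) \<partial>PiM I1 (\<lambda>_. cgauss s))"
proof -
  interpret P: product_sigma_finite "\<lambda>_. cgauss s" by (rule product_sigma_finite_cgauss) fact
  have "(\<integral>\<^sup>+x. F x \<partial>PiM (I1 \<union> I2) (\<lambda>_. cgauss s)) =
    (\<integral>\<^sup>+x. \<integral>\<^sup>+y. F (merge I1 I2 (x, y)) \<partial>PiM I2 (\<lambda>_. cgauss s) \<partial>PiM I1 (\<lambda>_. cgauss s))"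
    by (rule P.product_nn_integral_fold) (use fin in auto)
  also have "\<dots> = (\<integral>\<^sup>+x. \<integral>\<^sup>+y. F (merge I1 I2 (x, \<lambda>k\<in>I2. y (f k))) \<partial>PiM J (\<lambda>_. cgauss s) \<partial>PiM I1 (\<lambda>_. cgauss s))"
  proof (intro nn_integral_cong)
    fix x assume x: "x \<in> space (PiM I1 (\<lambda>_. cgauss s))"
    have m: "(\<lambda>y. F (merge I1 I2 (x, y))) \<in> borel_measurable (PiM I2 (\<lambda>_. cgauss s))"
      using x by measurable
    have t: "(\<lambda>\<omega>. \<lambda>k\<in>I2. \<omega> (f k)) \<in> PiM J (\<lambda>_. cgauss s) \<rightarrow>\<^sub>M PiM I2 (\<lambda>_. cgauss s)"
      using f(2) by (intro measurable_restrict measurable_component_singleton) auto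
    have "PiM I2 (\<lambda>_. cgauss s) = distr (PiM J (\<lambda>_. cgauss s)) (PiM I2 (\<lambda>_. cgauss s)) (\<lambda>\<omega>. \<lambda>k\<in>I2. \<omega> (f k))"
      using distr_PiM_reindex[of J "\<lambda>_. cgauss s" f I2] prob_space_cgauss[OF s] f
      by (simp add: image_subset_iff_funcset)
    then have "(\<integral>\<^sup>+y. F (merge I1 I2 (x, y)) \<partial>PiM I2 (\<lambda>_. cgauss s)) =
      (\<integral>\<^sup>+y. F (merge I1 I2 (x, y)) \<partial>distr (PiM J (\<lambda>_. cgauss s)) (PiM I2 (\<lambda>_. cgauss s)) (\<lambda>\<omega>. \<lambda>k\<in>I2. \<omega> (f k)))"
      by simp
    also have "\<dots> = (\<integral>\<^sup>+y. F (merge I1 I2 (x, \<lambda>k\<in>I2. y (f k))) \<partial>PiM J (\<lambda>_. cgauss s))"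
      by (rule nn_integral_distr[OF t]) (use m in simp)
    finally show "(\<integral>\<^sup>+y. F (merge I1 I2 (x, y)) \<partial>PiM I2 (\<lambda>_. cgauss s)) = (\<integral>\<^sup>+y. F (merge I1 I2 (x, \<lambda>k\<in>I2. y (f k))) \<partial>PiM J (\<lambda>_. cgauss s))" .
  qed
  finally show ?thesis .
qed

text \<open>Tonelli brings the two families seen by \<open>d\<close> alone, its incoming gains and
  its noise, to the innermost position; the triple \<open>r\<close> of everything else becomes a
  parameter that can be frozen.\<close>

lemma nn_integral_reorder:
  assumes "sigma_finite_measure A" "sigma_finite_measure B" "sigma_finite_measure C" "sigma_finite_measure D" "sigma_finite_measure U"
    and [measurable]: "F \<in> borel_measurable (A \<Otimes>\<^sub>M B \<Otimes>\<^sub>M C \<Otimes>\<^sub>M D \<Otimes>\<^sub>M U)"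
  shows "(\<integral>\<^sup>+a. \<integral>\<^sup>+b. \<integral>\<^sup>+c. \<integral>\<^sup>+e. \<integral>\<^sup>+u. F (a, b, c, e, u) \<partial>U \<partial>D \<partial>C \<partial>B \<partial>A)
      = (\<integral>\<^sup>+r. \<integral>\<^sup>+b. \<integral>\<^sup>+e. F (fst r, b, fst (snd r), e, snd (snd r)) \<partial>D \<partial>B \<partial>(A \<Otimes>\<^sub>M C \<Otimes>\<^sub>M U))" (is ?th1)
    "(\<lambda>r. \<integral>\<^sup>+b. \<integral>\<^sup>+e. F (fst r, b, fst (snd r), e, snd (snd r)) \<partial>D \<partial>B) \<in> borel_measurable (A \<Otimes>\<^sub>M C \<Otimes>\<^sub>M U)"
proof -
  interpret A: sigma_finite_measure A by fact
  interpret B: sigma_finite_measure B by fact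
  interpret C: sigma_finite_measure C by fact
  interpret D: sigma_finite_measure D by fact
  interpret U: sigma_finite_measure U by fact
  interpret CU: pair_sigma_finite C U ..
  interpret UB: pair_sigma_finite U B ..
  interpret CB: pair_sigma_finite C B ..
  interpret UD: pair_sigma_finite U D ..
  show m: "(\<lambda>r. \<integral>\<^sup>+b. \<integral>\<^sup>+e. F (fst r, b, fst (snd r), e, snd (snd r)) \<partial>D \<partial>B) \<in> borel_measurable (A \<Otimes>\<^sub>M C \<Otimes>\<^sub>M U)"
    by measurable
  have "(\<integral>\<^sup>+a. \<integral>\<^sup>+b. \<integral>\<^sup>+c. \<integral>\<^sup>+e. \<integral>\<^sup>+u. F (a, b, c, e, u) \<partial>U \<partial>D \<partial>C \<partial>B \<partial>A)
     = (\<integral>\<^sup>+a. \<integral>\<^sup>+c. \<integral>\<^sup>+u. \<integral>\<^sup>+b. \<integral>\<^sup>+e. F (a, b, c, e, u) \<partial>D \<partial>B \<partial>U \<partial>C \<partial>A)"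
  proof (intro nn_integral_cong)
    fix a assume a [measurable]: "a \<in> space A"
    have "(\<integral>\<^sup>+b. \<integral>\<^sup>+c. \<integral>\<^sup>+e. \<integral>\<^sup>+u. F (a, b, c, e, u) \<partial>U \<partial>D \<partial>C \<partial>B) = (\<integral>\<^sup>+c. \<integral>\<^sup>+b. \<integral>\<^sup>+e. \<integral>\<^sup>+u. F (a, b, c, e, u) \<partial>U \<partial>D \<partial>B \<partial>C)"
      by (rule CB.Fubini') measurable
    also have "\<dots> = (\<integral>\<^sup>+c. \<integral>\<^sup>+b. \<integral>\<^sup>+u. \<integral>\<^sup>+e. F (a, b, c, e, u) \<partial>D \<partial>U \<partial>B \<partial>C)"
    proof (intro nn_integral_cong)
      fix c b assume [measurable]: "c \<in> space C" "b \<in> space B"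
      show "(\<integral>\<^sup>+e. \<integral>\<^sup>+u. F (a, b, c, e, u) \<partial>U \<partial>D) = (\<integral>\<^sup>+u. \<integral>\<^sup>+e. F (a, b, c, e, u) \<partial>D \<partial>U)"
        by (rule UD.Fubini') measurable
    qed
    also have "\<dots> = (\<integral>\<^sup>+c. \<integral>\<^sup>+u. \<integral>\<^sup>+b. \<integral>\<^sup>+e. F (a, b, c, e, u) \<partial>D \<partial>B \<partial>U \<partial>C)"
    proof (intro nn_integral_cong)
      fix c assume [measurable]: "c \<in> space C"
      show "(\<integral>\<^sup>+b. \<integral>\<^sup>+u. \<integral>\<^sup>+e. F (a, b, c, e, u) \<partial>D \<partial>U \<partial>B) = (\<integral>\<^sup>+u. \<integral>\<^sup>+b. \<integral>\<^sup>+e. F (a, b, c, e, u) \<partial>D \<partial>B \<partial>U)"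
        by (rule UB.Fubini') measurable
    qed
    finally show "(\<integral>\<^sup>+b. \<integral>\<^sup>+c. \<integral>\<^sup>+e. \<integral>\<^sup>+u. F (a, b, c, e, u) \<partial>U \<partial>D \<partial>C \<partial>B) = (\<integral>\<^sup>+c. \<integral>\<^sup>+u. \<integral>\<^sup>+b. \<integral>\<^sup>+e. F (a, b, c, e, u) \<partial>D \<partial>B \<partial>U \<partial>C)" .
  qed
  also have "\<dots> = (\<integral>\<^sup>+a. \<integral>\<^sup>+r. \<integral>\<^sup>+b. \<integral>\<^sup>+e. F (a, b, fst r, e, snd r) \<partial>D \<partial>B \<partial>(C \<Otimes>\<^sub>M U) \<partial>A)"
  proof (intro nn_integral_cong)
    fix a assume [measurable]: "a \<in> space A"
    show "(\<integral>\<^sup>+c. \<integral>\<^sup>+u. \<integral>\<^sup>+b. \<integral>\<^sup>+e. F (a, b, c, e, u) \<partial>D \<partial>B \<partial>U \<partial>C) = (\<integral>\<^sup>+r. \<integral>\<^sup>+b. \<integral>\<^sup>+e. F (a, b, fst r, e, snd r) \<partial>D \<partial>B \<partial>(C \<Otimes>\<^sub>M U))"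
      by (subst U.nn_integral_fst[symmetric]) auto
  qed
  also have "\<dots> = (\<integral>\<^sup>+r. \<integral>\<^sup>+b. \<integral>\<^sup>+e. F (fst r, b, fst (snd r), e, snd (snd r)) \<partial>D \<partial>B \<partial>(A \<Otimes>\<^sub>M C \<Otimes>\<^sub>M U))"
    by (subst CU.P.nn_integral_fst[symmetric, OF m]) simp
  finally show ?th1 .
qed

abbreviation senders :: "nat \<Rightarrow> nat \<Rightarrow> nat set" where
  "senders K d \<equiv> {j. j \<le> K \<and> j \<noteq> d}"

definition join_gains :: "nat \<Rightarrow> nat \<Rightarrow> (nat \<times> nat \<Rightarrow> complex) \<Rightarrow> (nat \<Rightarrow> complex) \<Rightarrow> nat \<times> nat \<Rightarrow> complex" where
  "join_gains K d r h = merge {p \<in> gain_idx K. snd p \<noteq> d} (senders K d \<times> {d}) (r, \<lambda>p\<in>senders K d \<times> {d}. h (fst p))"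

definition join_noise :: "nat \<Rightarrow> nat \<Rightarrow> nat \<Rightarrow> (nat \<times> nat \<Rightarrow> complex) \<Rightarrow> (nat \<Rightarrow> complex) \<Rightarrow> nat \<times> nat \<Rightarrow> complex" where
  "join_noise K n d r z = merge {p \<in> noise_idx K n. fst p \<noteq> d} ({d} \<times> {1..n}) (r, \<lambda>p\<in>{d} \<times> {1..n}. z (snd p))"

definition restspace :: "real \<Rightarrow> nat \<Rightarrow> nat \<Rightarrow> nat \<Rightarrow> ((nat \<times> nat \<Rightarrow> complex) \<times> (nat \<times> nat \<Rightarrow> complex) \<times> real) measure" where
  "restspace N0 K n d = PiM {p \<in> gain_idx K. snd p \<noteq> d} (\<lambda>_. cgauss 1) \<Otimes>\<^sub>M
     PiM {p \<in> noise_idx K n. fst p \<noteq> d} (\<lambda>_. cgauss N0) \<Otimes>\<^sub>M uniform_measure lborel {0..1}"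

definition assemble :: "nat \<Rightarrow> nat \<Rightarrow> nat \<Rightarrow> nat \<Rightarrow> ((nat \<times> nat \<Rightarrow> complex) \<times> (nat \<times> nat \<Rightarrow> complex) \<times> real)
    \<Rightarrow> (nat \<Rightarrow> complex) \<times> (nat \<Rightarrow> complex) \<Rightarrow> nat \<times> (nat \<times> nat \<Rightarrow> complex) \<times> (nat \<times> nat \<Rightarrow> complex) \<times> real" where
  "assemble K n d w r p = (w, join_gains K d (fst r) (fst p), join_noise K n d (fst (snd r)) (snd p), snd (snd r))"

lemma finite_gain_idx: "finite (gain_idx K)"
  by (rule finite_subset[of _ "{..K} \<times> {..K}"]) (auto simp: gain_idx_def)

lemma finite_noise_idx: "finite (noise_idx K n)"
  by (rule finite_subset[of _ "{..K} \<times> {..n}"]) (auto simp: noise_idx_def)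

lemma prob_space_uniform01: "prob_space (uniform_measure lborel {0..1::real})"
  by (rule prob_space_uniform_measure) auto

context
  fixes N0 :: real and K n M d :: nat
  assumes N0: "0 < N0" and M: "1 \<le> M" and d: "1 \<le> d" "d \<le> K"
begin

lemma gain_split: "gain_idx K = {p \<in> gain_idx K. snd p \<noteq> d} \<union> senders K d \<times> {d}"
  using d by (auto simp: gain_idx_def)

lemma noise_split: "noise_idx K n = {p \<in> noise_idx K n. fst p \<noteq> d} \<union> {d} \<times> {1..n}"
  using d by (auto simp: noise_idx_def)

lemma join_gains_measurable:
  "(\<lambda>p. join_gains K d (fst p) (snd p)) \<in> PiM {p \<in> gain_idx K. snd p \<noteq> d} (\<lambda>_. cgauss 1) \<Otimes>\<^sub>M PiM (senders K d) (\<lambda>_. cgauss 1)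
     \<rightarrow>\<^sub>M PiM (gain_idx K) (\<lambda>_. cgauss 1)"
  by (subst gain_split) (unfold join_gains_def, measurable, auto)

lemma join_noise_measurable:
  "(\<lambda>p. join_noise K n d (fst p) (snd p)) \<in> PiM {p \<in> noise_idx K n. fst p \<noteq> d} (\<lambda>_. cgauss N0) \<Otimes>\<^sub>M PiM {1..n} (\<lambda>_. cgauss N0)
     \<rightarrow>\<^sub>M PiM (noise_idx K n) (\<lambda>_. cgauss N0)"
  by (subst noise_split) (unfold join_noise_def, measurable, auto)

lemma nn_integral_gain_split:
  assumes F [measurable]: "F \<in> borel_measurable (PiM (gain_idx K) (\<lambda>_. cgauss 1))"
  shows "(\<integral>\<^sup>+h. F h \<partial>PiM (gain_idx K) (\<lambda>_. cgauss 1)) =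
    (\<integral>\<^sup>+r. \<integral>\<^sup>+h. F (join_gains K d r h) \<partial>PiM (senders K d) (\<lambda>_. cgauss 1) \<partial>PiM {p \<in> gain_idx K. snd p \<noteq> d} (\<lambda>_. cgauss 1))"
proof -
  have "(\<integral>\<^sup>+h. F h \<partial>PiM ({p \<in> gain_idx K. snd p \<noteq> d} \<union> senders K d \<times> {d}) (\<lambda>_. cgauss 1)) =
    (\<integral>\<^sup>+r. \<integral>\<^sup>+h. F (join_gains K d r h) \<partial>PiM (senders K d) (\<lambda>_. cgauss 1) \<partial>PiM {p \<in> gain_idx K. snd p \<noteq> d} (\<lambda>_. cgauss 1))"
    unfolding join_gains_def
  proof (rule nn_integral_PiM_split)
    show "F \<in> borel_measurable (PiM ({p \<in> gain_idx K. snd p \<noteq> d} \<union> senders K d \<times> {d}) (\<lambda>_. cgauss 1))"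
      using F gain_split by simp
  qed (auto intro: finite_subset[OF _ finite_gain_idx] inj_onI)
  then show ?thesis using gain_split by simp
qed

lemma nn_integral_noise_split:
  assumes F [measurable]: "F \<in> borel_measurable (PiM (noise_idx K n) (\<lambda>_. cgauss N0))"
  shows "(\<integral>\<^sup>+h. F h \<partial>PiM (noise_idx K n) (\<lambda>_. cgauss N0)) =
    (\<integral>\<^sup>+r. \<integral>\<^sup>+h. F (join_noise K n d r h) \<partial>PiM {1..n} (\<lambda>_. cgauss N0) \<partial>PiM {p \<in> noise_idx K n. fst p \<noteq> d} (\<lambda>_. cgauss N0))"
proof -
  have "(\<integral>\<^sup>+h. F h \<partial>PiM ({p \<in> noise_idx K n. fst p \<noteq> d} \<union> {d} \<times> {1..n}) (\<lambda>_. cgauss N0)) =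
    (\<integral>\<^sup>+r. \<integral>\<^sup>+h. F (join_noise K n d r h) \<partial>PiM {1..n} (\<lambda>_. cgauss N0) \<partial>PiM {p \<in> noise_idx K n. fst p \<noteq> d} (\<lambda>_. cgauss N0))"
    unfolding join_noise_def
  proof (rule nn_integral_PiM_split[OF N0])
    show "F \<in> borel_measurable (PiM ({p \<in> noise_idx K n. fst p \<noteq> d} \<union> {d} \<times> {1..n}) (\<lambda>_. cgauss N0))"
      using F noise_split by simp
  qed (auto intro: finite_subset[OF _ finite_noise_idx] inj_onI)
  then show ?thesis using noise_split by simp
qed

lemma netspace_section:
  assumes F: "F \<in> borel_measurable (netspace N0 K n M)"
  shows "(\<lambda>p. F (w, p)) \<in> borel_measurable (PiM (gain_idx K) (\<lambda>_. cgauss 1) \<Otimes>\<^sub>M PiM (noise_idx K n) (\<lambda>_. cgauss N0) \<Otimes>\<^sub>M uniform_measure lborel {0..1})"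
  by (rule measurable_compose[OF measurable_Pair1' F[unfolded netspace_def]]) simp

lemma assemble_measurable:
  assumes r: "r \<in> space (restspace N0 K n d)"
  shows "assemble K n d w r \<in> PiM (senders K d) (\<lambda>_. cgauss 1) \<Otimes>\<^sub>M PiM {1..n} (\<lambda>_. cgauss N0) \<rightarrow>\<^sub>M netspace N0 K n M"
proof -
  obtain r1 r2 u where ru: "r = (r1, r2, u)" by (cases r)
  have r1: "r1 \<in> space (PiM {p \<in> gain_idx K. snd p \<noteq> d} (\<lambda>_. cgauss 1))"
    and r2: "r2 \<in> space (PiM {p \<in> noise_idx K n. fst p \<noteq> d} (\<lambda>_. cgauss N0))"
    using r by (auto simp: ru restspace_def space_pair_measure)
  have 1: "(\<lambda>p. join_gains K d r1 (fst p)) \<in> PiM (senders K d) (\<lambda>_. cgauss 1) \<Otimes>\<^sub>M PiM {1..n} (\<lambda>_. cgauss N0) \<rightarrow>\<^sub>M PiM (gain_idx K) (\<lambda>_. cgauss 1)"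
    using measurable_compose[OF measurable_compose[OF measurable_fst measurable_Pair1'[OF r1]] join_gains_measurable] by (simp only: fst_conv snd_conv)
  have 2: "(\<lambda>p. join_noise K n d r2 (snd p)) \<in> PiM (senders K d) (\<lambda>_. cgauss 1) \<Otimes>\<^sub>M PiM {1..n} (\<lambda>_. cgauss N0) \<rightarrow>\<^sub>M PiM (noise_idx K n) (\<lambda>_. cgauss N0)"
    using measurable_compose[OF measurable_compose[OF measurable_snd measurable_Pair1'[OF r2]] join_noise_measurable] by (simp only: fst_conv snd_conv)
  have "assemble K n d w r = (\<lambda>p. (w, join_gains K d r1 (fst p), join_noise K n d r2 (snd p), u))"
    by (simp add: assemble_def ru fun_eq_iff)
  then show ?thesis unfolding netspace_def
    by (simp only:) (intro measurable_Pair measurable_const 1 2, auto)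
qed

text \<open>Disintegration over the rest of the network \<open>r\<close>. The sum over messages
  stays inside, because the converse compares different messages for one and the same
  \<open>r\<close>.\<close>

lemma nn_integral_netspace:
  assumes F: "F \<in> borel_measurable (netspace N0 K n M)"
  defines "G \<equiv> \<lambda>r. \<Sum>w=1..M. \<integral>\<^sup>+h. \<integral>\<^sup>+z. F (assemble K n d w r (h, z)) \<partial>PiM {1..n} (\<lambda>_. cgauss N0) \<partial>PiM (senders K d) (\<lambda>_. cgauss 1)"
  shows "G \<in> borel_measurable (restspace N0 K n d)"
    and "(\<integral>\<^sup>+\<omega>. F \<omega> \<partial>netspace N0 K n M) = ennreal (1 / real M) * (\<integral>\<^sup>+r. G r \<partial>restspace N0 K n d)"
proof -
  let ?A = "PiM {p \<in> gain_idx K. snd p \<noteq> d} (\<lambda>_. cgauss 1)" and ?B = "PiM (senders K d) (\<lambda>_. cgauss 1)"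
  let ?C = "PiM {p \<in> noise_idx K n. fst p \<noteq> d} (\<lambda>_. cgauss N0)" and ?D = "PiM {1..n} (\<lambda>_. cgauss N0)"
  let ?U = "uniform_measure lborel {0..1::real}"
  let ?H = "PiM (gain_idx K) (\<lambda>_. cgauss 1)" and ?Z = "PiM (noise_idx K n) (\<lambda>_. cgauss N0)"
  interpret H: prob_space ?H by (rule prob_space_PiM_cgauss) simp
  interpret Z: prob_space ?Z by (rule prob_space_PiM_cgauss) (rule N0)
  interpret U: prob_space ?U by (rule prob_space_uniform01)
  interpret D: prob_space ?D by (rule prob_space_PiM_cgauss) (rule N0)
  interpret B: prob_space ?B by (rule prob_space_PiM_cgauss) simp
  interpret ZU: pair_prob_space ?Z ?U ..
  interpret HZU: pair_prob_space ?H "?Z \<Otimes>\<^sub>M ?U" ..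
  define F' where "F' w q = F (assemble K n d w (fst q, fst (snd (snd q)), snd (snd (snd (snd q)))) (fst (snd q), fst (snd (snd (snd q)))))" for w q
  have F'm: "F' w \<in> borel_measurable (?A \<Otimes>\<^sub>M ?B \<Otimes>\<^sub>M ?C \<Otimes>\<^sub>M ?D \<Otimes>\<^sub>M ?U)" for w
  proof -
    have 1: "(\<lambda>q. join_gains K d (fst q) (fst (snd q))) \<in> ?A \<Otimes>\<^sub>M ?B \<Otimes>\<^sub>M ?C \<Otimes>\<^sub>M ?D \<Otimes>\<^sub>M ?U \<rightarrow>\<^sub>M ?H"
    proof -
      have "(\<lambda>q. (fst q, fst (snd q))) \<in> ?A \<Otimes>\<^sub>M ?B \<Otimes>\<^sub>M ?C \<Otimes>\<^sub>M ?D \<Otimes>\<^sub>M ?U \<rightarrow>\<^sub>M ?A \<Otimes>\<^sub>M ?B" by measurable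
      from measurable_compose[OF this join_gains_measurable] show ?thesis by (simp only: fst_conv snd_conv)
    qed
    have 2: "(\<lambda>q. join_noise K n d (fst (snd (snd q))) (fst (snd (snd (snd q))))) \<in> ?A \<Otimes>\<^sub>M ?B \<Otimes>\<^sub>M ?C \<Otimes>\<^sub>M ?D \<Otimes>\<^sub>M ?U \<rightarrow>\<^sub>M ?Z"
    proof -
      have "(\<lambda>q. (fst (snd (snd q)), fst (snd (snd (snd q))))) \<in> ?A \<Otimes>\<^sub>M ?B \<Otimes>\<^sub>M ?C \<Otimes>\<^sub>M ?D \<Otimes>\<^sub>M ?U \<rightarrow>\<^sub>M ?C \<Otimes>\<^sub>M ?D" by measurable
      from measurable_compose[OF this join_noise_measurable] show ?thesis by (simp only: fst_conv snd_conv)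
    qed
    have 3: "(\<lambda>q. snd (snd (snd (snd q)))) \<in> ?A \<Otimes>\<^sub>M ?B \<Otimes>\<^sub>M ?C \<Otimes>\<^sub>M ?D \<Otimes>\<^sub>M ?U \<rightarrow>\<^sub>M ?U" by measurable
    show ?thesis
      using measurable_compose[OF measurable_Pair[OF 1 measurable_Pair[OF 2 3]] netspace_section[OF F, of w]]
      unfolding F'_def assemble_def by (simp only: fst_conv snd_conv)
  qed
  note re = nn_integral_reorder[OF prob_space_imp_sigma_finite prob_space_imp_sigma_finite prob_space_imp_sigma_finite prob_space_imp_sigma_finite prob_space_imp_sigma_finite,
      of ?A ?B ?C ?D ?U, OF prob_space_PiM_cgauss prob_space_PiM_cgauss prob_space_PiM_cgauss prob_space_PiM_cgauss prob_space_uniform01, OF _ _ N0 N0 F'm]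
  have Geq: "G = (\<lambda>r. \<Sum>w=1..M. \<integral>\<^sup>+b. \<integral>\<^sup>+e. F' w (fst r, b, fst (snd r), e, snd (snd r)) \<partial>?D \<partial>?B)"
    unfolding G_def F'_def by (simp only: fst_conv snd_conv prod.collapse)
  show Gm: "G \<in> borel_measurable (restspace N0 K n d)"
    unfolding Geq restspace_def by (intro borel_measurable_sum re(2)) auto
  have w: "(\<integral>\<^sup>+p. F (w, p) \<partial>(?H \<Otimes>\<^sub>M ?Z \<Otimes>\<^sub>M ?U)) = (\<integral>\<^sup>+r. \<integral>\<^sup>+b. \<integral>\<^sup>+e. F' w (fst r, b, fst (snd r), e, snd (snd r)) \<partial>?D \<partial>?B \<partial>restspace N0 K n d)" for w
  proof -
    note m = netspace_section[OF F, of w]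
    have "(\<integral>\<^sup>+p. F (w, p) \<partial>(?H \<Otimes>\<^sub>M ?Z \<Otimes>\<^sub>M ?U)) = (\<integral>\<^sup>+h. \<integral>\<^sup>+q. F (w, h, q) \<partial>(?Z \<Otimes>\<^sub>M ?U) \<partial>?H)"
      by (rule ZU.P.nn_integral_fst[symmetric, OF m])
    also have "\<dots> = (\<integral>\<^sup>+a. \<integral>\<^sup>+b. \<integral>\<^sup>+q. F (w, join_gains K d a b, q) \<partial>(?Z \<Otimes>\<^sub>M ?U) \<partial>?B \<partial>?A)"
      by (rule nn_integral_gain_split) (rule ZU.P.borel_measurable_nn_integral_fst[OF m])
    also have "\<dots> = (\<integral>\<^sup>+a. \<integral>\<^sup>+b. \<integral>\<^sup>+c. \<integral>\<^sup>+e. \<integral>\<^sup>+u. F' w (a, b, c, e, u) \<partial>?U \<partial>?D \<partial>?C \<partial>?B \<partial>?A)"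
    proof (intro nn_integral_cong)
      fix a b assume a: "a \<in> space ?A" and b: "b \<in> space ?B"
      let ?h = "join_gains K d a b"
      have h: "?h \<in> space ?H"
        using measurable_space[OF join_gains_measurable, of "(a, b)"] a b by (simp add: space_pair_measure)
      have m': "(\<lambda>q. F (w, ?h, q)) \<in> borel_measurable (?Z \<Otimes>\<^sub>M ?U)"
        by (rule measurable_compose[OF measurable_Pair1'[OF h] m])
      have "(\<integral>\<^sup>+q. F (w, ?h, q) \<partial>(?Z \<Otimes>\<^sub>M ?U)) = (\<integral>\<^sup>+z. \<integral>\<^sup>+u. F (w, ?h, z, u) \<partial>?U \<partial>?Z)"
        by (rule U.nn_integral_fst[symmetric, OF m'])
      also have "\<dots> = (\<integral>\<^sup>+c. \<integral>\<^sup>+e. \<integral>\<^sup>+u. F (w, ?h, join_noise K n d c e, u) \<partial>?U \<partial>?D \<partial>?C)"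
        by (rule nn_integral_noise_split) (rule U.borel_measurable_nn_integral_fst[OF m'])
      finally show "(\<integral>\<^sup>+q. F (w, ?h, q) \<partial>(?Z \<Otimes>\<^sub>M ?U)) = (\<integral>\<^sup>+c. \<integral>\<^sup>+e. \<integral>\<^sup>+u. F' w (a, b, c, e, u) \<partial>?U \<partial>?D \<partial>?C)"
        unfolding F'_def assemble_def by (simp only: fst_conv snd_conv)
    qed
    also have "\<dots> = (\<integral>\<^sup>+r. \<integral>\<^sup>+b. \<integral>\<^sup>+e. F' w (fst r, b, fst (snd r), e, snd (snd r)) \<partial>?D \<partial>?B \<partial>restspace N0 K n d)"
      unfolding restspace_def by (rule re(1)) auto
    finally show ?thesis .
  qed
  have "(\<integral>\<^sup>+\<omega>. F \<omega> \<partial>netspace N0 K n M) = (\<integral>\<^sup>+w. \<integral>\<^sup>+p. F (w, p) \<partial>(?H \<Otimes>\<^sub>M ?Z \<Otimes>\<^sub>M ?U) \<partial>measure_pmf (pmf_of_set {1..M}))"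
    unfolding netspace_def by (rule HZU.nn_integral_fst[symmetric]) (rule F[unfolded netspace_def])
  also have "\<dots> = (\<Sum>w=1..M. \<integral>\<^sup>+p. F (w, p) \<partial>(?H \<Otimes>\<^sub>M ?Z \<Otimes>\<^sub>M ?U)) / real M"
    using M by (subst nn_integral_pmf_of_set) (auto simp: ennreal_of_nat_eq_real_of_nat)
  also have "\<dots> = ennreal (1 / real M) * (\<Sum>w=1..M. \<integral>\<^sup>+p. F (w, p) \<partial>(?H \<Otimes>\<^sub>M ?Z \<Otimes>\<^sub>M ?U))"
    using M by (simp add: divide_ennreal_def inverse_ennreal inverse_eq_divide mult.commute)
  also have "(\<Sum>w=1..M. \<integral>\<^sup>+p. F (w, p) \<partial>(?H \<Otimes>\<^sub>M ?Z \<Otimes>\<^sub>M ?U)) = (\<integral>\<^sup>+r. G r \<partial>restspace N0 K n d)"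
    unfolding w Geq by (rule nn_integral_sum[symmetric]) (unfold restspace_def, rule re(2), auto)
  finally show "(\<integral>\<^sup>+\<omega>. F \<omega> \<partial>netspace N0 K n M) = ennreal (1 / real M) * (\<integral>\<^sup>+r. G r \<partial>restspace N0 K n d)" .
qed

end

section \<open>The channel to the destination for a frozen rest of the network\<close>

lemma join_gains_receiver: "j \<in> senders K d \<Longrightarrow> join_gains K d r h (j, d) = h j"
  by (simp add: join_gains_def merge_def)

lemma join_gains_other: "k \<noteq> d \<Longrightarrow> join_gains K d r h (j, k) = join_gains K d r h' (j, k)"
  by (simp add: join_gains_def merge_def)

lemma join_noise_receiver: "1 \<le> i \<Longrightarrow> i \<le> n \<Longrightarrow> join_noise K n d r z (d, i) = z i"
  by (simp add: join_noise_def merge_def)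

lemma join_noise_other: "k \<noteq> d \<Longrightarrow> join_noise K n d r z (k, i) = join_noise K n d r z' (k, i)"
  by (simp add: join_noise_def merge_def)

definition own_gains :: "nat \<Rightarrow> nat \<Rightarrow> (nat \<Rightarrow> complex) \<Rightarrow> nat \<Rightarrow> complex" where
  "own_gains K d h = (\<lambda>j. if j \<in> senders K d then h j else 0)"

lemma inc_join_gains: "inc K (join_gains K d r h) d = own_gains K d h"
  by (auto simp: inc_def own_gains_def join_gains_receiver fun_eq_iff)

text \<open>The zeros are placeholders for the gains into \<open>d\<close> and the noise at
  \<open>d\<close>, on which the silenced transmissions of the other nodes do not depend. For frozen
  \<open>r\<close> every message thus has a fixed signal, a codeword over senders and slots.\<close>

definition virtual_tx :: "protocol \<Rightarrow> nat \<Rightarrow> nat \<Rightarrow> nat \<Rightarrow> ((nat \<times> nat \<Rightarrow> complex) \<times> (nat \<times> nat \<Rightarrow> complex) \<times> real) \<Rightarrow> nat \<Rightarrow> nat \<Rightarrow> nat \<Rightarrow> complex" where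
  "virtual_tx p K n d r w = tx p K d w (join_gains K d (fst r) (\<lambda>_. 0)) (join_noise K n d (fst (snd r)) (\<lambda>_. 0)) (snd (snd r))"

lemma tx_join:
  assumes "1 \<le> d" "j \<in> senders K d"
  shows "tx p K d w (join_gains K d (fst r) h) (join_noise K n d (fst (snd r)) z) (snd (snd r)) i j = virtual_tx p K n d r w i j"
  unfolding virtual_tx_def
  by (rule tx_indep) (use assms join_gains_other join_noise_other in auto)

lemma hist_join:
  assumes "1 \<le> d" "1 \<le> i" "i \<le> n"
  shows "hist (silenced p d) K w (join_gains K d (fst r) h) (join_noise K n d (fst (snd r)) z) (snd (snd r)) n i d
     = recv (senders K d) (virtual_tx p K n d r w) h i + z i"
  unfolding hist_silenced_receiver[OF assms] recv_def
  using assms by (simp add: tx_join join_gains_receiver join_noise_receiver)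

definition observe :: "protocol \<Rightarrow> nat \<Rightarrow> nat \<Rightarrow> nat \<Rightarrow> ((nat \<times> nat \<Rightarrow> complex) \<times> (nat \<times> nat \<Rightarrow> complex) \<times> real) \<Rightarrow> nat \<Rightarrow> (nat \<Rightarrow> complex) \<Rightarrow> (nat \<Rightarrow> complex) \<Rightarrow> nat \<Rightarrow> complex" where
  "observe p K n d r w h z = (\<lambda>k\<in>{1..n}. recv (senders K d) (virtual_tx p K n d r w) h k + z k)"

lemma stop_time_observe:
  assumes d: "1 \<le> d"
  shows "stop_time p d n g u (observe p K n d r w h z) =
    stop_time p d n g u (\<lambda>s. hist (silenced p d) K w (join_gains K d (fst r) h) (join_noise K n d (fst (snd r)) z) (snd (snd r)) n s d)"
  by (rule stop_time_cong[symmetric]) (use stop_time_le[of p d n g u "observe p K n d r w h z"] hist_join[OF d] in \<open>auto simp: observe_def\<close>)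

lemma decision_assemble:
  assumes d: "1 \<le> d"
  shows "decision p K n (assemble K n d w r (h, z)) d = verdict p d n (own_gains K d h) (snd (snd r)) (observe p K n d r w h z)"
proof -
  have "decision p K n (assemble K n d w r (h, z)) d = verdict p d n (own_gains K d h) (snd (snd r))
    (\<lambda>s. hist (silenced p d) K w (join_gains K d (fst r) h) (join_noise K n d (fst (snd r)) z) (snd (snd r)) n s d)"
    unfolding assemble_def fst_conv snd_conv decision_eq_silenced_verdict[OF d] inc_join_gains ..
  also have "\<dots> = verdict p d n (own_gains K d h) (snd (snd r)) (observe p K n d r w h z)"
    by (rule verdict_cong) (use stop_time_le[of p d n "own_gains K d h" "snd (snd r)" "observe p K n d r w h z"] hist_join[OF d] in \<open>auto simp: observe_def\<close>)
  finally show ?thesis .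
qed

lemma power_assemble_ge:
  assumes d: "1 \<le> d" and n: "1 \<le> n"
    and m: "m \<le> stop_time p d n (own_gains K d h) (snd (snd r)) (observe p K n d r w h z)"
  shows "(\<Sum>i=1..m. energy (senders K d) (virtual_tx p K n d r w) i) \<le> real n * power p K n (assemble K n d w r (h, z))"
proof -
  let ?h = "join_gains K d (fst r) h" and ?z = "join_noise K n d (fst (snd r)) z"
  have "(\<Sum>i=1..m. energy (senders K d) (virtual_tx p K n d r w) i)
    = (\<Sum>i=1..m. \<Sum>j\<in>senders K d. (cmod (tx p K d w ?h ?z (snd (snd r)) i j))\<^sup>2)"
    unfolding energy_def by (intro sum.cong refl) (simp add: tx_join[OF d])
  also have "\<dots> \<le> real n * power p K n (w, ?h, ?z, snd (snd r))"
    by (rule power_ge_tx_energy[OF d n]) (use m in \<open>simp add: stop_time_observe[OF d] inc_join_gains\<close>)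
  finally show ?thesis by (simp add: assemble_def)
qed

definition verdict_region :: "protocol \<Rightarrow> nat \<Rightarrow> nat \<Rightarrow> nat \<Rightarrow> real \<Rightarrow> nat \<Rightarrow> ((nat \<Rightarrow> complex) \<times> (nat \<Rightarrow> complex)) set" where
  "verdict_region p K n d u w = {q \<in> space (PiM (senders K d) (\<lambda>_. cgauss 1) \<Otimes>\<^sub>M PiM {1..n} (\<lambda>_. borel)).
      verdict p d n (own_gains K d (fst q)) u (snd q) = w}"

section \<open>Energy and error of an admissible protocol at one destination\<close>

context
  fixes P N0 :: real and K n M d :: nat and p :: protocol
  assumes N0: "0 < N0" and d: "1 \<le> d" "d \<le> K" and adm: "admissible P N0 K n M p"
begin

abbreviation "Hd \<equiv> PiM (senders K d) (\<lambda>_. cgauss 1)"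
abbreviation "Zd \<equiv> PiM {1..n} (\<lambda>_. cgauss N0)"
abbreviation "Yd \<equiv> PiM {1..n} (\<lambda>_. borel :: complex measure)"

lemma adm_facts: "1 \<le> n" "1 \<le> M" "power p K n \<in> borel_measurable (netspace N0 K n M)"
    "{\<omega> \<in> space (netspace N0 K n M). decision p K n \<omega> d \<noteq> fst \<omega>} \<in> sets (netspace N0 K n M)"
    "(\<integral>\<^sup>+ \<omega>. ennreal (power p K n \<omega>) \<partial>netspace N0 K n M) \<le> ennreal P"
  using adm d by (auto simp: admissible_def)

lemma observe_in_space: "observe p K n d r w h z \<in> space Yd"
  by (auto simp: observe_def space_PiM)

text \<open>Admissibility provides measurability of the failure event, not of the decision
  functions. The region is recovered from that event by feeding in the noise \<open>y\<close> minus
  the received signal, for which \<open>d\<close> observes exactly \<open>y\<close>.\<close>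

lemma verdict_region_measurable:
  assumes r: "r \<in> space (restspace N0 K n d)"
  shows "verdict_region p K n d (snd (snd r)) w \<in> sets (Hd \<Otimes>\<^sub>M Yd)"
proof -
  let ?x = "virtual_tx p K n d r w"
  let ?f = "\<lambda>q. (fst q, \<lambda>k\<in>{1..n}. snd q k - recv (senders K d) ?x (fst q) k)"
  have f: "?f \<in> Hd \<Otimes>\<^sub>M Yd \<rightarrow>\<^sub>M Hd \<Otimes>\<^sub>M Zd"
    unfolding recv_def by measurable
  note am = assemble_measurable[OF N0 adm_facts(2) d r, of w]
  have "(\<lambda>q. assemble K n d w r (?f q)) \<in> Hd \<Otimes>\<^sub>M Yd \<rightarrow>\<^sub>M netspace N0 K n M"
    by (rule measurable_compose[OF f am])
  from measurable_sets[OF this adm_facts(4)]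
  have E: "(\<lambda>q. assemble K n d w r (?f q)) -` {\<omega> \<in> space (netspace N0 K n M). decision p K n \<omega> d \<noteq> fst \<omega>} \<inter> space (Hd \<Otimes>\<^sub>M Yd) \<in> sets (Hd \<Otimes>\<^sub>M Yd)" .
  have "verdict_region p K n d (snd (snd r)) w = space (Hd \<Otimes>\<^sub>M Yd) - ((\<lambda>q. assemble K n d w r (?f q)) -` {\<omega> \<in> space (netspace N0 K n M). decision p K n \<omega> d \<noteq> fst \<omega>} \<inter> space (Hd \<Otimes>\<^sub>M Yd))"
  proof -
    have "decision p K n (assemble K n d w r (?f q)) d = verdict p d n (own_gains K d (fst q)) (snd (snd r)) (snd q)"
      and "assemble K n d w r (?f q) \<in> space (netspace N0 K n M)" and "fst (assemble K n d w r (?f q)) = w"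
      if q: "q \<in> space (Hd \<Otimes>\<^sub>M Yd)" for q
    proof -
      have "observe p K n d r w (fst q) (\<lambda>k\<in>{1..n}. snd q k - recv (senders K d) ?x (fst q) k) = snd q"
        using q by (auto simp: observe_def fun_eq_iff space_pair_measure space_PiM PiE_def extensional_def)
      then show "decision p K n (assemble K n d w r (?f q)) d = verdict p d n (own_gains K d (fst q)) (snd (snd r)) (snd q)"
        using decision_assemble[OF d(1), of p K n w r "fst q" "snd (?f q)"] by simp
      show "assemble K n d w r (?f q) \<in> space (netspace N0 K n M)"
        using measurable_space[OF am measurable_space[OF f q]] .
      show "fst (assemble K n d w r (?f q)) = w" by (simp add: assemble_def)
    qed
    then show ?thesis unfolding verdict_region_def by auto
  qed
  then show ?thesis using sets.compl_sets[OF E] by simp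
qed

text \<open>For \<open>stop\<close>: by \<open>power_assemble_ge\<close>, spending less than the
  virtual energy up to slot \<open>i\<close> is possible only if \<open>d\<close> stopped before
  \<open>i\<close>, and then the verdict ignores everything from slot \<open>i\<close> on.\<close>

lemma reception_virtual:
  assumes r: "r \<in> space (restspace N0 K n d)"
  shows "reception (senders K d) n N0 (virtual_tx p K n d r w) (verdict_region p K n d (snd (snd r)) w)
    (\<lambda>q. real n * power p K n (assemble K n d w r q))"
proof
  show "(\<lambda>q. real n * power p K n (assemble K n d w r q)) \<in> borel_measurable (Hd \<Otimes>\<^sub>M Zd)"
    by (intro borel_measurable_times borel_measurable_const
      measurable_compose[OF assemble_measurable[OF N0 adm_facts(2) d r] adm_facts(3)])
  show "verdict_region p K n d (snd (snd r)) w \<in> sets (Hd \<Otimes>\<^sub>M Yd)" by (rule verdict_region_measurable[OF r])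
  fix h z y i
  assume h: "h \<in> space Hd" and i: "i \<in> {1..n}"
    and less: "real n * power p K n (assemble K n d w r (h, z)) < (\<Sum>k=1..i. energy (senders K d) (virtual_tx p K n d r w) k)"
    and v: "(h, \<lambda>k\<in>{1..n}. recv (senders K d) (virtual_tx p K n d r w) h k + z k) \<in> verdict_region p K n d (snd (snd r)) w"
    and y: "y \<in> extensional {1..n}" and eq: "\<And>k. k \<in> {1..<i} \<Longrightarrow> y k = recv (senders K d) (virtual_tx p K n d r w) h k + z k"
  have "stop_time p d n (own_gains K d h) (snd (snd r)) (observe p K n d r w h z) < i"
    using power_assemble_ge[OF d(1) adm_facts(1), of i p K h r w z] less by (meson leI not_less)
  then have "verdict p d n (own_gains K d h) (snd (snd r)) y = verdict p d n (own_gains K d h) (snd (snd r)) (observe p K n d r w h z)"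
    using i eq by (intro verdict_cong) (auto simp: observe_def)
  also have "\<dots> = w" using v by (simp add: verdict_region_def observe_def)
  finally show "(h, y) \<in> verdict_region p K n d (snd (snd r)) w"
    using h y by (auto simp: verdict_region_def space_pair_measure space_PiM PiE_def)
qed (auto simp: N0 power_nonneg)

lemma err_virtual:
  assumes r: "r \<in> space (restspace N0 K n d)"
  shows "reception.err (senders K d) n N0 (virtual_tx p K n d r w) (verdict_region p K n d (snd (snd r)) w)
    = (\<integral>\<^sup>+h. \<integral>\<^sup>+z. indicator {\<omega> \<in> space (netspace N0 K n M). decision p K n \<omega> d \<noteq> fst \<omega>} (assemble K n d w r (h, z)) \<partial>Zd \<partial>Hd)"
proof -
  interpret reception "senders K d" n N0 "virtual_tx p K n d r w" "verdict_region p K n d (snd (snd r)) w"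
    "\<lambda>q. real n * power p K n (assemble K n d w r q)" by (rule reception_virtual[OF r])
  show ?thesis unfolding err_def
  proof (intro nn_integral_cong)
    fix h z assume h: "h \<in> space Hd" and z: "z \<in> space Zd"
    have sp: "assemble K n d w r (h, z) \<in> space (netspace N0 K n M)"
      by (rule measurable_space[OF assemble_measurable[OF N0 adm_facts(2) d r]]) (use h z in \<open>simp add: space_pair_measure\<close>)
    have "(h, observe p K n d r w h z) \<in> verdict_region p K n d (snd (snd r)) w \<longleftrightarrow> decision p K n (assemble K n d w r (h, z)) d = w"
      unfolding decision_assemble[OF d(1)] verdict_region_def using h observe_in_space by (simp add: space_pair_measure)
    moreover have "fst (assemble K n d w r (h, z)) = w" by (simp add: assemble_def)
    ultimately show "indicator (- verdict_region p K n d (snd (snd r)) w) (h, \<lambda>k\<in>{1..n}. recv (senders K d) (virtual_tx p K n d r w) h k + z k)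
      = (indicator {\<omega> \<in> space (netspace N0 K n M). decision p K n \<omega> d \<noteq> fst \<omega>} (assemble K n d w r (h, z)) :: ennreal)"
      unfolding observe_def[symmetric] using sp by (auto simp: indicator_def)
  qed
qed

abbreviation "failure \<equiv> {\<omega> \<in> space (netspace N0 K n M). decision p K n \<omega> d \<noteq> fst \<omega>}"
abbreviation "rx_energy r w \<equiv> \<integral>\<^sup>+h. \<integral>\<^sup>+z. ennreal (real n * power p K n (assemble K n d w r (h, z))) \<partial>Zd \<partial>Hd"
abbreviation "rx_err r w \<equiv> \<integral>\<^sup>+h. \<integral>\<^sup>+z. indicator failure (assemble K n d w r (h, z)) \<partial>Zd \<partial>Hd"
abbreviation "rx_hit v r w \<equiv> \<integral>\<^sup>+h. \<integral>\<^sup>+y. indicator (verdict_region p K n d (snd (snd r)) w) (h, \<lambda>k\<in>{1..n}. recv (senders K d) (\<lambda>_ _. 0) h k + y k) \<partial>PiM {1..n} (\<lambda>_. cgauss v) \<partial>Hd"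

text \<open>The zero signal gives all messages the same reference law, and a pair of gains and
  output lies in the region of at most one message.\<close>

lemma rx_hit_sum:
  assumes r: "r \<in> space (restspace N0 K n d)" and v: "0 < v"
  shows "(\<Sum>w=1..M. rx_hit v r w) \<le> 1"
proof -
  let ?V = "PiM {1..n} (\<lambda>_. cgauss v)"
  interpret H: prob_space Hd by (rule prob_space_PiM_cgauss) simp
  interpret V: prob_space ?V by (rule prob_space_PiM_cgauss) (rule v)
  let ?f = "\<lambda>w q. indicator (verdict_region p K n d (snd (snd r)) w) (fst q, \<lambda>k\<in>{1..n}. recv (senders K d) (\<lambda>_ _. 0) (fst q) k + snd q k) :: ennreal"
  have sh: "(\<lambda>q. (fst q, \<lambda>k\<in>{1..n}. recv (senders K d) (\<lambda>_ _. 0) (fst q) k + snd q k)) \<in> Hd \<Otimes>\<^sub>M ?V \<rightarrow>\<^sub>M Hd \<Otimes>\<^sub>M Yd"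
    unfolding recv_def by measurable
  have m: "?f w \<in> borel_measurable (Hd \<Otimes>\<^sub>M ?V)" for w
    by (rule measurable_compose[OF sh borel_measurable_indicator[OF verdict_region_measurable[OF r]]])
  have eq: "rx_hit v r w = (\<integral>\<^sup>+q. ?f w q \<partial>(Hd \<Otimes>\<^sub>M ?V))" for w
    using V.nn_integral_fst[OF m[of w]] by (simp only: fst_conv snd_conv)
  have "(\<Sum>w=1..M. rx_hit v r w) = (\<integral>\<^sup>+q. (\<Sum>w=1..M. ?f w q) \<partial>(Hd \<Otimes>\<^sub>M ?V))"
    unfolding eq by (rule nn_integral_sum[symmetric]) (rule m)
  also have "\<dots> \<le> (\<integral>\<^sup>+q. 1 \<partial>(Hd \<Otimes>\<^sub>M ?V))"
  proof (intro nn_integral_mono)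
    fix q
    let ?q = "(fst q, \<lambda>k\<in>{1..n}. recv (senders K d) (\<lambda>_ _. 0) (fst q) k + snd q k)"
    define w0 where "w0 = verdict p d n (own_gains K d (fst ?q)) (snd (snd r)) (snd ?q)"
    have "(\<Sum>w=1..M. ?f w q) \<le> (\<Sum>w=1..M. if w = w0 then 1 else 0)"
      by (intro sum_mono) (auto simp: indicator_def verdict_region_def w0_def)
    also have "\<dots> \<le> 1" by (simp add: sum.delta)
    finally show "(\<Sum>w=1..M. ?f w q) \<le> 1" .
  qed
  also have "\<dots> = 1"
    by (simp add: V.emeasure_pair_measure_Times H.emeasure_space_1 V.emeasure_space_1 space_pair_measure del: One_nat_def)
  finally show ?thesis .
qed

lemma rest_prob_space: "prob_space (restspace N0 K n d)"
proof -
  interpret A: prob_space "PiM {p \<in> gain_idx K. snd p \<noteq> d} (\<lambda>_. cgauss 1)" by (rule prob_space_PiM_cgauss) simp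
  interpret C: prob_space "PiM {p \<in> noise_idx K n. fst p \<noteq> d} (\<lambda>_. cgauss N0)" by (rule prob_space_PiM_cgauss) (rule N0)
  interpret U: prob_space "uniform_measure lborel {0..1::real}" by (rule prob_space_uniform01)
  interpret CU: pair_prob_space "PiM {p \<in> noise_idx K n. fst p \<noteq> d} (\<lambda>_. cgauss N0)" "uniform_measure lborel {0..1::real}" ..
  interpret ACU: pair_prob_space "PiM {p \<in> gain_idx K. snd p \<noteq> d} (\<lambda>_. cgauss 1)"
    "PiM {p \<in> noise_idx K n. fst p \<noteq> d} (\<lambda>_. cgauss N0) \<Otimes>\<^sub>M uniform_measure lborel {0..1::real}" ..
  show ?thesis unfolding restspace_def by (rule ACU.prob_space_axioms)
qed

text \<open>Integration over \<open>r\<close> turns the sums over messages into \<open>M\<close>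
  times the mean energy, which is at most \<open>n * P\<close>, and \<open>M\<close> times the
  failure probability.\<close>

lemma averaged_bound:
  fixes a b c q :: real
  assumes a: "0 \<le> a" and b: "0 \<le> b" and c: "0 \<le> c" and P: "0 \<le> P"
    and pt: "\<And>r. r \<in> space (restspace N0 K n d) \<Longrightarrow>
       ennreal q \<le> ennreal a * (\<Sum>w=1..M. rx_energy r w) + (ennreal b * (\<Sum>w=1..M. rx_err r w) + ennreal c)"
  shows "q \<le> a * M * (n * P) + b * M * fail_uni N0 K n M p d + c"
proof -
  interpret R: prob_space "restspace N0 K n d" by (rule rest_prob_space)
  let ?R = "restspace N0 K n d"
  have M: "0 < real M" using adm_facts(2) by simp
  have m1: "(\<lambda>\<omega>. ennreal (real n * power p K n \<omega>)) \<in> borel_measurable (netspace N0 K n M)"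
    by (intro measurable_compose[OF _ measurable_ennreal] borel_measurable_times borel_measurable_const adm_facts(3))
  have m2: "indicator failure \<in> borel_measurable (netspace N0 K n M)"
    by (rule borel_measurable_indicator) (rule adm_facts(4))
  note g1 = nn_integral_netspace[OF N0 adm_facts(2) d m1] and g2 = nn_integral_netspace[OF N0 adm_facts(2) d m2]
  have s: "x = ennreal M * (ennreal (1 / M) * x)" for x
    using M by (simp add: mult.assoc[symmetric] ennreal_mult[symmetric])
  have i1: "(\<integral>\<^sup>+r. (\<Sum>w=1..M. rx_energy r w) \<partial>?R) \<le> ennreal (M * (n * P))"
  proof -
    have "ennreal (1 / M) * (\<integral>\<^sup>+r. (\<Sum>w=1..M. rx_energy r w) \<partial>?R) = (\<integral>\<^sup>+\<omega>. ennreal (real n * power p K n \<omega>) \<partial>netspace N0 K n M)"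
      by (rule g1(2)[symmetric])
    also have "\<dots> = ennreal n * (\<integral>\<^sup>+\<omega>. ennreal (power p K n \<omega>) \<partial>netspace N0 K n M)"
      by (simp only: nn_integral_cmult[OF measurable_compose[OF adm_facts(3) measurable_ennreal], symmetric] ennreal_mult[OF of_nat_0_le_iff power_nonneg])
    also have "\<dots> \<le> ennreal n * ennreal P" by (intro mult_left_mono adm_facts(5)) simp
    also have "\<dots> = ennreal (n * P)" using P by (simp add: ennreal_mult)
    finally have le: "ennreal (1 / M) * (\<integral>\<^sup>+r. (\<Sum>w=1..M. rx_energy r w) \<partial>?R) \<le> ennreal (n * P)" .
    have "(\<integral>\<^sup>+r. (\<Sum>w=1..M. rx_energy r w) \<partial>?R) = ennreal M * (ennreal (1 / M) * (\<integral>\<^sup>+r. (\<Sum>w=1..M. rx_energy r w) \<partial>?R))"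
      by (rule s)
    also have "\<dots> \<le> ennreal M * ennreal (n * P)" by (intro mult_left_mono le) simp
    finally show ?thesis using P by (simp add: ennreal_mult)
  qed
  have i2: "(\<integral>\<^sup>+r. (\<Sum>w=1..M. rx_err r w) \<partial>?R) \<le> ennreal (M * fail_uni N0 K n M p d)"
  proof -
    have "ennreal (1 / M) * (\<integral>\<^sup>+r. (\<Sum>w=1..M. rx_err r w) \<partial>?R) = (\<integral>\<^sup>+\<omega>. indicator failure \<omega> \<partial>netspace N0 K n M)"
      by (rule g2(2)[symmetric])
    also have "\<dots> = emeasure (netspace N0 K n M) failure" by (rule nn_integral_indicator) (rule adm_facts(4))
    also have "\<dots> = ennreal (fail_uni N0 K n M p d)"
      unfolding fail_uni_def
    proof (rule emeasure_eq_ennreal_measure)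
      have "emeasure (netspace N0 K n M) failure = ennreal (1 / M) * (\<integral>\<^sup>+r. (\<Sum>w=1..M. rx_err r w) \<partial>?R)"
        using g2(2) nn_integral_indicator[OF adm_facts(4)] by simp
      also have "\<dots> \<le> ennreal (1 / M) * (\<integral>\<^sup>+r. ennreal M \<partial>?R)"
      proof (intro mult_left_mono nn_integral_mono)
        fix r assume r: "r \<in> space ?R"
        interpret H: prob_space Hd by (rule prob_space_PiM_cgauss) simp
        interpret Z: prob_space Zd by (rule prob_space_PiM_cgauss) (rule N0)
        have "(\<Sum>w=1..M. rx_err r w) \<le> (\<Sum>w=1..M. \<integral>\<^sup>+h. \<integral>\<^sup>+z. 1 \<partial>Zd \<partial>Hd)"
          by (intro sum_mono nn_integral_mono) (auto simp: indicator_def)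
        also have "\<dots> = ennreal M"
          by (simp add: H.emeasure_space_1 Z.emeasure_space_1 ennreal_of_nat_eq_real_of_nat del: One_nat_def)
        finally show "(\<Sum>w=1..M. rx_err r w) \<le> ennreal M" .
      qed simp
      also have "\<dots> < \<top>" by (simp add: R.emeasure_space_1 ennreal_mult_less_top)
      finally show "emeasure (netspace N0 K n M) failure \<noteq> \<top>" by simp
    qed
    finally have le: "ennreal (1 / M) * (\<integral>\<^sup>+r. (\<Sum>w=1..M. rx_err r w) \<partial>?R) = ennreal (fail_uni N0 K n M p d)" .
    have "(\<integral>\<^sup>+r. (\<Sum>w=1..M. rx_err r w) \<partial>?R) = ennreal M * (ennreal (1 / M) * (\<integral>\<^sup>+r. (\<Sum>w=1..M. rx_err r w) \<partial>?R))"
      by (rule s)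
    also have "\<dots> = ennreal (M * fail_uni N0 K n M p d)" unfolding le by (simp add: ennreal_mult fail_uni_def)
    finally show ?thesis by simp
  qed
  have "ennreal q = (\<integral>\<^sup>+r. ennreal q \<partial>?R)" by (simp add: R.emeasure_space_1)
  also have "\<dots> \<le> (\<integral>\<^sup>+r. ennreal a * (\<Sum>w=1..M. rx_energy r w) + (ennreal b * (\<Sum>w=1..M. rx_err r w) + ennreal c) \<partial>?R)"
    by (intro nn_integral_mono pt)
  also have "\<dots> = ennreal a * (\<integral>\<^sup>+r. (\<Sum>w=1..M. rx_energy r w) \<partial>?R) + (ennreal b * (\<integral>\<^sup>+r. (\<Sum>w=1..M. rx_err r w) \<partial>?R) + ennreal c)"
  proof -
    note t1 = borel_measurable_times_ennreal[OF borel_measurable_const[of "ennreal a"] g1(1)]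
      and t2 = borel_measurable_times_ennreal[OF borel_measurable_const[of "ennreal b"] g2(1)]
    show ?thesis
      by (simp only: nn_integral_add[OF t1 borel_measurable_add[OF t2 borel_measurable_const]] nn_integral_add[OF t2 borel_measurable_const]
        nn_integral_cmult[OF g1(1)] nn_integral_cmult[OF g2(1)] nn_integral_const R.emeasure_space_1 mult_1_right)
  qed
  also have "\<dots> \<le> ennreal a * ennreal (M * (n * P)) + (ennreal b * ennreal (M * fail_uni N0 K n M p d) + ennreal c)"
    by (intro add_mono mult_left_mono i1 i2) auto
  also have "\<dots> = ennreal (a * (M * (n * P)) + (b * (M * fail_uni N0 K n M p d) + c))"
    using a b c P by (simp add: ennreal_mult ennreal_plus fail_uni_def)
  finally show ?thesis using a b c P by (subst (asm) ennreal_le_iff) (auto simp: fail_uni_def mult.assoc add.assoc)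
qed

text \<open>The energy bounds of all messages are added for fixed \<open>r\<close>. Since the
  reference probabilities sum to at most 1, their mean over the messages is at most
  \<open>1 / M\<close>; this is where the number of messages enters.\<close>

lemma converse_energy:
  fixes v l L \<kappa> g :: real
  assumes P: "0 < P" and v: "v = N0 + P" and l: "0 < l" "l \<le> 1" and L: "0 < L" and \<kappa>: "0 < \<kappa>" "\<kappa> < 1"
    and A0: "A0 = v * (L - n * kl N0 v)" "0 \<le> A0"
  shows "(1 - \<kappa>) * A0 \<le> n * P + (1 - \<kappa>) * A0 / \<kappa> * (fail_uni N0 K n M p d + exp g / M + exp (- l * g + l * (n * l + (1 + l) * L)))"
proof -
  define Q where "Q = (1 - \<kappa>) * A0"
  define bad where "bad = exp (- l * g + l * (n * l + (1 + l) * L))"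
  have Q: "0 \<le> Q" using \<kappa> A0 by (simp add: Q_def)
  have M: "0 < real M" using adm_facts(2) by simp
  have v0: "N0 \<le> v" "0 < v" using N0 P v by auto
  have "Q \<le> (1 / M) * M * (n * P) + (Q / \<kappa> / M) * M * fail_uni N0 K n M p d + Q / \<kappa> * (exp g / M + bad)"
  proof (rule averaged_bound)
    fix r assume r: "r \<in> space (restspace N0 K n d)"
    have w: "ennreal Q \<le> rx_energy r w + ennreal (Q / \<kappa>) * (rx_err r w + ennreal (exp g) * rx_hit v r w + ennreal bad)" for w
    proof -
      interpret reception "senders K d" n N0 "virtual_tx p K n d r w" "verdict_region p K n d (snd (snd r)) w"
        "\<lambda>q. real n * power p K n (assemble K n d w r q)" by (rule reception_virtual[OF r])
      show ?thesis
        using energy_bound[OF v0(1) l L \<kappa> A0, of g] unfolding err_virtual[OF r] hit_def Q_def bad_def .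
    qed
    have "ennreal M * ennreal Q = (\<Sum>w=1..M. ennreal Q)" by (simp add: ennreal_of_nat_eq_real_of_nat)
    also have "\<dots> \<le> (\<Sum>w=1..M. rx_energy r w + ennreal (Q / \<kappa>) * (rx_err r w + ennreal (exp g) * rx_hit v r w + ennreal bad))"
      by (intro sum_mono w)
    also have "\<dots> = (\<Sum>w=1..M. rx_energy r w) + ennreal (Q / \<kappa>) * ((\<Sum>w=1..M. rx_err r w) + ennreal (exp g) * (\<Sum>w=1..M. rx_hit v r w) + ennreal M * ennreal bad)"
      by (simp add: sum.distrib sum_distrib_left distrib_left ennreal_of_nat_eq_real_of_nat mult_ac)
    also have "\<dots> \<le> (\<Sum>w=1..M. rx_energy r w) + ennreal (Q / \<kappa>) * ((\<Sum>w=1..M. rx_err r w) + ennreal (exp g) * 1 + ennreal M * ennreal bad)"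
      by (intro add_mono mult_left_mono rx_hit_sum[OF r v0(2)]) auto
    finally have le: "ennreal M * ennreal Q \<le> (\<Sum>w=1..M. rx_energy r w) + ennreal (Q / \<kappa>) * ((\<Sum>w=1..M. rx_err r w) + ennreal (exp g) * 1 + ennreal M * ennreal bad)" .
    have MM: "ennreal (1 / M) * ennreal M = 1" using M by (simp add: ennreal_mult[symmetric])
    have "ennreal Q = ennreal (1 / M) * (ennreal M * ennreal Q)" unfolding mult.assoc[symmetric] MM by simp
    also have "\<dots> \<le> ennreal (1 / M) * ((\<Sum>w=1..M. rx_energy r w) + ennreal (Q / \<kappa>) * ((\<Sum>w=1..M. rx_err r w) + ennreal (exp g) * 1 + ennreal M * ennreal bad))"
      by (intro mult_left_mono le) simp
    also have "\<dots> = ennreal (1 / M) * (\<Sum>w=1..M. rx_energy r w)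
      + ((ennreal (1 / M) * ennreal (Q / \<kappa>)) * (\<Sum>w=1..M. rx_err r w) + (ennreal (Q / \<kappa>) * (ennreal (1 / M) * ennreal (exp g)) + ennreal (Q / \<kappa>) * ((ennreal (1 / M) * ennreal M) * ennreal bad)))"
      by (simp only: distrib_left mult_1_right mult_1_left mult_ac add_ac)
    also have "ennreal (1 / M) * ennreal (Q / \<kappa>) = ennreal (Q / \<kappa> / M)"
      using Q \<kappa> M by (subst ennreal_mult[symmetric]) auto
    also have "ennreal (Q / \<kappa>) * (ennreal (1 / M) * ennreal (exp g)) + ennreal (Q / \<kappa>) * ((ennreal (1 / M) * ennreal M) * ennreal bad) = ennreal (Q / \<kappa> * (exp g / M + bad))"
      unfolding MM using Q \<kappa> M by (simp add: ennreal_mult[symmetric] ennreal_plus[symmetric] distrib_left bad_def del: ennreal_plus)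
    finally show "ennreal Q \<le> ennreal (1 / M) * (\<Sum>w=1..M. rx_energy r w) + (ennreal (Q / \<kappa> / M) * (\<Sum>w=1..M. rx_err r w) + ennreal (Q / \<kappa> * (exp g / M + bad)))" .
  qed (use Q \<kappa> M P in \<open>auto simp: bad_def\<close>)
  then have "Q \<le> n * P + Q / \<kappa> * (fail_uni N0 K n M p d + exp g / M + bad)"
    using M by (simp add: distrib_left add.assoc)
  then show ?thesis unfolding Q_def bad_def .
qed

text \<open>Confusion of the messages 1 and 2 provides 1 / 2 whenever the total energy of all
  messages is at most \<open>E\<close>. The choice \<open>E = 4 * n * P * M\<close> makes Markov's
  inequality for this total lose 1 / 8, which leaves 3 / 8. The factor of the failure probability is
  finite for each \<open>n\<close> and \<open>M\<close>, which is enough for bounded blocks.\<close>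

lemma converse_short:
  assumes P: "0 < P" and M2: "2 \<le> M"
  shows "3 / 8 \<le> M * exp (confusion_exp n (4 * n * P * M) N0) * fail_uni N0 K n M p d"
proof -
  define E where "E = 4 * n * P * M"
  define c where "c = exp (confusion_exp n E N0)"
  have n: "0 < real n" "0 < real M" using adm_facts by auto
  have E: "0 < E" using n P by (simp add: E_def)
  have c: "0 < c" by (simp add: c_def)
  have "1 / 2 \<le> (1 / (2 * E)) * M * (n * P) + c * M * fail_uni N0 K n M p d + 0"
  proof (rule averaged_bound)
    fix r assume r: "r \<in> space (restspace N0 K n d)"
    let ?G = "\<Sum>w=1..M. rx_energy r w"
    show "ennreal (1 / 2) \<le> ennreal (1 / (2 * E)) * ?G + (ennreal c * (\<Sum>w=1..M. rx_err r w) + ennreal 0)"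
    proof (cases "?G \<le> ennreal E")
      case True
      have En: "rx_energy r w \<le> ennreal E" if "w \<in> {1..M}" for w
        by (rule order_trans[OF member_le_sum[OF that] True]) auto
      have "ennreal (1 / 2) \<le> ennreal c * (rx_err r 1 + rx_err r 2)"
        unfolding c_def err_virtual[OF r, symmetric]
      proof (rule confusion_bound_pair[OF reception_virtual[OF r] reception_virtual[OF r] _ E])
        show "verdict_region p K n d (snd (snd r)) 1 \<inter> verdict_region p K n d (snd (snd r)) 2 = {}"
          by (auto simp: verdict_region_def)
      qed (use En M2 in auto)
      also have "rx_err r 1 + rx_err r 2 = (\<Sum>w\<in>{1,2}. rx_err r w)" by simp
      also have "ennreal c * \<dots> \<le> ennreal c * (\<Sum>w=1..M. rx_err r w)"
        using M2 by (intro mult_left_mono sum_mono2) auto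
      finally show ?thesis by (simp add: add_increasing)
    next
      case False
      have "ennreal (1 / 2) = ennreal (1 / (2 * E)) * ennreal E"
        using E by (subst ennreal_mult[symmetric]) auto
      also have "\<dots> \<le> ennreal (1 / (2 * E)) * ?G" using False by (intro mult_left_mono) auto
      finally show ?thesis by (simp add: add_increasing2)
    qed
  qed (use E c P in auto)
  moreover have "(1 / (2 * E)) * M * (n * P) = 1 / 8" using n P by (simp add: E_def field_simps)
  ultimately show ?thesis by (simp add: E_def c_def mult_ac)
qed

end

section \<open>Converse\<close>

lemma num_msgs_ge: "2 powr (real n * R) \<le> real (num_msgs n R)"
  unfolding num_msgs_def by linarith

lemma num_msgs_ge_2:
  assumes "0 < R" "1 \<le> n" shows "2 \<le> num_msgs n R"
proof -
  have "0 < real n * R" using assms by simp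
  then have "1 < 2 powr (real n * R)" by simp
  then show ?thesis unfolding num_msgs_def by linarith
qed

lemma confusion_exp_mono:
  fixes N0 P :: real and n n' M M' :: nat
  assumes "0 < N0" "0 < P" "n \<le> n'" "M \<le> M'"
  shows "confusion_exp n (4 * n * P * M) N0 \<le> confusion_exp n' (4 * n' * P * M') N0"
proof -
  have "real n * (4 * real n * P * real M) \<le> real n' * (4 * real n' * P * real M')"
    using assms by (intro mult_mono) auto
  then have "2 * (128 * real n * (4 * real n * P * real M) + 1) / N0 \<le> 2 * (128 * real n' * (4 * real n' * P * real M') + 1) / N0"
    using assms by (intro divide_right_mono mult_left_mono add_right_mono) (auto simp: mult.assoc)
  then show ?thesis using assms unfolding confusion_exp_def by simp
qed

text \<open>Below any fixed block length the failure probability is bounded away from 0, so the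
  block lengths of a reliable sequence tend to infinity. Then all error terms of
  \<open>converse_energy\<close> vanish, and \<open>q s \<le> P\<close> remains, against the choice
  of \<open>s\<close>.\<close>

lemma achievable_uni_le:
  assumes P: "0 < P" and N0: "0 < N0" and d: "\<forall>K\<ge>1. 1 \<le> d K \<and> d K \<le> K"
    and ach: "achievable_uni P N0 d R"
  shows "R \<le> log 2 (1 + P / N0)"
proof (rule ccontr)
  assume "\<not> R \<le> log 2 (1 + P / N0)"
  then have RC: "log 2 (1 + P / N0) < R" by simp
  have "1 < 1 + P / N0" using P N0 by simp
  then have "0 < log 2 (1 + P / N0)" by simp
  then have R: "0 < R" using RC by simp
  obtain \<pi> nK where adm: "\<And>K. 1 \<le> K \<Longrightarrow> admissible P N0 K (nK K) (num_msgs (nK K) R) (\<pi> K)"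
    and lim: "(\<lambda>K. fail_uni N0 K (nK K) (num_msgs (nK K) R) (\<pi> K) (d K)) \<longlonglongrightarrow> 0"
    using ach by (auto simp: achievable_uni_def)
  define f where "f K = fail_uni N0 K (nK K) (num_msgs (nK K) R) (\<pi> K) (d K)" for K
  have flim: "f \<longlonglongrightarrow> 0" using lim by (simp add: f_def[abs_def])
  have n1: "1 \<le> nK K" if "1 \<le> K" for K using adm[OF that] by (simp add: admissible_def)
  have inf: "filterlim nK at_top sequentially"
    unfolding filterlim_at_top
  proof
    fix B
    define Mx where "Mx = num_msgs B R"
    define cc where "cc = Mx * exp (confusion_exp B (4 * B * P * Mx) N0) + 1"
    have cc: "0 < cc" by (simp add: cc_def add_nonneg_pos)
    have "\<forall>\<^sub>F K in sequentially. f K < 3 / 8 / cc"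
      using flim cc by (intro order_tendstoD) auto
    then show "\<forall>\<^sub>F K in sequentially. B \<le> nK K"
      using eventually_ge_at_top[of 1]
    proof eventually_elim
      case (elim K)
      show ?case
      proof (rule ccontr)
        assume "\<not> B \<le> nK K"
        then have nB: "nK K \<le> B" by simp
        let ?M = "num_msgs (nK K) R"
        have "2 powr (real (nK K) * R) \<le> 2 powr (real B * R)" using nB R by (intro powr_mono mult_right_mono) auto
        then have MM: "?M \<le> Mx" unfolding Mx_def num_msgs_def by (intro nat_mono ceiling_mono)
        have "3 / 8 \<le> ?M * exp (confusion_exp (nK K) (4 * nK K * P * ?M) N0) * f K"
          unfolding f_def
          by (rule converse_short[OF N0 _ _ adm P num_msgs_ge_2[OF R n1]]) (use d elim in auto)
        also have "\<dots> \<le> (Mx * exp (confusion_exp B (4 * B * P * Mx) N0)) * f K"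
          using confusion_exp_mono[OF N0 P nB MM] MM
          by (intro mult_right_mono mult_mono) (auto simp: f_def fail_uni_def)
        also have "\<dots> \<le> cc * f K" unfolding cc_def by (intro mult_right_mono) (auto simp: f_def fail_uni_def)
        finally have "3 / 8 / cc \<le> f K" using cc by (simp add: field_simps)
        then show False using elim by simp
      qed
    qed
  qed
  \<comment> \<open>The output variance at full power. It gives
    \<open>v * (ln (1 + P / N0) - kl N0 v) = P\<close>, so that a rate above capacity leaves the
    strict gap \<open>gt\<close>.\<close>
  define v where "v = N0 + P"
  define \<rho> where "\<rho> = R * ln 2"
  have v: "0 < v" "N0 \<le> v" using P N0 by (auto simp: v_def)
  have vN: "v / N0 = 1 + P / N0" "1 - N0 / v = P / v" using N0 v by (auto simp: v_def field_simps)
  have rho: "ln (1 + P / N0) < \<rho>" using RC by (simp add: \<rho>_def log_def divide_less_eq)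
  have kl0: "0 \<le> kl N0 v" by (rule kl_nonneg[OF N0 v(2)])
  have gt: "P < v * (\<rho> - kl N0 v)"
  proof -
    have "v * (\<rho> - kl N0 v) > v * (ln (1 + P / N0) - kl N0 v)" using rho v by (intro mult_strict_left_mono) auto
    also have "v * (ln (1 + P / N0) - kl N0 v) = P" unfolding kl_def vN using v by simp
    finally show ?thesis by simp
  qed
  \<comment> \<open>The resulting lower bound on energy per slot. A single slack \<open>s\<close>
    serves as \<open>l\<close>, as \<kappa> and in the rate: \<open>g = n * (\<rho> - s)\<close> and
    \<open>L = n * lam\<close>. For \<open>s = 0\<close> the value is
    \<open>v * (\<rho> - kl N0 v)\<close>, which exceeds \<open>P\<close>.\<close>
  define q where "q s = (1 - s) * (v * ((\<rho> - 3 * s) / (1 + s) - kl N0 v))" for s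
  have "(q \<longlongrightarrow> (1 - 0) * (v * ((\<rho> - 3 * 0) / (1 + 0) - kl N0 v))) (at_right 0)"
    unfolding q_def by (intro tendsto_intros) auto
  then have "\<forall>\<^sub>F s in at_right 0. P < q s" using gt by (intro order_tendstoD) auto
  moreover have "\<forall>\<^sub>F s in at_right (0::real). 0 < s" by (rule eventually_at_right_less)
  moreover have "\<forall>\<^sub>F s in at_right (0::real). s < 1" by (rule eventually_at_right_real[of 0 1, THEN eventually_mono]) auto
  ultimately have "\<forall>\<^sub>F s in at_right (0::real). P < q s \<and> 0 < s \<and> s < 1" by eventually_elim auto
  then obtain s where s: "P < q s" "0 < s" "s < 1"
    by (auto dest!: eventually_happens'[OF trivial_limit_at_right_real[of 0]])
  define lam where "lam = (\<rho> - 3 * s) / (1 + s)"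
  have qs: "q s = (1 - s) * (v * (lam - kl N0 v))" by (simp add: q_def lam_def)
  have lk: "0 < lam - kl N0 v"
  proof -
    have "0 < (1 - s) * (v * (lam - kl N0 v))" using s P by (simp add: qs)
    then show ?thesis using s v by (simp add: zero_less_mult_iff)
  qed
  have l0: "0 < lam" using lk kl0 by simp
  have main: "q s \<le> P + q s / s * (f K + exp (- s * nK K) + exp (- s * s * nK K))" if K: "1 \<le> K" for K
  proof -
    let ?n = "nK K" let ?M = "num_msgs (nK K) R"
    have n: "1 \<le> ?n" by (rule n1[OF K])
    have M: "exp (?n * \<rho>) \<le> ?M" using num_msgs_ge[of ?n R] by (simp add: powr_def \<rho>_def mult_ac)
    then have M0: "0 < real ?M" by (meson exp_gt_zero less_le_trans)
    \<comment> \<open>Of the \<open>3 * s\<close> subtracted in \<open>lam\<close>, one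
      \<open>s\<close> pays for the slack in \<open>g\<close>, one for the error
      \<open>n * l\<close>, and the third remains as decay.\<close>
    have bad: "- s * (?n * (\<rho> - s)) + s * (?n * s + (1 + s) * (?n * lam)) = - s * s * ?n"
    proof -
      have e: "(1 + s) * (?n * lam) = ?n * (\<rho> - 3 * s)" using s by (simp add: lam_def)
      show ?thesis unfolding e by (simp add: algebra_simps)
    qed
    have "exp (?n * (\<rho> - s)) / ?M \<le> exp (?n * (\<rho> - s)) / exp (?n * \<rho>)"
      using M M0 by (intro divide_left_mono mult_pos_pos) auto
    also have "\<dots> = exp (- s * ?n)" by (simp add: exp_diff[symmetric] algebra_simps)
    finally have gM: "exp (?n * (\<rho> - s)) / ?M \<le> exp (- s * ?n)" .
    have A0: "v * (?n * lam - ?n * kl N0 v) = ?n * (v * (lam - kl N0 v))" by (simp add: algebra_simps)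
    have "(1 - s) * (v * (?n * lam - ?n * kl N0 v)) \<le> ?n * P + (1 - s) * (v * (?n * lam - ?n * kl N0 v)) / s *
       (fail_uni N0 K ?n ?M (\<pi> K) (d K) + exp (?n * (\<rho> - s)) / ?M + exp (- s * (?n * (\<rho> - s)) + s * (?n * s + (1 + s) * (?n * lam))))"
      by (rule converse_energy[OF N0 _ _ adm[OF K] P v_def]) (use d K s l0 n lk v A0 in auto)
    then have "?n * q s \<le> ?n * P + ?n * q s / s * (f K + exp (?n * (\<rho> - s)) / ?M + exp (- s * s * ?n))"
      unfolding bad A0 qs f_def by (simp add: mult_ac)
    also have "\<dots> \<le> ?n * P + ?n * q s / s * (f K + exp (- s * ?n) + exp (- s * s * ?n))"
      using gM s P by (intro add_left_mono mult_left_mono add_right_mono) auto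
    also have "\<dots> = ?n * (P + q s / s * (f K + exp (- s * ?n) + exp (- s * s * ?n)))" by (simp add: algebra_simps)
    finally show ?thesis using n by simp
  qed
  have e: "(\<lambda>K. exp (- c * real (nK K))) \<longlonglongrightarrow> 0" if "0 < c" for c :: real
  proof -
    have "((\<lambda>x::nat. exp (- c * real x)) \<longlongrightarrow> 0) at_top" using that by real_asymp
    from filterlim_compose[OF this inf] show ?thesis .
  qed
  have e1: "(\<lambda>K. exp (- s * real (nK K))) \<longlonglongrightarrow> 0" and e2: "(\<lambda>K. exp (- s * s * real (nK K))) \<longlonglongrightarrow> 0"
    using e[of s] e[of "s * s"] s by auto
  have "(\<lambda>K. P + q s / s * (f K + exp (- s * nK K) + exp (- s * s * nK K))) \<longlonglongrightarrow> P + q s / s * (0 + 0 + 0)"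
    by (intro tendsto_intros flim e1 e2)
  moreover have "\<forall>\<^sub>F K in sequentially. q s \<le> P + q s / s * (f K + exp (- s * nK K) + exp (- s * s * nK K))"
    using eventually_ge_at_top[of 1] by eventually_elim (rule main)
  ultimately have "q s \<le> P + q s / s * (0 + 0 + 0)" by (intro tendsto_lowerbound) auto
  then show False using s by simp
qed

section \<open>Random Gaussian codebooks\<close>

text \<open>The combination with coefficients \<open>a\<close> is again a circular Gaussian
  variable, of variance \<open>\<Sum>j\<in>J. (cmod (a j))\<^sup>2\<close>. Integrating out one
  coordinate preserves the form of the integrand and replaces \<open>l\<close> by
  \<open>l / D\<close>.\<close>

lemma nn_integral_PiM_cgauss_exp_dist:
  assumes J: "finite J" and l: "0 \<le> l"
  shows "(\<integral>\<^sup>+c. ennreal (exp (- l * (cmod (y - (\<Sum>j\<in>J. a j * c j)))\<^sup>2)) \<partial>PiM J (\<lambda>_. cgauss 1))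
    = ennreal (1 / (1 + l * (\<Sum>j\<in>J. (cmod (a j))\<^sup>2)) * exp (- l * (cmod y)\<^sup>2 / (1 + l * (\<Sum>j\<in>J. (cmod (a j))\<^sup>2))))"
  using J l
proof (induction J arbitrary: l)
  case empty
  then show ?case by (simp add: PiM_empty nn_integral_count_space_finite)
next
  case (insert j0 J)
  interpret P: product_sigma_finite "\<lambda>_. cgauss 1" by (rule product_sigma_finite_cgauss) simp
  define D where "D = 1 + l * (cmod (a j0))\<^sup>2"
  define l' where "l' = l / D"
  define \<alpha> where "\<alpha> = (\<Sum>j\<in>J. (cmod (a j))\<^sup>2)"
  have D: "1 \<le> D" using insert.prems by (simp add: D_def)
  have \<alpha>: "0 \<le> \<alpha>" by (simp add: \<alpha>_def sum_nonneg)
  have l': "0 \<le> l'" using insert.prems D by (simp add: l'_def)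
  have inner: "(\<integral>\<^sup>+c. ennreal (exp (- l * (cmod (Y - a j0 * c))\<^sup>2)) \<partial>cgauss 1) = ennreal (1 / D * exp (- l' * (cmod Y)\<^sup>2))" for Y
  proof -
    have e: "- l * (cmod (Y - a j0 * c))\<^sup>2 = (- l * (cmod (a j0))\<^sup>2) * (cmod c)\<^sup>2 + 2 * Re (cnj (of_real l * Y * cnj (a j0)) * c) + (- l * (cmod Y)\<^sup>2)" for c
    proof -
      have e: "(cmod (Y - a j0 * c))\<^sup>2 = (cmod Y)\<^sup>2 + 2 * Re (cnj Y * - (a j0 * c)) + (cmod (a j0 * c))\<^sup>2"
        using cmod_add_sq[of Y "- (a j0 * c)"] by simp
      show ?thesis unfolding e by (simp add: norm_mult power_mult_distrib algebra_simps)
    qed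
    have k: "(- l * (cmod (a j0))\<^sup>2) * 1 < 1" using D by (simp add: D_def)
    have b: "(cmod (of_real l * Y * cnj (a j0)))\<^sup>2 = l * (D - 1) * (cmod Y)\<^sup>2"
      by (simp add: norm_mult power_mult_distrib D_def power2_eq_square)
    have x: "l * (D - 1) * (cmod Y)\<^sup>2 / D + - l * (cmod Y)\<^sup>2 = - l' * (cmod Y)\<^sup>2"
      using D by (simp add: l'_def field_simps)
    have D': "1 - - l * (cmod (a j0))\<^sup>2 * 1 = D" by (simp add: D_def)
    show ?thesis unfolding e nn_integral_cgauss_exp_linear[OF zero_less_one k] D' b mult_1_left x ..
  qed
  have "(\<integral>\<^sup>+c. ennreal (exp (- l * (cmod (y - (\<Sum>j\<in>insert j0 J. a j * c j)))\<^sup>2)) \<partial>PiM (insert j0 J) (\<lambda>_. cgauss 1))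
     = (\<integral>\<^sup>+x. \<integral>\<^sup>+c. ennreal (exp (- l * (cmod (y - (\<Sum>j\<in>insert j0 J. a j * (x(j0 := c)) j)))\<^sup>2)) \<partial>cgauss 1 \<partial>PiM J (\<lambda>_. cgauss 1))"
    by (rule P.product_nn_integral_insert) (use insert.hyps in measurable)
  also have "\<dots> = (\<integral>\<^sup>+x. \<integral>\<^sup>+c. ennreal (exp (- l * (cmod ((y - (\<Sum>j\<in>J. a j * x j)) - a j0 * c))\<^sup>2)) \<partial>cgauss 1 \<partial>PiM J (\<lambda>_. cgauss 1))"
  proof (intro nn_integral_cong)
    fix x c
    have "(\<Sum>j\<in>J. a j * (x(j0 := c)) j) = (\<Sum>j\<in>J. a j * x j)" using insert.hyps by (intro sum.cong) auto
    then show "ennreal (exp (- l * (cmod (y - (\<Sum>j\<in>insert j0 J. a j * (x(j0 := c)) j)))\<^sup>2)) = ennreal (exp (- l * (cmod ((y - (\<Sum>j\<in>J. a j * x j)) - a j0 * c))\<^sup>2))"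
      using insert.hyps by (simp add: algebra_simps)
  qed
  also have "\<dots> = (\<integral>\<^sup>+x. ennreal (1 / D) * ennreal (exp (- l' * (cmod (y - (\<Sum>j\<in>J. a j * x j)))\<^sup>2)) \<partial>PiM J (\<lambda>_. cgauss 1))"
    unfolding inner by (intro nn_integral_cong) (use D in \<open>auto simp: ennreal_mult[symmetric]\<close>)
  also have "\<dots> = ennreal (1 / D) * ennreal (1 / (1 + l' * \<alpha>) * exp (- l' * (cmod y)\<^sup>2 / (1 + l' * \<alpha>)))"
    unfolding \<alpha>_def by (subst nn_integral_cmult) (measurable, simp only: insert.IH[OF l'])
  also have "\<dots> = ennreal (1 / D * (1 / (1 + l' * \<alpha>) * exp (- l' * (cmod y)\<^sup>2 / (1 + l' * \<alpha>))))"
    using D l' \<alpha> by (subst ennreal_mult) (auto intro!: mult_nonneg_nonneg)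
  also have "\<dots> = ennreal (1 / (1 + l * ((cmod (a j0))\<^sup>2 + \<alpha>)) * exp (- l * (cmod y)\<^sup>2 / (1 + l * ((cmod (a j0))\<^sup>2 + \<alpha>))))"
  proof -
    have "D * (1 + l' * \<alpha>) = D + l * \<alpha>" using D by (simp add: l'_def distrib_left)
    then have e: "D * (1 + l' * \<alpha>) = 1 + l * ((cmod (a j0))\<^sup>2 + \<alpha>)" by (simp add: D_def distrib_left)
    have e2: "l' / (1 + l' * \<alpha>) = l / (1 + l * ((cmod (a j0))\<^sup>2 + \<alpha>))" unfolding e[symmetric] l'_def using D by simp
    have "- l' * (cmod y)\<^sup>2 / (1 + l' * \<alpha>) = - (l' / (1 + l' * \<alpha>)) * (cmod y)\<^sup>2" by simp
    also have "\<dots> = - l * (cmod y)\<^sup>2 / (1 + l * ((cmod (a j0))\<^sup>2 + \<alpha>))" unfolding e2 by simp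
    finally have e3: "- l' * (cmod y)\<^sup>2 / (1 + l' * \<alpha>) = - l * (cmod y)\<^sup>2 / (1 + l * ((cmod (a j0))\<^sup>2 + \<alpha>))" .
    have e4: "1 / D * (1 / (1 + l' * \<alpha>) * X) = 1 / (1 + l * ((cmod (a j0))\<^sup>2 + \<alpha>)) * X" for X
      unfolding e[symmetric] by simp
    show ?thesis unfolding e3 e4 ..
  qed
  finally show ?case using insert.hyps by (simp add: \<alpha>_def)
qed

text \<open>One independent unit-variance symbol per slot and sender. Amplitudes are kept with the
  gains in the vector \<open>a\<close>, so the same analysis covers the source alone and every
  coalition of relays.\<close>

definition codeword_space :: "'i set \<Rightarrow> 'j set \<Rightarrow> ('i \<Rightarrow> 'j \<Rightarrow> complex) measure" where
  "codeword_space I J = PiM I (\<lambda>_. PiM J (\<lambda>_. cgauss 1))"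

definition codebook_space :: "nat \<Rightarrow> 'i set \<Rightarrow> 'j set \<Rightarrow> (nat \<Rightarrow> 'i \<Rightarrow> 'j \<Rightarrow> complex) measure" where
  "codebook_space M I J = PiM {1..M} (\<lambda>_. codeword_space I J)"

lemma prob_space_codeword_space: "prob_space (codeword_space I J)"
  unfolding codeword_space_def by (intro prob_space_PiM prob_space_PiM_cgauss) simp

lemma prob_space_codebook_space: "prob_space (codebook_space M I J)"
  unfolding codebook_space_def by (intro prob_space_PiM prob_space_codeword_space)

lemma nn_integral_codebook_component:
  assumes w: "w \<in> {1..M}" and f: "f \<in> borel_measurable (codeword_space I J)"
  shows "(\<integral>\<^sup>+cb. f (cb w) \<partial>codebook_space M I J) = (\<integral>\<^sup>+c. f c \<partial>codeword_space I J)"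
proof -
  have "codeword_space I J = distr (codebook_space M I J) (codeword_space I J) (\<lambda>cb. cb w)"
    unfolding codebook_space_def using w by (intro distr_PiM_component[symmetric] prob_space_codeword_space)
  then have "(\<integral>\<^sup>+c. f c \<partial>codeword_space I J) = (\<integral>\<^sup>+c. f c \<partial>distr (codebook_space M I J) (codeword_space I J) (\<lambda>cb. cb w))" by simp
  also have "\<dots> = (\<integral>\<^sup>+cb. f (cb w) \<partial>codebook_space M I J)"
    using w f unfolding codebook_space_def by (subst nn_integral_distr) auto
  finally show ?thesis ..
qed

lemma nn_integral_codeword_prod:
  assumes I: "finite I" and f: "\<And>i. i \<in> I \<Longrightarrow> f i \<in> borel_measurable (PiM J (\<lambda>_. cgauss 1))"
  shows "(\<integral>\<^sup>+c. (\<Prod>i\<in>I. f i (c i)) \<partial>codeword_space I J) = (\<Prod>i\<in>I. \<integral>\<^sup>+x. f i x \<partial>PiM J (\<lambda>_. cgauss 1))"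
proof -
  interpret P: product_sigma_finite "\<lambda>_. PiM J (\<lambda>_. cgauss 1)"
    by (simp add: product_sigma_finite_def prob_space_imp_sigma_finite[OF prob_space_PiM_cgauss])
  show ?thesis unfolding codeword_space_def by (rule P.product_nn_integral_prod[OF I f])
qed

section \<open>Exponential bounds for the distance test\<close>

lemma sum_le_exp_markov:
  fixes f :: "'i \<Rightarrow> real"
  assumes "finite I" "(\<Sum>i\<in>I. f i) \<le> real (card I) * b" "0 \<le> l"
  shows "(1::ennreal) \<le> (\<Prod>i\<in>I. ennreal (exp (l * b)) * ennreal (exp (- l * f i)))"
proof -
  have "(\<Prod>i\<in>I. ennreal (exp (l * b)) * ennreal (exp (- l * f i))) = ennreal (\<Prod>i\<in>I. exp (l * b - l * f i))"
    using assms(1) by (subst prod_ennreal[symmetric]) (auto simp: ennreal_mult[symmetric] exp_add[symmetric] intro!: prod.cong)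
  also have "(\<Prod>i\<in>I. exp (l * b - l * f i)) = exp (l * (card I * b - (\<Sum>i\<in>I. f i)))"
    using assms(1) by (simp add: exp_sum[symmetric] sum_subtractf sum_distrib_left algebra_simps)
  finally have eq: "(\<Prod>i\<in>I. ennreal (exp (l * b)) * ennreal (exp (- l * f i))) = ennreal (exp (l * (card I * b - (\<Sum>i\<in>I. f i))))" .
  have "0 \<le> l * (card I * b - (\<Sum>i\<in>I. f i))" using assms by (intro mult_nonneg_nonneg) auto
  then show ?thesis unfolding eq by (simp add: one_le_exp_iff)
qed

lemma noise_large_bound:
  assumes I: "finite I" and N0: "0 < N0" and t: "0 < t" "t * N0 < 1"
  shows "(\<integral>\<^sup>+z. indicator {z. real (card I) * b < (\<Sum>i\<in>I. (cmod (z i))\<^sup>2)} z \<partial>PiM I (\<lambda>_. cgauss N0))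
    \<le> ennreal (exp (- t * b) / (1 - t * N0)) ^ card I"
proof -
  interpret P: product_sigma_finite "\<lambda>_. cgauss N0" by (rule product_sigma_finite_cgauss) fact
  have "(\<integral>\<^sup>+z. indicator {z. real (card I) * b < (\<Sum>i\<in>I. (cmod (z i))\<^sup>2)} z \<partial>PiM I (\<lambda>_. cgauss N0))
    \<le> (\<integral>\<^sup>+z. (\<Prod>i\<in>I. ennreal (exp (- t * b)) * ennreal (exp (t * (cmod (0 + z i))\<^sup>2))) \<partial>PiM I (\<lambda>_. cgauss N0))"
  proof (intro nn_integral_mono)
    fix z
    show "indicator {z. real (card I) * b < (\<Sum>i\<in>I. (cmod (z i))\<^sup>2)} z \<le> (\<Prod>i\<in>I. ennreal (exp (- t * b)) * ennreal (exp (t * (cmod (0 + z i))\<^sup>2)))"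
      using sum_le_exp_markov[OF I, of "\<lambda>i. - (cmod (z i))\<^sup>2" "- b" t] t by (auto simp: indicator_def sum_negf)
  qed
  also have "\<dots> = (\<Prod>i\<in>I. \<integral>\<^sup>+z. ennreal (exp (- t * b)) * ennreal (exp (t * (cmod (0 + z))\<^sup>2)) \<partial>cgauss N0)"
    by (rule P.product_nn_integral_prod[OF I]) measurable
  also have "\<dots> = (\<Prod>i\<in>I. ennreal (exp (- t * b)) * ennreal (1 / (1 - t * N0) * exp (t * (cmod 0)\<^sup>2 / (1 - t * N0))))"
    by (subst nn_integral_cmult) (measurable, simp only: nn_integral_cgauss_exp_shift[OF N0 t(2)])
  also have "\<dots> = ennreal (exp (- t * b) / (1 - t * N0)) ^ card I"
    using t by (simp add: ennreal_mult[symmetric])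
  finally show ?thesis .
qed

text \<open>Each received symbol has variance \<open>N0 + \<alpha>\<close>, so an energy below a
  level \<open>b\<close> smaller than this is a lower tail. The code is integrated out first for
  fixed noise, which leaves an exponential moment of the noise with parameter
  \<open>t / D\<close>.\<close>

lemma received_small_bound:
  fixes a :: "'j \<Rightarrow> complex"
  assumes I: "finite I" and J: "finite J" and N0: "0 < N0" and t: "0 < t"
  defines "\<alpha> \<equiv> \<Sum>j\<in>J. (cmod (a j))\<^sup>2"
  shows "(\<integral>\<^sup>+z. \<integral>\<^sup>+c. indicator {y. (\<Sum>i\<in>I. (cmod (y i))\<^sup>2) < real (card I) * b} (\<lambda>i. (\<Sum>j\<in>J. a j * c i j) + z i) \<partial>codeword_space I J \<partial>PiM I (\<lambda>_. cgauss N0))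
    \<le> ennreal (exp (t * b) / (1 + t * (N0 + \<alpha>))) ^ card I"
proof -
  interpret P: product_sigma_finite "\<lambda>_. cgauss N0" by (rule product_sigma_finite_cgauss) fact
  have \<alpha>: "0 \<le> \<alpha>" by (simp add: \<alpha>_def sum_nonneg)
  define D where "D = 1 + t * \<alpha>"
  have D: "1 \<le> D" using t \<alpha> by (simp add: D_def)
  define t' where "t' = t / D"
  have t': "0 < t'" using t D by (simp add: t'_def)
  have "(\<integral>\<^sup>+c. indicator {y. (\<Sum>i\<in>I. (cmod (y i))\<^sup>2) < real (card I) * b} (\<lambda>i. (\<Sum>j\<in>J. a j * c i j) + z i) \<partial>codeword_space I J)
     \<le> (\<Prod>i\<in>I. ennreal (exp (t * b) / D) * ennreal (exp (- t' * (cmod (0 + z i))\<^sup>2)))" for z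
  proof -
    have "(\<integral>\<^sup>+c. indicator {y. (\<Sum>i\<in>I. (cmod (y i))\<^sup>2) < real (card I) * b} (\<lambda>i. (\<Sum>j\<in>J. a j * c i j) + z i) \<partial>codeword_space I J)
      \<le> (\<integral>\<^sup>+c. (\<Prod>i\<in>I. ennreal (exp (t * b)) * ennreal (exp (- t * (cmod (z i - (\<Sum>j\<in>J. - a j * c i j)))\<^sup>2))) \<partial>codeword_space I J)"
    proof (intro nn_integral_mono)
      fix c
      show "indicator {y. (\<Sum>i\<in>I. (cmod (y i))\<^sup>2) < real (card I) * b} (\<lambda>i. (\<Sum>j\<in>J. a j * c i j) + z i)
        \<le> (\<Prod>i\<in>I. ennreal (exp (t * b)) * ennreal (exp (- t * (cmod (z i - (\<Sum>j\<in>J. - a j * c i j)))\<^sup>2)))"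
        using sum_le_exp_markov[OF I, of "\<lambda>i. (cmod ((\<Sum>j\<in>J. a j * c i j) + z i))\<^sup>2" b t] t
        by (auto simp: indicator_def sum_negf add.commute)
    qed
    also have "\<dots> = (\<Prod>i\<in>I. \<integral>\<^sup>+x. ennreal (exp (t * b)) * ennreal (exp (- t * (cmod (z i - (\<Sum>j\<in>J. - a j * x j)))\<^sup>2)) \<partial>PiM J (\<lambda>_. cgauss 1))"
      by (rule nn_integral_codeword_prod[OF I]) measurable
    also have "\<dots> = (\<Prod>i\<in>I. ennreal (exp (t * b)) * ennreal (1 / D * exp (- t * (cmod (z i))\<^sup>2 / D)))"
    proof -
      note d = nn_integral_PiM_cgauss_exp_dist[OF J less_imp_le[OF t], of _ "\<lambda>j. - a j", unfolded norm_minus_cancel]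
      show ?thesis unfolding D_def \<alpha>_def by (subst nn_integral_cmult) (measurable, simp only: d)
    qed
    also have "\<dots> = (\<Prod>i\<in>I. ennreal (exp (t * b) / D) * ennreal (exp (- t' * (cmod (0 + z i))\<^sup>2)))"
      using D by (intro prod.cong refl) (simp add: ennreal_mult[symmetric] t'_def)
    finally show ?thesis .
  qed
  then have "(\<integral>\<^sup>+z. \<integral>\<^sup>+c. indicator {y. (\<Sum>i\<in>I. (cmod (y i))\<^sup>2) < real (card I) * b} (\<lambda>i. (\<Sum>j\<in>J. a j * c i j) + z i) \<partial>codeword_space I J \<partial>PiM I (\<lambda>_. cgauss N0))
    \<le> (\<integral>\<^sup>+z. (\<Prod>i\<in>I. ennreal (exp (t * b) / D) * ennreal (exp (- t' * (cmod (0 + z i))\<^sup>2))) \<partial>PiM I (\<lambda>_. cgauss N0))"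
    by (rule nn_integral_mono)
  also have "\<dots> = (\<Prod>i\<in>I. \<integral>\<^sup>+z. ennreal (exp (t * b) / D) * ennreal (exp (- t' * (cmod (0 + z))\<^sup>2)) \<partial>cgauss N0)"
    by (rule P.product_nn_integral_prod[OF I]) measurable
  also have "\<dots> = (\<Prod>i\<in>I. ennreal (exp (t * b) / D) * ennreal (1 / (1 - - t' * N0) * exp (- t' * (cmod 0)\<^sup>2 / (1 - - t' * N0))))"
  proof -
    have "- t' * N0 < 1" using mult_pos_pos[OF t' N0] by simp
    then show ?thesis
      by (subst nn_integral_cmult) (measurable, simp only: nn_integral_cgauss_exp_shift[OF N0])
  qed
  also have "\<dots> = ennreal (exp (t * b) / (1 + t * (N0 + \<alpha>))) ^ card I"
  proof -
    have "D * (1 + t' * N0) = D + t * N0" using D by (simp add: t'_def distrib_left)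
    then have "D * (1 + t' * N0) = 1 + t * (N0 + \<alpha>)" by (simp add: D_def distrib_left)
    then show ?thesis using D mult_pos_pos[OF t' N0] by (simp add: ennreal_mult[symmetric])
  qed
  finally show ?thesis .
qed

text \<open>A codeword independent of the output fits it with probability about
  \<open>N0 / \<beta>\<close> per slot, uniformly in the hypothetical gains: \<open>a\<close> enters
  only through \<open>D = 1 + \<alpha> / N0\<close>, and \<open>ln u \<le> u - 1\<close> at
  \<open>u = \<beta> / (N0 * D)\<close> eliminates \<open>D\<close>. Strong and weak hypotheses are
  covered by the same bound.\<close>

lemma wrong_codeword_bound:
  assumes I: "finite I" and J: "finite J" and N0: "0 < N0" and \<beta>: "0 < \<beta>"
    and y: "real (card I) * \<beta> \<le> (\<Sum>i\<in>I. (cmod (y i))\<^sup>2)"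
  shows "(\<integral>\<^sup>+c. indicator {v. (\<Sum>i\<in>I. (cmod (y i - v i))\<^sup>2) \<le> real (card I) * (N0 + \<eta>)} (\<lambda>i. \<Sum>j\<in>J. a j * c i j) \<partial>codeword_space I J)
    \<le> ennreal (exp (\<eta> / N0) * N0 / \<beta>) ^ card I"
proof -
  define \<alpha> where "\<alpha> = (\<Sum>j\<in>J. (cmod (a j))\<^sup>2)"
  have \<alpha>: "0 \<le> \<alpha>" by (simp add: \<alpha>_def sum_nonneg)
  define D where "D = 1 + 1 / N0 * \<alpha>"
  have D: "1 \<le> D" using N0 \<alpha> by (simp add: D_def)
  have "(\<integral>\<^sup>+c. indicator {v. (\<Sum>i\<in>I. (cmod (y i - v i))\<^sup>2) \<le> real (card I) * (N0 + \<eta>)} (\<lambda>i. \<Sum>j\<in>J. a j * c i j) \<partial>codeword_space I J)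
    \<le> (\<integral>\<^sup>+c. (\<Prod>i\<in>I. ennreal (exp (1 / N0 * (N0 + \<eta>))) * ennreal (exp (- (1 / N0) * (cmod (y i - (\<Sum>j\<in>J. a j * c i j)))\<^sup>2))) \<partial>codeword_space I J)"
  proof (intro nn_integral_mono)
    fix c
    show "indicator {v. (\<Sum>i\<in>I. (cmod (y i - v i))\<^sup>2) \<le> real (card I) * (N0 + \<eta>)} (\<lambda>i. \<Sum>j\<in>J. a j * c i j)
      \<le> (\<Prod>i\<in>I. ennreal (exp (1 / N0 * (N0 + \<eta>))) * ennreal (exp (- (1 / N0) * (cmod (y i - (\<Sum>j\<in>J. a j * c i j)))\<^sup>2)))"
      using sum_le_exp_markov[OF I, of "\<lambda>i. (cmod (y i - (\<Sum>j\<in>J. a j * c i j)))\<^sup>2" "N0 + \<eta>" "1 / N0"] N0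
      by (auto simp: indicator_def)
  qed
  also have "\<dots> = (\<Prod>i\<in>I. \<integral>\<^sup>+x. ennreal (exp (1 / N0 * (N0 + \<eta>))) * ennreal (exp (- (1 / N0) * (cmod (y i - (\<Sum>j\<in>J. a j * x j)))\<^sup>2)) \<partial>PiM J (\<lambda>_. cgauss 1))"
    by (rule nn_integral_codeword_prod[OF I]) measurable
  also have "\<dots> = (\<Prod>i\<in>I. ennreal (exp (1 / N0 * (N0 + \<eta>))) * ennreal (1 / D * exp (- (1 / N0) * (cmod (y i))\<^sup>2 / D)))"
  proof -
    have "0 \<le> 1 / N0" using N0 by simp
    note d = nn_integral_PiM_cgauss_exp_dist[OF J this]
    show ?thesis unfolding D_def \<alpha>_def by (subst nn_integral_cmult) (measurable, simp only: d)
  qed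
  also have "\<dots> = ennreal (\<Prod>i\<in>I. exp (1 / N0 * (N0 + \<eta>) - ln D - (cmod (y i))\<^sup>2 / (N0 * D)))"
  proof (subst prod_ennreal[symmetric])
    show "(\<Prod>i\<in>I. ennreal (exp (1 / N0 * (N0 + \<eta>))) * ennreal (1 / D * exp (- (1 / N0) * (cmod (y i))\<^sup>2 / D)))
      = (\<Prod>i\<in>I. ennreal (exp (1 / N0 * (N0 + \<eta>) - ln D - (cmod (y i))\<^sup>2 / (N0 * D))))"
    proof (intro prod.cong refl)
      fix i
      have "exp (1 / N0 * (N0 + \<eta>) - ln D - (cmod (y i))\<^sup>2 / (N0 * D)) = exp (1 / N0 * (N0 + \<eta>)) * (1 / D * exp (- (1 / N0) * (cmod (y i))\<^sup>2 / D))"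
        using D by (simp add: exp_diff exp_minus divide_inverse)
      then show "ennreal (exp (1 / N0 * (N0 + \<eta>))) * ennreal (1 / D * exp (- (1 / N0) * (cmod (y i))\<^sup>2 / D)) = ennreal (exp (1 / N0 * (N0 + \<eta>) - ln D - (cmod (y i))\<^sup>2 / (N0 * D)))"
        using D by (simp add: ennreal_mult[symmetric])
    qed
  qed simp
  also have "(\<Prod>i\<in>I. exp (1 / N0 * (N0 + \<eta>) - ln D - (cmod (y i))\<^sup>2 / (N0 * D)))
     = exp (card I * (1 / N0 * (N0 + \<eta>) - ln D) - (\<Sum>i\<in>I. (cmod (y i))\<^sup>2) / (N0 * D))"
    using I by (simp add: exp_sum[symmetric] sum_subtractf sum_divide_distrib)
  also have "\<dots> \<le> exp (card I * (\<eta> / N0 - ln (\<beta> / N0)))"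
  proof -
    have "card I * (1 / N0 * (N0 + \<eta>) - ln D) - (\<Sum>i\<in>I. (cmod (y i))\<^sup>2) / (N0 * D)
      \<le> card I * (1 / N0 * (N0 + \<eta>) - ln D) - (card I * \<beta>) / (N0 * D)"
      using y D N0 by (intro diff_left_mono divide_right_mono) auto
    also have "\<dots> = card I * (1 / N0 * (N0 + \<eta>) - ln D - \<beta> / (N0 * D))" by (simp add: algebra_simps)
    also have "\<dots> \<le> card I * (\<eta> / N0 - ln (\<beta> / N0))"
    proof (intro mult_left_mono)
      have "ln (\<beta> / (N0 * D)) \<le> \<beta> / (N0 * D) - 1" using \<beta> N0 D by (intro ln_le_minus_one) auto
      moreover have "ln (\<beta> / (N0 * D)) = ln (\<beta> / N0) - ln D"
        using \<beta> N0 D ln_div[of "\<beta> / N0" D] by simp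
      moreover have "1 / N0 * (N0 + \<eta>) = 1 + \<eta> / N0" using N0 by (simp add: field_simps)
      ultimately show "1 / N0 * (N0 + \<eta>) - ln D - \<beta> / (N0 * D) \<le> \<eta> / N0 - ln (\<beta> / N0)" by simp
    qed simp
    finally show ?thesis by simp
  qed
  also have "\<dots> = (exp (\<eta> / N0) * N0 / \<beta>) ^ card I"
    using \<beta> N0 by (simp add: exp_of_nat_mult exp_diff)
  finally show ?thesis using \<beta> N0 by (simp add: ennreal_power ennreal_leI)
qed

text \<open>The receiver knows the effective gain vector \<open>a\<close> only up to membership in the family \<open>A\<close>. This
  event contains all situations in which the true codeword fails the distance test for \<open>a\<close> or some
  other codeword passes it for some element of \<open>A\<close>.\<close>

definition confused :: "'i set \<Rightarrow> 'j set \<Rightarrow> real \<Rightarrow> nat \<Rightarrow> ('j \<Rightarrow> complex) set \<Rightarrow> ('j \<Rightarrow> complex) \<Rightarrow> nat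
    \<Rightarrow> (nat \<Rightarrow> 'i \<Rightarrow> 'j \<Rightarrow> complex) \<Rightarrow> ('i \<Rightarrow> complex) \<Rightarrow> bool" where
  "confused I J \<tau> M A a w cb z \<longleftrightarrow> real (card I) * \<tau> < (\<Sum>i\<in>I. (cmod (z i))\<^sup>2) \<or>
     (\<exists>w'\<in>{1..M} - {w}. \<exists>a'\<in>A.
        (\<Sum>i\<in>I. (cmod ((\<Sum>j\<in>J. a j * cb w i j) + z i - (\<Sum>j\<in>J. a' j * cb w' i j)))\<^sup>2) \<le> real (card I) * \<tau>)"

text \<open>Outside \<open>L\<close> the coordinate is the constant \<open>undefined\<close>.
  Settling this case once frees the later measurability proofs from index conditions.\<close>

lemma PiM_cgauss_component_measurable: "(\<lambda>h. h p) \<in> borel_measurable (PiM L (\<lambda>_. cgauss s))"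
proof (cases "p \<in> L")
  case True
  then show ?thesis
    using measurable_component_singleton[of p L "\<lambda>_. cgauss s", unfolded measurable_cong_sets[OF refl sets_cgauss]] by simp
next
  case False
  have "(\<lambda>h. h p) \<in> borel_measurable (PiM L (\<lambda>_. cgauss s)) \<longleftrightarrow> (\<lambda>_. undefined :: complex) \<in> borel_measurable (PiM L (\<lambda>_. cgauss s))"
    by (rule measurable_cong) (use False in \<open>simp add: space_PiM PiE_def extensional_def\<close>)
  then show ?thesis by simp
qed

lemma codeword_entry_measurable: "(\<lambda>c. c i j) \<in> borel_measurable (codeword_space I J)"
proof (cases "i \<in> I")
  case True
  show ?thesis unfolding codeword_space_def
    by (rule measurable_compose[OF measurable_component_singleton[OF True] PiM_cgauss_component_measurable])
next
  case False
  have "(\<lambda>c. c i j) \<in> borel_measurable (codeword_space I J) \<longleftrightarrow> (\<lambda>_. undefined j :: complex) \<in> borel_measurable (codeword_space I J)"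
    by (rule measurable_cong) (use False in \<open>simp add: codeword_space_def space_PiM PiE_def extensional_def\<close>)
  then show ?thesis by simp
qed

lemma codebook_entry_measurable: "(\<lambda>cb. cb w i j) \<in> borel_measurable (codebook_space M I J)"
proof (cases "w \<in> {1..M}")
  case True
  show ?thesis unfolding codebook_space_def
    by (rule measurable_compose[OF measurable_component_singleton[OF True] codeword_entry_measurable])
next
  case False
  have "(\<lambda>cb. cb w i j) \<in> borel_measurable (codebook_space M I J) \<longleftrightarrow> (\<lambda>_. undefined i j :: complex) \<in> borel_measurable (codebook_space M I J)"
    by (rule measurable_cong) (use False in \<open>simp add: codebook_space_def space_PiM PiE_def extensional_def del: One_nat_def\<close>)
  then show ?thesis by simp
qed

text \<open>Either the noise is large, or the output is weak, or the output is strong enough and a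
  wrong codeword fits it. The first two are tail bounds. The third is a union over \<open>w'\<close>
  and \<open>A\<close>; each of its terms is evaluated with all codewords but that of
  \<open>w'\<close> held fixed, so that the output is a constant.\<close>

lemma confused_bound:
  fixes I :: "'i set" and J :: "'j set" and a :: "'j \<Rightarrow> complex"
  assumes I: "finite I" and J: "finite J" and N0: "0 < N0" and \<beta>: "0 < \<beta>" and t: "0 < t" "t * N0 < 1" and t': "0 < t'"
    and w: "w \<in> {1..M}" and A: "finite A" and b0: "b0 \<le> (\<Sum>j\<in>J. (cmod (a j))\<^sup>2)" "0 \<le> b0"
  shows "(\<integral>\<^sup>+z. \<integral>\<^sup>+cb. indicator {cb. confused I J (N0 + \<eta>) M A a w cb z} cb \<partial>codebook_space M I J \<partial>PiM I (\<lambda>_. cgauss N0))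
    \<le> ennreal (exp (- t * (N0 + \<eta>)) / (1 - t * N0)) ^ card I + ennreal (exp (t' * \<beta>) / (1 + t' * (N0 + b0))) ^ card I
      + real M * real (card A) * ennreal (exp (\<eta> / N0) * N0 / \<beta>) ^ card I"
proof -
  let ?CB = "codebook_space M I J" and ?C = "codeword_space I J" and ?Z = "PiM I (\<lambda>_. cgauss N0)"
  let ?\<tau> = "N0 + \<eta>"
  interpret CB: prob_space ?CB by (rule prob_space_codebook_space)
  interpret C: prob_space ?C by (rule prob_space_codeword_space)
  interpret Z: prob_space ?Z by (rule prob_space_PiM_cgauss) (rule N0)
  interpret P: product_sigma_finite "\<lambda>_::nat. codeword_space I J"
    by (simp add: product_sigma_finite_def prob_space_imp_sigma_finite[OF prob_space_codeword_space])
  let ?v = "\<lambda>b c i. \<Sum>j\<in>J. b j * c i j"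
  define Sy where "Sy c z = (\<Sum>i\<in>I. (cmod (?v a c i + z i))\<^sup>2)" for c and z :: "'i \<Rightarrow> complex"
  define Sd where "Sd c z a' c' = (\<Sum>i\<in>I. (cmod (?v a c i + z i - ?v a' c' i))\<^sup>2)" for c c' a' and z :: "'i \<Rightarrow> complex"
  note mI = borel_measurable_sum borel_measurable_power measurable_compose[OF _ borel_measurable_norm] borel_measurable_add borel_measurable_diff
    borel_measurable_times borel_measurable_const
  have Sy1: "(\<lambda>cb. Sy (cb w) z) \<in> borel_measurable ?CB" for z
    unfolding Sy_def by (intro mI codebook_entry_measurable w)
  have Sy2: "(\<lambda>c. Sy c z) \<in> borel_measurable ?C" for z
    unfolding Sy_def by (intro mI codeword_entry_measurable)
  have Sy3: "(\<lambda>q. Sy (snd q w) (fst q)) \<in> borel_measurable (?Z \<Otimes>\<^sub>M ?CB)"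
  proof -
    have z: "(\<lambda>z. z i) \<in> borel_measurable ?Z" if "i \<in> I" for i using that by measurable
    show ?thesis
      unfolding Sy_def by (intro mI measurable_compose[OF measurable_snd codebook_entry_measurable] measurable_compose[OF measurable_fst z] w)
  qed
  have Sd1: "(\<lambda>cb. Sd (cb w) z a' (cb w')) \<in> borel_measurable ?CB" if "w' \<in> {1..M}" for w' z a'
    unfolding Sd_def by (intro mI codebook_entry_measurable w that)
  let ?small = "\<lambda>c z. Sy c z < real (card I) * \<beta>"
  let ?bad = "\<lambda>c z a' c'. \<not> ?small c z \<and> Sd c z a' c' \<le> real (card I) * ?\<tau>"
  define X where "X = ennreal (exp (\<eta> / N0) * N0 / \<beta>) ^ card I"
  have wrong: "(\<integral>\<^sup>+cb. indicator {cb. ?bad (cb w) z a' (cb w')} cb \<partial>?CB) \<le> X" if w': "w' \<in> {1..M} - {w}" for z a' w'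
  proof -
    have ins: "{1..M} = insert w' ({1..M} - {w'})" using w' by auto
    have "Measurable.pred ?CB (\<lambda>cb. ?bad (cb w) z a' (cb w'))"
    proof -
      have wM: "w' \<in> {1..M}" using w' by auto
      note [measurable] = Sy1[of z] Sd1[OF wM, of z a']
      show ?thesis by measurable
    qed
    then have m: "(\<lambda>cb. indicator {cb. ?bad (cb w) z a' (cb w')} cb :: ennreal) \<in> borel_measurable ?CB"
      unfolding pred_def by (intro borel_measurable_indicator') (simp only: mem_Collect_eq)
    have "(\<integral>\<^sup>+cb. indicator {cb. ?bad (cb w) z a' (cb w')} cb \<partial>PiM (insert w' ({1..M} - {w'})) (\<lambda>_. ?C))
      = (\<integral>\<^sup>+x. \<integral>\<^sup>+c. indicator {cb. ?bad (cb w) z a' (cb w')} (x(w' := c)) \<partial>?C \<partial>PiM ({1..M} - {w'}) (\<lambda>_. ?C))"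
      by (rule P.product_nn_integral_insert) (use m ins in \<open>auto simp: codebook_space_def insert_Diff_if\<close>)
    also have "\<dots> \<le> (\<integral>\<^sup>+x. X \<partial>PiM ({1..M} - {w'}) (\<lambda>_. ?C))"
    proof (intro nn_integral_mono)
      fix x :: "nat \<Rightarrow> 'i \<Rightarrow> 'j \<Rightarrow> complex"
      show "(\<integral>\<^sup>+c. indicator {cb. ?bad (cb w) z a' (cb w')} (x(w' := c)) \<partial>?C) \<le> X"
      proof (cases "?small (x w) z")
        case True
        then have "(\<integral>\<^sup>+c. indicator {cb. ?bad (cb w) z a' (cb w')} (x(w' := c)) \<partial>?C) = 0"
          using w' by (simp add: indicator_def)
        then show ?thesis by simp
      next
        case False
        have "(\<integral>\<^sup>+c. indicator {cb. ?bad (cb w) z a' (cb w')} (x(w' := c)) \<partial>?C)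
          \<le> (\<integral>\<^sup>+c. indicator {v. (\<Sum>i\<in>I. (cmod ((?v a (x w) i + z i) - v i))\<^sup>2) \<le> real (card I) * ?\<tau>} (?v a' c) \<partial>?C)"
          using w' by (intro nn_integral_mono) (auto simp: indicator_def Sd_def)
        also have "\<dots> \<le> X" unfolding X_def
          by (rule wrong_codeword_bound[OF I J N0 \<beta>]) (use False in \<open>simp add: Sy_def\<close>)
        finally show ?thesis .
      qed
    qed
    also have "\<dots> = X"
    proof -
      interpret R: prob_space "PiM ({1..M} - {w'}) (\<lambda>_. ?C)" by (intro prob_space_PiM prob_space_codeword_space)
      show ?thesis by (simp add: R.emeasure_space_1 del: One_nat_def)
    qed
    finally show ?thesis using ins by (simp add: codebook_space_def)
  qed
  have small_m: "(\<lambda>q. indicator {q. ?small (snd q w) (fst q)} q :: ennreal) \<in> borel_measurable (?Z \<Otimes>\<^sub>M ?CB)"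
  proof -
    have "Measurable.pred (?Z \<Otimes>\<^sub>M ?CB) (\<lambda>q. ?small (snd q w) (fst q))"
      by (rule borel_measurable_pred_less[OF Sy3 borel_measurable_const])
    then show ?thesis unfolding pred_def by (intro borel_measurable_indicator') (simp only: mem_Collect_eq)
  qed
  have bad_m: "(\<lambda>cb. indicator {cb. ?bad (cb w) z a' (cb w')} cb :: ennreal) \<in> borel_measurable ?CB" if w': "w' \<in> {1..M} - {w}" for z a' w'
  proof -
    have "Measurable.pred ?CB (\<lambda>cb. ?bad (cb w) z a' (cb w'))"
    proof -
      have wM: "w' \<in> {1..M}" using w' by auto
      note [measurable] = Sy1[of z] Sd1[OF wM, of z a']
      show ?thesis by measurable
    qed
    then show ?thesis unfolding pred_def by (intro borel_measurable_indicator') (simp only: mem_Collect_eq)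
  qed
  have sm: "(\<lambda>cb. indicator {c. ?small c z} (cb w) :: ennreal) \<in> borel_measurable ?CB" for z
  proof -
    have "Measurable.pred ?CB (\<lambda>cb. ?small (cb w) z)"
      by (rule borel_measurable_pred_less[OF Sy1 borel_measurable_const])
    then show ?thesis unfolding pred_def by (intro borel_measurable_indicator') (simp only: mem_Collect_eq)
  qed
  let ?big = "\<lambda>z. real (card I) * ?\<tau> < (\<Sum>i\<in>I. (cmod (z i))\<^sup>2)"
  have big_m: "(\<lambda>z. indicator {z. ?big z} z :: ennreal) \<in> borel_measurable ?Z"
  proof -
    have "Measurable.pred ?Z ?big" by measurable
    then show ?thesis unfolding pred_def by (intro borel_measurable_indicator') (simp only: mem_Collect_eq)
  qed
  let ?W = "{1..M} - {w}"
  have inner: "(\<integral>\<^sup>+cb. indicator {cb. confused I J ?\<tau> M A a w cb z} cb \<partial>?CB)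
     \<le> indicator {z. ?big z} z + (\<integral>\<^sup>+cb. indicator {c. ?small c z} (cb w) \<partial>?CB) + real M * real (card A) * X" for z
  proof -
    have "(\<integral>\<^sup>+cb. indicator {cb. confused I J ?\<tau> M A a w cb z} cb \<partial>?CB)
      \<le> (\<integral>\<^sup>+cb. (indicator {z. ?big z} z + indicator {c. ?small c z} (cb w)) + (\<Sum>w'\<in>?W. \<Sum>a'\<in>A. indicator {cb. ?bad (cb w) z a' (cb w')} cb) \<partial>?CB)"
    proof (intro nn_integral_mono)
      fix cb
      let ?S = "\<Sum>w'\<in>?W. \<Sum>a'\<in>A. indicator {cb. ?bad (cb w) z a' (cb w')} cb :: ennreal"
      show "indicator {cb. confused I J ?\<tau> M A a w cb z} cb \<le> (indicator {z. ?big z} z + indicator {c. ?small c z} (cb w)) + ?S"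
      proof (cases "confused I J ?\<tau> M A a w cb z \<and> \<not> ?big z \<and> \<not> ?small (cb w) z")
        case True
        then obtain w' a' where wa: "w' \<in> ?W" "a' \<in> A" and b: "?bad (cb w) z a' (cb w')"
          unfolding confused_def Sd_def by blast
        have "1 = (indicator {cb. ?bad (cb w) z a' (cb w')} cb :: ennreal)" using b by (simp add: indicator_def)
        also have "\<dots> \<le> (\<Sum>a'\<in>A. indicator {cb. ?bad (cb w) z a' (cb w')} cb)"
          using wa A by (intro member_le_sum) auto
        also have "\<dots> \<le> ?S"
          using wa by (intro member_le_sum[of w' ?W "\<lambda>w'. \<Sum>a'\<in>A. indicator {cb. ?bad (cb w) z a' (cb w')} cb"]) auto
        finally have "1 \<le> ?S" .
        then have "1 \<le> (indicator {z. ?big z} z + indicator {c. ?small c z} (cb w)) + ?S" by (rule add_increasing[OF zero_le])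
        then show ?thesis using True by (simp add: indicator_def)
      next
        case False
        then show ?thesis by (auto simp: indicator_def intro: add_increasing2)
      qed
    qed
    also have "\<dots> = (indicator {z. ?big z} z + (\<integral>\<^sup>+cb. indicator {c. ?small c z} (cb w) \<partial>?CB)) + (\<Sum>w'\<in>?W. \<Sum>a'\<in>A. \<integral>\<^sup>+cb. indicator {cb. ?bad (cb w) z a' (cb w')} cb \<partial>?CB)"
    proof -
      have s1: "(\<lambda>cb. \<Sum>a'\<in>A. indicator {cb. ?bad (cb w) z a' (cb w')} cb :: ennreal) \<in> borel_measurable ?CB" if "w' \<in> ?W" for w'
        by (intro borel_measurable_sum bad_m that)
      have s2: "(\<lambda>cb. \<Sum>w'\<in>?W. \<Sum>a'\<in>A. indicator {cb. ?bad (cb w) z a' (cb w')} cb :: ennreal) \<in> borel_measurable ?CB"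
        by (rule borel_measurable_sum) (rule s1)
      have e1: "(\<integral>\<^sup>+cb. (\<Sum>w'\<in>?W. \<Sum>a'\<in>A. indicator {cb. ?bad (cb w) z a' (cb w')} cb) \<partial>?CB) = (\<Sum>w'\<in>?W. \<Sum>a'\<in>A. \<integral>\<^sup>+cb. indicator {cb. ?bad (cb w) z a' (cb w')} cb \<partial>?CB)"
        by (subst nn_integral_sum[OF s1], assumption) (intro sum.cong refl nn_integral_sum bad_m)
      show ?thesis
        by (simp only: nn_integral_add[OF borel_measurable_add[OF borel_measurable_const sm] s2] nn_integral_add[OF borel_measurable_const sm]
          e1 nn_integral_const CB.emeasure_space_1 mult_1_right)
    qed
    also have "\<dots> \<le> (indicator {z. ?big z} z + (\<integral>\<^sup>+cb. indicator {c. ?small c z} (cb w) \<partial>?CB)) + (\<Sum>w'\<in>?W. \<Sum>a'\<in>A. X)"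
      by (intro add_left_mono sum_mono wrong)
    also have "(\<Sum>w'\<in>?W. \<Sum>a'\<in>A. X) \<le> real M * real (card A) * X"
    proof -
      have "(\<Sum>w'\<in>?W. \<Sum>a'\<in>A. X) = of_nat (card ?W) * (of_nat (card A) * X)" by simp
      also have "\<dots> \<le> of_nat M * (of_nat (card A) * X)"
        using w by (intro mult_right_mono) (auto simp: card_Diff_subset)
      finally show ?thesis by (simp add: ennreal_of_nat_eq_real_of_nat[symmetric] mult.assoc ennreal_mult)
    qed
    finally show ?thesis by (simp add: add_left_mono)
  qed
  have "(\<integral>\<^sup>+z. \<integral>\<^sup>+cb. indicator {cb. confused I J ?\<tau> M A a w cb z} cb \<partial>?CB \<partial>?Z)
    \<le> (\<integral>\<^sup>+z. indicator {z. ?big z} z + (\<integral>\<^sup>+cb. indicator {c. ?small c z} (cb w) \<partial>?CB) + real M * real (card A) * X \<partial>?Z)"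
    by (intro nn_integral_mono inner)
  also have "\<dots> = (\<integral>\<^sup>+z. indicator {z. ?big z} z \<partial>?Z) + (\<integral>\<^sup>+z. \<integral>\<^sup>+cb. indicator {c. ?small c z} (cb w) \<partial>?CB \<partial>?Z) + real M * real (card A) * X"
  proof -
    have s: "(\<lambda>z. \<integral>\<^sup>+cb. indicator {c. ?small c z} (cb w) \<partial>?CB) \<in> borel_measurable ?Z"
      using CB.borel_measurable_nn_integral_fst[OF small_m] by (simp add: indicator_def)
    show ?thesis
      by (simp only: nn_integral_add[OF borel_measurable_add[OF big_m s] borel_measurable_const] nn_integral_add[OF big_m s]
        nn_integral_const Z.emeasure_space_1 mult_1_right)
  qed
  also have "\<dots> \<le> ennreal (exp (- t * ?\<tau>) / (1 - t * N0)) ^ card I + ennreal (exp (t' * \<beta>) / (1 + t' * (N0 + b0))) ^ card I + real M * real (card A) * X"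
  proof (intro add_mono order_refl)
    show "(\<integral>\<^sup>+z. indicator {z. ?big z} z \<partial>?Z) \<le> ennreal (exp (- t * ?\<tau>) / (1 - t * N0)) ^ card I"
      by (rule noise_large_bound[OF I N0 t])
    have "(\<integral>\<^sup>+z. \<integral>\<^sup>+cb. indicator {c. ?small c z} (cb w) \<partial>?CB \<partial>?Z) = (\<integral>\<^sup>+z. \<integral>\<^sup>+c. indicator {c. ?small c z} c \<partial>?C \<partial>?Z)"
    proof (intro nn_integral_cong nn_integral_codebook_component[OF w])
      fix z
      have "Measurable.pred ?C (\<lambda>c. ?small c z)"
        by (rule borel_measurable_pred_less[OF Sy2 borel_measurable_const])
      then show "(\<lambda>c. indicator {c. ?small c z} c :: ennreal) \<in> borel_measurable ?C"
        unfolding pred_def by (intro borel_measurable_indicator') (simp only: mem_Collect_eq)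
    qed
    also have "\<dots> = (\<integral>\<^sup>+z. \<integral>\<^sup>+c. indicator {y. (\<Sum>i\<in>I. (cmod (y i))\<^sup>2) < real (card I) * \<beta>} (\<lambda>i. ?v a c i + z i) \<partial>?C \<partial>?Z)"
      by (intro nn_integral_cong) (simp add: indicator_def Sy_def)
    also have "\<dots> \<le> ennreal (exp (t' * \<beta>) / (1 + t' * (N0 + (\<Sum>j\<in>J. (cmod (a j))\<^sup>2)))) ^ card I"
      by (rule received_small_bound[OF I J N0 t'])
    also have "\<dots> \<le> ennreal (exp (t' * \<beta>) / (1 + t' * (N0 + b0))) ^ card I"
      using t' N0 b0 by (intro power_mono ennreal_leI divide_left_mono mult_pos_pos add_mono mult_left_mono) (auto intro!: add_pos_nonneg mult_nonneg_nonneg)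
    finally show "(\<integral>\<^sup>+z. \<integral>\<^sup>+cb. indicator {c. ?small c z} (cb w) \<partial>?CB \<partial>?Z) \<le> ennreal (exp (t' * \<beta>) / (1 + t' * (N0 + b0))) ^ card I" .
  qed
  finally show ?thesis unfolding X_def .
qed

text \<open>The constants \<eta> and \<rho> depend on \<open>N0\<close>, \<open>b0\<close> and
  \<open>r\<close> only. This uniformity allows the block length to be chosen after
  \<open>K\<close>, although the family \<open>A\<close> of coalitions grows like
  \<open>2 ^ K\<close>.\<close>

lemma confusion_rate:
  fixes N0 b0 r :: real
  assumes N0: "0 < N0" and b0: "0 < b0" and r: "r < ln (1 + b0 / N0)"
  shows "\<exists>(\<eta>::real) (\<rho>::real). 0 < \<eta> \<and> 0 < \<rho> \<and> \<rho> < 1 \<and>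
    (\<forall>(I::nat set) (J::nat set) (a::nat \<Rightarrow> complex) (M::nat) (w::nat) A. finite I \<longrightarrow> finite J \<longrightarrow> w \<in> {1..M} \<longrightarrow> finite A \<longrightarrow>
      b0 \<le> (\<Sum>j\<in>J. (cmod (a j))\<^sup>2) \<longrightarrow> real M \<le> 2 * exp (real (card I) * r) \<longrightarrow>
      (\<integral>\<^sup>+z. \<integral>\<^sup>+cb. indicator {cb. confused I J (N0 + \<eta>) M A a w cb z} cb \<partial>codebook_space M I J \<partial>PiM I (\<lambda>_. cgauss N0))
        \<le> ennreal ((2 + 2 * real (card A)) * \<rho> ^ card I))"
proof -
  \<comment> \<open>The gap to capacity in three shares: one for the noise threshold \<eta>, one for
    the energy level \<beta>, and one that survives as \<open>\<rho>3 = exp (- g)\<close>.\<close>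
  define g where "g = (ln (1 + b0 / N0) - r) / 3"
  have g: "0 < g" using r by (simp add: g_def)
  define \<eta> where "\<eta> = N0 * g"
  have \<eta>: "0 < \<eta>" using g N0 by (simp add: \<eta>_def)
  define v0 where "v0 = N0 + b0"
  have v0: "0 < v0" using N0 b0 by (simp add: v0_def)
  define \<theta> where "\<theta> = exp (- g)"
  have \<theta>: "0 < \<theta>" "\<theta> < 1" using g by (auto simp: \<theta>_def)
  define \<beta> where "\<beta> = v0 * \<theta>"
  have \<beta>: "0 < \<beta>" using v0 \<theta> by (simp add: \<beta>_def)
  \<comment> \<open>The normalised parameter \<open>t * N0\<close>. The bound 1 / 2 admits the
    estimate of \<open>ln (1 - x)\<close>, and \<open>g / 4\<close> makes
    \<open>x * (2 * x - g)\<close> negative.\<close>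
  define x where "x = min (1/2) (g / 4)"
  have x: "0 < x" "x \<le> 1/2" "x \<le> g / 4" using g by (auto simp: x_def)
  define t where "t = x / N0"
  have t: "0 < t" "t * N0 < 1" using x N0 by (auto simp: t_def)
  \<comment> \<open>The normalised parameter of the lower tail; being half of
    \<open>1 - \<theta>\<close>, it makes \<open>y * (y - (1 - \<theta>))\<close> negative.\<close>
  define y where "y = (1 - \<theta>) / 2"
  have y: "0 < y" "y < 1" using \<theta> by (auto simp: y_def)
  define t' where "t' = y / v0"
  have t': "0 < t'" using y v0 by (simp add: t'_def)
  define \<rho>1 where "\<rho>1 = exp (- t * (N0 + \<eta>)) / (1 - t * N0)"
  define \<rho>2 where "\<rho>2 = exp (t' * \<beta>) / (1 + t' * (N0 + b0))"
  define \<rho>3 where "\<rho>3 = exp (r + \<eta> / N0) * N0 / \<beta>"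
  have \<rho>1: "0 < \<rho>1" "\<rho>1 < 1"
  proof -
    show "0 < \<rho>1" using t by (simp add: \<rho>1_def)
    have e: "\<rho>1 = exp (- x - x * g - ln (1 - x))"
    proof -
      have "- t * (N0 + \<eta>) = - x - x * g" "t * N0 = x" using N0 by (auto simp: t_def \<eta>_def field_simps)
      then have "\<rho>1 = exp (- x - x * g) / (1 - x)" unfolding \<rho>1_def by (simp only:)
      also have "\<dots> = exp (- x - x * g - ln (1 - x))" using x by (subst exp_diff[of _ "ln (1 - x)"]) simp
      finally show ?thesis .
    qed
    have "- x - 2 * x\<^sup>2 \<le> ln (1 - x)" using x by (intro ln_one_minus_pos_lower_bound) auto
    then have "- x - x * g - ln (1 - x) \<le> x * (2 * x - g)" by (simp add: power2_eq_square algebra_simps)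
    also have "\<dots> < 0" using x g by (intro mult_pos_neg) auto
    finally show "\<rho>1 < 1" unfolding e by simp
  qed
  have \<rho>2: "0 < \<rho>2" "\<rho>2 < 1"
  proof -
    have p: "0 < 1 + y" using y by simp
    have e0: "t' * (N0 + b0) = y" "t' * \<beta> = y * \<theta>" using v0 by (auto simp: t'_def v0_def[symmetric] \<beta>_def)
    show "0 < \<rho>2" using p by (simp add: \<rho>2_def e0)
    have e: "\<rho>2 = exp (y * \<theta> - ln (1 + y))" using p by (simp add: \<rho>2_def e0 exp_diff)
    have "y - y\<^sup>2 \<le> ln (1 + y)" using y by (intro ln_one_plus_pos_lower_bound) auto
    then have "y * \<theta> - ln (1 + y) \<le> y * (y - (1 - \<theta>))" by (simp add: power2_eq_square algebra_simps)
    also have "\<dots> < 0" using y \<theta> by (intro mult_pos_neg) (auto simp: y_def)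
    finally show "\<rho>2 < 1" unfolding e by simp
  qed
  have \<rho>3: "\<rho>3 = exp (- g)"
  proof -
    have "N0 / \<beta> = exp (g - ln (1 + b0 / N0))"
    proof -
      have "exp (ln (1 + b0 / N0)) = v0 / N0" using N0 b0 by (subst exp_ln) (auto simp: v0_def field_simps add_pos_pos)
      then show ?thesis using N0 v0 by (simp add: exp_diff \<beta>_def \<theta>_def exp_minus field_simps)
    qed
    then have "\<rho>3 = exp (r + \<eta> / N0) * exp (g - ln (1 + b0 / N0))"
      unfolding \<rho>3_def times_divide_eq_right[symmetric] by (simp only:)
    also have "\<dots> = exp (- g)"
    proof -
      have "r + \<eta> / N0 + (g - ln (1 + b0 / N0)) = - g" using N0 by (simp add: \<eta>_def g_def field_simps)
      then show ?thesis unfolding exp_add[symmetric] by (simp only:)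
    qed
    finally show ?thesis .
  qed
  define \<rho> where "\<rho> = max \<rho>1 (max \<rho>2 \<rho>3)"
  have \<rho>: "0 < \<rho>" "\<rho> < 1" "\<rho>1 \<le> \<rho>" "\<rho>2 \<le> \<rho>" "\<rho>3 \<le> \<rho>"
    using \<rho>1 \<rho>2 g by (auto simp: \<rho>_def \<rho>3)
  show ?thesis
  proof (rule exI[of _ \<eta>], rule exI[of _ \<rho>], intro conjI allI impI)
    fix I J :: "nat set" and a :: "nat \<Rightarrow> complex" and M w :: nat and A :: "(nat \<Rightarrow> complex) set"
    assume I: "finite I" and J: "finite J" and w: "w \<in> {1..M}" and A: "finite A"
      and b: "b0 \<le> (\<Sum>j\<in>J. (cmod (a j))\<^sup>2)" and M: "real M \<le> 2 * exp (real (card I) * r)"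
    let ?n = "card I"
    have "(\<integral>\<^sup>+z. \<integral>\<^sup>+cb. indicator {cb. confused I J (N0 + \<eta>) M A a w cb z} cb \<partial>codebook_space M I J \<partial>PiM I (\<lambda>_. cgauss N0))
      \<le> ennreal \<rho>1 ^ ?n + ennreal \<rho>2 ^ ?n + real M * real (card A) * ennreal (exp (\<eta> / N0) * N0 / \<beta>) ^ ?n"
      unfolding \<rho>1_def \<rho>2_def by (rule confused_bound[OF I J N0 \<beta> t t' w A b less_imp_le[OF b0]])
    also have "\<dots> = ennreal (\<rho>1 ^ ?n + \<rho>2 ^ ?n + real M * real (card A) * (exp (\<eta> / N0) * N0 / \<beta>) ^ ?n)"
    proof -
      have p: "0 \<le> (exp (\<eta> / N0) * N0 / \<beta>) ^ ?n" using N0 \<beta> by simp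
      show ?thesis
        using \<rho>1 \<rho>2 N0 \<beta> p by (simp add: ennreal_power ennreal_mult[symmetric] ennreal_plus[symmetric] del: ennreal_plus)
    qed
    also have "\<dots> \<le> ennreal ((2 + 2 * real (card A)) * \<rho> ^ ?n)"
    proof (intro ennreal_leI)
      have 1: "\<rho>1 ^ ?n \<le> \<rho> ^ ?n" "\<rho>2 ^ ?n \<le> \<rho> ^ ?n" using \<rho> \<rho>1 \<rho>2 by (auto intro!: power_mono)
      have "real M * real (card A) * (exp (\<eta> / N0) * N0 / \<beta>) ^ ?n \<le> (2 * exp (?n * r)) * real (card A) * (exp (\<eta> / N0) * N0 / \<beta>) ^ ?n"
        using M N0 \<beta> by (intro mult_right_mono) auto
      also have "\<dots> = 2 * card A * \<rho>3 ^ ?n"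
        by (simp add: \<rho>3_def exp_add exp_of_nat_mult power_mult_distrib power_divide)
      also have "\<dots> \<le> 2 * card A * \<rho> ^ ?n" using \<rho> g by (intro mult_left_mono power_mono) (auto simp: \<rho>3)
      finally show "\<rho>1 ^ ?n + \<rho>2 ^ ?n + real M * real (card A) * (exp (\<eta> / N0) * N0 / \<beta>) ^ ?n \<le> (2 + 2 * real (card A)) * \<rho> ^ ?n"
        using 1 by (simp add: algebra_simps)
    qed
    finally show "(\<integral>\<^sup>+z. \<integral>\<^sup>+cb. indicator {cb. confused I J (N0 + \<eta>) M A a w cb z} cb \<partial>codebook_space M I J \<partial>PiM I (\<lambda>_. cgauss N0))
      \<le> ennreal ((2 + 2 * real (card A)) * \<rho> ^ ?n)" .
  qed (use \<eta> \<rho> in auto)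
qed

section \<open>The gain of cooperating relays\<close>

lemma nn_integral_PiM_project:
  assumes s: "0 < s" and f: "inj_on f I" "f ` I \<subseteq> L" and F: "F \<in> borel_measurable (PiM I (\<lambda>_. cgauss s))"
  shows "(\<integral>\<^sup>+x. F (\<lambda>k\<in>I. x (f k)) \<partial>PiM L (\<lambda>_. cgauss s)) = (\<integral>\<^sup>+x. F x \<partial>PiM I (\<lambda>_. cgauss s))"
proof -
  have t: "(\<lambda>\<omega>. \<lambda>k\<in>I. \<omega> (f k)) \<in> PiM L (\<lambda>_. cgauss s) \<rightarrow>\<^sub>M PiM I (\<lambda>_. cgauss s)"
    using f(2) by (intro measurable_restrict measurable_component_singleton) auto
  have "PiM I (\<lambda>_. cgauss s) = distr (PiM L (\<lambda>_. cgauss s)) (PiM I (\<lambda>_. cgauss s)) (\<lambda>\<omega>. \<lambda>k\<in>I. \<omega> (f k))"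
    using distr_PiM_reindex[of L "\<lambda>_. cgauss s" f I] prob_space_cgauss[OF s] f by (simp add: image_subset_iff_funcset)
  then have "(\<integral>\<^sup>+x. F x \<partial>PiM I (\<lambda>_. cgauss s)) = (\<integral>\<^sup>+x. F x \<partial>distr (PiM L (\<lambda>_. cgauss s)) (PiM I (\<lambda>_. cgauss s)) (\<lambda>\<omega>. \<lambda>k\<in>I. \<omega> (f k)))" by simp
  also have "\<dots> = (\<integral>\<^sup>+x. F (\<lambda>k\<in>I. x (f k)) \<partial>PiM L (\<lambda>_. cgauss s))"
    by (rule nn_integral_distr[OF t]) (use F in simp)
  finally show ?thesis ..
qed

definition strong_prob :: "real \<Rightarrow> real" where
  "strong_prob G = measure (cgauss 1) {x. G \<le> (cmod x)\<^sup>2}"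

lemma emeasure_strong: "emeasure (cgauss 1) {x. G \<le> (cmod x)\<^sup>2} = ennreal (strong_prob G)"
proof -
  interpret prob_space "cgauss 1" by (rule prob_space_cgauss) simp
  show ?thesis by (simp add: strong_prob_def emeasure_eq_measure)
qed

text \<open>If \<open>(cmod x)\<^sup>2 < G\<close> held almost surely, the exponential moment
  \<open>1 / (1 - t)\<close> could not exceed \<open>exp \<bar>G\<bar>\<close> for
  \<open>0 < t < 1\<close>; the chosen \<open>t\<close> makes it twice as large.\<close>

lemma strong_prob_bounds: "0 < strong_prob G" "strong_prob G \<le> 1"
proof -
  interpret prob_space "cgauss 1" by (rule prob_space_cgauss) simp
  have m: "{x. G \<le> (cmod x)\<^sup>2} \<in> sets (cgauss 1)" by simp
  show "strong_prob G \<le> 1" by (simp add: strong_prob_def)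
  show "0 < strong_prob G"
  proof (rule ccontr)
    assume "\<not> 0 < strong_prob G"
    then have "emeasure (cgauss 1) {x. G \<le> (cmod x)\<^sup>2} = 0" by (simp add: emeasure_strong ennreal_neg)
    then have "AE x in cgauss 1. \<not> G \<le> (cmod x)\<^sup>2" using m by (intro AE_I[of _ _ "{x. G \<le> (cmod x)\<^sup>2}"]) auto
    then have ae: "AE x in cgauss 1. ennreal (exp (t * (cmod (0 + x))\<^sup>2)) \<le> ennreal (exp (\<bar>G\<bar>))" if "0 < t" "t < 1" for t
    proof eventually_elim
      case (elim x)
      have "t * (cmod x)\<^sup>2 \<le> 1 * (cmod x)\<^sup>2" using that by (intro mult_right_mono) auto
      then show ?case using elim by (intro ennreal_leI) simp
    qed
    define t where "t = 1 - exp (- \<bar>G\<bar>) / 2"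
    have e: "exp (- \<bar>G\<bar>) \<le> 1" "0 < exp (- \<bar>G\<bar>)" by auto
    have t: "0 < t" "t < 1" using e unfolding t_def by linarith+
    have "ennreal (1 / (1 - t)) = (\<integral>\<^sup>+x. ennreal (exp (t * (cmod (0 + x))\<^sup>2)) \<partial>cgauss 1)"
      using t by (subst nn_integral_cgauss_exp_shift) auto
    also have "\<dots> \<le> (\<integral>\<^sup>+x. ennreal (exp \<bar>G\<bar>) \<partial>cgauss 1)" by (rule nn_integral_mono_AE[OF ae[OF t]])
    also have "\<dots> = ennreal (exp \<bar>G\<bar>)" using emeasure_space_1 by simp
    finally have "1 / (1 - t) \<le> exp \<bar>G\<bar>" by simp
    moreover have "1 / (1 - t) = 2 * exp \<bar>G\<bar>" by (simp add: t_def exp_minus field_simps)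
    ultimately show False by simp
  qed
qed

definition coop_gain :: "nat \<Rightarrow> real \<Rightarrow> (nat \<times> nat \<Rightarrow> complex) \<Rightarrow> nat \<Rightarrow> real" where
  "coop_gain K G h k = (\<Sum>j\<in>{1..K} - {k}. if G \<le> (cmod (h (0, j)))\<^sup>2 then (cmod (h (j, k)))\<^sup>2 else 0)"

text \<open>The lower tail of a sum of independent terms, each nonzero with probability
  \<open>strong_prob G\<close> and then of mean 1. The gains into \<open>k\<close> are integrated
  first: for fixed source gains a strong relay contributes the factor \<open>1 / (1 + t)\<close>, a
  weak one 1.\<close>

lemma gain_concentration:
  assumes k: "k \<in> {1..K}" and \<delta>: "0 < \<delta>" "\<delta> < 1"
  shows "(\<integral>\<^sup>+h. indicator {h. coop_gain K G h k < (1 - \<delta>) * (real (K - 1) * strong_prob G)} h \<partial>PiM (gain_idx K) (\<lambda>_. cgauss 1))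
     \<le> ennreal (exp (- real (K - 1) * (strong_prob G * \<delta>\<^sup>2 / 4)))"
proof -
  define q where "q = strong_prob G"
  have q: "0 < q" "q \<le> 1" using strong_prob_bounds[of G] by (auto simp: q_def)
  \<comment> \<open>The minimiser of \<open>t * t - t * \<delta>\<close>, whose minimum
    \<open>- \<delta>\<^sup>2 / 4\<close> is the exponent per relay up to the factor
    \<open>strong_prob G\<close>.\<close>
  define t where "t = \<delta> / 2"
  have t: "0 < t" using \<delta> by (simp add: t_def)
  let ?J = "{1..K} - {k}"
  have cJ: "card ?J = K - 1" using k by simp
  let ?R = "PiM {p \<in> gain_idx K. snd p \<noteq> k} (\<lambda>_. cgauss 1)" and ?S = "PiM (senders K k) (\<lambda>_. cgauss 1)"
  interpret P: product_sigma_finite "\<lambda>_. cgauss 1" by (rule product_sigma_finite_cgauss) simp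
  interpret c: prob_space "cgauss 1" by (rule prob_space_cgauss) simp
  let ?c = "ennreal (exp (t * ((1 - \<delta>) * (real (K - 1) * q))))"
  define F where "F h = ?c * (\<Prod>j\<in>?J. ennreal (exp (- t * (if G \<le> (cmod (h (0, j)))\<^sup>2 then (cmod (h (j, k)))\<^sup>2 else 0))))" for h :: "nat \<times> nat \<Rightarrow> complex"
  define \<phi> where "\<phi> x = (if G \<le> (cmod x)\<^sup>2 then ennreal (1 / (1 + t)) else 1)" for x
  have \<phi>m [measurable]: "\<phi> \<in> borel_measurable borel" unfolding \<phi>_def by measurable
  have pm: "(0, j) \<in> gain_idx K" "(j, k) \<in> gain_idx K" if "j \<in> ?J" for j using that k by (auto simp: gain_idx_def)
  have Fm: "F \<in> borel_measurable (PiM (gain_idx K) (\<lambda>_. cgauss 1))"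
  proof -
    have [measurable]: "(\<lambda>h. h (0, j)) \<in> borel_measurable (PiM (gain_idx K) (\<lambda>_. cgauss 1))"
        "(\<lambda>h. h (j, k)) \<in> borel_measurable (PiM (gain_idx K) (\<lambda>_. cgauss 1))" if "j \<in> ?J" for j
      using pm[OF that] by measurable
    show ?thesis unfolding F_def by measurable
  qed
  have "(\<integral>\<^sup>+h. indicator {h. coop_gain K G h k < (1 - \<delta>) * (real (K - 1) * strong_prob G)} h \<partial>PiM (gain_idx K) (\<lambda>_. cgauss 1))
    \<le> (\<integral>\<^sup>+h. F h \<partial>PiM (gain_idx K) (\<lambda>_. cgauss 1))"
  proof (intro nn_integral_mono)
    fix h
    show "indicator {h. coop_gain K G h k < (1 - \<delta>) * (real (K - 1) * strong_prob G)} h \<le> F h"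
    proof (cases "coop_gain K G h k < (1 - \<delta>) * (real (K - 1) * strong_prob G)")
      case True
      have "F h = ?c * ennreal (exp (- t * coop_gain K G h k))"
        unfolding F_def coop_gain_def by (simp add: prod_ennreal exp_sum[symmetric] sum_distrib_left sum_negf)
      also have "\<dots> = ennreal (exp (t * ((1 - \<delta>) * (real (K - 1) * q) - coop_gain K G h k)))"
        by (simp add: ennreal_mult[symmetric] exp_add[symmetric] right_diff_distrib)
      also have "1 \<le> \<dots>" using True t by (simp add: q_def one_le_exp_iff)
      finally show ?thesis using True by simp
    qed simp
  qed
  also have "\<dots> = (\<integral>\<^sup>+r. \<integral>\<^sup>+x. F (join_gains K k r x) \<partial>?S \<partial>?R)"
    by (rule nn_integral_gain_split[where M=1, OF zero_less_one]) (use k Fm in auto)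
  also have "\<dots> = (\<integral>\<^sup>+r. ?c * (\<Prod>j\<in>?J. \<phi> ((\<lambda>j\<in>?J. r (0, j)) j)) \<partial>?R)"
  proof (intro nn_integral_cong)
    fix r :: "nat \<times> nat \<Rightarrow> complex"
    have sen: "senders K k = insert 0 ?J" using k by auto
    have n0: "0 \<notin> ?J" by simp
    let ?f = "\<lambda>j x. if j = 0 then 1 else ennreal (exp (- t * (if G \<le> (cmod (r (0, j)))\<^sup>2 then (cmod (0 + x))\<^sup>2 else 0)))"
    have "F (join_gains K k r x) = ?c * (\<Prod>j\<in>senders K k. ?f j (x j))" for x
    proof -
      have "(\<Prod>j\<in>?J. ennreal (exp (- t * (if G \<le> (cmod (join_gains K k r x (0, j)))\<^sup>2 then (cmod (join_gains K k r x (j, k)))\<^sup>2 else 0))))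
        = (\<Prod>j\<in>?J. ?f j (x j))"
        using k by (intro prod.cong refl) (auto simp: join_gains_def merge_def gain_idx_def)
      then show ?thesis unfolding F_def sen using n0 by simp
    qed
    then have "(\<integral>\<^sup>+x. F (join_gains K k r x) \<partial>?S) = ?c * (\<integral>\<^sup>+x. (\<Prod>j\<in>senders K k. ?f j (x j)) \<partial>?S)"
      by (simp only:) (rule nn_integral_cmult, measurable)
    also have "(\<integral>\<^sup>+x. (\<Prod>j\<in>senders K k. ?f j (x j)) \<partial>?S) = (\<Prod>j\<in>senders K k. \<integral>\<^sup>+x. ?f j x \<partial>cgauss 1)"
      by (rule P.product_nn_integral_prod) auto
    also have "\<dots> = (\<Prod>j\<in>?J. \<integral>\<^sup>+x. ?f j x \<partial>cgauss 1)"
      unfolding sen using n0 c.emeasure_space_1 by simp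
    also have "\<dots> = (\<Prod>j\<in>?J. \<phi> ((\<lambda>j\<in>?J. r (0, j)) j))"
    proof (intro prod.cong refl)
      fix j assume j: "j \<in> ?J"
      have "(\<integral>\<^sup>+x. ennreal (exp (- t * (cmod (0 + x))\<^sup>2)) \<partial>cgauss 1) = ennreal (1 / (1 + t))"
        using t by (subst nn_integral_cgauss_exp_shift) auto
      then show "(\<integral>\<^sup>+x. ?f j x \<partial>cgauss 1) = \<phi> ((\<lambda>j\<in>?J. r (0, j)) j)"
        using j c.emeasure_space_1 by (auto simp: \<phi>_def)
    qed
    finally show "(\<integral>\<^sup>+x. F (join_gains K k r x) \<partial>?S) = ?c * (\<Prod>j\<in>?J. \<phi> ((\<lambda>j\<in>?J. r (0, j)) j))" .
  qed
  also have "\<dots> = (\<integral>\<^sup>+x. ?c * (\<Prod>j\<in>?J. \<phi> (x j)) \<partial>PiM ?J (\<lambda>_. cgauss 1))"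
    by (rule nn_integral_PiM_project[where F="\<lambda>x. ?c * (\<Prod>j\<in>?J. \<phi> (x j))" and f="\<lambda>j. (0, j)"]) (use k in \<open>auto simp: gain_idx_def inj_on_def\<close>)
  also have "\<dots> = ?c * (\<integral>\<^sup>+x. (\<Prod>j\<in>?J. \<phi> (x j)) \<partial>PiM ?J (\<lambda>_. cgauss 1))"
    by (rule nn_integral_cmult) measurable
  also have "(\<integral>\<^sup>+x. (\<Prod>j\<in>?J. \<phi> (x j)) \<partial>PiM ?J (\<lambda>_. cgauss 1)) = (\<Prod>j\<in>?J. \<integral>\<^sup>+x. \<phi> x \<partial>cgauss 1)"
    by (rule P.product_nn_integral_prod) auto
  also have "\<dots> = (\<integral>\<^sup>+x. \<phi> x \<partial>cgauss 1) ^ (K - 1)" by (simp only: prod_constant cJ)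
  also have "(\<integral>\<^sup>+x. \<phi> x \<partial>cgauss 1) = ennreal (1 - q * (t / (1 + t)))"
  proof -
    let ?A = "{x. G \<le> (cmod x)\<^sup>2}"
    have A: "?A \<in> sets (cgauss 1)" by simp
    have "(\<integral>\<^sup>+x. \<phi> x \<partial>cgauss 1) = (\<integral>\<^sup>+x. ennreal (1 / (1 + t)) * indicator ?A x + indicator (space (cgauss 1) - ?A) x \<partial>cgauss 1)"
      by (intro nn_integral_cong) (auto simp: \<phi>_def indicator_def)
    also have "\<dots> = ennreal (1 / (1 + t)) * emeasure (cgauss 1) ?A + emeasure (cgauss 1) (space (cgauss 1) - ?A)"
      using A by (subst nn_integral_add) (auto simp: nn_integral_cmult_indicator)
    also have "emeasure (cgauss 1) (space (cgauss 1) - ?A) = ennreal (1 - q)"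
      unfolding c.emeasure_eq_measure c.prob_compl[OF A] by (simp add: q_def strong_prob_def)
    also have "emeasure (cgauss 1) ?A = ennreal q" by (simp add: emeasure_strong q_def)
    also have "ennreal (1 / (1 + t)) * ennreal q + ennreal (1 - q) = ennreal (1 / (1 + t) * q + (1 - q))"
      using q t by (simp add: ennreal_mult[symmetric] ennreal_plus[symmetric] del: ennreal_plus)
    also have "1 / (1 + t) * q + (1 - q) = 1 - q * (t / (1 + t))" using t by (simp add: field_simps)
    finally show ?thesis .
  qed
  also have "?c * ennreal (1 - q * (t / (1 + t))) ^ (K - 1) \<le> ?c * ennreal (exp (- (q * (t / (1 + t))))) ^ (K - 1)"
    using exp_ge_add_one_self[of "- (q * (t / (1 + t)))"] by (intro mult_left_mono power_mono ennreal_leI) auto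
  also have "\<dots> = ennreal (exp (t * ((1 - \<delta>) * (real (K - 1) * q)) - real (K - 1) * (q * (t / (1 + t)))))"
  proof -
    have "exp (- (q * (t / (1 + t)))) ^ (K - 1) = exp (- (real (K - 1) * (q * (t / (1 + t)))))"
      by (simp add: exp_of_nat_mult[symmetric])
    moreover have "exp (t * ((1 - \<delta>) * (real (K - 1) * q))) * exp (- (real (K - 1) * (q * (t / (1 + t)))))
      = exp (t * ((1 - \<delta>) * (real (K - 1) * q)) - real (K - 1) * (q * (t / (1 + t))))"
      by (simp only: exp_add[symmetric] diff_conv_add_uminus)
    ultimately show ?thesis by (simp only: ennreal_power[OF exp_ge_zero] ennreal_mult[OF exp_ge_zero exp_ge_zero, symmetric])
  qed
  also have "\<dots> \<le> ennreal (exp (- real (K - 1) * (strong_prob G * \<delta>\<^sup>2 / 4)))"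
  proof (intro ennreal_leI, subst exp_le_cancel_iff)
    have "1 - t \<le> 1 / (1 + t)" using t by (simp add: field_simps)
    then have "t * (1 - t) \<le> t * (1 / (1 + t))" using t by (intro mult_left_mono) auto
    then have "t * (1 - \<delta>) - t / (1 + t) \<le> t * (1 - \<delta>) - t * (1 - t)" by simp
    also have "\<dots> = - (\<delta>\<^sup>2 / 4)" by (simp add: t_def power2_eq_square field_simps)
    finally have "t * (1 - \<delta>) - t / (1 + t) \<le> - (\<delta>\<^sup>2 / 4)" .
    then have "(real (K - 1) * q) * (t * (1 - \<delta>) - t / (1 + t)) \<le> (real (K - 1) * q) * - (\<delta>\<^sup>2 / 4)"
      using q by (intro mult_left_mono) auto
    then show "t * ((1 - \<delta>) * (real (K - 1) * q)) - real (K - 1) * (q * (t / (1 + t))) \<le> - real (K - 1) * (strong_prob G * \<delta>\<^sup>2 / 4)"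
      by (simp add: q_def algebra_simps)
  qed
  finally show ?thesis .
qed

section \<open>The cooperative protocol\<close>

text \<open>The alternative \<open>M < w\<close> guarantees that \<open>LEAST\<close> has a witness;
  if no message passes the test, the default decision is 1.\<close>

definition first_msg :: "nat \<Rightarrow> (nat \<Rightarrow> bool) \<Rightarrow> nat" where
  "first_msg M T = (let w = (LEAST w. 1 \<le> w \<and> (T w \<or> M < w)) in if w \<le> M then w else 1)"

lemma first_msg_range: "1 \<le> M \<Longrightarrow> first_msg M T \<in> {1..M}"
proof -
  assume M: "1 \<le> M"
  have "1 \<le> (LEAST w. 1 \<le> w \<and> (T w \<or> M < w))"
    using LeastI[of "\<lambda>w. 1 \<le> w \<and> (T w \<or> M < w)" "M + 1"] by simp
  then show ?thesis using M by (simp add: first_msg_def Let_def)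
qed

lemma first_msg_eq:
  assumes "w \<in> {1..M}" "T w" "\<And>w'. w' \<in> {1..M} - {w} \<Longrightarrow> \<not> T w'"
  shows "first_msg M T = w"
proof -
  have "(LEAST w. 1 \<le> w \<and> (T w \<or> M < w)) = w"
  proof (rule Least_equality)
    show "1 \<le> w \<and> (T w \<or> M < w)" using assms by simp
    fix v assume "1 \<le> v \<and> (T v \<or> M < v)"
    then show "w \<le> v" using assms(1) assms(3)[of v] by (cases "v \<le> M") auto
  qed
  then show ?thesis using assms(1) by (simp add: first_msg_def)
qed

definition decode :: "'i set \<Rightarrow> 'j set \<Rightarrow> real \<Rightarrow> (nat \<Rightarrow> 'i \<Rightarrow> 'j \<Rightarrow> complex) \<Rightarrow> ('j \<Rightarrow> complex) set \<Rightarrow> nat \<Rightarrow> ('i \<Rightarrow> complex) \<Rightarrow> nat" where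
  "decode I J \<tau> cb A M y = first_msg M (\<lambda>w. \<exists>a\<in>A. (\<Sum>i\<in>I. (cmod (y i - (\<Sum>j\<in>J. a j * cb w i j)))\<^sup>2) \<le> real (card I) * \<tau>)"

lemma decode_range: "1 \<le> M \<Longrightarrow> decode I J \<tau> cb A M y \<in> {1..M}"
  unfolding decode_def by (rule first_msg_range)

lemma decode_cong:
  assumes "\<And>i. i \<in> I \<Longrightarrow> y i = y' i" shows "decode I J \<tau> cb A M y = decode I J \<tau> cb A M y'"
  unfolding decode_def using assms by (simp cong: sum.cong)

lemma decode_eq:
  assumes w: "w \<in> {1..M}" and a: "a \<in> A" and nc: "\<not> confused I J \<tau> M A a w cb z"
    and y: "\<And>i. i \<in> I \<Longrightarrow> y i = (\<Sum>j\<in>J. a j * cb w i j) + z i"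
  shows "decode I J \<tau> cb A M y = w"
proof -
  have "decode I J \<tau> cb A M y = decode I J \<tau> cb A M (\<lambda>i. (\<Sum>j\<in>J. a j * cb w i j) + z i)"
    by (rule decode_cong) (rule y)
  also have "\<dots> = w" unfolding decode_def
  proof (rule first_msg_eq[OF w])
    show "\<exists>a'\<in>A. (\<Sum>i\<in>I. (cmod ((\<Sum>j\<in>J. a j * cb w i j) + z i - (\<Sum>j\<in>J. a' j * cb w i j)))\<^sup>2) \<le> real (card I) * \<tau>"
      using nc a by (intro bexI[of _ a]) (auto simp: confused_def)
  qed (use nc in \<open>auto simp: confused_def\<close>)
  finally show ?thesis .
qed

text \<open>A receiver does not know which relays are transmitting, hence tests all subsets of them.\<close>

definition coalitions :: "nat \<Rightarrow> real \<Rightarrow> (nat \<Rightarrow> complex) \<Rightarrow> (nat \<Rightarrow> complex) set" where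
  "coalitions K s g = (\<lambda>S j. if j \<in> S then of_real s * g j else 0) ` Pow {1..K}"

text \<open>In the first \<open>n1\<close> slots the source sends a Gaussian codeword. Relays whose gain from the source
  reaches \<open>G\<close> decode it and spend the following \<open>n2\<close> slots sending independent Gaussian
  codewords for their estimates.\<close>

definition coop :: "nat \<Rightarrow> nat \<Rightarrow> nat \<Rightarrow> nat \<Rightarrow> real \<Rightarrow> real \<Rightarrow> real \<Rightarrow> real \<Rightarrow> real
    \<Rightarrow> (nat \<Rightarrow> nat \<Rightarrow> nat \<Rightarrow> complex) \<Rightarrow> (nat \<Rightarrow> nat \<Rightarrow> nat \<Rightarrow> complex) \<Rightarrow> protocol" where
  "coop K n1 n2 M G s1 s2 \<tau>1 \<tau>2 cb1 cb2 =
    \<lparr>src_on = \<lambda>i. 1 \<le> i \<and> i \<le> n1,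
     src_sym = \<lambda>i w u. of_real s1 * cb1 w i 0,
     switch = \<lambda>k t obs g u. t = n1 \<and> G \<le> (cmod (g 0))\<^sup>2,
     relay_sym = \<lambda>k i obs g u. of_real s2 * cb2 (decode {1..n1} {0} \<tau>1 cb1 {\<lambda>_. of_real s1 * g 0} M obs) i k,
     decide = \<lambda>k obs g u. if G \<le> (cmod (g 0))\<^sup>2 then decode {1..n1} {0} \<tau>1 cb1 {\<lambda>_. of_real s1 * g 0} M obs
       else decode {n1+1..n1+n2} {1..K} \<tau>2 cb2 (coalitions K s2 g) M obs\<rparr>"

text \<open>What relay \<open>k\<close> decodes, expressed by the sample point instead of a run: in
  the first phase the observation depends on the code, \<open>w\<close>, the gain from the source
  and the noise alone.\<close>

definition estimate :: "nat \<Rightarrow> nat \<Rightarrow> real \<Rightarrow> real \<Rightarrow> (nat \<Rightarrow> nat \<Rightarrow> nat \<Rightarrow> complex) \<Rightarrow> nat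
    \<Rightarrow> (nat \<times> nat \<Rightarrow> complex) \<Rightarrow> (nat \<times> nat \<Rightarrow> complex) \<Rightarrow> nat \<Rightarrow> nat" where
  "estimate n1 M s1 \<tau>1 cb1 w h z k = decode {1..n1} {0} \<tau>1 cb1 {\<lambda>_. of_real s1 * h (0, k)} M
     (\<lambda>i. of_real s1 * h (0, k) * cb1 w i 0 + z (k, i))"

definition coop_vec :: "nat \<Rightarrow> real \<Rightarrow> real \<Rightarrow> (nat \<times> nat \<Rightarrow> complex) \<Rightarrow> nat \<Rightarrow> nat \<Rightarrow> complex" where
  "coop_vec K G s h k j = (if j \<in> {1..K} \<and> j \<noteq> k \<and> G \<le> (cmod (h (0, j)))\<^sup>2 then of_real s * h (j, k) else 0)"

lemma coop_vec_energy: "(\<Sum>j=1..K. (cmod (coop_vec K G s h k j))\<^sup>2) = s\<^sup>2 * coop_gain K G h k"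
proof -
  have "(\<Sum>j=1..K. (cmod (coop_vec K G s h k j))\<^sup>2) = (\<Sum>j\<in>{1..K} - {k}. (cmod (coop_vec K G s h k j))\<^sup>2)"
    by (rule sum.mono_neutral_right) (auto simp: coop_vec_def)
  also have "\<dots> = s\<^sup>2 * coop_gain K G h k"
    unfolding coop_gain_def sum_distrib_left
    by (intro sum.cong) (auto simp: coop_vec_def norm_mult power_mult_distrib)
  finally show ?thesis .
qed

lemma coop_vec_coalitions: "coop_vec K G s h k \<in> coalitions K s (inc K h k)"
  unfolding coalitions_def coop_vec_def
  by (intro image_eqI[where x="{j\<in>{1..K}. j \<noteq> k \<and> G \<le> (cmod (h (0, j)))\<^sup>2}"]) (auto simp: inc_def fun_eq_iff)

lemma coalitions_bound: "finite (coalitions K s g)" "card (coalitions K s g) \<le> 2 ^ K"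
proof -
  show "finite (coalitions K s g)" by (simp add: coalitions_def)
  have "card (coalitions K s g) \<le> card (Pow {1..K})" unfolding coalitions_def by (rule card_image_le) simp
  then show "card (coalitions K s g) \<le> 2 ^ K" by (simp add: card_Pow)
qed

definition relayed :: "nat \<Rightarrow> nat \<Rightarrow> nat \<Rightarrow> real \<Rightarrow> real \<Rightarrow> real \<Rightarrow> real \<Rightarrow> (nat \<Rightarrow> nat \<Rightarrow> nat \<Rightarrow> complex) \<Rightarrow> (nat \<Rightarrow> nat \<Rightarrow> nat \<Rightarrow> complex)
    \<Rightarrow> nat \<Rightarrow> (nat \<times> nat \<Rightarrow> complex) \<Rightarrow> (nat \<times> nat \<Rightarrow> complex) \<Rightarrow> nat \<Rightarrow> nat \<Rightarrow> complex" where
  "relayed K n1 M G s1 s2 \<tau>1 cb1 cb2 w h z k i = (\<Sum>j\<in>{1..K}.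
     coop_vec K G s2 h k j * cb2 (estimate n1 M s1 \<tau>1 cb1 w h z j) i j) + z (k, i)"

section \<open>Runs of the cooperative protocol\<close>

context
  fixes K n1 n2 M :: nat and G s1 s2 \<tau>1 \<tau>2 :: real and cb1 cb2 :: "nat \<Rightarrow> nat \<Rightarrow> nat \<Rightarrow> complex"
  assumes K: "1 \<le> K" and n1: "1 \<le> n1" and n2: "1 \<le> n2" and M: "1 \<le> M"
begin

abbreviation "coop_prot \<equiv> coop K n1 n2 M G s1 s2 \<tau>1 \<tau>2 cb1 cb2"
abbreviation "coop_est w h z k \<equiv> estimate n1 M s1 \<tau>1 cb1 w h z k"

lemma inc_source: "k \<noteq> 0 \<Longrightarrow> inc K h k 0 = h (0, k)"
  by (simp add: inc_def)

lemma coop_switched: "k \<noteq> 0 \<Longrightarrow> switched coop_prot K h u H k i \<longleftrightarrow> n1 < i \<and> G \<le> (cmod (h (0, k)))\<^sup>2"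
  using n1 by (auto simp: switched_def coop_def inc_source)

lemma coop_sw_time: "k \<noteq> 0 \<Longrightarrow> G \<le> (cmod (h (0, k)))\<^sup>2 \<Longrightarrow> sw_time coop_prot K h u H k = n1"
  unfolding sw_time_def coop_def using n1 by (intro Least_equality) (auto simp: inc_source)

lemma coop_transmits: "transmits coop_prot K h u H k i \<longleftrightarrow>
    (if k = 0 then 1 \<le> i \<and> i \<le> n1 else k \<le> K \<and> n1 < i \<and> G \<le> (cmod (h (0, k)))\<^sup>2)"
  using coop_switched[of k h u H i] by (auto simp: transmits_def) (auto simp: coop_def)

lemma coop_yval1:
  assumes "1 \<le> i" "i \<le> n1" "k \<noteq> 0"
  shows "yval coop_prot K w h z u H i k = of_real s1 * h (0, k) * cb1 w i 0 + z (k, i)"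
proof -
  have "{j. j \<le> K \<and> j \<noteq> k \<and> transmits coop_prot K h u H j i} = {0}"
    using assms by (auto simp: coop_transmits split: if_splits)
  then show ?thesis by (simp add: yval_def symb_def coop_def)
qed

lemma coop_hist1:
  assumes i: "1 \<le> i" "i \<le> m" "i \<le> n1" "k \<noteq> 0"
  shows "hist coop_prot K w h z u m i k = of_real s1 * h (0, k) * cb1 w i 0 + z (k, i)"
proof -
  obtain i' where i': "i = Suc i'" using i by (cases i) auto
  have "hist coop_prot K w h z u m i k = hist coop_prot K w h z u i i k" by (rule hist_stable[OF i(2)])
  also have "\<dots> = yval coop_prot K w h z u (hist coop_prot K w h z u i') i k" by (simp add: i')
  finally show ?thesis using coop_yval1[OF i(1,3,4)] by simp
qed

lemma coop_decode1:
  assumes "n1 \<le> m" "k \<noteq> 0"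
  shows "decode {1..n1} {0} \<tau>1 cb1 {\<lambda>_. of_real s1 * inc K h k 0} M (trunc (hist coop_prot K w h z u m) k n1) = coop_est w h z k"
  unfolding estimate_def inc_source[OF assms(2)]
  by (rule decode_cong) (use assms in \<open>auto simp: trunc_def coop_hist1\<close>)

lemma coop_symb:
  assumes "n1 \<le> m" "k \<noteq> 0" "G \<le> (cmod (h (0, k)))\<^sup>2"
  shows "symb coop_prot K w h u (hist coop_prot K w h z u m) k i = of_real s2 * cb2 (coop_est w h z k) i k"
  unfolding symb_def coop_sw_time[of k h, OF assms(2,3)] using coop_decode1[OF assms(1,2)] assms(2)
  by (simp add: coop_def)

lemma coop_hist2:
  assumes i: "n1 < i" "i \<le> m" "k \<noteq> 0"
  shows "hist coop_prot K w h z u m i k = relayed K n1 M G s1 s2 \<tau>1 cb1 cb2 w h z k i"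
proof -
  obtain i' where i': "i = Suc i'" using i by (cases i) auto
  let ?H = "hist coop_prot K w h z u i'"
  have "hist coop_prot K w h z u m i k = hist coop_prot K w h z u i i k" by (rule hist_stable[OF i(2)])
  also have "\<dots> = yval coop_prot K w h z u ?H i k" by (simp add: i')
  also have "\<dots> = (\<Sum>j\<in>{j\<in>{1..K}. j \<noteq> k \<and> G \<le> (cmod (h (0, j)))\<^sup>2}. h (j, k) * (of_real s2 * cb2 (coop_est w h z j) i j)) + z (k, i)"
  proof -
    have "{j. j \<le> K \<and> j \<noteq> k \<and> transmits coop_prot K h u ?H j i} = {j\<in>{1..K}. j \<noteq> k \<and> G \<le> (cmod (h (0, j)))\<^sup>2}"
      using i by (auto simp: coop_transmits split: if_splits)
    moreover have "symb coop_prot K w h u ?H j i = of_real s2 * cb2 (coop_est w h z j) i j" if "j \<in> {j\<in>{1..K}. j \<noteq> k \<and> G \<le> (cmod (h (0, j)))\<^sup>2}" for j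
      using that i i' by (intro coop_symb) auto
    ultimately show ?thesis by (simp add: yval_def)
  qed
  also have "\<dots> = relayed K n1 M G s1 s2 \<tau>1 cb1 cb2 w h z k i"
    unfolding relayed_def by (subst sum.inter_filter) (auto intro!: sum.cong simp: coop_vec_def)
  finally show ?thesis .
qed

lemma coop_decision:
  assumes k: "k \<in> {1..K}"
  shows "decision coop_prot K (n1 + n2) (w, h, z, u) k = (if G \<le> (cmod (h (0, k)))\<^sup>2 then coop_est w h z k
    else decode {n1+1..n1+n2} {1..K} \<tau>2 cb2 (coalitions K s2 (inc K h k)) M (relayed K n1 M G s1 s2 \<tau>1 cb1 cb2 w h z k))"
proof -
  let ?H = "hist coop_prot K w h z u (n1 + n2)"
  have k0: "k \<noteq> 0" using k by simp
  show ?thesis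
  proof (cases "G \<le> (cmod (h (0, k)))\<^sup>2")
    case True
    then have "decision coop_prot K (n1 + n2) (w, h, z, u) k = decide coop_prot k (trunc ?H k n1) (inc K h k) u"
      using coop_switched[OF k0, of h u ?H "n1 + n2"] coop_sw_time[of k h, OF k0 True] n2 by (simp add: decision_def Let_def)
    also have "\<dots> = decode {1..n1} {0} \<tau>1 cb1 {\<lambda>_. of_real s1 * inc K h k 0} M (trunc ?H k n1)"
      using True inc_source[OF k0] by (simp add: coop_def)
    also have "\<dots> = coop_est w h z k" by (rule coop_decode1) (use k0 in auto)
    finally show ?thesis using True by simp
  next
    case False
    then have "decision coop_prot K (n1 + n2) (w, h, z, u) k = decide coop_prot k (trunc ?H k (n1 + n2)) (inc K h k) u"
      using coop_switched[OF k0, of h u ?H "n1 + n2"] by (simp add: decision_def Let_def)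
    also have "\<dots> = decode {n1+1..n1+n2} {1..K} \<tau>2 cb2 (coalitions K s2 (inc K h k)) M (trunc ?H k (n1 + n2))"
      using False inc_source[OF k0] by (simp add: coop_def)
    also have "\<dots> = decode {n1+1..n1+n2} {1..K} \<tau>2 cb2 (coalitions K s2 (inc K h k)) M (relayed K n1 M G s1 s2 \<tau>1 cb1 cb2 w h z k)"
      by (rule decode_cong) (use k0 in \<open>auto simp: trunc_def coop_hist2\<close>)
    finally show ?thesis using False by simp
  qed
qed

text \<open>Formulated with the estimates actually made, since the power constraint also counts
  outcomes in which relays are wrong.\<close>

lemma coop_power:
  "real (n1 + n2) * power coop_prot K (n1 + n2) (w, h, z, u) = (\<Sum>i=1..n1. s1\<^sup>2 * (cmod (cb1 w i 0))\<^sup>2)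
    + (\<Sum>i=n1+1..n1+n2. \<Sum>j=1..K. if G \<le> (cmod (h (0, j)))\<^sup>2 then s2\<^sup>2 * (cmod (cb2 (coop_est w h z j) i j))\<^sup>2 else 0)"
proof -
  define e where "e i = (\<Sum>k\<in>{k. k \<le> K \<and> transmits coop_prot K h u (hist coop_prot K w h z u (i - 1)) k i}. (cmod (symb coop_prot K w h u (hist coop_prot K w h z u (i - 1)) k i))\<^sup>2)" for i
  have e1: "e i = s1\<^sup>2 * (cmod (cb1 w i 0))\<^sup>2" if "i \<in> {1..n1}" for i
  proof -
    have "{k. k \<le> K \<and> transmits coop_prot K h u (hist coop_prot K w h z u (i - 1)) k i} = {0}"
      using that by (auto simp: coop_transmits split: if_splits)
    then show ?thesis unfolding e_def by (simp add: symb_def) (simp add: coop_def norm_mult power_mult_distrib)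
  qed
  have e2: "e i = (\<Sum>j=1..K. if G \<le> (cmod (h (0, j)))\<^sup>2 then s2\<^sup>2 * (cmod (cb2 (coop_est w h z j) i j))\<^sup>2 else 0)" if "i \<in> {n1+1..n1+n2}" for i
  proof -
    have "{k. k \<le> K \<and> transmits coop_prot K h u (hist coop_prot K w h z u (i - 1)) k i} = {j\<in>{1..K}. G \<le> (cmod (h (0, j)))\<^sup>2}"
      using that by (auto simp: coop_transmits split: if_splits)
    moreover have "(cmod (symb coop_prot K w h u (hist coop_prot K w h z u (i - 1)) j i))\<^sup>2 = s2\<^sup>2 * (cmod (cb2 (coop_est w h z j) i j))\<^sup>2"
      if j: "j \<in> {j\<in>{1..K}. G \<le> (cmod (h (0, j)))\<^sup>2}" for j
    proof -
      have "symb coop_prot K w h u (hist coop_prot K w h z u (i - 1)) j i = of_real s2 * cb2 (coop_est w h z j) i j"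
        by (rule coop_symb) (use j \<open>i \<in> {n1+1..n1+n2}\<close> in auto)
      then show ?thesis by (simp add: norm_mult power_mult_distrib)
    qed
    ultimately have "e i = (\<Sum>j\<in>{j\<in>{1..K}. G \<le> (cmod (h (0, j)))\<^sup>2}. s2\<^sup>2 * (cmod (cb2 (coop_est w h z j) i j))\<^sup>2)"
      unfolding e_def by simp
    then show ?thesis by (subst (asm) sum.inter_filter) auto
  qed
  have "real (n1 + n2) * power coop_prot K (n1 + n2) (w, h, z, u) = (\<Sum>i=1..n1+n2. e i)"
    using n1 by (simp add: power_def e_def Let_def)
  also have "{1..n1+n2} = {1..n1} \<union> {n1+1..n1+n2}" by auto
  also have "(\<Sum>i\<in>\<dots>. e i) = (\<Sum>i\<in>{1..n1}. e i) + (\<Sum>i\<in>{n1+1..n1+n2}. e i)" by (rule sum.union_disjoint) auto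
  finally show ?thesis using e1 e2 by simp
qed

text \<open>Once every strong relay has decoded \<open>w\<close>, the relays jointly send the
  codeword of \<open>w\<close> through the vector \<open>coop_vec\<close>, which is among the tested
  \<open>coalitions\<close>. The second phase is then an ordinary decoding problem.\<close>

lemma coop_correct:
  assumes w: "w \<in> {1..M}"
    and ok1: "\<And>k. k \<in> {1..K} \<Longrightarrow> G \<le> (cmod (h (0, k)))\<^sup>2 \<Longrightarrow>
      \<not> confused {1..n1} {0} \<tau>1 M {\<lambda>_. of_real s1 * h (0, k)} (\<lambda>_. of_real s1 * h (0, k)) w cb1 (\<lambda>i. z (k, i))"
    and ok2: "\<And>k. k \<in> {1..K} \<Longrightarrow> \<not> confused {n1+1..n1+n2} {1..K} \<tau>2 M (coalitions K s2 (inc K h k)) (coop_vec K G s2 h k) w cb2 (\<lambda>i. z (k, i))"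
    and k: "k \<in> {1..K}"
  shows "decision coop_prot K (n1 + n2) (w, h, z, u) k = w"
proof -
  have est: "coop_est w h z j = w" if j: "j \<in> {1..K}" "G \<le> (cmod (h (0, j)))\<^sup>2" for j
    unfolding estimate_def by (rule decode_eq[OF w _ ok1[OF j]]) auto
  have "decode {n1+1..n1+n2} {1..K} \<tau>2 cb2 (coalitions K s2 (inc K h k)) M (relayed K n1 M G s1 s2 \<tau>1 cb1 cb2 w h z k) = w"
    by (rule decode_eq[OF w coop_vec_coalitions ok2[OF k]]) (use est in \<open>auto simp: relayed_def coop_vec_def intro!: sum.cong\<close>)
  then show ?thesis unfolding coop_decision[OF k] using est[OF k] by simp
qed

end

section \<open>Measurability in gains, noise and codebooks\<close>

lemma borel_le_pred:
  fixes f g :: "'a \<Rightarrow> real"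
  shows "f \<in> borel_measurable N \<Longrightarrow> g \<in> borel_measurable N \<Longrightarrow> Measurable.pred N (\<lambda>x. f x \<le> g x)"
  unfolding pred_def by (rule borel_measurable_le)

lemma first_msg_measurable:
  assumes T: "\<And>w. Measurable.pred N (\<lambda>x. T x w)"
  shows "(\<lambda>x. first_msg M (T x)) \<in> N \<rightarrow>\<^sub>M count_space UNIV"
proof -
  have L: "(\<lambda>x. LEAST w. 1 \<le> w \<and> (T x w \<or> M < w)) \<in> N \<rightarrow>\<^sub>M count_space UNIV"
  proof (rule measurable_Least)
    fix w
    show "Measurable.pred N (\<lambda>x. 1 \<le> w \<and> (T x w \<or> M < w))"
      by (intro pred_intros_logic(3,5) T) auto
  qed
  have "(\<lambda>w. if w \<le> M then w else 1) \<in> count_space UNIV \<rightarrow>\<^sub>M count_space UNIV" by simp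
  from measurable_compose[OF L this] show ?thesis unfolding first_msg_def Let_def .
qed

text \<open>The decoder's family of gain vectors depends on the gains and is therefore given as an image.\<close>

context
  fixes N :: "'x measure" and y :: "'x \<Rightarrow> nat \<Rightarrow> complex" and cb :: "'x \<Rightarrow> nat \<Rightarrow> nat \<Rightarrow> nat \<Rightarrow> complex"
    and \<alpha> :: "'s \<Rightarrow> 'x \<Rightarrow> nat \<Rightarrow> complex" and S :: "'s set"
  assumes S: "finite S"
    and ym: "\<And>i. (\<lambda>x. y x i) \<in> borel_measurable N"
    and cbm: "\<And>w i j. (\<lambda>x. cb x w i j) \<in> borel_measurable N"
    and \<alpha>m: "\<And>s j. (\<lambda>x. \<alpha> s x j) \<in> borel_measurable N"
begin

lemma decode_measurable: "(\<lambda>x. decode I J \<tau> (cb x) ((\<lambda>s. \<alpha> s x) ` S) M (y x)) \<in> N \<rightarrow>\<^sub>M count_space UNIV"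
  unfolding decode_def
proof (rule first_msg_measurable)
  fix w
  note mI = borel_measurable_const borel_measurable_sum borel_measurable_power measurable_compose[OF _ borel_measurable_norm]
    borel_measurable_add borel_measurable_diff borel_measurable_times ym cbm \<alpha>m
  have "Measurable.pred N (\<lambda>x. \<exists>s\<in>S. (\<Sum>i\<in>I. (cmod (y x i - (\<Sum>j\<in>J. \<alpha> s x j * cb x w i j)))\<^sup>2) \<le> real (card I) * \<tau>)"
    by (intro pred_intros_finite(4) S borel_le_pred mI)
  then show "Measurable.pred N (\<lambda>x. \<exists>a\<in>(\<lambda>s. \<alpha> s x) ` S. (\<Sum>i\<in>I. (cmod (y x i - (\<Sum>j\<in>J. a j * cb x w i j)))\<^sup>2) \<le> real (card I) * \<tau>)"
    by simp
qed

lemma confused_measurable: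
  assumes am: "\<And>j. (\<lambda>x. a x j) \<in> borel_measurable N"
  shows "Measurable.pred N (\<lambda>x. confused I J \<tau> M ((\<lambda>s. \<alpha> s x) ` S) (a x) w (cb x) (y x))"
proof -
  note mI = borel_measurable_const borel_measurable_sum borel_measurable_power measurable_compose[OF _ borel_measurable_norm]
    borel_measurable_add borel_measurable_diff borel_measurable_times ym cbm \<alpha>m am
  have 1: "Measurable.pred N (\<lambda>x. real (card I) * \<tau> < (\<Sum>i\<in>I. (cmod (y x i))\<^sup>2))"
    by (intro borel_measurable_pred_less mI)
  have 2: "Measurable.pred N (\<lambda>x. \<exists>w'\<in>{1..M} - {w}. \<exists>s\<in>S. (\<Sum>i\<in>I. (cmod ((\<Sum>j\<in>J. a x j * cb x w i j) + y x i - (\<Sum>j\<in>J. \<alpha> s x j * cb x w' i j)))\<^sup>2) \<le> real (card I) * \<tau>)"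
    by (intro pred_intros_finite(4) S finite_Diff finite_atLeastAtMost borel_le_pred mI)
  show ?thesis using pred_intros_logic(5)[OF 1 2] unfolding confused_def by simp
qed

end

context
  fixes N :: "'x measure" and h z :: "'x \<Rightarrow> nat \<times> nat \<Rightarrow> complex" and cb1 cb2 :: "'x \<Rightarrow> nat \<Rightarrow> nat \<Rightarrow> nat \<Rightarrow> complex"
  assumes hm [measurable]: "\<And>p. (\<lambda>x. h x p) \<in> borel_measurable N"
    and zm [measurable]: "\<And>p. (\<lambda>x. z x p) \<in> borel_measurable N"
    and c1m [measurable]: "\<And>w i j. (\<lambda>x. cb1 x w i j) \<in> borel_measurable N"
    and c2m [measurable]: "\<And>w i j. (\<lambda>x. cb2 x w i j) \<in> borel_measurable N"
begin

lemma estimate_measurable: "(\<lambda>x. estimate n1 M s1 \<tau>1 (cb1 x) w (h x) (z x) k) \<in> N \<rightarrow>\<^sub>M count_space UNIV"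
proof -
  have "(\<lambda>x. decode {1..n1} {0} \<tau>1 (cb1 x) ((\<lambda>s. (\<lambda>_. of_real s1 * h x (0, k))) ` {()}) M (\<lambda>i. of_real s1 * h x (0, k) * cb1 x w i 0 + z x (k, i)))
    \<in> N \<rightarrow>\<^sub>M count_space UNIV"
    by (rule decode_measurable) (simp_all, measurable)
  then show ?thesis unfolding estimate_def by simp
qed

lemma coop_vec_measurable [measurable]: "(\<lambda>x. coop_vec K G s (h x) k j) \<in> borel_measurable N"
  unfolding coop_vec_def by measurable

lemma coop_gain_measurable [measurable]: "(\<lambda>x. coop_gain K G (h x) k) \<in> borel_measurable N"
  unfolding coop_gain_def by measurable

lemma sent_measurable [measurable]: "(\<lambda>x. cb2 x (estimate n1 M s1 \<tau>1 (cb1 x) w (h x) (z x) k) i j) \<in> borel_measurable N"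
  by (rule measurable_compose_countable[OF c2m estimate_measurable])

lemma relayed_measurable: "(\<lambda>x. relayed K n1 M G s1 s2 \<tau>1 (cb1 x) (cb2 x) w (h x) (z x) k i) \<in> borel_measurable N"
  unfolding relayed_def by measurable

lemma coalition_vec_measurable: "(\<lambda>x. if j \<in> S then of_real s * inc K (h x) k j else 0) \<in> borel_measurable N"
  unfolding inc_def by measurable

lemma decode2_measurable:
  "(\<lambda>x. decode I J \<tau> (cb2 x) (coalitions K s (inc K (h x) k)) M (relayed K n1 M G s1 s2 \<tau>1 (cb1 x) (cb2 x) w (h x) (z x) k)) \<in> N \<rightarrow>\<^sub>M count_space UNIV"
  unfolding coalitions_def
  by (rule decode_measurable, simp, rule relayed_measurable, rule c2m, rule coalition_vec_measurable)

lemma confused1_measurable: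
  "Measurable.pred N (\<lambda>x. confused {1..n1} {0} \<tau> M {\<lambda>_. of_real s1 * h x (0, k)} (\<lambda>_. of_real s1 * h x (0, k)) w (cb1 x) (\<lambda>i. z x (k, i)))"
proof -
  have "Measurable.pred N (\<lambda>x. confused {1..n1} {0} \<tau> M ((\<lambda>s. (\<lambda>_. of_real s1 * h x (0, k))) ` {()}) (\<lambda>_. of_real s1 * h x (0, k)) w (cb1 x) (\<lambda>i. z x (k, i)))"
    by (rule confused_measurable) (simp_all, measurable)
  then show ?thesis by simp
qed

lemma confused2_measurable:
  "Measurable.pred N (\<lambda>x. confused I J \<tau> M (coalitions K s (inc K (h x) k)) (coop_vec K G s (h x) k) w (cb2 x) (\<lambda>i. z x (k, i)))"
  unfolding coalitions_def
  by (rule confused_measurable, simp, rule zm, rule c2m, rule coalition_vec_measurable, rule coop_vec_measurable)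

end

section \<open>Averaging over the codebooks\<close>

abbreviation gain_space :: "nat \<Rightarrow> (nat \<times> nat \<Rightarrow> complex) measure" where
  "gain_space K \<equiv> PiM (gain_idx K) (\<lambda>_. cgauss 1)"

abbreviation noise_space :: "real \<Rightarrow> nat \<Rightarrow> nat \<Rightarrow> (nat \<times> nat \<Rightarrow> complex) measure" where
  "noise_space N0 K n \<equiv> PiM (noise_idx K n) (\<lambda>_. cgauss N0)"

text \<open>For quantities that ignore the seed, as all those of \<open>coop\<close> do, the sample
  space reduces to an average over messages and an integral over gains and noise.\<close>

lemma nn_integral_netspace_seedless:
  assumes N0: "0 < N0" and M: "1 \<le> M"
    and f: "\<And>w. f w \<in> borel_measurable (gain_space K \<Otimes>\<^sub>M noise_space N0 K n)"
    and F: "\<And>w h z u. F (w, h, z, u) = f w (h, z)"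
  shows "F \<in> borel_measurable (netspace N0 K n M)"
    and "(\<integral>\<^sup>+\<omega>. F \<omega> \<partial>netspace N0 K n M) = ennreal (1 / real M) * (\<Sum>w=1..M. \<integral>\<^sup>+y. f w y \<partial>(gain_space K \<Otimes>\<^sub>M noise_space N0 K n))"
proof -
  let ?H = "gain_space K" and ?Z = "noise_space N0 K n" and ?U = "uniform_measure lborel {0..1::real}"
  interpret H: prob_space ?H by (rule prob_space_PiM_cgauss) simp
  interpret Z: prob_space ?Z by (rule prob_space_PiM_cgauss) (rule N0)
  interpret U: prob_space ?U by (rule prob_space_uniform01)
  interpret ZU: pair_prob_space ?Z ?U ..
  interpret HZU: pair_prob_space ?H "?Z \<Otimes>\<^sub>M ?U" ..
  have m: "(\<lambda>p. F (w, p)) \<in> borel_measurable (?H \<Otimes>\<^sub>M ?Z \<Otimes>\<^sub>M ?U)" for w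
  proof -
    have "(\<lambda>p. (fst p, fst (snd p))) \<in> ?H \<Otimes>\<^sub>M ?Z \<Otimes>\<^sub>M ?U \<rightarrow>\<^sub>M ?H \<Otimes>\<^sub>M ?Z"
      by (intro measurable_Pair measurable_fst measurable_compose[OF measurable_snd measurable_fst])
    from measurable_compose[OF this f[of w]] show ?thesis
      by (rule measurable_cong[THEN iffD1, rotated]) (auto simp: F)
  qed
  have "F \<in> borel_measurable (count_space UNIV \<Otimes>\<^sub>M (?H \<Otimes>\<^sub>M ?Z \<Otimes>\<^sub>M ?U))"
    by (rule measurable_pair_measure_countable1) (auto intro: m)
  then show Fm: "F \<in> borel_measurable (netspace N0 K n M)"
    unfolding netspace_def by (subst measurable_cong_sets[OF sets_pair_measure_cong[OF _ refl] refl]) auto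
  have w: "(\<integral>\<^sup>+p. F (w, p) \<partial>(?H \<Otimes>\<^sub>M ?Z \<Otimes>\<^sub>M ?U)) = (\<integral>\<^sup>+y. f w y \<partial>(?H \<Otimes>\<^sub>M ?Z))" for w
  proof -
    have "(\<integral>\<^sup>+p. F (w, p) \<partial>(?H \<Otimes>\<^sub>M ?Z \<Otimes>\<^sub>M ?U)) = (\<integral>\<^sup>+h. \<integral>\<^sup>+q. F (w, h, q) \<partial>(?Z \<Otimes>\<^sub>M ?U) \<partial>?H)"
      by (rule ZU.P.nn_integral_fst[symmetric, OF m])
    also have "\<dots> = (\<integral>\<^sup>+h. \<integral>\<^sup>+z. f w (h, z) \<partial>?Z \<partial>?H)"
    proof (intro nn_integral_cong)
      fix h assume h: "h \<in> space ?H"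
      have "(\<integral>\<^sup>+q. F (w, h, q) \<partial>(?Z \<Otimes>\<^sub>M ?U)) = (\<integral>\<^sup>+z. \<integral>\<^sup>+u. F (w, h, z, u) \<partial>?U \<partial>?Z)"
        by (rule U.nn_integral_fst[symmetric]) (rule measurable_compose[OF measurable_Pair1'[OF h] m])
      then show "(\<integral>\<^sup>+q. F (w, h, q) \<partial>(?Z \<Otimes>\<^sub>M ?U)) = (\<integral>\<^sup>+z. f w (h, z) \<partial>?Z)"
        by (simp only: F nn_integral_const U.emeasure_space_1 mult_1_right)
    qed
    also have "\<dots> = (\<integral>\<^sup>+y. f w y \<partial>(?H \<Otimes>\<^sub>M ?Z))" by (rule Z.nn_integral_fst[OF f])
    finally show ?thesis .
  qed
  have "(\<integral>\<^sup>+\<omega>. F \<omega> \<partial>netspace N0 K n M) = (\<integral>\<^sup>+w. \<integral>\<^sup>+p. F (w, p) \<partial>(?H \<Otimes>\<^sub>M ?Z \<Otimes>\<^sub>M ?U) \<partial>measure_pmf (pmf_of_set {1..M}))"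
    unfolding netspace_def by (rule HZU.nn_integral_fst[symmetric]) (rule Fm[unfolded netspace_def])
  also have "\<dots> = (\<Sum>w=1..M. \<integral>\<^sup>+p. F (w, p) \<partial>(?H \<Otimes>\<^sub>M ?Z \<Otimes>\<^sub>M ?U)) / real M"
    using M by (subst nn_integral_pmf_of_set) (auto simp: ennreal_of_nat_eq_real_of_nat)
  also have "\<dots> = ennreal (1 / real M) * (\<Sum>w=1..M. \<integral>\<^sup>+p. F (w, p) \<partial>(?H \<Otimes>\<^sub>M ?Z \<Otimes>\<^sub>M ?U))"
    using M by (simp add: divide_ennreal_def inverse_ennreal inverse_eq_divide mult.commute)
  finally show "(\<integral>\<^sup>+\<omega>. F \<omega> \<partial>netspace N0 K n M) = ennreal (1 / real M) * (\<Sum>w=1..M. \<integral>\<^sup>+y. f w y \<partial>(?H \<Otimes>\<^sub>M ?Z))"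
    unfolding w .
qed

lemma nn_integral_PiM_component:
  assumes s: "0 < s" and p: "p \<in> L" and f: "f \<in> borel_measurable borel"
  shows "(\<integral>\<^sup>+h. f (h p) \<partial>PiM L (\<lambda>_. cgauss s)) = (\<integral>\<^sup>+x. f x \<partial>cgauss s)"
proof -
  have "cgauss s = distr (PiM L (\<lambda>_. cgauss s)) (cgauss s) (\<lambda>h. h p)"
    using p by (intro distr_PiM_component[symmetric] prob_space_cgauss s)
  then have "(\<integral>\<^sup>+x. f x \<partial>cgauss s) = (\<integral>\<^sup>+x. f x \<partial>distr (PiM L (\<lambda>_. cgauss s)) (cgauss s) (\<lambda>h. h p))" by (simp only:)
  also have "\<dots> = (\<integral>\<^sup>+h. f (h p) \<partial>PiM L (\<lambda>_. cgauss s))"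
    by (rule nn_integral_distr[OF measurable_component_singleton[OF p]])
      (simp only: f measurable_cong_sets[OF sets_distr[THEN trans, OF sets_cgauss] refl] measurable_cong_sets[OF sets_cgauss refl])
  finally show ?thesis ..
qed

text \<open>An entry is the signal received from a unit vector, so the bound on mean received energy
  gives its second moment.\<close>

lemma codebook_entry_power:
  assumes w: "w \<in> {1..M}" and i: "i \<in> I" and j: "j \<in> J" and J: "finite J"
  shows "(\<integral>\<^sup>+cb. ennreal ((cmod (cb w i j))\<^sup>2) \<partial>codebook_space M I J) \<le> 1"
proof -
  interpret P: prob_space "PiM J (\<lambda>_. cgauss 1)" by (rule prob_space_PiM_cgauss) simp
  have m: "(\<lambda>c. ennreal ((cmod (c i j))\<^sup>2)) \<in> borel_measurable (codeword_space I J)"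
    by (intro measurable_compose[OF _ measurable_ennreal] borel_measurable_power measurable_compose[OF _ borel_measurable_norm] codeword_entry_measurable)
  have m1: "(\<lambda>x. ennreal ((cmod (x j))\<^sup>2)) \<in> borel_measurable (PiM J (\<lambda>_. cgauss 1))"
    by (intro measurable_compose[OF _ measurable_ennreal] borel_measurable_power measurable_compose[OF _ borel_measurable_norm] PiM_cgauss_component_measurable)
  have "(\<integral>\<^sup>+cb. ennreal ((cmod (cb w i j))\<^sup>2) \<partial>codebook_space M I J) = (\<integral>\<^sup>+c. ennreal ((cmod (c i j))\<^sup>2) \<partial>codeword_space I J)"
    by (rule nn_integral_codebook_component[OF w m])
  also have "\<dots> = (\<integral>\<^sup>+x. ennreal ((cmod (x j))\<^sup>2) \<partial>PiM J (\<lambda>_. cgauss 1))"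
  proof -
    have "PiM J (\<lambda>_. cgauss 1) = distr (codeword_space I J) (PiM J (\<lambda>_. cgauss 1)) (\<lambda>c. c i)"
      unfolding codeword_space_def using i by (intro distr_PiM_component[symmetric] P.prob_space_axioms)
    then have "(\<integral>\<^sup>+x. ennreal ((cmod (x j))\<^sup>2) \<partial>PiM J (\<lambda>_. cgauss 1))
      = (\<integral>\<^sup>+x. ennreal ((cmod (x j))\<^sup>2) \<partial>distr (codeword_space I J) (PiM J (\<lambda>_. cgauss 1)) (\<lambda>c. c i))" by (simp only:)
    also have "\<dots> = (\<integral>\<^sup>+c. ennreal ((cmod (c i j))\<^sup>2) \<partial>codeword_space I J)"
      unfolding codeword_space_def
      by (rule nn_integral_distr[OF measurable_component_singleton[OF i]]) (simp only: m1 measurable_distr_eq1)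
    finally show ?thesis ..
  qed
  also have "\<dots> = (\<integral>\<^sup>+x. ennreal ((cmod (recv J (\<lambda>_ j'. if j' = j then 1 else 0) x 0))\<^sup>2) \<partial>PiM J (\<lambda>_. cgauss 1))"
    using j J by (intro nn_integral_cong) (simp add: recv_def if_distrib if_distribR cong: if_cong)
  also have "\<dots> \<le> ennreal (energy J (\<lambda>_ j'. if j' = j then 1 else 0) 0)" by (rule nn_integral_recv_sq_le[OF J])
  also have "\<dots> = 1" using j J by (simp add: energy_def if_distrib if_distribR cong: if_cong)
  finally show ?thesis .
qed

lemma confused_cong:
  assumes "\<And>i. i \<in> I \<Longrightarrow> z i = z' i"
  shows "confused I J \<tau> M A a w cb z \<longleftrightarrow> confused I J \<tau> M A a w cb z'"
  unfolding confused_def using assms by (simp cong: sum.cong)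

lemma nn_integral_confused_node:
  fixes I J :: "nat set"
  assumes N0: "0 < N0" and k: "k \<in> {1..K}" and I: "I \<subseteq> {1..n}" and A: "finite A"
  shows "(\<integral>\<^sup>+z. \<integral>\<^sup>+cb. indicator {cb. confused I J \<tau> M A a w cb (\<lambda>i. z (k, i))} cb \<partial>codebook_space M I J \<partial>noise_space N0 K n)
    = (\<integral>\<^sup>+z. \<integral>\<^sup>+cb. indicator {cb. confused I J \<tau> M A a w cb z} cb \<partial>codebook_space M I J \<partial>PiM I (\<lambda>_. cgauss N0))"
proof -
  let ?C = "codebook_space M I J" and ?Z = "PiM I (\<lambda>_. cgauss N0)"
  interpret C: prob_space ?C by (rule prob_space_codebook_space)
  define \<phi> where "\<phi> z = (\<integral>\<^sup>+cb. indicator {cb. confused I J \<tau> M A a w cb z} cb \<partial>?C)" for z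
  have "Measurable.pred (?Z \<Otimes>\<^sub>M ?C) (\<lambda>x. confused I J \<tau> M ((\<lambda>s. s) ` A) a w (snd x) (fst x))"
    by (rule confused_measurable[OF A]) (intro borel_measurable_const measurable_compose[OF measurable_fst PiM_cgauss_component_measurable]
      measurable_compose[OF measurable_snd codebook_entry_measurable])+
  then have "(\<lambda>x. indicator {x. confused I J \<tau> M A a w (snd x) (fst x)} x :: ennreal) \<in> borel_measurable (?Z \<Otimes>\<^sub>M ?C)"
    unfolding pred_def image_ident by (intro borel_measurable_indicator') (simp only: mem_Collect_eq)
  from C.borel_measurable_nn_integral_fst[OF this] have \<phi>m: "\<phi> \<in> borel_measurable ?Z"
    unfolding \<phi>_def by (rule measurable_cong[THEN iffD1, rotated]) (auto intro!: nn_integral_cong simp: indicator_def)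
  have "(\<integral>\<^sup>+z. \<phi> (\<lambda>i. z (k, i)) \<partial>noise_space N0 K n) = (\<integral>\<^sup>+z. \<phi> (\<lambda>i\<in>I. z (k, i)) \<partial>noise_space N0 K n)"
  proof (intro nn_integral_cong)
    fix z
    have "confused I J \<tau> M A a w cb (\<lambda>i. z (k, i)) \<longleftrightarrow> confused I J \<tau> M A a w cb (\<lambda>i\<in>I. z (k, i))" for cb
      by (rule confused_cong) simp
    then show "\<phi> (\<lambda>i. z (k, i)) = \<phi> (\<lambda>i\<in>I. z (k, i))" unfolding \<phi>_def by (simp only:)
  qed
  also have "\<dots> = (\<integral>\<^sup>+z. \<phi> z \<partial>?Z)"
    by (rule nn_integral_PiM_project[OF N0 _ _ \<phi>m]) (use k I in \<open>auto simp: inj_on_def noise_idx_def\<close>)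
  finally show ?thesis unfolding \<phi>_def .
qed

lemma nn_integral_pair_pair:
  assumes "sigma_finite_measure A" "sigma_finite_measure B" "sigma_finite_measure C" "sigma_finite_measure D"
    and F: "F \<in> borel_measurable ((A \<Otimes>\<^sub>M B) \<Otimes>\<^sub>M (C \<Otimes>\<^sub>M D))"
  shows "(\<integral>\<^sup>+x. F x \<partial>((A \<Otimes>\<^sub>M B) \<Otimes>\<^sub>M (C \<Otimes>\<^sub>M D))) = (\<integral>\<^sup>+c. \<integral>\<^sup>+d. \<integral>\<^sup>+a. \<integral>\<^sup>+b. F ((a, b), (c, d)) \<partial>B \<partial>A \<partial>D \<partial>C)"
proof -
  interpret A: sigma_finite_measure A by fact
  interpret B: sigma_finite_measure B by fact
  interpret C: sigma_finite_measure C by fact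
  interpret D: sigma_finite_measure D by fact
  interpret AB: pair_sigma_finite A B ..
  interpret CD: pair_sigma_finite C D ..
  interpret Q: pair_sigma_finite "A \<Otimes>\<^sub>M B" "C \<Otimes>\<^sub>M D" ..
  have s: "(\<lambda>\<theta>. F (\<theta>, y)) \<in> borel_measurable (A \<Otimes>\<^sub>M B)" if "y \<in> space (C \<Otimes>\<^sub>M D)" for y
    by (rule measurable_compose[OF measurable_Pair2'[OF that] F])
  have F': "(\<lambda>(y, \<theta>). F (\<theta>, y)) \<in> borel_measurable ((C \<Otimes>\<^sub>M D) \<Otimes>\<^sub>M (A \<Otimes>\<^sub>M B))"
    using F by (rule measurable_pair_swap)
  have g: "(\<lambda>y. \<integral>\<^sup>+\<theta>. F (\<theta>, y) \<partial>(A \<Otimes>\<^sub>M B)) \<in> borel_measurable (C \<Otimes>\<^sub>M D)"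
    using AB.borel_measurable_nn_integral_fst[OF F'] by simp
  have "(\<integral>\<^sup>+x. F x \<partial>((A \<Otimes>\<^sub>M B) \<Otimes>\<^sub>M (C \<Otimes>\<^sub>M D))) = (\<integral>\<^sup>+y. \<integral>\<^sup>+\<theta>. F (\<theta>, y) \<partial>(A \<Otimes>\<^sub>M B) \<partial>(C \<Otimes>\<^sub>M D))"
    by (rule Q.nn_integral_snd[symmetric]) (use F in simp)
  also have "\<dots> = (\<integral>\<^sup>+c. \<integral>\<^sup>+d. \<integral>\<^sup>+\<theta>. F (\<theta>, (c, d)) \<partial>(A \<Otimes>\<^sub>M B) \<partial>D \<partial>C)"
    by (rule D.nn_integral_fst[symmetric, OF g])
  also have "\<dots> = (\<integral>\<^sup>+c. \<integral>\<^sup>+d. \<integral>\<^sup>+a. \<integral>\<^sup>+b. F ((a, b), (c, d)) \<partial>B \<partial>A \<partial>D \<partial>C)"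
    by (intro nn_integral_cong B.nn_integral_fst[symmetric] s) (simp add: space_pair_measure)
  finally show ?thesis .
qed

text \<open>A single code must meet the power constraint and fail rarely at the same time. If no
  \<theta> did, \<open>g \<theta> / P\<close> plus \<open>\<gamma> / (2 * F)\<close> times
  \<open>f \<theta>\<close> would be at least 1 everywhere, but its mean is at most
  \<open>1 - \<gamma> / 2\<close>. The reserve \<gamma> in the mean power is paid back by the factor
  \<open>2 / \<gamma>\<close> in the failure bound.\<close>

lemma exists_below_averages:
  assumes T: "prob_space T" and f: "f \<in> borel_measurable T" and g: "g \<in> borel_measurable T"
    and F: "(\<integral>\<^sup>+\<theta>. f \<theta> \<partial>T) \<le> ennreal F" "0 < F" and P: "0 < (P::real)" and \<gamma>: "0 < \<gamma>" "\<gamma> < 1"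
    and Gb: "(\<integral>\<^sup>+\<theta>. g \<theta> \<partial>T) \<le> ennreal ((1 - \<gamma>) * P)"
  shows "\<exists>\<theta>. g \<theta> \<le> ennreal P \<and> f \<theta> \<le> ennreal (2 * F / \<gamma>)"
proof (rule ccontr)
  assume n: "\<not> ?thesis"
  interpret T: prob_space T by fact
  let ?a = "ennreal (1 / P)" and ?b = "ennreal (\<gamma> / (2 * F))"
  have 1: "1 \<le> ?a * g \<theta> + ?b * f \<theta>" for \<theta>
  proof -
    consider "ennreal P \<le> g \<theta>" | "ennreal (2 * F / \<gamma>) \<le> f \<theta>" using n by (meson linear)
    then show ?thesis
    proof cases
      case 1
      have "1 = ?a * ennreal P" using P by (simp add: ennreal_mult[symmetric])
      also have "\<dots> \<le> ?a * g \<theta>" using 1 by (intro mult_left_mono) auto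
      finally show ?thesis by (rule add_increasing2[OF zero_le])
    next
      case 2
      have "1 = ?b * ennreal (2 * F / \<gamma>)" using F \<gamma> by (simp add: ennreal_mult[symmetric])
      also have "\<dots> \<le> ?b * f \<theta>" using 2 by (intro mult_left_mono) auto
      finally show ?thesis by (rule add_increasing[OF zero_le])
    qed
  qed
  have "1 = (\<integral>\<^sup>+\<theta>. 1 \<partial>T)" by (simp add: T.emeasure_space_1)
  also have "\<dots> \<le> (\<integral>\<^sup>+\<theta>. ?a * g \<theta> + ?b * f \<theta> \<partial>T)" by (rule nn_integral_mono) (rule 1)
  also have "\<dots> = ?a * (\<integral>\<^sup>+\<theta>. g \<theta> \<partial>T) + ?b * (\<integral>\<^sup>+\<theta>. f \<theta> \<partial>T)"
    using f g by (simp add: nn_integral_add nn_integral_cmult)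
  also have "\<dots> \<le> ?a * ennreal ((1 - \<gamma>) * P) + ?b * ennreal F"
    using F Gb by (intro add_mono mult_left_mono) auto
  also have "\<dots> = ennreal (1 - \<gamma> + \<gamma> / 2)"
    using P F \<gamma> by (simp add: ennreal_mult[symmetric] ennreal_plus[symmetric] del: ennreal_plus)
  finally show False using \<gamma> by simp
qed

context
  fixes N :: "'x measure" and h z :: "'x \<Rightarrow> nat \<times> nat \<Rightarrow> complex" and cb1 cb2 :: "'x \<Rightarrow> nat \<Rightarrow> nat \<Rightarrow> nat \<Rightarrow> complex"
    and K n1 n2 M :: nat
  assumes hm [measurable]: "\<And>p. (\<lambda>x. h x p) \<in> borel_measurable N"
    and zm: "\<And>p. (\<lambda>x. z x p) \<in> borel_measurable N"
    and c1m [measurable]: "\<And>w i j. (\<lambda>x. cb1 x w i j) \<in> borel_measurable N"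
    and c2m: "\<And>w i j. (\<lambda>x. cb2 x w i j) \<in> borel_measurable N"
    and K: "1 \<le> K" and n1: "1 \<le> n1" and n2: "1 \<le> n2" and M: "1 \<le> M"
begin

lemma coop_decision_measurable:
  assumes k: "k \<in> {1..K}"
  shows "(\<lambda>x. decision (coop K n1 n2 M G s1 s2 \<tau>1 \<tau>2 (cb1 x) (cb2 x)) K (n1 + n2) (w, h x, z x, u) k) \<in> N \<rightarrow>\<^sub>M count_space UNIV"
  unfolding coop_decision[OF K n1 n2 M k]
proof (rule measurable_If)
  show "(\<lambda>x. estimate n1 M s1 \<tau>1 (cb1 x) w (h x) (z x) k) \<in> N \<rightarrow>\<^sub>M count_space UNIV"
    by (rule estimate_measurable[OF hm zm c1m c2m])
  show "(\<lambda>x. decode {n1+1..n1+n2} {1..K} \<tau>2 (cb2 x) (coalitions K s2 (inc K (h x) k)) M (relayed K n1 M G s1 s2 \<tau>1 (cb1 x) (cb2 x) w (h x) (z x) k)) \<in> N \<rightarrow>\<^sub>M count_space UNIV"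
    by (rule decode2_measurable[OF hm zm c1m c2m])
  show "{x \<in> space N. G \<le> (cmod (h x (0, k)))\<^sup>2} \<in> sets N"
    by (rule borel_measurable_le) (intro borel_measurable_const borel_measurable_power measurable_compose[OF _ borel_measurable_norm] hm)+
qed

lemma coop_power_measurable:
  "(\<lambda>x. power (coop K n1 n2 M G s1 s2 \<tau>1 \<tau>2 (cb1 x) (cb2 x)) K (n1 + n2) (w, h x, z x, u)) \<in> borel_measurable N"
proof -
  note sent = sent_measurable[where h=h and z=z and ?cb1.0=cb1 and ?cb2.0=cb2, OF hm zm c1m c2m]
  have S: "{x \<in> space N. G \<le> (cmod (h x (0, j)))\<^sup>2} \<in> sets N" for j
    by (rule borel_measurable_le) (intro borel_measurable_const borel_measurable_power measurable_compose[OF _ borel_measurable_norm] hm)+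
  have "power (coop K n1 n2 M G s1 s2 \<tau>1 \<tau>2 (cb1 x) (cb2 x)) K (n1 + n2) (w, h x, z x, u)
    = (1 / real (n1 + n2)) * ((\<Sum>i=1..n1. s1\<^sup>2 * (cmod (cb1 x w i 0))\<^sup>2)
      + (\<Sum>i=n1+1..n1+n2. \<Sum>j=1..K. if G \<le> (cmod (h x (0, j)))\<^sup>2 then s2\<^sup>2 * (cmod (cb2 x (estimate n1 M s1 \<tau>1 (cb1 x) w (h x) (z x) j) i j))\<^sup>2 else 0))" for x
    unfolding coop_power[OF K n1 n2 M, of G s1 s2 \<tau>1 \<tau>2 "cb1 x" "cb2 x" w "h x" "z x" u, symmetric] using n1 by (simp only: mult.assoc[symmetric]) simp
  then show ?thesis
    by (simp only:) (intro borel_measurable_times borel_measurable_add borel_measurable_sum borel_measurable_const measurable_If S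
      borel_measurable_power measurable_compose[OF _ borel_measurable_norm] sent c1m)
qed

end

lemma indicator_pred_measurable:
  assumes "Measurable.pred X P" shows "(\<lambda>x. indicator {x. P x} x :: ennreal) \<in> borel_measurable X"
  using assms unfolding pred_def by (intro borel_measurable_indicator') (simp only: mem_Collect_eq)

lemma nn_integral_strong:
  assumes j: "j \<in> {1..K}"
  shows "(\<integral>\<^sup>+h. indicator {h. G \<le> (cmod (h (0, j)))\<^sup>2} h \<partial>gain_space K) = ennreal (strong_prob G)"
proof -
  have "(\<integral>\<^sup>+h. indicator {h. G \<le> (cmod (h (0, j)))\<^sup>2} h \<partial>gain_space K) = (\<integral>\<^sup>+h. indicator {x. G \<le> (cmod x)\<^sup>2} (h (0, j)) \<partial>gain_space K)"
    by (simp add: indicator_def)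
  also have "\<dots> = (\<integral>\<^sup>+x. indicator {x. G \<le> (cmod x)\<^sup>2} x \<partial>cgauss 1)"
    by (rule nn_integral_PiM_component) (use j in \<open>auto simp: gain_idx_def\<close>)
  also have "\<dots> = ennreal (strong_prob G)" by (subst nn_integral_indicator) (auto simp: emeasure_strong)
  finally show ?thesis .
qed

section \<open>Mean power and mean failure of the random code\<close>

context
  fixes K n1 n2 M :: nat and G s1 s2 \<tau>1 \<tau>2 N0 :: real
  assumes K: "1 \<le> K" and n1: "1 \<le> n1" and n2: "1 \<le> n2" and M: "1 \<le> M" and N0: "0 < N0"
begin

abbreviation coop_books where
  "coop_books \<equiv> codebook_space M {1..n1} {0::nat} \<Otimes>\<^sub>M codebook_space M {n1+1..n1+n2} {1..K}"

abbreviation coop_net where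
  "coop_net \<equiv> gain_space K \<Otimes>\<^sub>M noise_space N0 K (n1 + n2)"

abbreviation coop_of where
  "coop_of \<theta> \<equiv> coop K n1 n2 M G s1 s2 \<tau>1 \<tau>2 (fst \<theta>) (snd \<theta>)"

lemma joint_measurable:
  shows "(\<lambda>x. fst (snd x) p) \<in> borel_measurable (coop_books \<Otimes>\<^sub>M coop_net)"
    and "(\<lambda>x. snd (snd x) p) \<in> borel_measurable (coop_books \<Otimes>\<^sub>M coop_net)"
    and "(\<lambda>x. fst (fst x) w i j) \<in> borel_measurable (coop_books \<Otimes>\<^sub>M coop_net)"
    and "(\<lambda>x. snd (fst x) w i j) \<in> borel_measurable (coop_books \<Otimes>\<^sub>M coop_net)"
  by (rule measurable_compose[OF measurable_snd measurable_compose[OF measurable_fst PiM_cgauss_component_measurable]]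
    measurable_compose[OF measurable_snd measurable_compose[OF measurable_snd PiM_cgauss_component_measurable]]
    measurable_compose[OF measurable_fst measurable_compose[OF measurable_fst codebook_entry_measurable]]
    measurable_compose[OF measurable_fst measurable_compose[OF measurable_snd codebook_entry_measurable]])+

lemma net_measurable:
  shows "(\<lambda>x. fst x p) \<in> borel_measurable coop_net" and "(\<lambda>x. snd x p) \<in> borel_measurable coop_net"
  by (rule measurable_compose[OF measurable_fst PiM_cgauss_component_measurable]
    measurable_compose[OF measurable_snd PiM_cgauss_component_measurable])+

lemma coop_joint_integral:
  assumes "F \<in> borel_measurable (coop_books \<Otimes>\<^sub>M coop_net)"
  shows "(\<integral>\<^sup>+x. F x \<partial>(coop_books \<Otimes>\<^sub>M coop_net)) = (\<integral>\<^sup>+h. \<integral>\<^sup>+z. \<integral>\<^sup>+c1. \<integral>\<^sup>+c2. F ((c1, c2), (h, z))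
      \<partial>codebook_space M {n1+1..n1+n2} {1..K} \<partial>codebook_space M {1..n1} {0} \<partial>noise_space N0 K (n1 + n2) \<partial>gain_space K)"
  by (rule nn_integral_pair_pair[OF _ _ _ _ assms])
    (rule prob_space_imp_sigma_finite, (rule prob_space_codebook_space | rule prob_space_PiM_cgauss, simp add: N0))+

text \<open>The estimates depend on the first codebook, the gains and the noise, all independent of
  the second codebook; so the symbol of a relay has mean power at most \<open>s2\<^sup>2\<close>
  even when its estimate is wrong. On average \<open>real K * strong_prob G\<close> relays
  transmit.\<close>

lemma coop_power_average:
  assumes w: "w \<in> {1..M}"
  shows "(\<integral>\<^sup>+x. ennreal (power (coop_of (fst x)) K (n1 + n2) (w, fst (snd x), snd (snd x), 0)) \<partial>(coop_books \<Otimes>\<^sub>M coop_net))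
    \<le> ennreal ((real n1 * s1\<^sup>2 + real n2 * (real K * strong_prob G * s2\<^sup>2)) / real (n1 + n2))"
proof -
  let ?C1 = "codebook_space M {1..n1} {0::nat}" and ?C2 = "codebook_space M {n1+1..n1+n2} {1..K}"
  let ?H = "gain_space K" and ?Z = "noise_space N0 K (n1 + n2)"
  interpret C1: prob_space ?C1 by (rule prob_space_codebook_space)
  interpret C2: prob_space ?C2 by (rule prob_space_codebook_space)
  interpret H: prob_space ?H by (rule prob_space_PiM_cgauss) simp
  interpret Z: prob_space ?Z by (rule prob_space_PiM_cgauss) (rule N0)
  have q: "0 \<le> strong_prob G" using strong_prob_bounds(1)[of G] by simp
  let ?n = "ennreal (1 / real (n1 + n2))"
  define A where "A c1 = (\<Sum>i=1..n1. ennreal (s1\<^sup>2) * ennreal ((cmod (c1 w i 0))\<^sup>2))" for c1 :: "nat \<Rightarrow> nat \<Rightarrow> nat \<Rightarrow> complex"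
  define B where "B h e c2 = (\<Sum>i=n1+1..n1+n2. \<Sum>j=1..K. indicator {h. G \<le> (cmod (h (0, j)))\<^sup>2} h * ennreal (s2\<^sup>2) * ennreal ((cmod (c2 (e j) i j))\<^sup>2))"
    for h :: "nat \<times> nat \<Rightarrow> complex" and e :: "nat \<Rightarrow> nat" and c2 :: "nat \<Rightarrow> nat \<Rightarrow> nat \<Rightarrow> complex"
  have sq1: "(\<lambda>c1. ennreal ((cmod (c1 w i j))\<^sup>2)) \<in> borel_measurable ?C1" for w i j
    by (intro measurable_compose[OF _ measurable_ennreal] borel_measurable_power measurable_compose[OF _ borel_measurable_norm] codebook_entry_measurable)
  have sq2: "(\<lambda>c2. ennreal ((cmod (c2 w i j))\<^sup>2)) \<in> borel_measurable ?C2" for w i j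
    by (intro measurable_compose[OF _ measurable_ennreal] borel_measurable_power measurable_compose[OF _ borel_measurable_norm] codebook_entry_measurable)
  have Am: "A \<in> borel_measurable ?C1" unfolding A_def
    by (intro borel_measurable_sum borel_measurable_times_ennreal borel_measurable_const sq1)
  have Bm: "B h e \<in> borel_measurable ?C2" for h e unfolding B_def
    by (intro borel_measurable_sum borel_measurable_times_ennreal borel_measurable_const sq2)
  have pw: "ennreal (power (coop_of (c1, c2)) K (n1 + n2) (w, h, z, 0)) = ?n * (A c1 + B h (estimate n1 M s1 \<tau>1 c1 w h z) c2)" for c1 c2 h z
  proof -
    have "A c1 = ennreal (\<Sum>i=1..n1. s1\<^sup>2 * (cmod (c1 w i 0))\<^sup>2)"
      unfolding A_def by (simp add: ennreal_mult[symmetric] sum_nonneg del: One_nat_def)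
    moreover have "B h (estimate n1 M s1 \<tau>1 c1 w h z) c2 = ennreal (\<Sum>i=n1+1..n1+n2. \<Sum>j=1..K. if G \<le> (cmod (h (0, j)))\<^sup>2 then s2\<^sup>2 * (cmod (c2 (estimate n1 M s1 \<tau>1 c1 w h z j) i j))\<^sup>2 else 0)"
    proof -
      have "ennreal (\<Sum>i=n1+1..n1+n2. \<Sum>j=1..K. if G \<le> (cmod (h (0, j)))\<^sup>2 then s2\<^sup>2 * (cmod (c2 (estimate n1 M s1 \<tau>1 c1 w h z j) i j))\<^sup>2 else 0)
        = (\<Sum>i=n1+1..n1+n2. \<Sum>j=1..K. ennreal (if G \<le> (cmod (h (0, j)))\<^sup>2 then s2\<^sup>2 * (cmod (c2 (estimate n1 M s1 \<tau>1 c1 w h z j) i j))\<^sup>2 else 0))"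
        by (subst sum_ennreal[symmetric], simp add: sum_nonneg, subst sum_ennreal[symmetric], auto)
      also have "\<dots> = B h (estimate n1 M s1 \<tau>1 c1 w h z) c2"
        unfolding B_def by (intro sum.cong refl) (simp add: indicator_def ennreal_mult)
      finally show ?thesis ..
    qed
    ultimately have "A c1 + B h (estimate n1 M s1 \<tau>1 c1 w h z) c2 = ennreal (real (n1 + n2) * power (coop_of (c1, c2)) K (n1 + n2) (w, h, z, 0))"
      unfolding fst_conv snd_conv coop_power[OF K n1 n2 M] by (simp only:) (intro ennreal_plus[symmetric] sum_nonneg; simp)
    then have "?n * (A c1 + B h (estimate n1 M s1 \<tau>1 c1 w h z) c2) = ennreal (1 / real (n1 + n2) * (real (n1 + n2) * power (coop_of (c1, c2)) K (n1 + n2) (w, h, z, 0)))"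
      by (simp only:) (intro ennreal_mult[symmetric] mult_nonneg_nonneg power_nonneg, simp_all)
    also have "1 / real (n1 + n2) * (real (n1 + n2) * power (coop_of (c1, c2)) K (n1 + n2) (w, h, z, 0)) = power (coop_of (c1, c2)) K (n1 + n2) (w, h, z, 0)"
      using n1 by (simp only: mult.assoc[symmetric]) simp
    finally show ?thesis ..
  qed
  have A1: "(\<integral>\<^sup>+c1. A c1 \<partial>?C1) \<le> ennreal (real n1 * s1\<^sup>2)"
  proof -
    have "(\<integral>\<^sup>+c1. A c1 \<partial>?C1) = (\<Sum>i=1..n1. ennreal (s1\<^sup>2) * (\<integral>\<^sup>+c1. ennreal ((cmod (c1 w i 0))\<^sup>2) \<partial>?C1))"
      unfolding A_def
      by (subst nn_integral_sum, (intro borel_measurable_times_ennreal borel_measurable_const sq1)[1], rule sum.cong[OF refl], rule nn_integral_cmult, rule sq1)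
    also have "\<dots> \<le> (\<Sum>i=1..n1. ennreal (s1\<^sup>2) * 1)"
      by (intro sum_mono mult_left_mono codebook_entry_power w) auto
    also have "\<dots> = ennreal (real n1 * s1\<^sup>2)" by (simp add: ennreal_of_nat_eq_real_of_nat ennreal_mult)
    finally show ?thesis .
  qed
  have B1: "(\<integral>\<^sup>+c2. B h e c2 \<partial>?C2) \<le> (\<Sum>i=n1+1..n1+n2. \<Sum>j=1..K. indicator {h. G \<le> (cmod (h (0, j)))\<^sup>2} h * ennreal (s2\<^sup>2))"
    if e: "\<And>j. e j \<in> {1..M}" for h e
  proof -
    have "(\<integral>\<^sup>+c2. B h e c2 \<partial>?C2) = (\<Sum>i=n1+1..n1+n2. \<Sum>j=1..K. indicator {h. G \<le> (cmod (h (0, j)))\<^sup>2} h * ennreal (s2\<^sup>2) * (\<integral>\<^sup>+c2. ennreal ((cmod (c2 (e j) i j))\<^sup>2) \<partial>?C2))"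
      unfolding B_def
      by (subst nn_integral_sum, (intro borel_measurable_sum borel_measurable_times_ennreal borel_measurable_const sq2)[1], rule sum.cong[OF refl],
          subst nn_integral_sum, (intro borel_measurable_times_ennreal borel_measurable_const sq2)[1], rule sum.cong[OF refl], rule nn_integral_cmult, rule sq2)
    also have "\<dots> \<le> (\<Sum>i=n1+1..n1+n2. \<Sum>j=1..K. indicator {h. G \<le> (cmod (h (0, j)))\<^sup>2} h * ennreal (s2\<^sup>2) * 1)"
      by (intro sum_mono mult_left_mono codebook_entry_power e) auto
    finally show ?thesis by simp
  qed
  have sm: "(\<lambda>h. indicator {h. G \<le> (cmod (h (0, j)))\<^sup>2} h * ennreal (s2\<^sup>2)) \<in> borel_measurable ?H" for j
  proof -
    have "Measurable.pred ?H (\<lambda>h. G \<le> (cmod (h (0, j)))\<^sup>2)"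
      by (intro borel_le_pred borel_measurable_const borel_measurable_power measurable_compose[OF _ borel_measurable_norm] PiM_cgauss_component_measurable)
    then show ?thesis by (intro borel_measurable_times_ennreal borel_measurable_const indicator_pred_measurable)
  qed
  have sm': "(\<lambda>h. \<Sum>i=n1+1..n1+n2. \<Sum>j=1..K. indicator {h. G \<le> (cmod (h (0, j)))\<^sup>2} h * ennreal (s2\<^sup>2)) \<in> borel_measurable ?H"
    by (intro borel_measurable_sum sm)
  have H1: "(\<integral>\<^sup>+h. (\<Sum>i=n1+1..n1+n2. \<Sum>j=1..K. indicator {h. G \<le> (cmod (h (0, j)))\<^sup>2} h * ennreal (s2\<^sup>2)) \<partial>?H) = ennreal (real n2 * (real K * strong_prob G * s2\<^sup>2))"
  proof -
    have 1: "(\<integral>\<^sup>+h. indicator {h. G \<le> (cmod (h (0, j)))\<^sup>2} h * ennreal (s2\<^sup>2) \<partial>?H) = ennreal (strong_prob G * s2\<^sup>2)" if "j \<in> {1..K}" for j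
    proof -
      have "Measurable.pred ?H (\<lambda>h. G \<le> (cmod (h (0, j)))\<^sup>2)"
        by (intro borel_le_pred borel_measurable_const borel_measurable_power measurable_compose[OF _ borel_measurable_norm] PiM_cgauss_component_measurable)
      from nn_integral_multc[OF indicator_pred_measurable[OF this]] show ?thesis
        by (simp only: nn_integral_strong[OF that] ennreal_mult[OF q zero_le_power2])
    qed
    have "(\<integral>\<^sup>+h. (\<Sum>i=n1+1..n1+n2. \<Sum>j=1..K. indicator {h. G \<le> (cmod (h (0, j)))\<^sup>2} h * ennreal (s2\<^sup>2)) \<partial>?H)
      = (\<Sum>i=n1+1..n1+n2. \<Sum>j=1..K. ennreal (strong_prob G * s2\<^sup>2))"
      by (subst nn_integral_sum, (intro borel_measurable_sum sm)[1], rule sum.cong[OF refl], subst nn_integral_sum, rule sm, rule sum.cong[OF refl], rule 1)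
    also have "\<dots> = ennreal (real n2 * (real K * strong_prob G * s2\<^sup>2))"
      using q by (simp add: ennreal_of_nat_eq_real_of_nat ennreal_mult mult.assoc)
    finally show ?thesis .
  qed
  have "(\<integral>\<^sup>+x. ennreal (power (coop_of (fst x)) K (n1 + n2) (w, fst (snd x), snd (snd x), 0)) \<partial>(coop_books \<Otimes>\<^sub>M coop_net))
    = (\<integral>\<^sup>+h. \<integral>\<^sup>+z. \<integral>\<^sup>+c1. \<integral>\<^sup>+c2. ?n * (A c1 + B h (estimate n1 M s1 \<tau>1 c1 w h z) c2) \<partial>?C2 \<partial>?C1 \<partial>?Z \<partial>?H)"
  proof -
    have "(\<lambda>x. ennreal (power (coop_of (fst x)) K (n1 + n2) (w, fst (snd x), snd (snd x), 0))) \<in> borel_measurable (coop_books \<Otimes>\<^sub>M coop_net)"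
      by (rule measurable_compose[OF coop_power_measurable measurable_ennreal]) (rule joint_measurable K n1 n2 M)+
    from coop_joint_integral[OF this] show ?thesis by (simp only: fst_conv snd_conv pw[unfolded fst_conv snd_conv])
  qed
  also have "\<dots> \<le> (\<integral>\<^sup>+h. \<integral>\<^sup>+z. ?n * (ennreal (real n1 * s1\<^sup>2) + (\<Sum>i=n1+1..n1+n2. \<Sum>j=1..K. indicator {h. G \<le> (cmod (h (0, j)))\<^sup>2} h * ennreal (s2\<^sup>2))) \<partial>?Z \<partial>?H)"
  proof (intro nn_integral_mono)
    fix h z :: "nat \<times> nat \<Rightarrow> complex"
    let ?B = "\<Sum>i=n1+1..n1+n2. \<Sum>j=1..K. indicator {h. G \<le> (cmod (h (0, j)))\<^sup>2} h * ennreal (s2\<^sup>2)"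
    have e: "estimate n1 M s1 \<tau>1 c1 w h z j \<in> {1..M}" for c1 j unfolding estimate_def by (rule decode_range[OF M])
    have "(\<integral>\<^sup>+c1. \<integral>\<^sup>+c2. ?n * (A c1 + B h (estimate n1 M s1 \<tau>1 c1 w h z) c2) \<partial>?C2 \<partial>?C1)
      = (\<integral>\<^sup>+c1. ?n * (A c1 + (\<integral>\<^sup>+c2. B h (estimate n1 M s1 \<tau>1 c1 w h z) c2 \<partial>?C2)) \<partial>?C1)"
      by (simp only: nn_integral_cmult[OF borel_measurable_add[OF borel_measurable_const Bm]] nn_integral_add[OF borel_measurable_const Bm]
        nn_integral_const C2.emeasure_space_1 mult_1_right)
    also have "\<dots> \<le> (\<integral>\<^sup>+c1. ?n * (A c1 + ?B) \<partial>?C1)"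
      by (intro nn_integral_mono mult_left_mono add_left_mono B1 e) auto
    also have "\<dots> = ?n * ((\<integral>\<^sup>+c1. A c1 \<partial>?C1) + ?B)"
      by (simp only: nn_integral_cmult[OF borel_measurable_add[OF Am borel_measurable_const]] nn_integral_add[OF Am borel_measurable_const]
        nn_integral_const C1.emeasure_space_1 mult_1_right)
    also have "\<dots> \<le> ?n * (ennreal (real n1 * s1\<^sup>2) + ?B)" by (intro mult_left_mono add_right_mono A1) auto
    finally show "(\<integral>\<^sup>+c1. \<integral>\<^sup>+c2. ?n * (A c1 + B h (estimate n1 M s1 \<tau>1 c1 w h z) c2) \<partial>?C2 \<partial>?C1) \<le> ?n * (ennreal (real n1 * s1\<^sup>2) + ?B)" .
  qed
  also have "\<dots> = ?n * (ennreal (real n1 * s1\<^sup>2) + ennreal (real n2 * (real K * strong_prob G * s2\<^sup>2)))"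
    by (simp only: nn_integral_const Z.emeasure_space_1 H.emeasure_space_1 mult_1_right
      nn_integral_cmult[OF borel_measurable_add[OF borel_measurable_const sm']] nn_integral_add[OF borel_measurable_const sm'] H1)
  also have "\<dots> = ennreal ((real n1 * s1\<^sup>2 + real n2 * (real K * strong_prob G * s2\<^sup>2)) / real (n1 + n2))"
    using q by (simp add: ennreal_mult[symmetric] ennreal_plus[symmetric] del: ennreal_plus)
  finally show ?thesis .
qed

text \<open>A union bound over nodes and three causes: \<open>P1\<close>, a strong node is confused
  in the first phase; \<open>P2\<close>, the second phase confuses although the cooperative gain
  suffices; \<open>P3\<close>, this gain is too small. Codebooks and noise are integrated inside the
  gains, so the confusion bounds apply to each realisation of the gains.\<close>

lemma coop_failure_average:
  assumes w: "w \<in> {1..M}"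
    and e1: "\<And>x::complex. G \<le> (cmod x)\<^sup>2 \<Longrightarrow> (\<integral>\<^sup>+z. \<integral>\<^sup>+cb. indicator {cb. confused {1..n1} {0} \<tau>1 M {\<lambda>_. of_real s1 * x} (\<lambda>_. of_real s1 * x) w cb z} cb
        \<partial>codebook_space M {1..n1} {0::nat} \<partial>PiM {1..n1} (\<lambda>_. cgauss N0)) \<le> \<epsilon>1"
    and e2: "\<And>a A. finite A \<Longrightarrow> card A \<le> 2 ^ K \<Longrightarrow> b0 \<le> (\<Sum>j=1..K. (cmod (a j))\<^sup>2) \<Longrightarrow> (\<integral>\<^sup>+z. \<integral>\<^sup>+cb. indicator {cb. confused {n1+1..n1+n2} {1..K} \<tau>2 M A a w cb z} cb
        \<partial>codebook_space M {n1+1..n1+n2} {1..K} \<partial>PiM {n1+1..n1+n2} (\<lambda>_. cgauss N0)) \<le> \<epsilon>2"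
    and e3: "\<And>k. k \<in> {1..K} \<Longrightarrow> (\<integral>\<^sup>+h. indicator {h. s2\<^sup>2 * coop_gain K G h k < b0} h \<partial>gain_space K) \<le> \<epsilon>3"
  shows "(\<integral>\<^sup>+x. indicator {x. \<exists>k\<in>{1..K}. decision (coop_of (fst x)) K (n1 + n2) (w, fst (snd x), snd (snd x), 0) k \<noteq> w} x \<partial>(coop_books \<Otimes>\<^sub>M coop_net))
    \<le> of_nat K * (\<epsilon>1 + \<epsilon>2 + \<epsilon>3)"
proof -
  let ?C1 = "codebook_space M {1..n1} {0::nat}" and ?C2 = "codebook_space M {n1+1..n1+n2} {1..K}"
  let ?H = "gain_space K" and ?Z = "noise_space N0 K (n1 + n2)"
  let ?Q = "coop_books \<Otimes>\<^sub>M coop_net"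
  interpret C1: prob_space ?C1 by (rule prob_space_codebook_space)
  interpret C2: prob_space ?C2 by (rule prob_space_codebook_space)
  interpret H: prob_space ?H by (rule prob_space_PiM_cgauss) simp
  interpret Z: prob_space ?Z by (rule prob_space_PiM_cgauss) (rule N0)
  let ?c1 = "\<lambda>k h z c1. confused {1..n1} {0} \<tau>1 M {\<lambda>_. of_real s1 * h (0, k)} (\<lambda>_. of_real s1 * h (0, k)) w c1 (\<lambda>i. z (k, i))"
  let ?c2 = "\<lambda>k h z c2. confused {n1+1..n1+n2} {1..K} \<tau>2 M (coalitions K s2 (inc K h k)) (coop_vec K G s2 h k) w c2 (\<lambda>i. z (k, i))"
  define P1 where "P1 k x \<longleftrightarrow> G \<le> (cmod (fst (snd x) (0, k)))\<^sup>2 \<and> ?c1 k (fst (snd x)) (snd (snd x)) (fst (fst x))"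
    for k and x :: "((nat \<Rightarrow> nat \<Rightarrow> nat \<Rightarrow> complex) \<times> (nat \<Rightarrow> nat \<Rightarrow> nat \<Rightarrow> complex)) \<times> (nat \<times> nat \<Rightarrow> complex) \<times> (nat \<times> nat \<Rightarrow> complex)"
  define P2 where "P2 k x \<longleftrightarrow> b0 \<le> s2\<^sup>2 * coop_gain K G (fst (snd x)) k \<and> ?c2 k (fst (snd x)) (snd (snd x)) (snd (fst x))"
    for k and x :: "((nat \<Rightarrow> nat \<Rightarrow> nat \<Rightarrow> complex) \<times> (nat \<Rightarrow> nat \<Rightarrow> nat \<Rightarrow> complex)) \<times> (nat \<times> nat \<Rightarrow> complex) \<times> (nat \<times> nat \<Rightarrow> complex)"
  define P3 where "P3 k x \<longleftrightarrow> s2\<^sup>2 * coop_gain K G (fst (snd x)) k < b0"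
    for k and x :: "((nat \<Rightarrow> nat \<Rightarrow> nat \<Rightarrow> complex) \<times> (nat \<Rightarrow> nat \<Rightarrow> nat \<Rightarrow> complex)) \<times> (nat \<times> nat \<Rightarrow> complex) \<times> (nat \<times> nat \<Rightarrow> complex)"
  note jm = joint_measurable
  have gm: "(\<lambda>x. s2\<^sup>2 * coop_gain K G (fst (snd x)) k) \<in> borel_measurable ?Q" for k
    by (rule borel_measurable_times, rule borel_measurable_const)
      (rule coop_gain_measurable[where h="\<lambda>x. fst (snd x)" and z="\<lambda>x. snd (snd x)" and ?cb1.0="\<lambda>x. fst (fst x)" and ?cb2.0="\<lambda>x. snd (fst x)"]; rule jm)
  have m1: "(\<lambda>x. indicator {x. P1 k x} x :: ennreal) \<in> borel_measurable ?Q" for k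
  proof (rule indicator_pred_measurable)
    have 1: "Measurable.pred ?Q (\<lambda>x. G \<le> (cmod (fst (snd x) (0, k)))\<^sup>2)"
      by (intro borel_le_pred borel_measurable_const borel_measurable_power measurable_compose[OF _ borel_measurable_norm] jm)
    show "Measurable.pred ?Q (P1 k)" unfolding P1_def
      by (rule pred_intros_logic(3)[OF 1 confused1_measurable[where h="\<lambda>x. fst (snd x)" and z="\<lambda>x. snd (snd x)" and ?cb1.0="\<lambda>x. fst (fst x)" and ?cb2.0="\<lambda>x. snd (fst x)", OF jm]])
  qed
  have m2: "(\<lambda>x. indicator {x. P2 k x} x :: ennreal) \<in> borel_measurable ?Q" for k
  proof (rule indicator_pred_measurable)
    show "Measurable.pred ?Q (P2 k)" unfolding P2_def
      by (rule pred_intros_logic(3)[OF borel_le_pred[OF borel_measurable_const gm] confused2_measurable[where h="\<lambda>x. fst (snd x)" and z="\<lambda>x. snd (snd x)" and ?cb1.0="\<lambda>x. fst (fst x)" and ?cb2.0="\<lambda>x. snd (fst x)", OF jm]])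
  qed
  have m3: "(\<lambda>x. indicator {x. P3 k x} x :: ennreal) \<in> borel_measurable ?Q" for k
  proof (rule indicator_pred_measurable)
    show "Measurable.pred ?Q (P3 k)" unfolding P3_def
      by (rule borel_measurable_pred_less[OF gm borel_measurable_const])
  qed
  have i1: "(\<integral>\<^sup>+x. indicator {x. P1 k x} x \<partial>?Q) \<le> \<epsilon>1" if k: "k \<in> {1..K}" for k
  proof -
    have "(\<integral>\<^sup>+x. indicator {x. P1 k x} x \<partial>?Q) = (\<integral>\<^sup>+h. \<integral>\<^sup>+z. \<integral>\<^sup>+c1. \<integral>\<^sup>+c2. indicator {x. P1 k x} ((c1, c2), (h, z)) \<partial>?C2 \<partial>?C1 \<partial>?Z \<partial>?H)"
      by (rule coop_joint_integral[OF m1])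
    also have "\<dots> = (\<integral>\<^sup>+h. \<integral>\<^sup>+z. \<integral>\<^sup>+c1. indicator {h. G \<le> (cmod (h (0, k)))\<^sup>2} h * indicator {c1. ?c1 k h z c1} c1 \<partial>?C1 \<partial>?Z \<partial>?H)"
    proof (intro nn_integral_cong)
      fix h z c1
      have "(\<integral>\<^sup>+c2. indicator {x. P1 k x} ((c1, c2), (h, z)) \<partial>?C2) = (\<integral>\<^sup>+c2. indicator {h. G \<le> (cmod (h (0, k)))\<^sup>2} h * indicator {c1. ?c1 k h z c1} c1 \<partial>?C2)"
        by (rule nn_integral_cong) (simp add: P1_def indicator_def del: One_nat_def)
      also have "\<dots> = indicator {h. G \<le> (cmod (h (0, k)))\<^sup>2} h * indicator {c1. ?c1 k h z c1} c1"
        by (simp only: nn_integral_const C2.emeasure_space_1 mult_1_right)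
      finally show "(\<integral>\<^sup>+c2. indicator {x. P1 k x} ((c1, c2), (h, z)) \<partial>?C2) = indicator {h. G \<le> (cmod (h (0, k)))\<^sup>2} h * indicator {c1. ?c1 k h z c1} c1" .
    qed
    also have "\<dots> \<le> (\<integral>\<^sup>+h. \<epsilon>1 \<partial>?H)"
    proof (rule nn_integral_mono)
      fix h
      show "(\<integral>\<^sup>+z. \<integral>\<^sup>+c1. indicator {h. G \<le> (cmod (h (0, k)))\<^sup>2} h * indicator {c1. ?c1 k h z c1} c1 \<partial>?C1 \<partial>?Z) \<le> \<epsilon>1"
      proof (cases "G \<le> (cmod (h (0, k)))\<^sup>2")
        case True
        then have "(\<integral>\<^sup>+z. \<integral>\<^sup>+c1. indicator {h. G \<le> (cmod (h (0, k)))\<^sup>2} h * indicator {c1. ?c1 k h z c1} c1 \<partial>?C1 \<partial>?Z)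
          = (\<integral>\<^sup>+z. \<integral>\<^sup>+c1. indicator {c1. ?c1 k h z c1} c1 \<partial>?C1 \<partial>?Z)" by (simp only: indicator_simps mem_Collect_eq mult_1_left)
        also have "\<dots> = (\<integral>\<^sup>+z. \<integral>\<^sup>+cb. indicator {cb. confused {1..n1} {0} \<tau>1 M {\<lambda>_. of_real s1 * h (0, k)} (\<lambda>_. of_real s1 * h (0, k)) w cb z} cb \<partial>?C1 \<partial>PiM {1..n1} (\<lambda>_. cgauss N0))"
          by (rule nn_integral_confused_node[OF N0 k]) auto
        also have "\<dots> \<le> \<epsilon>1" by (rule e1[OF True])
        finally show ?thesis .
      next
        case False
        then show ?thesis by (simp only: indicator_simps mem_Collect_eq nn_integral_const mult_zero_left zero_le not_False_eq_True)
      qed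
    qed
    also have "\<dots> = \<epsilon>1" by (simp only: nn_integral_const H.emeasure_space_1 mult_1_right)
    finally show ?thesis .
  qed
  have i2: "(\<integral>\<^sup>+x. indicator {x. P2 k x} x \<partial>?Q) \<le> \<epsilon>2" if k: "k \<in> {1..K}" for k
  proof -
    have "(\<integral>\<^sup>+x. indicator {x. P2 k x} x \<partial>?Q) = (\<integral>\<^sup>+h. \<integral>\<^sup>+z. \<integral>\<^sup>+c1. \<integral>\<^sup>+c2. indicator {x. P2 k x} ((c1, c2), (h, z)) \<partial>?C2 \<partial>?C1 \<partial>?Z \<partial>?H)"
      by (rule coop_joint_integral[OF m2])
    also have "\<dots> = (\<integral>\<^sup>+h. \<integral>\<^sup>+z. \<integral>\<^sup>+c1. \<integral>\<^sup>+c2. indicator {h. b0 \<le> s2\<^sup>2 * coop_gain K G h k} h * indicator {c2. ?c2 k h z c2} c2 \<partial>?C2 \<partial>?C1 \<partial>?Z \<partial>?H)"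
      by (intro nn_integral_cong) (simp add: P2_def indicator_def del: One_nat_def)
    also have "\<dots> = (\<integral>\<^sup>+h. \<integral>\<^sup>+z. \<integral>\<^sup>+c2. indicator {h. b0 \<le> s2\<^sup>2 * coop_gain K G h k} h * indicator {c2. ?c2 k h z c2} c2 \<partial>?C2 \<partial>?Z \<partial>?H)"
      by (simp only: nn_integral_const C1.emeasure_space_1 mult_1_right)
    also have "\<dots> \<le> (\<integral>\<^sup>+h. \<epsilon>2 \<partial>?H)"
    proof (rule nn_integral_mono)
      fix h
      show "(\<integral>\<^sup>+z. \<integral>\<^sup>+c2. indicator {h. b0 \<le> s2\<^sup>2 * coop_gain K G h k} h * indicator {c2. ?c2 k h z c2} c2 \<partial>?C2 \<partial>?Z) \<le> \<epsilon>2"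
      proof (cases "b0 \<le> s2\<^sup>2 * coop_gain K G h k")
        case True
        then have "(\<integral>\<^sup>+z. \<integral>\<^sup>+c2. indicator {h. b0 \<le> s2\<^sup>2 * coop_gain K G h k} h * indicator {c2. ?c2 k h z c2} c2 \<partial>?C2 \<partial>?Z)
          = (\<integral>\<^sup>+z. \<integral>\<^sup>+c2. indicator {c2. ?c2 k h z c2} c2 \<partial>?C2 \<partial>?Z)" by (simp only: indicator_simps mem_Collect_eq mult_1_left)
        also have "\<dots> = (\<integral>\<^sup>+z. \<integral>\<^sup>+cb. indicator {cb. confused {n1+1..n1+n2} {1..K} \<tau>2 M (coalitions K s2 (inc K h k)) (coop_vec K G s2 h k) w cb z} cb \<partial>?C2 \<partial>PiM {n1+1..n1+n2} (\<lambda>_. cgauss N0))"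
          by (rule nn_integral_confused_node[OF N0 k _ coalitions_bound(1)]) auto
        also have "\<dots> \<le> \<epsilon>2" by (rule e2[OF coalitions_bound]) (use True in \<open>simp only: coop_vec_energy\<close>)
        finally show ?thesis .
      next
        case False
        then show ?thesis by (simp only: indicator_simps mem_Collect_eq nn_integral_const mult_zero_left zero_le not_False_eq_True)
      qed
    qed
    also have "\<dots> = \<epsilon>2" by (simp only: nn_integral_const H.emeasure_space_1 mult_1_right)
    finally show ?thesis .
  qed
  have i3: "(\<integral>\<^sup>+x. indicator {x. P3 k x} x \<partial>?Q) \<le> \<epsilon>3" if k: "k \<in> {1..K}" for k
  proof -
    have "(\<integral>\<^sup>+x. indicator {x. P3 k x} x \<partial>?Q) = (\<integral>\<^sup>+h. \<integral>\<^sup>+z. \<integral>\<^sup>+c1. \<integral>\<^sup>+c2. indicator {x. P3 k x} ((c1, c2), (h, z)) \<partial>?C2 \<partial>?C1 \<partial>?Z \<partial>?H)"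
      by (rule coop_joint_integral[OF m3])
    also have "\<dots> = (\<integral>\<^sup>+h. \<integral>\<^sup>+z. \<integral>\<^sup>+c1. \<integral>\<^sup>+c2. indicator {h. s2\<^sup>2 * coop_gain K G h k < b0} h \<partial>?C2 \<partial>?C1 \<partial>?Z \<partial>?H)"
      by (intro nn_integral_cong) (simp add: P3_def indicator_def)
    also have "\<dots> = (\<integral>\<^sup>+h. indicator {h. s2\<^sup>2 * coop_gain K G h k < b0} h \<partial>?H)"
      by (simp only: nn_integral_const C1.emeasure_space_1 C2.emeasure_space_1 Z.emeasure_space_1 mult_1_right)
    also have "\<dots> \<le> \<epsilon>3" by (rule e3[OF k])
    finally show ?thesis .
  qed
  have "(\<integral>\<^sup>+x. indicator {x. \<exists>k\<in>{1..K}. decision (coop_of (fst x)) K (n1 + n2) (w, fst (snd x), snd (snd x), 0) k \<noteq> w} x \<partial>?Q)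
    \<le> (\<integral>\<^sup>+x. (\<Sum>k=1..K. indicator {x. P1 k x} x + indicator {x. P2 k x} x + indicator {x. P3 k x} x) \<partial>?Q)"
  proof (rule nn_integral_mono)
    fix x
    let ?S = "\<lambda>k. indicator {x. P1 k x} x + indicator {x. P2 k x} x + indicator {x. P3 k x} x :: ennreal"
    obtain c1 c2 h z where x: "x = ((c1, c2), (h, z))" by (metis prod.collapse)
    show "indicator {x. \<exists>k\<in>{1..K}. decision (coop_of (fst x)) K (n1 + n2) (w, fst (snd x), snd (snd x), 0) k \<noteq> w} x \<le> (\<Sum>k=1..K. ?S k)"
    proof (cases "\<exists>k\<in>{1..K}. P1 k x \<or> P2 k x \<or> P3 k x")
      case True
      then obtain k where k: "k \<in> {1..K}" "P1 k x \<or> P2 k x \<or> P3 k x" by blast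
      have "1 \<le> ?S k" using k(2) by (auto simp: indicator_def)
      also have "?S k \<le> (\<Sum>k=1..K. ?S k)" by (rule member_le_sum[OF k(1)]) auto
      finally show ?thesis by (auto simp: indicator_def)
    next
      case False
      have "decision (coop K n1 n2 M G s1 s2 \<tau>1 \<tau>2 c1 c2) K (n1 + n2) (w, h, z, 0) k = w" if k: "k \<in> {1..K}" for k
      proof (rule coop_correct[OF K n1 n2 M w _ _ k])
        fix j assume j: "j \<in> {1..K}"
        show "\<not> ?c1 j h z c1" if "G \<le> (cmod (h (0, j)))\<^sup>2" using False j that by (auto simp: x P1_def)
        show "\<not> ?c2 j h z c2" using False j by (auto simp: x P2_def P3_def)
      qed
      then show ?thesis by (simp add: x)
    qed
  qed
  also have "\<dots> = (\<Sum>k=1..K. (\<integral>\<^sup>+x. indicator {x. P1 k x} x \<partial>?Q) + (\<integral>\<^sup>+x. indicator {x. P2 k x} x \<partial>?Q) + (\<integral>\<^sup>+x. indicator {x. P3 k x} x \<partial>?Q))"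
    by (subst nn_integral_sum, (intro borel_measurable_add m1 m2 m3)[1], rule sum.cong[OF refl],
      simp only: nn_integral_add[OF borel_measurable_add[OF m1 m2] m3] nn_integral_add[OF m1 m2])
  also have "\<dots> \<le> (\<Sum>k=1..K. \<epsilon>1 + \<epsilon>2 + \<epsilon>3)" by (intro sum_mono add_mono i1 i2 i3)
  also have "\<dots> = of_nat K * (\<epsilon>1 + \<epsilon>2 + \<epsilon>3)" by simp
  finally show ?thesis .
qed

end

text \<open>Mean power and failure are functions of the pair \<theta> of codebooks, and some pair is
  good for both. The cooperative protocol ignores the seed, which is set to 0 during the
  averaging.\<close>

lemma coop_code_exists:
  fixes P \<gamma> \<epsilon> N0 G s1 s2 \<tau>1 \<tau>2 b0 :: real and \<epsilon>1 \<epsilon>2 \<epsilon>3 :: ennreal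
  assumes K: "1 \<le> K" and n1: "1 \<le> n1" and n2: "1 \<le> n2" and M: "1 \<le> M" and N0: "0 < N0"
    and e1: "\<And>w x. w \<in> {1..M} \<Longrightarrow> G \<le> (cmod x)\<^sup>2 \<Longrightarrow> (\<integral>\<^sup>+z. \<integral>\<^sup>+cb. indicator {cb. confused {1..n1} {0} \<tau>1 M {\<lambda>_. of_real s1 * x} (\<lambda>_. of_real s1 * x) w cb z} cb
        \<partial>codebook_space M {1..n1} {0::nat} \<partial>PiM {1..n1} (\<lambda>_. cgauss N0)) \<le> \<epsilon>1"
    and e2: "\<And>w a A. w \<in> {1..M} \<Longrightarrow> finite A \<Longrightarrow> card A \<le> 2 ^ K \<Longrightarrow> b0 \<le> (\<Sum>j=1..K. (cmod (a j))\<^sup>2) \<Longrightarrow>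
        (\<integral>\<^sup>+z. \<integral>\<^sup>+cb. indicator {cb. confused {n1+1..n1+n2} {1..K} \<tau>2 M A a w cb z} cb
        \<partial>codebook_space M {n1+1..n1+n2} {1..K} \<partial>PiM {n1+1..n1+n2} (\<lambda>_. cgauss N0)) \<le> \<epsilon>2"
    and e3: "\<And>k. k \<in> {1..K} \<Longrightarrow> (\<integral>\<^sup>+h. indicator {h. s2\<^sup>2 * coop_gain K G h k < b0} h \<partial>gain_space K) \<le> \<epsilon>3"
    and P: "0 < P" and \<gamma>: "0 < \<gamma>" "\<gamma> < 1" and \<epsilon>: "0 < \<epsilon>" "of_nat K * (\<epsilon>1 + \<epsilon>2 + \<epsilon>3) \<le> ennreal \<epsilon>"
    and budget: "(real n1 * s1\<^sup>2 + real n2 * (real K * strong_prob G * s2\<^sup>2)) / real (n1 + n2) \<le> (1 - \<gamma>) * P"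
  shows "\<exists>p. admissible P N0 K (n1 + n2) M p \<and> fail_multi N0 K (n1 + n2) M p \<le> 2 * \<epsilon> / \<gamma>"
proof -
  let ?T = "codebook_space M {1..n1} {0::nat} \<Otimes>\<^sub>M codebook_space M {n1+1..n1+n2} {1..K}"
  let ?Y = "gain_space K \<Otimes>\<^sub>M noise_space N0 K (n1 + n2)"
  let ?N = "netspace N0 K (n1 + n2) M"
  let ?p = "\<lambda>\<theta>. coop K n1 n2 M G s1 s2 \<tau>1 \<tau>2 (fst \<theta>) (snd \<theta>)"
  interpret C1: prob_space "codebook_space M {1..n1} {0::nat}" by (rule prob_space_codebook_space)
  interpret C2: prob_space "codebook_space M {n1+1..n1+n2} {1..K}" by (rule prob_space_codebook_space)
  interpret H: prob_space "gain_space K" by (rule prob_space_PiM_cgauss) simp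
  interpret Z: prob_space "noise_space N0 K (n1 + n2)" by (rule prob_space_PiM_cgauss) (rule N0)
  interpret T: pair_prob_space "codebook_space M {1..n1} {0::nat}" "codebook_space M {n1+1..n1+n2} {1..K}" ..
  interpret Y: pair_prob_space "gain_space K" "noise_space N0 K (n1 + n2)" ..
  define F where "F w x = (indicator {x. \<exists>k\<in>{1..K}. decision (?p (fst x)) K (n1 + n2) (w, fst (snd x), snd (snd x), 0) k \<noteq> w} x :: ennreal)" for w x
  define E where "E w x = ennreal (power (?p (fst x)) K (n1 + n2) (w, fst (snd x), snd (snd x), 0))" for w x
  have pred: "Measurable.pred X (\<lambda>x. \<exists>k\<in>S. decision (coop K n1 n2 M G s1 s2 \<tau>1 \<tau>2 (c1 x) (c2 x)) K (n1 + n2) (w, h x, z x, 0) k \<noteq> w)"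
    if S: "S \<subseteq> {1..K}" and m: "\<And>p. (\<lambda>x. h x p) \<in> borel_measurable X" "\<And>p. (\<lambda>x. z x p) \<in> borel_measurable X"
      "\<And>w i j. (\<lambda>x. c1 x w i j) \<in> borel_measurable X" "\<And>w i j. (\<lambda>x. c2 x w i j) \<in> borel_measurable X"
    for S w and X :: "'x measure" and h z c1 c2
  proof (rule pred_intros_finite(4))
    show "finite S" using S by (rule finite_subset) simp
    fix k assume "k \<in> S"
    then have k: "k \<in> {1..K}" using S by blast
    have "(\<lambda>d. d \<noteq> w) \<in> count_space UNIV \<rightarrow>\<^sub>M count_space (UNIV :: bool set)" by simp
    from measurable_compose[OF coop_decision_measurable[where h=h and z=z and ?cb1.0=c1 and ?cb2.0=c2, OF m K n1 n2 M k] this]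
    show "Measurable.pred X (\<lambda>x. decision (coop K n1 n2 M G s1 s2 \<tau>1 \<tau>2 (c1 x) (c2 x)) K (n1 + n2) (w, h x, z x, 0) k \<noteq> w)" .
  qed
  have Fm: "F w \<in> borel_measurable (?T \<Otimes>\<^sub>M ?Y)" for w
    unfolding F_def by (rule indicator_pred_measurable, rule pred[OF subset_refl]; rule joint_measurable[OF K n1 n2 M N0])
  have Em: "E w \<in> borel_measurable (?T \<Otimes>\<^sub>M ?Y)" for w
    unfolding E_def by (rule measurable_compose[OF coop_power_measurable measurable_ennreal]) (rule joint_measurable[OF K n1 n2 M N0] K n1 n2 M)+
  define f where "f \<theta> = ennreal (1 / real M) * (\<Sum>w=1..M. \<integral>\<^sup>+y. F w (\<theta>, y) \<partial>?Y)" for \<theta>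
  define g where "g \<theta> = ennreal (1 / real M) * (\<Sum>w=1..M. \<integral>\<^sup>+y. E w (\<theta>, y) \<partial>?Y)" for \<theta>
  have fs: "(\<lambda>\<theta>. \<integral>\<^sup>+y. F w (\<theta>, y) \<partial>?Y) \<in> borel_measurable ?T" for w by (rule Y.borel_measurable_nn_integral_fst[OF Fm])
  have gs: "(\<lambda>\<theta>. \<integral>\<^sup>+y. E w (\<theta>, y) \<partial>?Y) \<in> borel_measurable ?T" for w by (rule Y.borel_measurable_nn_integral_fst[OF Em])
  have avg: "(\<integral>\<^sup>+\<theta>. ennreal (1 / real M) * (\<Sum>w=1..M. \<integral>\<^sup>+y. X w (\<theta>, y) \<partial>?Y) \<partial>?T) \<le> c"
    if X: "\<And>w. X w \<in> borel_measurable (?T \<Otimes>\<^sub>M ?Y)" "\<And>w. w \<in> {1..M} \<Longrightarrow> (\<integral>\<^sup>+x. X w x \<partial>(?T \<Otimes>\<^sub>M ?Y)) \<le> c" for X :: "nat \<Rightarrow> _ \<Rightarrow> ennreal" and c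
  proof -
    have xs: "(\<lambda>\<theta>. \<integral>\<^sup>+y. X w (\<theta>, y) \<partial>?Y) \<in> borel_measurable ?T" for w by (rule Y.borel_measurable_nn_integral_fst[OF X(1)])
    have "(\<integral>\<^sup>+\<theta>. ennreal (1 / real M) * (\<Sum>w=1..M. \<integral>\<^sup>+y. X w (\<theta>, y) \<partial>?Y) \<partial>?T)
      = ennreal (1 / real M) * (\<Sum>w=1..M. \<integral>\<^sup>+\<theta>. \<integral>\<^sup>+y. X w (\<theta>, y) \<partial>?Y \<partial>?T)"
      by (simp only: nn_integral_cmult[OF borel_measurable_sum[OF xs]] nn_integral_sum[OF xs])
    also have "\<dots> = ennreal (1 / real M) * (\<Sum>w=1..M. \<integral>\<^sup>+x. X w x \<partial>(?T \<Otimes>\<^sub>M ?Y))"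
      by (simp only: Y.nn_integral_fst[OF X(1)])
    also have "\<dots> \<le> ennreal (1 / real M) * (\<Sum>w=1..M. c)" by (intro mult_left_mono sum_mono X(2)) auto
    also have "(\<Sum>w=1..M. c) = ennreal (real M) * c" by (simp add: ennreal_of_nat_eq_real_of_nat)
    also have "ennreal (1 / real M) * (ennreal (real M) * c) = c"
      using M by (simp add: mult.assoc[symmetric] ennreal_mult[symmetric])
    finally show ?thesis .
  qed
  have "\<exists>\<theta>. g \<theta> \<le> ennreal P \<and> f \<theta> \<le> ennreal (2 * \<epsilon> / \<gamma>)"
  proof (rule exists_below_averages[OF T.prob_space_axioms _ _ _ \<epsilon>(1) P \<gamma>])
    show "f \<in> borel_measurable ?T" unfolding f_def by (intro borel_measurable_times_ennreal borel_measurable_const borel_measurable_sum fs)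
    show "g \<in> borel_measurable ?T" unfolding g_def by (intro borel_measurable_times_ennreal borel_measurable_const borel_measurable_sum gs)
    show "(\<integral>\<^sup>+\<theta>. f \<theta> \<partial>?T) \<le> ennreal \<epsilon>" unfolding f_def
    proof (rule avg[OF Fm])
      fix w assume w: "w \<in> {1..M}"
      have "(\<integral>\<^sup>+x. F w x \<partial>(?T \<Otimes>\<^sub>M ?Y)) \<le> of_nat K * (\<epsilon>1 + \<epsilon>2 + \<epsilon>3)"
        unfolding F_def by (rule coop_failure_average[OF K n1 n2 M N0 w e1[OF w] e2[OF w] e3])
      then show "(\<integral>\<^sup>+x. F w x \<partial>(?T \<Otimes>\<^sub>M ?Y)) \<le> ennreal \<epsilon>" using \<epsilon>(2) by (rule order_trans)
    qed
    show "(\<integral>\<^sup>+\<theta>. g \<theta> \<partial>?T) \<le> ennreal ((1 - \<gamma>) * P)" unfolding g_def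
    proof (rule avg[OF Em])
      fix w assume w: "w \<in> {1..M}"
      show "(\<integral>\<^sup>+x. E w x \<partial>(?T \<Otimes>\<^sub>M ?Y)) \<le> ennreal ((1 - \<gamma>) * P)"
        unfolding E_def by (rule order_trans[OF coop_power_average[OF K n1 n2 M N0 w] ennreal_leI[OF budget]])
    qed
  qed
  then obtain \<theta> where \<theta>: "g \<theta> \<le> ennreal P" "f \<theta> \<le> ennreal (2 * \<epsilon> / \<gamma>)" by blast
  let ?q = "?p \<theta>"
  have ym: "(\<lambda>x. fst x p) \<in> borel_measurable ?Y" "(\<lambda>x. snd x p) \<in> borel_measurable ?Y" for p
    by (rule net_measurable[OF K n1 n2 M N0])+
  have seed: "decision ?q K (n1 + n2) (w, h, z, u) k = decision ?q K (n1 + n2) (w, h, z, 0) k" if "k \<in> {1..K}" for w h z u k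
    unfolding coop_decision[OF K n1 n2 M that] ..
  have seed_power: "power ?q K (n1 + n2) (w, h, z, u) = power ?q K (n1 + n2) (w, h, z, 0)" for w h z u
  proof -
    have "real (n1 + n2) * power ?q K (n1 + n2) (w, h, z, u) = real (n1 + n2) * power ?q K (n1 + n2) (w, h, z, 0)"
      unfolding coop_power[OF K n1 n2 M] ..
    then show ?thesis using n1 by simp
  qed
  have dec: "(\<lambda>\<omega>. indicator {\<omega>. \<exists>k\<in>S. decision ?q K (n1 + n2) \<omega> k \<noteq> fst \<omega>} \<omega> :: ennreal) \<in> borel_measurable ?N"
    "(\<integral>\<^sup>+\<omega>. indicator {\<omega>. \<exists>k\<in>S. decision ?q K (n1 + n2) \<omega> k \<noteq> fst \<omega>} \<omega> \<partial>?N)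
      = ennreal (1 / real M) * (\<Sum>w=1..M. \<integral>\<^sup>+y. indicator {y. \<exists>k\<in>S. decision ?q K (n1 + n2) (w, fst y, snd y, 0) k \<noteq> w} y \<partial>?Y)"
    if S: "S \<subseteq> {1..K}" for S
  proof -
    have a: "(\<lambda>y. indicator {y. \<exists>k\<in>S. decision ?q K (n1 + n2) (w, fst y, snd y, 0) k \<noteq> w} y :: ennreal) \<in> borel_measurable ?Y" for w
      by (rule indicator_pred_measurable, rule pred[OF S]; (rule ym | rule borel_measurable_const))
    have b: "indicator {\<omega>. \<exists>k\<in>S. decision ?q K (n1 + n2) \<omega> k \<noteq> fst \<omega>} (w, h, z, u)
      = (indicator {y. \<exists>k\<in>S. decision ?q K (n1 + n2) (w, fst y, snd y, 0) k \<noteq> w} (h, z) :: ennreal)" for w h z u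
    proof -
      have "(\<exists>k\<in>S. decision ?q K (n1 + n2) (w, h, z, u) k \<noteq> w) \<longleftrightarrow> (\<exists>k\<in>S. decision ?q K (n1 + n2) (w, h, z, 0) k \<noteq> w)"
      using S seed[of _ w h z u] by (auto simp: subset_iff)
      then show "indicator {\<omega>. \<exists>k\<in>S. decision ?q K (n1 + n2) \<omega> k \<noteq> fst \<omega>} (w, h, z, u)
      = (indicator {y. \<exists>k\<in>S. decision ?q K (n1 + n2) (w, fst y, snd y, 0) k \<noteq> w} (h, z) :: ennreal)"
        by (simp add: indicator_def)
    qed
    note c = nn_integral_netspace_seedless[where f="\<lambda>w y. indicator {y. \<exists>k\<in>S. decision ?q K (n1 + n2) (w, fst y, snd y, 0) k \<noteq> w} y"
        and F="\<lambda>\<omega>. indicator {\<omega>. \<exists>k\<in>S. decision ?q K (n1 + n2) \<omega> k \<noteq> fst \<omega>} \<omega>", OF N0 M a b]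
    show "(\<lambda>\<omega>. indicator {\<omega>. \<exists>k\<in>S. decision ?q K (n1 + n2) \<omega> k \<noteq> fst \<omega>} \<omega> :: ennreal) \<in> borel_measurable ?N"
      by (rule c(1))
    show "(\<integral>\<^sup>+\<omega>. indicator {\<omega>. \<exists>k\<in>S. decision ?q K (n1 + n2) \<omega> k \<noteq> fst \<omega>} \<omega> \<partial>?N)
      = ennreal (1 / real M) * (\<Sum>w=1..M. \<integral>\<^sup>+y. indicator {y. \<exists>k\<in>S. decision ?q K (n1 + n2) (w, fst y, snd y, 0) k \<noteq> w} y \<partial>?Y)"
      by (rule c(2))
  qed
  have dec_set: "{\<omega> \<in> space ?N. \<exists>k\<in>S. decision ?q K (n1 + n2) \<omega> k \<noteq> fst \<omega>} \<in> sets ?N" if "S \<subseteq> {1..K}" for S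
  proof -
    have "{\<omega>. \<exists>k\<in>S. decision ?q K (n1 + n2) \<omega> k \<noteq> fst \<omega>} \<inter> space ?N \<in> sets ?N"
      using dec(1)[OF that] by (simp only: borel_measurable_indicator_iff)
    then show ?thesis by (simp only: Collect_conj_eq Int_commute Collect_mem_eq)
  qed
  have pow: "(\<lambda>\<omega>. ennreal (power ?q K (n1 + n2) \<omega>)) \<in> borel_measurable ?N"
    "(\<integral>\<^sup>+\<omega>. ennreal (power ?q K (n1 + n2) \<omega>) \<partial>?N) = ennreal (1 / real M) * (\<Sum>w=1..M. \<integral>\<^sup>+y. ennreal (power ?q K (n1 + n2) (w, fst y, snd y, 0)) \<partial>?Y)"
  proof -
    have a: "(\<lambda>y. ennreal (power ?q K (n1 + n2) (w, fst y, snd y, 0))) \<in> borel_measurable ?Y" for w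
      by (rule measurable_compose[OF coop_power_measurable measurable_ennreal]) (rule ym borel_measurable_const K n1 n2 M)+
    have b: "ennreal (power ?q K (n1 + n2) (w, h, z, u)) = ennreal (power ?q K (n1 + n2) (w, fst (h, z), snd (h, z), 0))" for w h z u
      by (simp only: seed_power[of w h z u] fst_conv snd_conv)
    note c = nn_integral_netspace_seedless[where f="\<lambda>w y. ennreal (power ?q K (n1 + n2) (w, fst y, snd y, 0))"
        and F="\<lambda>\<omega>. ennreal (power ?q K (n1 + n2) \<omega>)", OF N0 M a b]
    show "(\<lambda>\<omega>. ennreal (power ?q K (n1 + n2) \<omega>)) \<in> borel_measurable ?N" by (rule c(1))
    show "(\<integral>\<^sup>+\<omega>. ennreal (power ?q K (n1 + n2) \<omega>) \<partial>?N) = ennreal (1 / real M) * (\<Sum>w=1..M. \<integral>\<^sup>+y. ennreal (power ?q K (n1 + n2) (w, fst y, snd y, 0)) \<partial>?Y)"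
      by (rule c(2))
  qed
  have "admissible P N0 K (n1 + n2) M ?q"
    unfolding admissible_def
  proof (intro conjI ballI allI)
    show "1 \<le> n1 + n2" "1 \<le> M" using n1 M by auto
    show "src_on ?q 1" using n1 by (simp add: coop_def)
    fix k obs g' u
    show "decide ?q k obs g' u \<in> {1..M}" by (simp add: coop_def decode_range[OF M] del: atLeastAtMost_iff One_nat_def)
  next
    have "(\<lambda>\<omega>. enn2real (ennreal (power ?q K (n1 + n2) \<omega>))) \<in> borel_measurable ?N"
      by (rule measurable_compose[OF pow(1)]) simp
    then show "power ?q K (n1 + n2) \<in> borel_measurable ?N" by (simp only: enn2real_ennreal[OF power_nonneg])
  next
    fix k assume "k \<in> {1..K}"
    then have "{k} \<subseteq> {1..K}" by simp
    from dec_set[OF this] show "{\<omega> \<in> space ?N. decision ?q K (n1 + n2) \<omega> k \<noteq> fst \<omega>} \<in> sets ?N" by simp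
  next
    show "(\<integral>\<^sup>+\<omega>. ennreal (power ?q K (n1 + n2) \<omega>) \<partial>?N) \<le> ennreal P"
      using \<theta>(1) unfolding pow(2) g_def E_def by simp
  qed
  moreover have "fail_multi N0 K (n1 + n2) M ?q \<le> 2 * \<epsilon> / \<gamma>"
  proof -
    let ?S = "{\<omega> \<in> space ?N. \<exists>k\<in>{1..K}. decision ?q K (n1 + n2) \<omega> k \<noteq> fst \<omega>}"
    have "emeasure ?N ?S = (\<integral>\<^sup>+\<omega>. indicator ?S \<omega> \<partial>?N)" by (rule nn_integral_indicator[symmetric, OF dec_set]) simp
    also have "\<dots> = (\<integral>\<^sup>+\<omega>. indicator {\<omega>. \<exists>k\<in>{1..K}. decision ?q K (n1 + n2) \<omega> k \<noteq> fst \<omega>} \<omega> \<partial>?N)"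
      by (rule nn_integral_cong) (simp add: indicator_def)
    also have "\<dots> = f \<theta>" unfolding dec(2)[OF subset_refl] f_def
      by (intro arg_cong2[where f="(*)"] refl sum.cong nn_integral_cong) (simp add: F_def indicator_def)
    finally have "emeasure ?N ?S \<le> ennreal (2 * \<epsilon> / \<gamma>)" using \<theta>(2) by simp
    then show ?thesis unfolding fail_multi_def measure_def by (rule enn2real_leI[rotated]) (use \<epsilon> \<gamma> in simp)
  qed
  ultimately show ?thesis by blast
qed

section \<open>Achievability\<close>

lemma num_msgs_le:
  assumes "0 < R" shows "real (num_msgs n R) \<le> 2 * exp (real n * (R * ln 2))"
proof -
  have "1 \<le> 2 powr (real n * R)" using assms by (intro ge_one_powr_ge_zero) auto
  then have "real (num_msgs n R) \<le> 2 * 2 powr (real n * R)" unfolding num_msgs_def by linarith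
  then show ?thesis by (simp add: powr_def mult.assoc)
qed

text \<open>The three factors \<open>1 - \<delta>\<close> come from the reserve in the relays'
  power, from the deviation of the gain from its mean, and from the ratio of \<open>K - 1\<close> to
  \<open>K\<close>, as a node does not hear itself.\<close>

lemma gain_deficit:
  fixes P \<delta> :: real
  assumes k: "k \<in> {1..K}" and P: "0 < P" and \<delta>: "0 < \<delta>" "\<delta> < 1" and K: "1 \<le> \<delta> * real K"
    and s: "s\<^sup>2 = (1 - \<delta>) * P / (real K * strong_prob G)"
  shows "(\<integral>\<^sup>+h. indicator {h. s\<^sup>2 * coop_gain K G h k < (1 - \<delta>) ^ 3 * P} h \<partial>gain_space K)
    \<le> ennreal (exp (- real (K - 1) * (strong_prob G * \<delta>\<^sup>2 / 4)))"
proof -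
  have q: "0 < strong_prob G" by (rule strong_prob_bounds)
  have K0: "1 \<le> K" using k by simp
  have s0: "0 < s\<^sup>2" unfolding s using q P \<delta> K0 by simp
  have "(1 - \<delta>) ^ 3 * P \<le> s\<^sup>2 * ((1 - \<delta>) * (real (K - 1) * strong_prob G))"
  proof -
    have "(1 - \<delta>) * real K \<le> real (K - 1)" using K K0 by (simp add: algebra_simps of_nat_diff)
    then have "1 - \<delta> \<le> real (K - 1) / real K" using K0 by (simp add: field_simps)
    then have "(1 - \<delta>)\<^sup>2 * P * (1 - \<delta>) \<le> (1 - \<delta>)\<^sup>2 * P * (real (K - 1) / real K)"
      using P by (intro mult_left_mono) auto
    also have "\<dots> = s\<^sup>2 * ((1 - \<delta>) * (real (K - 1) * strong_prob G))"
      unfolding s using q K0 by (simp add: field_simps power2_eq_square)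
    finally show ?thesis by (simp add: power3_eq_cube power2_eq_square mult_ac)
  qed
  then have "coop_gain K G h k < (1 - \<delta>) * (real (K - 1) * strong_prob G)" if "s\<^sup>2 * coop_gain K G h k < (1 - \<delta>) ^ 3 * P" for h
    using that s0 mult_less_cancel_left_pos[of "s\<^sup>2"] by (meson less_le_trans)
  then have "(\<integral>\<^sup>+h. indicator {h. s\<^sup>2 * coop_gain K G h k < (1 - \<delta>) ^ 3 * P} h \<partial>gain_space K)
    \<le> (\<integral>\<^sup>+h. indicator {h. coop_gain K G h k < (1 - \<delta>) * (real (K - 1) * strong_prob G)} h \<partial>gain_space K)"
    by (intro nn_integral_mono) (simp add: indicator_def)
  also have "\<dots> \<le> ennreal (exp (- real (K - 1) * (strong_prob G * \<delta>\<^sup>2 / 4)))" by (rule gain_concentration[OF k \<delta>])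
  finally show ?thesis .
qed

text \<open>One integer \<open>m\<close> controls all losses: the time of the first phase, the power
  reserve and the deviation of the gain. As \<open>m\<close> grows the rate condition tends to
  \<open>c < ln (1 + P / N0)\<close>, so by continuity a finite \<open>m\<close> suffices.\<close>

lemma achievable_multi_below:
  assumes P: "0 < P" and N0: "0 < N0" and R: "0 < R" and RC: "R < log 2 (1 + P / N0)"
  shows "achievable_multi P N0 R"
proof -
  define c where "c = R * ln 2"
  have c: "0 < c" "c < ln (1 + P / N0)" using R RC by (auto simp: c_def log_def field_simps)
  have "\<exists>m::nat. 2 \<le> m \<and> c / (1 - 1 / real m) < ln (1 + (1 - 1 / real m) ^ 3 * P / N0)"
  proof -
    have i: "(\<lambda>m. 1 / real m) \<longlonglongrightarrow> 0" by (rule lim_1_over_n)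
    have p: "1 + (1 - 0) ^ 3 * P / N0 \<noteq> 0" using P N0 by (simp add: add_pos_pos less_imp_neq[symmetric])
    have "(\<lambda>m. ln (1 + (1 - 1 / real m) ^ 3 * P / N0) - c / (1 - 1 / real m)) \<longlonglongrightarrow> ln (1 + (1 - 0) ^ 3 * P / N0) - c / (1 - 0)"
      by (intro tendsto_diff tendsto_ln tendsto_add tendsto_const tendsto_divide tendsto_mult tendsto_power i p) (use N0 in auto)
    then have "\<forall>\<^sub>F m in sequentially. 0 < ln (1 + (1 - 1 / real m) ^ 3 * P / N0) - c / (1 - 1 / real m)"
      by (rule order_tendstoD(1)) (use c in simp)
    moreover have "\<forall>\<^sub>F m in sequentially. (2::nat) \<le> m" by (rule eventually_ge_at_top)
    ultimately have "\<forall>\<^sub>F m in sequentially. 2 \<le> m \<and> c / (1 - 1 / real m) < ln (1 + (1 - 1 / real m) ^ 3 * P / N0)"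
      by eventually_elim simp
    then show ?thesis by (auto simp: eventually_sequentially)
  qed
  then obtain m :: nat where m: "2 \<le> m" and m': "c / (1 - 1 / real m) < ln (1 + (1 - 1 / real m) ^ 3 * P / N0)" by blast
  \<comment> \<open>The first phase takes the fraction \<open>1 / m\<close> of the block. In nats
    per slot its rate is therefore \<open>m * c\<close>, and that of the second phase is
    \<open>c / (1 - \<delta>)\<close>.\<close>
  define \<delta> where "\<delta> = 1 / real m"
  have \<delta>: "0 < \<delta>" "\<delta> \<le> 1 / 2" "\<delta> < 1" using m by (auto simp: \<delta>_def field_simps)
  define b0 where "b0 = (1 - \<delta>) ^ 3 * P"
  have b0: "0 < b0" using \<delta> P by (simp add: b0_def)
  have r2: "c / (1 - \<delta>) < ln (1 + b0 / N0)" using m' by (simp add: \<delta>_def b0_def)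
  \<comment> \<open>Chosen such that \<open>G * P / N0 = exp (real m * c)\<close>: a node with
    source gain at least \<open>G\<close> can then decode at the rate \<open>m * c\<close> of the
    short first phase.\<close>
  define G where "G = N0 / P * exp (real m * c)"
  have G: "0 < G * P" "real m * c < ln (1 + G * P / N0)"
  proof -
    show "0 < G * P" using P N0 by (simp add: G_def)
    have "real m * c = ln (exp (real m * c))" by simp
    also have "\<dots> < ln (1 + exp (real m * c))" by (subst ln_less_cancel_iff) (auto simp: add_pos_pos)
    also have "exp (real m * c) = G * P / N0" using P N0 by (simp add: G_def)
    finally show "real m * c < ln (1 + G * P / N0)" .
  qed
  define q where "q = strong_prob G"
  have q: "0 < q" by (simp add: q_def strong_prob_bounds)
  obtain \<eta>1 \<rho>1 :: real where \<rho>1: "0 < \<eta>1" "0 < \<rho>1" "\<rho>1 < 1" and conf1: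
    "\<And>(I::nat set) (J::nat set) (a::nat \<Rightarrow> complex) (M::nat) (w::nat) A. finite I \<Longrightarrow> finite J \<Longrightarrow> w \<in> {1..M} \<Longrightarrow> finite A \<Longrightarrow>
      G * P \<le> (\<Sum>j\<in>J. (cmod (a j))\<^sup>2) \<Longrightarrow> real M \<le> 2 * exp (real (card I) * (real m * c)) \<Longrightarrow>
      (\<integral>\<^sup>+z. \<integral>\<^sup>+cb. indicator {cb. confused I J (N0 + \<eta>1) M A a w cb z} cb \<partial>codebook_space M I J \<partial>PiM I (\<lambda>_. cgauss N0))
        \<le> ennreal ((2 + 2 * real (card A)) * \<rho>1 ^ card I)"
    using confusion_rate[OF N0 G] by metis
  obtain \<eta>2 \<rho>2 :: real where \<rho>2: "0 < \<eta>2" "0 < \<rho>2" "\<rho>2 < 1" and conf2: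
    "\<And>(I::nat set) (J::nat set) (a::nat \<Rightarrow> complex) (M::nat) (w::nat) A. finite I \<Longrightarrow> finite J \<Longrightarrow> w \<in> {1..M} \<Longrightarrow> finite A \<Longrightarrow>
      b0 \<le> (\<Sum>j\<in>J. (cmod (a j))\<^sup>2) \<Longrightarrow> real M \<le> 2 * exp (real (card I) * (c / (1 - \<delta>))) \<Longrightarrow>
      (\<integral>\<^sup>+z. \<integral>\<^sup>+cb. indicator {cb. confused I J (N0 + \<eta>2) M A a w cb z} cb \<partial>codebook_space M I J \<partial>PiM I (\<lambda>_. cgauss N0))
        \<le> ennreal ((2 + 2 * real (card A)) * \<rho>2 ^ card I)"
    using confusion_rate[OF N0 b0 r2] by metis
  \<comment> \<open>For \<open>K < m\<close> the ratio of \<open>K - 1\<close> to \<open>K\<close>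
    is too small for \<open>gain_deficit\<close>, and the trivial bound 1 is taken; a protocol is
    required for such \<open>K\<close> too, but the limit is unaffected.\<close>
  define \<beta> where "\<beta> K = (if m \<le> K then exp (- real (K - 1) * (q * \<delta>\<^sup>2 / 4)) else 1)" for K
  define b where "b K = 2 * (1 / real K + real K * \<beta> K) / (\<delta> / 2)" for K
  have "\<exists>n p. admissible P N0 K n (num_msgs n R) p \<and> fail_multi N0 K n (num_msgs n R) p \<le> b K" if K: "1 \<le> K" for K
  proof -
    \<comment> \<open>With \<open>K\<close> fixed, \<open>t\<close> is so large that confusion,
      including the factor \<open>2 ^ K\<close> for the coalitions, costs at most
      \<open>1 / (real K)\<^sup>2\<close> per node.\<close>
    have "\<exists>t::nat. 1 \<le> t \<and> 4 * \<rho>1 ^ t + (2 + 2 * 2 ^ K) * (\<rho>2 ^ (m - 1)) ^ t \<le> 1 / (real K)\<^sup>2"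
    proof -
      have "\<rho>2 ^ (m - 1) < 1" using \<rho>2 m by (intro power_less_one_iff[THEN iffD2]) auto
      then have "(\<lambda>t. 4 * \<rho>1 ^ t + (2 + 2 * 2 ^ K) * (\<rho>2 ^ (m - 1)) ^ t) \<longlonglongrightarrow> 4 * 0 + (2 + 2 * 2 ^ K) * 0"
        using \<rho>1 \<rho>2 by (intro tendsto_add tendsto_mult tendsto_const LIMSEQ_power_zero) auto
      then have "\<forall>\<^sub>F t in sequentially. 4 * \<rho>1 ^ t + (2 + 2 * 2 ^ K) * (\<rho>2 ^ (m - 1)) ^ t < 1 / (real K)\<^sup>2"
        by (rule order_tendstoD(2)) (use K in simp)
      moreover have "\<forall>\<^sub>F t in sequentially. (1::nat) \<le> t" by (rule eventually_ge_at_top)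
      ultimately have "\<forall>\<^sub>F t in sequentially. 1 \<le> t \<and> 4 * \<rho>1 ^ t + (2 + 2 * 2 ^ K) * (\<rho>2 ^ (m - 1)) ^ t \<le> 1 / (real K)\<^sup>2"
        by eventually_elim simp
      then show ?thesis by (auto simp: eventually_sequentially)
    qed
    then obtain t :: nat where t: "1 \<le> t" "4 * \<rho>1 ^ t + (2 + 2 * 2 ^ K) * (\<rho>2 ^ (m - 1)) ^ t \<le> 1 / (real K)\<^sup>2" by blast
    define n2 where "n2 = (m - 1) * t"
    have n: "t + n2 = m * t" using m by (simp add: n2_def algebra_simps diff_mult_distrib)
    have n2: "1 \<le> n2" "real n2 = real m * real t * (1 - \<delta>)"
      using m t by (auto simp: n2_def \<delta>_def of_nat_diff field_simps)
    define M where "M = num_msgs (t + n2) R"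
    have M: "1 \<le> M" using num_msgs_ge_2[OF R, of "t + n2"] t by (simp add: M_def)
    have Mle: "real M \<le> 2 * exp (real m * real t * c)"
      using num_msgs_le[OF R, of "t + n2"] by (simp add: M_def n c_def)
    \<comment> \<open>The amplitude at which the mean total power of the strong relays is
      \<open>(1 - \<delta>) * P\<close>.\<close>
    define s2 where "s2 = sqrt ((1 - \<delta>) * P / (real K * q))"
    have s2: "s2\<^sup>2 = (1 - \<delta>) * P / (real K * q)" unfolding s2_def using \<delta> P q by (intro real_sqrt_pow2) simp
    have \<beta>0: "0 < \<beta> K" by (simp add: \<beta>_def)
    have "\<exists>p. admissible P N0 K (t + n2) M p \<and> fail_multi N0 K (t + n2) M p \<le> 2 * (1 / real K + real K * \<beta> K) / (\<delta> / 2)"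
    proof (rule coop_code_exists[where G=G and ?s1.0="sqrt P" and ?s2.0=s2 and ?\<tau>1.0="N0 + \<eta>1" and ?\<tau>2.0="N0 + \<eta>2" and ?b0.0=b0
        and ?\<epsilon>1.0="ennreal (4 * \<rho>1 ^ t)" and ?\<epsilon>2.0="ennreal ((2 + 2 * 2 ^ K) * (\<rho>2 ^ (m - 1)) ^ t)" and ?\<epsilon>3.0="ennreal (\<beta> K)"])
      fix w and x :: complex assume w: "w \<in> {1..M}" and x: "G \<le> (cmod x)\<^sup>2"
      let ?a = "\<lambda>_::nat. of_real (sqrt P) * x"
      have "(\<integral>\<^sup>+z. \<integral>\<^sup>+cb. indicator {cb. confused {1..t} {0} (N0 + \<eta>1) M {?a} ?a w cb z} cb \<partial>codebook_space M {1..t} {0::nat} \<partial>PiM {1..t} (\<lambda>_. cgauss N0))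
        \<le> ennreal ((2 + 2 * real (card {?a})) * \<rho>1 ^ card {1..t})"
      proof (rule conf1)
        show "G * P \<le> (\<Sum>j\<in>{0::nat}. (cmod (of_real (sqrt P) * x))\<^sup>2)"
          using x P by (simp add: norm_mult power_mult_distrib mult.commute)
        show "real M \<le> 2 * exp (real (card {1..t}) * (real m * c))" using Mle by (simp add: mult_ac)
      qed (use w in auto)
      then show "(\<integral>\<^sup>+z. \<integral>\<^sup>+cb. indicator {cb. confused {1..t} {0} (N0 + \<eta>1) M {?a} ?a w cb z} cb \<partial>codebook_space M {1..t} {0::nat} \<partial>PiM {1..t} (\<lambda>_. cgauss N0))
        \<le> ennreal (4 * \<rho>1 ^ t)" by (simp del: One_nat_def)
    next
      fix w and a :: "nat \<Rightarrow> complex" and A :: "(nat \<Rightarrow> complex) set" assume w: "w \<in> {1..M}" and A: "finite A" "card A \<le> 2 ^ K" and a: "b0 \<le> (\<Sum>j=1..K. (cmod (a j))\<^sup>2)"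
      have cI: "card {t+1..t+n2} = n2" by simp
      have "(\<integral>\<^sup>+z. \<integral>\<^sup>+cb. indicator {cb. confused {t+1..t+n2} {1..K} (N0 + \<eta>2) M A a w cb z} cb \<partial>codebook_space M {t+1..t+n2} {1..K} \<partial>PiM {t+1..t+n2} (\<lambda>_. cgauss N0))
        \<le> ennreal ((2 + 2 * real (card A)) * \<rho>2 ^ card {t+1..t+n2})"
      proof (rule conf2)
        have "real n2 * (c / (1 - \<delta>)) = real m * real t * c" using \<delta> by (simp add: n2 field_simps)
        then show "real M \<le> 2 * exp (real (card {t+1..t+n2}) * (c / (1 - \<delta>)))" unfolding cI using Mle by (simp only:)
      qed (use w A a in auto)
      also have "\<dots> \<le> ennreal ((2 + 2 * 2 ^ K) * (\<rho>2 ^ (m - 1)) ^ t)"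
      proof (rule ennreal_leI)
        have "real (card A) \<le> 2 ^ K" using A(2) by (metis of_nat_le_iff of_nat_numeral of_nat_power)
        then have "(2 + 2 * real (card A)) * \<rho>2 ^ n2 \<le> (2 + 2 * 2 ^ K) * \<rho>2 ^ n2" using \<rho>2 by (intro mult_right_mono) auto
        then show "(2 + 2 * real (card A)) * \<rho>2 ^ card {t+1..t+n2} \<le> (2 + 2 * 2 ^ K) * (\<rho>2 ^ (m - 1)) ^ t"
          unfolding cI by (simp add: n2_def power_mult)
      qed
      finally show "(\<integral>\<^sup>+z. \<integral>\<^sup>+cb. indicator {cb. confused {t+1..t+n2} {1..K} (N0 + \<eta>2) M A a w cb z} cb \<partial>codebook_space M {t+1..t+n2} {1..K} \<partial>PiM {t+1..t+n2} (\<lambda>_. cgauss N0))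
        \<le> ennreal ((2 + 2 * 2 ^ K) * (\<rho>2 ^ (m - 1)) ^ t)" .
    next
      fix k assume k: "k \<in> {1..K}"
      show "(\<integral>\<^sup>+h. indicator {h. s2\<^sup>2 * coop_gain K G h k < b0} h \<partial>gain_space K) \<le> ennreal (\<beta> K)"
      proof (cases "m \<le> K")
        case True
        then have "1 \<le> \<delta> * real K" using m by (simp add: \<delta>_def field_simps)
        from gain_deficit[OF k P \<delta>(1,3) this s2[unfolded q_def]] show ?thesis using True by (simp add: \<beta>_def b0_def q_def)
      next
        case False
        interpret H: prob_space "gain_space K" by (rule prob_space_PiM_cgauss) simp
        have "(\<integral>\<^sup>+h. indicator {h. s2\<^sup>2 * coop_gain K G h k < b0} h \<partial>gain_space K) \<le> (\<integral>\<^sup>+h. 1 \<partial>gain_space K)"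
          by (intro nn_integral_mono) (simp add: indicator_def)
        also have "\<dots> = 1" by (simp add: H.emeasure_space_1)
        finally show ?thesis using False by (simp add: \<beta>_def)
      qed
    next
      show "0 < 1 / real K + real K * \<beta> K" using K \<beta>0 by (simp add: add_pos_pos)
      have "of_nat K * (ennreal (4 * \<rho>1 ^ t) + ennreal ((2 + 2 * 2 ^ K) * (\<rho>2 ^ (m - 1)) ^ t) + ennreal (\<beta> K))
        = ennreal (real K * (4 * \<rho>1 ^ t + (2 + 2 * 2 ^ K) * (\<rho>2 ^ (m - 1)) ^ t + \<beta> K))"
        using \<rho>1 \<rho>2 \<beta>0 by (simp add: ennreal_of_nat_eq_real_of_nat ennreal_mult[symmetric] ennreal_plus[symmetric] del: ennreal_plus)
      also have "\<dots> \<le> ennreal (1 / real K + real K * \<beta> K)"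
      proof (rule ennreal_leI)
        have "real K * (4 * \<rho>1 ^ t + (2 + 2 * 2 ^ K) * (\<rho>2 ^ (m - 1)) ^ t + \<beta> K) \<le> real K * (1 / (real K)\<^sup>2 + \<beta> K)"
          using t(2) by (intro mult_left_mono add_right_mono) auto
        also have "\<dots> = 1 / real K + real K * \<beta> K" using K by (simp add: distrib_left power2_eq_square)
        finally show "real K * (4 * \<rho>1 ^ t + (2 + 2 * 2 ^ K) * (\<rho>2 ^ (m - 1)) ^ t + \<beta> K) \<le> 1 / real K + real K * \<beta> K" .
      qed
      finally show "of_nat K * (ennreal (4 * \<rho>1 ^ t) + ennreal ((2 + 2 * 2 ^ K) * (\<rho>2 ^ (m - 1)) ^ t) + ennreal (\<beta> K)) \<le> ennreal (1 / real K + real K * \<beta> K)" .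
      \<comment> \<open>The source spends \<open>P\<close> for the fraction \<delta> of the time,
        the relays \<open>(1 - \<delta>) * P\<close> for the rest. The sum
        \<open>\<delta> + (1 - \<delta>)\<^sup>2\<close> leaves the reserve
        \<open>\<gamma> = \<delta> / 2\<close> because \<delta> is at most 1 / 2.\<close>
      have "(real t * (sqrt P)\<^sup>2 + real n2 * (real K * strong_prob G * s2\<^sup>2)) / real (t + n2)
        = (real t * P + real m * real t * (1 - \<delta>) * ((1 - \<delta>) * P)) / (real m * real t)"
        using P K q by (simp add: n n2(2) s2 q_def)
      also have "\<dots> = (\<delta> + (1 - \<delta>)\<^sup>2) * P" using t(1) m by (simp add: \<delta>_def field_simps power2_eq_square)
      also have "\<dots> \<le> (1 - \<delta> / 2) * P"
      proof -
        have "\<delta> * \<delta> \<le> \<delta> * (1 / 2)" using \<delta> by (intro mult_left_mono) auto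
        then show ?thesis using P by (intro mult_right_mono) (auto simp: power2_eq_square algebra_simps)
      qed
      finally show "(real t * (sqrt P)\<^sup>2 + real n2 * (real K * strong_prob G * s2\<^sup>2)) / real (t + n2) \<le> (1 - \<delta> / 2) * P" .
    qed (use K t n2 M N0 P \<delta> in auto)
    then show ?thesis unfolding b_def M_def by blast
  qed
  then have "\<forall>K. \<exists>np. 1 \<le> K \<longrightarrow> admissible P N0 K (fst np) (num_msgs (fst np) R) (snd np) \<and> fail_multi N0 K (fst np) (num_msgs (fst np) R) (snd np) \<le> b K"
    by (metis fst_conv snd_conv)
  then obtain np where np: "\<And>K. 1 \<le> K \<Longrightarrow> admissible P N0 K (fst (np K)) (num_msgs (fst (np K)) R) (snd (np K)) \<and>
      fail_multi N0 K (fst (np K)) (num_msgs (fst (np K)) R) (snd (np K)) \<le> b K"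
    by metis
  have b: "b \<longlonglongrightarrow> 0"
  proof -
    define \<alpha> where "\<alpha> = q * \<delta>\<^sup>2 / 4"
    have \<alpha>: "0 < \<alpha>" using q \<delta> by (simp add: \<alpha>_def)
    have l: "(\<lambda>K. 2 * (1 / real K + real K * exp (- (real K - 1) * \<alpha>)) / (\<delta> / 2)) \<longlonglongrightarrow> 0"
      using \<alpha> \<delta>(1) by real_asymp
    have "\<forall>\<^sub>F K in sequentially. b K = 2 * (1 / real K + real K * exp (- (real K - 1) * \<alpha>)) / (\<delta> / 2)"
      using eventually_ge_at_top[of "max 1 m"] by eventually_elim (simp add: b_def \<beta>_def \<alpha>_def of_nat_diff)
    from tendsto_cong[OF this] l show ?thesis by simp
  qed
  have "(\<lambda>K. fail_multi N0 K (fst (np K)) (num_msgs (fst (np K)) R) (snd (np K))) \<longlonglongrightarrow> 0"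
  proof (rule tendsto_sandwich[OF _ _ tendsto_const b])
    show "\<forall>\<^sub>F K in sequentially. 0 \<le> fail_multi N0 K (fst (np K)) (num_msgs (fst (np K)) R) (snd (np K))"
      by (simp add: fail_multi_def)
    show "\<forall>\<^sub>F K in sequentially. fail_multi N0 K (fst (np K)) (num_msgs (fst (np K)) R) (snd (np K)) \<le> b K"
      using eventually_ge_at_top[of 1] by eventually_elim (use np in blast)
  qed
  then show ?thesis unfolding achievable_multi_def
    using np by (intro exI[of _ "\<lambda>K. snd (np K)"] exI[of _ "\<lambda>K. fst (np K)"]) auto
qed

lemma prob_space_netspace:
  assumes "0 < N0" shows "prob_space (netspace N0 K n M)"
proof -
  interpret H: prob_space "gain_space K" by (rule prob_space_PiM_cgauss) simp
  interpret Z: prob_space "noise_space N0 K n" by (rule prob_space_PiM_cgauss[OF assms])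
  interpret U: prob_space "uniform_measure lborel {0..1::real}" by (rule prob_space_uniform01)
  interpret W: prob_space "measure_pmf (pmf_of_set {1..M})" by (rule prob_space_measure_pmf)
  interpret ZU: pair_prob_space "noise_space N0 K n" "uniform_measure lborel {0..1::real}" ..
  interpret HZU: pair_prob_space "gain_space K" "noise_space N0 K n \<Otimes>\<^sub>M uniform_measure lborel {0..1::real}" ..
  interpret WHZU: pair_prob_space "measure_pmf (pmf_of_set {1..M})" "gain_space K \<Otimes>\<^sub>M noise_space N0 K n \<Otimes>\<^sub>M uniform_measure lborel {0..1::real}" ..
  show ?thesis unfolding netspace_def by (rule WHZU.prob_space_axioms)
qed

lemma achievable_multi_imp_uni:
  assumes N0: "0 < N0" and d: "\<forall>K\<ge>1. 1 \<le> d K \<and> d K \<le> K" and ach: "achievable_multi P N0 R"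
  shows "achievable_uni P N0 d R"
proof -
  obtain \<pi> nK where adm: "\<And>K. 1 \<le> K \<Longrightarrow> admissible P N0 K (nK K) (num_msgs (nK K) R) (\<pi> K)"
    and lim: "(\<lambda>K. fail_multi N0 K (nK K) (num_msgs (nK K) R) (\<pi> K)) \<longlonglongrightarrow> 0"
    using ach unfolding achievable_multi_def by blast
  have le: "fail_uni N0 K (nK K) (num_msgs (nK K) R) (\<pi> K) (d K) \<le> fail_multi N0 K (nK K) (num_msgs (nK K) R) (\<pi> K)" if K: "1 \<le> K" for K
  proof -
    let ?N = "netspace N0 K (nK K) (num_msgs (nK K) R)"
    let ?S = "\<lambda>k. {\<omega> \<in> space ?N. decision (\<pi> K) K (nK K) \<omega> k \<noteq> fst \<omega>}"
    interpret prob_space ?N by (rule prob_space_netspace[OF N0])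
    have s: "?S k \<in> sets ?N" if "k \<in> {1..K}" for k using adm[OF K] that unfolding admissible_def by blast
    have "{\<omega> \<in> space ?N. \<exists>k\<in>{1..K}. decision (\<pi> K) K (nK K) \<omega> k \<noteq> fst \<omega>} = (\<Union>k\<in>{1..K}. ?S k)" by blast
    moreover have "(\<Union>k\<in>{1..K}. ?S k) \<in> sets ?N" using s by (intro sets.finite_UN) auto
    moreover have "d K \<in> {1..K}" using d K by auto
    ultimately show ?thesis unfolding fail_uni_def fail_multi_def by (intro finite_measure_mono) auto
  qed
  have "(\<lambda>K. fail_uni N0 K (nK K) (num_msgs (nK K) R) (\<pi> K) (d K)) \<longlonglongrightarrow> 0"
  proof (rule tendsto_sandwich[OF _ _ tendsto_const lim])
    show "\<forall>\<^sub>F K in sequentially. 0 \<le> fail_uni N0 K (nK K) (num_msgs (nK K) R) (\<pi> K) (d K)" by (simp add: fail_uni_def)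
    show "\<forall>\<^sub>F K in sequentially. fail_uni N0 K (nK K) (num_msgs (nK K) R) (\<pi> K) (d K) \<le> fail_multi N0 K (nK K) (num_msgs (nK K) R) (\<pi> K)"
      using eventually_ge_at_top[of 1] by eventually_elim (rule le)
  qed
  then show ?thesis unfolding achievable_uni_def using adm by blast
qed

theorem theorem1:
  fixes P N0 :: real and d :: "nat \<Rightarrow> nat"
  assumes "0 < P" and "0 < N0"
    and "\<forall>K\<ge>1. 1 \<le> d K \<and> d K \<le> K"
  shows "capacity_uni P N0 d = capacity_multi P N0
       \<and> capacity_multi P N0 = log 2 (1 + P / N0)"
proof -
  let ?C = "log 2 (1 + P / N0)"
  have "1 < 1 + P / N0" using assms(1,2) by simp
  then have C: "0 < ?C" using zero_less_log_cancel_iff[of 2 "1 + P / N0"] by linarith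
  \<comment> \<open>Both sets of rates contain the open interval from 0 to \<open>?C\<close> and are
    bounded by \<open>?C\<close>; whether \<open>?C\<close> itself is achievable does not affect the
    supremum. Multicasting inherits the upper bound from unicasting, and unicasting the
    achievability from multicasting.\<close>
  have Sup: "Sup {R. A R} = ?C" if up: "\<And>R. A R \<Longrightarrow> R \<le> ?C" and low: "\<And>R. 0 < R \<Longrightarrow> R < ?C \<Longrightarrow> A R" for A
  proof (rule cSup_eq)
    fix y assume "\<And>x. x \<in> {R. A R} \<Longrightarrow> x \<le> y"
    then show "?C \<le> y" by (intro dense_le_bounded[OF C]) (auto intro: low)
  qed (use up in auto)
  have low: "achievable_multi P N0 R" if "0 < R" "R < ?C" for R
    by (rule achievable_multi_below[OF assms(1,2) that])
  have "capacity_multi P N0 = ?C" unfolding capacity_multi_def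
    by (rule Sup[OF achievable_uni_le[OF assms achievable_multi_imp_uni[OF assms(2,3)]] low])
  moreover have "capacity_uni P N0 d = ?C" unfolding capacity_uni_def
    by (rule Sup[OF achievable_uni_le[OF assms] achievable_multi_imp_uni[OF assms(2,3) low]])
  ultimately show ?thesis by simp
qed

end
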